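(* Let $X$ be a space-like oriented semi-Riemannian manifold of signature $(p,q)$ with $p,q\ge1$, and let $\phi$ be a calibration of degree $p$ on $X$. Suppose that $T$ is a $\phi$-subvariety with compact support. Then $T$ is homologically volume maximizing: for any other positive space-like rectifiable $p$-current $S$ with compact support which is homologous to $T$ (that is, $S=T+dR$ for some current $R$ of dimension $p+1$ with compact support, $dR$ denoting the boundary of $R$), one has $$\mathrm{vol}(T)\ \ge\ \mathrm{vol}(S).$$ Moreover, equality occurs if and only if $S$ is also a $\phi$-subvariety.
   Context: At each $x\in X$ identify the Grassmannian of oriented space-like $p$-planes in $T_xX$ (planes on which the metric is positive definite) with a subset of $\Lambda^pT_xX$ by $P\mapsto e_1\wedge\cdots\wedge e_p$ for any oriented orthonormal basis. It has two connected components. A space-like orientation of $X$ is a continuous choice of one component, denoted $G^+_{\rm space}(p)_x$ (the positive space-like planes). The mass ball $B_x\subset\Lambda^pT_xX$ is the convex hull of $G^+_{\rm space}(p)_x$; the mass cone is $\mathcal{C}_x=\{t\xi:t>0,\ \xi\in B_x\}$. For $\xi\in\mathcal{C}_x$ there is a unique $\lambda>0$ with $\lambda\xi\in\partial B_x$, and the mass norm is $|\xi|=1/\lambda$ (so $|\xi|=1$ for $\xi\in G^+_{\rm space}(p)_x$). A calibration of degree $p$ is a $d$-closed smooth $p$-form $\phi$ on $X$ with $\phi(\xi)\ge1$ for all $\xi\in G^+_{\rm space}(p)$; set $G(\phi)=\{\xi\in G^+_{\rm space}(p):\phi(\xi)=1\}$. A $p$-current $T$ representable by integration has, for any auxiliary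 Riemannian metric, a polar form $T=\overrightarrow{T}\,\|T\|$, i.e. $T(\varphi)=\int\varphi(\overrightarrow{T})\,d\|T\|$. For a subset $\mathcal{S}\subset\Lambda^pTX$ closed under multiplication by positive scalars, $T$ is of type $\mathcal{S}$ if $\overrightarrow{T}(x)\in\mathcal{S}_x$ for $\|T\|$-a.a. $x$ (independent of the auxiliary metric). $T$ is positive space-like if it is of type $\mathcal{C}$. A positive space-like $T$ has a semi-Riemannian polar form $T=\overrightarrow{T}\|T\|$ in which $\|T\|$ is a non-negative Radon measure and $\overrightarrow{T}(x)\in\mathcal{C}_x$ has mass norm $1$ for $\|T\|$-a.a. $x$; $\mathrm{vol}(T)=\int\|T\|$ for this measure. A $\phi$-subvariety is a locally rectifiable current $T$ of dimension $p$ of type $\mathbb{R}^+\cdot G(\phi)$ (so that, in the semi-Riemannian polar form, $\overrightarrow{T}\in G(\phi)$ $\|T\|$-a.e.). *)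

theory Defs
  imports "HOL-Analysis.Analysis"
begin

section \<open>Smooth manifolds\<close>

primrec iter_deriv ::
  "'a::real_normed_vector list \<Rightarrow> ('a \<Rightarrow> 'b::real_normed_vector) \<Rightarrow> 'a \<Rightarrow> 'b" where
  "iter_deriv [] f = f"
| "iter_deriv (u # us) f = iter_deriv us (\<lambda>y. frechet_derivative f (at y) u)"

text \<open>To be used on open sets only.\<close>

definition smooth_on :: "'a::real_normed_vector set \<Rightarrow> ('a \<Rightarrow> 'b::real_normed_vector) \<Rightarrow> bool" where
  "smooth_on S f \<longleftrightarrow> (\<forall>us. iter_deriv us f differentiable_on S)"

type_synonym ('x, 'n) chart = "'x set \<times> ('x \<Rightarrow> real ^ 'n)"

definition chart_img :: "('x, 'n) chart \<Rightarrow> (real ^ 'n) set" where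
  "chart_img c = snd c ` fst c"

definition chart_inv :: "('x, 'n) chart \<Rightarrow> real ^ 'n \<Rightarrow> 'x" where
  "chart_inv c = inv_into (fst c) (snd c)"

text \<open>The manifold is the whole type \<open>'x\<close>; the Hausdorff and second countability axioms are
  imposed through the sort of \<open>'x\<close>. The atlas need not be maximal.\<close>

definition smooth_atlas :: "('x::topological_space, 'n::finite) chart set \<Rightarrow> bool" where
  "smooth_atlas A \<longleftrightarrow>
     (\<Union>c\<in>A. fst c) = UNIV \<and>
     (\<forall>c\<in>A. open (fst c) \<and> open (chart_img c) \<and>
        homeomorphism (fst c) (chart_img c) (snd c) (chart_inv c)) \<and>
     (\<forall>c\<in>A. \<forall>d\<in>A. smooth_on (snd c ` (fst c \<inter> fst d)) (snd d \<circ> chart_inv c))"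

text \<open>The tangent space at \<open>x\<close> is identified with \<open>real ^ 'n\<close> by means of the differential at \<open>x\<close>
  of one chart around \<open>x\<close>, chosen once and for all. Since this choice does not vary continuously
  (or even measurably) with \<open>x\<close>, regularity of tensor fields is always expressed in a fixed
  chart, through the maps \<open>from_chart\<close> below.\<close>

definition chart_at :: "('x, 'n) chart set \<Rightarrow> 'x \<Rightarrow> ('x, 'n) chart" where
  "chart_at A x = (SOME c. c \<in> A \<and> x \<in> fst c)"

text \<open>The inverse of the differential at \<open>x\<close> of a chart \<open>c\<close>, as a map into the tangent space
  at \<open>x\<close>.\<close>

definition from_chart ::
  "('x, 'n::finite) chart set \<Rightarrow> ('x, 'n) chart \<Rightarrow> 'x \<Rightarrow> real ^ 'n \<Rightarrow> real ^ 'n" where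
  "from_chart A c x =
     frechet_derivative (snd (chart_at A x) \<circ> chart_inv c) (at (snd c x))"


section \<open>Differential forms\<close>

text \<open>The arguments of a form of degree \<open>CARD('i)\<close> are indexed by the finite type \<open>'i\<close>.\<close>

type_synonym ('x, 'i, 'n) form = "'x \<Rightarrow> ('i \<Rightarrow> real ^ 'n) \<Rightarrow> real"

definition alt_form :: "(('i::finite \<Rightarrow> real ^ 'n::finite) \<Rightarrow> real) \<Rightarrow> bool" where
  "alt_form \<alpha> \<longleftrightarrow>
     (\<forall>v i. linear (\<lambda>u. \<alpha> (v(i := u)))) \<and>
     (\<forall>v i j. i \<noteq> j \<and> v i = v j \<longrightarrow> \<alpha> v = 0)"

definition form_in_chart ::
  "('x, 'n::finite) chart set \<Rightarrow> ('x, 'n) chart \<Rightarrow> ('x, 'i, 'n) form \<Rightarrow>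
     real ^ 'n \<Rightarrow> ('i \<Rightarrow> real ^ 'n) \<Rightarrow> real" where
  "form_in_chart A c \<omega> y v = \<omega> (chart_inv c y) (\<lambda>i. from_chart A c (chart_inv c y) (v i))"

definition smooth_form ::
  "('x::topological_space, 'n::finite) chart set \<Rightarrow> ('x, 'i::finite, 'n) form \<Rightarrow> bool" where
  "smooth_form A \<omega> \<longleftrightarrow>
     (\<forall>x. alt_form (\<omega> x)) \<and>
     (\<forall>c\<in>A. \<forall>v. smooth_on (chart_img c) (\<lambda>y. form_in_chart A c \<omega> y v))"

text \<open>The exterior derivative raises the index type from \<open>'i\<close> to \<open>'i option\<close>, where \<open>None\<close> is
  regarded as the first argument. In the usual alternating sum of the
  \<open>(-1)^i D\<^sub>v\<^sub>i \<omega>(v\<^sub>0, \<dots>, omit v\<^sub>i, \<dots>, v\<^sub>p)\<close>, moving \<open>v\<^sub>0\<close> to the slot vacated by \<open>v\<^sub>i\<close>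
  contributes the sign \<open>(-1)^(i-1)\<close>, so that every term with \<open>i > 0\<close> occurs with a minus sign.\<close>

definition ext_deriv ::
  "('x, 'n::finite) chart set \<Rightarrow> ('x, 'i::finite, 'n) form \<Rightarrow> ('x, 'i option, 'n) form" where
  "ext_deriv A \<omega> x v =
     (let c = chart_at A x;
          D = (\<lambda>u w. frechet_derivative (\<lambda>y. form_in_chart A c \<omega> y w) (at (snd c x)) u)
      in D (v None) (v \<circ> Some) - (\<Sum>i\<in>UNIV. D (v (Some i)) ((v \<circ> Some)(i := v None))))"

definition form_support :: "('x::topological_space, 'i, 'n) form \<Rightarrow> 'x set" where
  "form_support \<omega> = closure {x. \<exists>v. \<omega> x v \<noteq> 0}"

definition test_form ::
  "('x::topological_space, 'n::finite) chart set \<Rightarrow> ('x, 'i::finite, 'n) form \<Rightarrow> bool" where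
  "test_form A \<omega> \<longleftrightarrow> smooth_form A \<omega> \<and> compact (form_support \<omega>)"

definition null_sequence ::
  "('x::topological_space, 'n::finite) chart set \<Rightarrow> (nat \<Rightarrow> ('x, 'i::finite, 'n) form) \<Rightarrow> bool" where
  "null_sequence A \<omega> \<longleftrightarrow>
     (\<forall>k. test_form A (\<omega> k)) \<and>
     (\<exists>K. compact K \<and> (\<forall>k. form_support (\<omega> k) \<subseteq> K)) \<and>
     (\<forall>c\<in>A. \<forall>L us v. compact L \<and> L \<subseteq> chart_img c \<longrightarrow>
        uniform_limit L (\<lambda>k. iter_deriv us (\<lambda>y. form_in_chart A c (\<omega> k) y v)) (\<lambda>_. 0) sequentially)"


section \<open>Currents\<close>

text \<open>A current of dimension \<open>CARD('i)\<close> is given by its values on test forms; its values on other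
  arguments are irrelevant.\<close>

type_synonym ('x, 'i, 'n) current = "('x, 'i, 'n) form \<Rightarrow> real"

definition is_current ::
  "('x::topological_space, 'n::finite) chart set \<Rightarrow> ('x, 'i::finite, 'n) current \<Rightarrow> bool" where
  "is_current A T \<longleftrightarrow>
     (\<forall>\<omega> \<eta>. test_form A \<omega> \<and> test_form A \<eta> \<longrightarrow> T (\<lambda>x v. \<omega> x v + \<eta> x v) = T \<omega> + T \<eta>) \<and>
     (\<forall>a \<omega>. test_form A \<omega> \<longrightarrow> T (\<lambda>x v. a * \<omega> x v) = a * T \<omega>) \<and>
     (\<forall>\<omega>. null_sequence A \<omega> \<longrightarrow> (\<lambda>k. T (\<omega> k)) \<longlonglongrightarrow> 0)"

definition current_support ::
  "('x::topological_space, 'n::finite) chart set \<Rightarrow> ('x, 'i::finite, 'n) current \<Rightarrow> 'x set" where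
  "current_support A T =
     {x. \<forall>U. open U \<and> x \<in> U \<longrightarrow> (\<exists>\<omega>. test_form A \<omega> \<and> form_support \<omega> \<subseteq> U \<and> T \<omega> \<noteq> 0)}"

definition boundary ::
  "('x, 'n::finite) chart set \<Rightarrow> ('x, 'i::finite option, 'n) current \<Rightarrow> ('x, 'i, 'n) current" where
  "boundary A R \<omega> = R (ext_deriv A \<omega>)"

definition homologous ::
  "('x::topological_space, 'n::finite) chart set \<Rightarrow>
     ('x, 'i::finite, 'n) current \<Rightarrow> ('x, 'i, 'n) current \<Rightarrow> bool" where
  "homologous A S T \<longleftrightarrow>
     (\<exists>R. is_current A R \<and> compact (current_support A R) \<and>
        (\<forall>\<omega>. test_form A \<omega> \<longrightarrow> S \<omega> = T \<omega> + boundary A R \<omega>))"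


section \<open>Multivectors\<close>

text \<open>The exterior power of degree \<open>CARD('i)\<close> is realized as the space of alternating tensors;
  tensors are indexed by the maps \<open>'i \<Rightarrow> 'n\<close>.\<close>

definition wedge :: "('i::finite \<Rightarrow> real ^ 'n::finite) \<Rightarrow> real ^ ('i \<Rightarrow> 'n)" where
  "wedge v = (\<chi> f. det (\<chi> i j. v i $ f j))"

definition multivectors :: "(real ^ ('i::finite \<Rightarrow> 'n::finite)) set" where
  "multivectors = span (range wedge)"

text \<open>The normalization is such that \<open>pairing \<alpha> (wedge v) = \<alpha> v\<close> for alternating \<open>\<alpha>\<close>.\<close>

definition pairing ::
  "(('i::finite \<Rightarrow> real ^ 'n::finite) \<Rightarrow> real) \<Rightarrow> real ^ ('i \<Rightarrow> 'n) \<Rightarrow> real" where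
  "pairing \<alpha> \<xi> = (\<Sum>f\<in>UNIV. \<xi> $ f * \<alpha> (\<lambda>i. axis (f i) 1)) / fact CARD('i)"


section \<open>Metrics\<close>

type_synonym ('x, 'n) metric = "'x \<Rightarrow> real ^ 'n \<Rightarrow> real ^ 'n \<Rightarrow> real"

definition smooth_symmetric_tensor ::
  "('x::topological_space, 'n::finite) chart set \<Rightarrow> ('x, 'n) metric \<Rightarrow> bool" where
  "smooth_symmetric_tensor A g \<longleftrightarrow>
     (\<forall>x. bilinear (g x)) \<and> (\<forall>x u v. g x u v = g x v u) \<and>
     (\<forall>c\<in>A. \<forall>u v. smooth_on (chart_img c)
        (\<lambda>y. let x = chart_inv c y in g x (from_chart A c x u) (from_chart A c x v)))"

definition riemannian_metric ::
  "('x::topological_space, 'n::finite) chart set \<Rightarrow> ('x, 'n) metric \<Rightarrow> bool" where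
  "riemannian_metric A h \<longleftrightarrow>
     smooth_symmetric_tensor A h \<and> (\<forall>x v. v \<noteq> 0 \<longrightarrow> h x v v > 0)"

text \<open>The signature is \<open>(CARD('p), CARD('q))\<close>, with \<open>CARD('p)\<close> positive directions.\<close>

definition semi_riemannian_metric ::
  "('x::topological_space, 'p::finite + 'q::finite) chart set \<Rightarrow> ('x, 'p + 'q) metric \<Rightarrow> bool" where
  "semi_riemannian_metric A g \<longleftrightarrow>
     smooth_symmetric_tensor A g \<and>
     (\<forall>x. \<exists>b :: 'p + 'q \<Rightarrow> real ^ ('p + 'q).
        \<forall>i j. g x (b i) (b j) = (if i \<noteq> j then 0 else if i \<in> range Inl then 1 else - 1))"

definition orthonormal_frame ::
  "('x, 'n) metric \<Rightarrow> 'x \<Rightarrow> ('i \<Rightarrow> real ^ 'n) \<Rightarrow> bool" where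
  "orthonormal_frame g x e \<longleftrightarrow> (\<forall>i j. g x (e i) (e j) = (if i = j then 1 else 0))"


section \<open>Polar forms and rectifiability\<close>

text \<open>On a second countable manifold, Borel measures that are finite on compact sets are regular.\<close>

definition radon_measure :: "'x::topological_space measure \<Rightarrow> bool" where
  "radon_measure \<mu> \<longleftrightarrow> sets \<mu> = sets borel \<and> (\<forall>K. compact K \<longrightarrow> emeasure \<mu> K < \<infinity>)"

text \<open>\<open>T = \<xi> \<mu>\<close>. Measurability of the multivector field \<open>\<xi>\<close> is part of the integrability of all its
  pairings with test forms.\<close>

definition represents ::
  "('x::topological_space, 'n::finite) chart set \<Rightarrow> ('x, 'i::finite, 'n) current \<Rightarrow>
     ('x \<Rightarrow> real ^ ('i \<Rightarrow> 'n)) \<Rightarrow> 'x measure \<Rightarrow> bool" where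
  "represents A T \<xi> \<mu> \<longleftrightarrow>
     radon_measure \<mu> \<and>
     (\<forall>\<omega>. test_form A \<omega> \<longrightarrow>
        integrable \<mu> (\<lambda>x. pairing (\<omega> x) (\<xi> x)) \<and> T \<omega> = (LINT x|\<mu>. pairing (\<omega> x) (\<xi> x)))"

text \<open>The mass norm of a Riemannian metric, i.e. the dual norm of the comass.\<close>

definition riemannian_mass ::
  "('x, 'n::finite) metric \<Rightarrow> 'x \<Rightarrow> real ^ ('i::finite \<Rightarrow> 'n) \<Rightarrow> real" where
  "riemannian_mass h x \<xi> =
     Sup {pairing \<alpha> \<xi> | \<alpha>. alt_form \<alpha> \<and> (\<forall>e. orthonormal_frame h x e \<longrightarrow> \<alpha> e \<le> 1)}"

definition riemannian_polar_form ::
  "('x::topological_space, 'n::finite) chart set \<Rightarrow> ('x, 'n) metric \<Rightarrow>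
     ('x, 'i::finite, 'n) current \<Rightarrow> ('x \<Rightarrow> real ^ ('i \<Rightarrow> 'n)) \<Rightarrow> 'x measure \<Rightarrow> bool" where
  "riemannian_polar_form A h T \<xi> \<mu> \<longleftrightarrow>
     represents A T \<xi> \<mu> \<and> (AE x in \<mu>. \<xi> x \<in> multivectors \<and> riemannian_mass h x (\<xi> x) = 1)"

text \<open>Being of type \<open>\<S>\<close>, for a field \<open>\<S>\<close> of sets closed under multiplication by positive
  scalars, does not depend on the auxiliary metric \<open>h\<close>.\<close>

definition of_type ::
  "('x::topological_space, 'n::finite) chart set \<Rightarrow> ('x \<Rightarrow> (real ^ ('i::finite \<Rightarrow> 'n)) set) \<Rightarrow>
     ('x, 'i, 'n) current \<Rightarrow> bool" where
  "of_type A \<S> T \<longleftrightarrow>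
     (\<exists>h \<xi> \<mu>. riemannian_metric A h \<and> riemannian_polar_form A h T \<xi> \<mu> \<and> (AE x in \<mu>. \<xi> x \<in> \<S> x))"

text \<open>The frame at \<open>chart_inv c (F y)\<close> which is the image of the standard frame of \<open>real ^ 'i\<close> under
  the differential at \<open>y\<close> of \<open>chart_inv c \<circ> F\<close>.\<close>

definition push_frame ::
  "('x, 'n::finite) chart set \<Rightarrow> ('x, 'n) chart \<Rightarrow> (real ^ 'i::finite \<Rightarrow> real ^ 'n) \<Rightarrow>
     real ^ 'i \<Rightarrow> 'i \<Rightarrow> real ^ 'n" where
  "push_frame A c F y i =
     from_chart A c (chart_inv c (F y)) (frechet_derivative F (at y) (axis i 1))"

text \<open>A locally rectifiable current is a countable sum, with integer coefficients \<open>m k\<close>, of Lipschitz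
  images of compact sets \<open>K k\<close> in Euclidean space, whose masses with respect to an auxiliary
  Riemannian metric are summable over every compact set \<open>C\<close>. The pieces are taken small enough to
  lie in a chart each; the differentials exist almost everywhere by Rademacher's theorem, and the
  values at the other points do not matter.\<close>

definition locally_rectifiable ::
  "('x::topological_space, 'n::finite) chart set \<Rightarrow> ('x, 'i::finite, 'n) current \<Rightarrow> bool" where
  "locally_rectifiable A T \<longleftrightarrow>
     is_current A T \<and>
     (\<exists>(m :: nat \<Rightarrow> int) (K :: nat \<Rightarrow> (real ^ 'i) set) (c :: nat \<Rightarrow> ('x, 'n) chart)
       (F :: nat \<Rightarrow> real ^ 'i \<Rightarrow> real ^ 'n) h.
        riemannian_metric A h \<and>
        (\<forall>k. compact (K k) \<and> c k \<in> A \<and> (\<exists>L. L-lipschitz_on UNIV (F k)) \<and>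
           F k ` K k \<subseteq> chart_img (c k)) \<and>
        (\<forall>C. compact C \<longrightarrow>
           (\<Sum>k. \<integral>\<^sup>+ y. ennreal (\<bar>of_int (m k)\<bar> *
              riemannian_mass h (chart_inv (c k) (F k y)) (wedge (push_frame A (c k) (F k) y))) *
              indicator {y \<in> K k. chart_inv (c k) (F k y) \<in> C} y \<partial>lebesgue) < \<infinity>) \<and>
        (\<forall>\<omega>. test_form A \<omega> \<longrightarrow>
           (\<lambda>k. of_int (m k) *
              (LINT y:K k|lebesgue. \<omega> (chart_inv (c k) (F k y)) (push_frame A (c k) (F k) y)))
             sums T \<omega>))"


section \<open>Space-like geometry\<close>

definition space_like_planes ::
  "('x, 'p::finite + 'q::finite) metric \<Rightarrow> 'x \<Rightarrow> (real ^ ('p \<Rightarrow> 'p + 'q)) set" where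
  "space_like_planes g x = {wedge e | e. orthonormal_frame g x e}"

text \<open>A choice \<open>G x\<close> of a connected component of the space-like planes at each point \<open>x\<close> is
  continuous if around every point there is a continuous frame (in the coordinates of some chart)
  that represents the chosen components.\<close>

definition space_like_orientation ::
  "('x::topological_space, 'p::finite + 'q::finite) chart set \<Rightarrow> ('x, 'p + 'q) metric \<Rightarrow>
     ('x \<Rightarrow> (real ^ ('p \<Rightarrow> 'p + 'q)) set) \<Rightarrow> bool" where
  "space_like_orientation A g G \<longleftrightarrow>
     (\<forall>x. G x \<in> components (space_like_planes g x)) \<and>
     (\<forall>x. \<exists>c\<in>A. \<exists>U e. open U \<and> x \<in> U \<and> U \<subseteq> fst c \<and>
        (\<forall>i. continuous_on U (e i)) \<and>
        (\<forall>y\<in>U. wedge (\<lambda>i. from_chart A c y (e i y)) \<in> G y))"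

text \<open>In what follows, \<open>G\<close> is the field of positive space-like planes.\<close>

definition mass_ball ::
  "('x \<Rightarrow> (real ^ ('i::finite \<Rightarrow> 'n::finite)) set) \<Rightarrow> 'x \<Rightarrow> (real ^ ('i \<Rightarrow> 'n)) set" where
  "mass_ball G x = convex hull (G x)"

definition mass_cone ::
  "('x \<Rightarrow> (real ^ ('i::finite \<Rightarrow> 'n::finite)) set) \<Rightarrow> 'x \<Rightarrow> (real ^ ('i \<Rightarrow> 'n)) set" where
  "mass_cone G x = {t *\<^sub>R \<xi> | t \<xi>. t > 0 \<and> \<xi> \<in> mass_ball G x}"

text \<open>The boundary of the mass ball is taken in the space of multivectors, not in the larger space
  of all tensors.\<close>

definition mass_norm ::
  "('x \<Rightarrow> (real ^ ('i::finite \<Rightarrow> 'n::finite)) set) \<Rightarrow> 'x \<Rightarrow> real ^ ('i \<Rightarrow> 'n) \<Rightarrow> real" where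
  "mass_norm G x \<xi> =
     1 / (THE l. l > 0 \<and> l *\<^sub>R \<xi> \<in> (top_of_set multivectors) frontier_of (mass_ball G x))"

definition positive_space_like ::
  "('x::topological_space, 'n::finite) chart set \<Rightarrow> ('x \<Rightarrow> (real ^ ('i::finite \<Rightarrow> 'n)) set) \<Rightarrow>
     ('x, 'i, 'n) current \<Rightarrow> bool" where
  "positive_space_like A G T \<longleftrightarrow> of_type A (mass_cone G) T"

definition semi_riemannian_polar_form ::
  "('x::topological_space, 'n::finite) chart set \<Rightarrow> ('x \<Rightarrow> (real ^ ('i::finite \<Rightarrow> 'n)) set) \<Rightarrow>
     ('x, 'i, 'n) current \<Rightarrow> ('x \<Rightarrow> real ^ ('i \<Rightarrow> 'n)) \<Rightarrow> 'x measure \<Rightarrow> bool" where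
  "semi_riemannian_polar_form A G T \<xi> \<mu> \<longleftrightarrow>
     represents A T \<xi> \<mu> \<and> (AE x in \<mu>. \<xi> x \<in> mass_cone G x \<and> mass_norm G x (\<xi> x) = 1)"

definition vol ::
  "('x::topological_space, 'n::finite) chart set \<Rightarrow> ('x \<Rightarrow> (real ^ ('i::finite \<Rightarrow> 'n)) set) \<Rightarrow>
     ('x, 'i, 'n) current \<Rightarrow> ennreal" where
  "vol A G T =
     (THE a. \<exists>\<xi> \<mu>. semi_riemannian_polar_form A G T \<xi> \<mu> \<and> a = emeasure \<mu> (space \<mu>))"

definition calibration ::
  "('x::topological_space, 'n::finite) chart set \<Rightarrow> ('x \<Rightarrow> (real ^ ('i::finite \<Rightarrow> 'n)) set) \<Rightarrow>
     ('x, 'i, 'n) form \<Rightarrow> bool" where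
  "calibration A G \<phi> \<longleftrightarrow>
     smooth_form A \<phi> \<and> (\<forall>x v. ext_deriv A \<phi> x v = 0) \<and> (\<forall>x. \<forall>\<xi>\<in>G x. pairing (\<phi> x) \<xi> \<ge> 1)"

definition calibrated_planes ::
  "('x \<Rightarrow> (real ^ ('i::finite \<Rightarrow> 'n::finite)) set) \<Rightarrow> ('x, 'i, 'n) form \<Rightarrow>
     'x \<Rightarrow> (real ^ ('i \<Rightarrow> 'n)) set" where
  "calibrated_planes G \<phi> x = {\<xi> \<in> G x. pairing (\<phi> x) \<xi> = 1}"

definition calibrated_subvariety ::
  "('x::topological_space, 'n::finite) chart set \<Rightarrow> ('x \<Rightarrow> (real ^ ('i::finite \<Rightarrow> 'n)) set) \<Rightarrow>
     ('x, 'i, 'n) form \<Rightarrow> ('x, 'i, 'n) current \<Rightarrow> bool" where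
  "calibrated_subvariety A G \<phi> T \<longleftrightarrow>
     locally_rectifiable A T \<and>
     of_type A (\<lambda>x. {t *\<^sub>R \<xi> | t \<xi>. t > 0 \<and> \<xi> \<in> calibrated_planes G \<phi> x}) T"

end

theory Submission
  imports Defs "HOL-Analysis.Analysis"
begin

text \<open>Let \<open>\<psi>\<close> be a cutoff function that is 1 near the supports of \<open>S\<close>, \<open>T\<close> and \<open>R\<close>. Since \<open>\<phi>\<close> is closed and
  \<open>d\<psi>\<close> vanishes near the support of \<open>R\<close>, homologous currents agree on \<open>\<psi> \<phi>\<close>. It remains to compare
  \<open>S (\<psi> \<phi>)\<close>, the integral of \<open>\<phi> \<xi>\<close> for a polar form \<open>S = \<xi> \<mu>\<close>, with the volume. The multivector \<open>\<xi>\<close> of a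
  rectifiable current is simple almost everywhere, being tangent to bi-Lipschitz pieces. A simple
  element of the mass cone is a positive multiple \<open>k \<eta>\<close> of a positive plane \<open>\<eta>\<close>, by the reverse
  Cauchy-Schwarz inequality \<open>\<eta> \<cdot> \<zeta> \<ge> 1\<close> for positive planes, and \<open>\<eta>\<close> lies on the boundary of the mass ball,
  so \<open>k\<close> is its mass norm. Hence \<open>\<phi> \<xi> \<ge> k\<close>, with equality precisely when \<open>\<phi> \<eta> = 1\<close>.\<close>

section \<open>Density points and differentiability of Lipschitz functions\<close>

text \<open>The abstract polar form and the Lipschitz pieces describe a current independently of
  each other, and the pieces may overlap and cancel. Both descriptions are therefore turned into
  signed measures on the manifold, one for each coordinate of the multivector, and compared there.
  Overlaps are harmless because two pieces share their tangent planes at density points of their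
  intersection. Density points also give the differentiability of Lipschitz maps, which is why they
  come at the start. The fixed identification of the tangent spaces jumps from point to point. Hence
  a multivector field is accessible only through pairings with test forms that read its coordinates
  in one chart, and the factor \<open>k\<close> is recovered from these coordinates as the square
  root of a Gram determinant. \<open>vol\<close> is given by a definite description, so all polar
  forms must be shown to have the same total mass. The calibration is positive on the mass cone, and
  weighting a representing measure by it gives a measure common to all polar forms, relative to
  which they can be compared.\<close>

lemma closed_density_box:
  fixes E :: "'a::euclidean_space set"
  assumes "closed E"
  obtains N where "negligible N"
    "\<And>x e. x \<in> E - N \<Longrightarrow> 0 < e \<Longrightarrow>
       \<exists>d>0. \<forall>h. 0 < h \<and> h < d \<longrightarrow> measure lebesgue (E \<inter> cbox x (x + h *\<^sub>R One)) > (1 - e) * h ^ DIM('a)"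
proof -
  have meas: "E \<inter> cbox a b \<in> lmeasurable" for a b
    by (intro lmeasurable_compact closed_Int_compact assms compact_cbox)
  have "(indicator E :: 'a \<Rightarrow> real) integrable_on cbox a b" for a b
  proof -
    have "(\<lambda>x. if x \<in> E then 1 else (0::real)) integrable_on cbox a b"
      using integrable_on_const[OF meas, of 1 a b]
      by (simp add: integrable_restrict_Int)
    then show ?thesis by (simp add: indicator_def[abs_def] of_bool_def)
  qed
  \<comment> \<open>Lebesgue differentiation is used over cubes with lower corner \<open>x\<close>,
    so the density statement sees only the positive orthant.\<close>
  then obtain N where N: "negligible N"
    "\<And>x e. \<lbrakk>x \<notin> N; 0 < e\<rbrakk> \<Longrightarrow>
        \<exists>d>0. \<forall>h. 0 < h \<and> h < d \<longrightarrow>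
           norm (integral (cbox x (x + h *\<^sub>R One)) (indicator E) /\<^sub>R h ^ DIM('a) - (indicator E x :: real)) < e"
    using integrable_ccontinuous_explicit[of "indicator E :: 'a \<Rightarrow> real"] by blast
  show thesis
  proof (rule that[OF N(1)])
    fix x and e :: real assume x: "x \<in> E - N" and e: "0 < e"
    then obtain d where d: "d > 0" "\<And>h. 0 < h \<and> h < d \<Longrightarrow>
           norm (integral (cbox x (x + h *\<^sub>R One)) (indicator E) /\<^sub>R h ^ DIM('a) - (indicator E x :: real)) < e"
      using N(2)[of x e] by blast
    show "\<exists>d>0. \<forall>h. 0 < h \<and> h < d \<longrightarrow> measure lebesgue (E \<inter> cbox x (x + h *\<^sub>R One)) > (1 - e) * h ^ DIM('a)"
    proof (intro exI[of _ d] conjI allI impI d(1))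
      fix h :: real assume h: "0 < h \<and> h < d"
      have "\<bar>measure lebesgue (E \<inter> cbox x (x + h *\<^sub>R One)) / h ^ DIM('a) - 1\<bar> < e"
        using d(2)[OF h] x
        by (simp add: Equivalence_Lebesgue_Henstock_Integration.integral_indicator[OF meas] divide_inverse mult.commute)
      then have "1 - e < measure lebesgue (E \<inter> cbox x (x + h *\<^sub>R One)) / h ^ DIM('a)"
        by linarith
      then show "measure lebesgue (E \<inter> cbox x (x + h *\<^sub>R One)) > (1 - e) * h ^ DIM('a)"
        using h by (simp add: pos_less_divide_eq)
    qed
  qed
qed

lemma content_cube:
  fixes x :: "'a::euclidean_space"
  assumes "s \<ge> 0"
  shows "measure lebesgue (cbox x (x + s *\<^sub>R One)) = s ^ DIM('a)"
  using assms by (subst measure_completion) (auto simp: content_cbox inner_simps)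

text \<open>If no point of \<open>E\<close> is close to \<open>x + h\<close>, then a cube at
  \<open>x + h\<close> of size comparable to \<open>norm h\<close> misses \<open>E\<close>. It fills
  a fixed proportion of a cube at \<open>x\<close>, which contradicts density.\<close>

lemma closed_density_orthant:
  fixes E :: "'a::euclidean_space set"
  assumes "closed E"
  obtains N where "negligible N"
    "\<And>x \<eta>. x \<in> E - N \<Longrightarrow> 0 < \<eta> \<Longrightarrow>
       \<exists>r>0. \<forall>h. norm h < r \<and> (\<forall>b\<in>Basis. h \<bullet> b \<ge> 0) \<longrightarrow> (\<exists>z\<in>E. norm (z - (x + h)) \<le> \<eta> * norm h)"
proof -
  obtain N where N: "negligible N"
    "\<And>x e. x \<in> E - N \<Longrightarrow> 0 < e \<Longrightarrow>
       \<exists>d>0. \<forall>h. 0 < h \<and> h < d \<longrightarrow> measure lebesgue (E \<inter> cbox x (x + h *\<^sub>R One)) > (1 - e) * h ^ DIM('a)"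
    using closed_density_box[OF assms] by blast
  show thesis
  proof (rule that[OF N(1)])
    fix x and \<eta> :: real assume x: "x \<in> E - N" and \<eta>: "0 < \<eta>"
    define n where "n = real DIM('a)"
    have n: "n > 0" by (simp add: n_def)
    \<comment> \<open>The volume ratio of the two cubes below, with sides
      \<open>t = \<eta> * norm h / n\<close> and \<open>s = (1 + \<eta>) * norm h\<close>. Dividing
      by the dimension \<open>n\<close> keeps every point of the small cube within
      \<open>\<eta> * norm h\<close> of its corner.\<close>
    define e where "e = (\<eta> / (n * (1 + \<eta>))) ^ DIM('a)"
    have "e > 0" using \<eta> n by (simp add: e_def)
    then obtain d where d: "d > 0"
      "\<And>h. 0 < h \<and> h < d \<Longrightarrow> measure lebesgue (E \<inter> cbox x (x + h *\<^sub>R One)) > (1 - e) * h ^ DIM('a)"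
      using N(2)[OF x] by blast
    show "\<exists>r>0. \<forall>h. norm h < r \<and> (\<forall>b\<in>Basis. h \<bullet> b \<ge> 0) \<longrightarrow> (\<exists>z\<in>E. norm (z - (x + h)) \<le> \<eta> * norm h)"
    proof (intro exI[of _ "d / (1 + \<eta>)"] conjI allI impI)
      show "0 < d / (1 + \<eta>)" using d \<eta> by simp
      fix h :: 'a assume h: "norm h < d / (1 + \<eta>) \<and> (\<forall>b\<in>Basis. 0 \<le> h \<bullet> b)"
      show "\<exists>z\<in>E. norm (z - (x + h)) \<le> \<eta> * norm h"
      proof (rule ccontr)
        assume "\<not> ?thesis"
        then have far: "norm (z - (x + h)) > \<eta> * norm h" if "z \<in> E" for z
          using that by auto
        have "h \<noteq> 0" using far[of x] x by auto
        then have k: "norm h > 0" by simp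
        define s where "s = (1 + \<eta>) * norm h"
        define t where "t = \<eta> * norm h / n"
        have s: "0 < s" "s < d" using h k \<eta> by (auto simp: s_def field_simps intro: add_pos_pos)
        have t: "t > 0" using k \<eta> n by (simp add: t_def)
        have n1: "n \<ge> 1" unfolding n_def using DIM_ge_Suc0[where 'a='a] by linarith
        have tle: "t \<le> \<eta> * norm h"
          unfolding t_def using n1 k \<eta> divide_left_mono[of 1 n "\<eta> * norm h"] by simp
        define Q where "Q = cbox x (x + s *\<^sub>R One)"
        define q where "q = cbox (x + h) (x + h + t *\<^sub>R One)"
        have qQ: "q \<subseteq> Q"
        proof
          fix z assume z: "z \<in> q"
          show "z \<in> Q"
            unfolding Q_def mem_box
          proof (intro ballI conjI)
            fix b :: 'a assume b: "b \<in> Basis"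
            have "\<bar>h \<bullet> b\<bar> \<le> norm h" using b by (rule Basis_le_norm)
            moreover have "(x + h) \<bullet> b \<le> z \<bullet> b" "z \<bullet> b \<le> (x + h + t *\<^sub>R One) \<bullet> b"
              using z b unfolding q_def mem_box by auto
            ultimately show "x \<bullet> b \<le> z \<bullet> b" "z \<bullet> b \<le> (x + s *\<^sub>R One) \<bullet> b"
              using h b tle by (auto simp: inner_simps s_def algebra_simps)
          qed
        qed
        have qE: "q \<inter> E = {}"
        proof (rule ccontr)
          assume "q \<inter> E \<noteq> {}"
          then obtain z where z: "z \<in> q" "z \<in> E" by blast
          have "norm (z - (x + h)) \<le> (\<Sum>b\<in>Basis. \<bar>(z - (x + h)) \<bullet> b\<bar>)" by (rule norm_le_l1)
          also have "\<dots> \<le> (\<Sum>b\<in>(Basis::'a set). t)"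
            by (rule sum_mono) (use z in \<open>auto simp: q_def mem_box inner_simps algebra_simps\<close>)
          also have "\<dots> = \<eta> * norm h" using n by (simp add: t_def n_def)
          finally show False using far[OF z(2)] by simp
        qed
        have "measure lebesgue (E \<inter> Q) \<le> measure lebesgue (Q - q)"
          using qE by (intro measure_mono_fmeasurable)
            (auto simp: Q_def q_def intro!: fmeasurable_Diff sets.Int borel_closed assms)
        also have "\<dots> = measure lebesgue Q - measure lebesgue q"
          using qQ by (intro measurable_measure_Diff) (auto simp: Q_def q_def)
        also have "\<dots> = s ^ DIM('a) - t ^ DIM('a)"
          using s t content_cube[of s x] content_cube[of t "x + h"] by (simp add: Q_def q_def)
        also have "\<dots> = (1 - e) * s ^ DIM('a)"
        proof -
          have "t = \<eta> / (n * (1 + \<eta>)) * s"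
            proof -
            have "(1 + \<eta>) \<noteq> 0" using \<eta> by simp
            then show ?thesis unfolding t_def s_def using n by simp
          qed
          then have "t ^ DIM('a) = e * s ^ DIM('a)"
            unfolding e_def by (simp only: power_mult_distrib)
          then show ?thesis by (simp add: left_diff_distrib)
        qed
        finally show False using d(2)[of s] s by (simp add: Q_def)
      qed
    qed
  qed
qed

text \<open>Coordinate reflections carry the orthant of \<open>h\<close> to the positive one, and
  each of the finitely many reflected copies of \<open>E\<close> contributes one null set.\<close>

lemma closed_density_points:
  fixes E :: "'a::euclidean_space set"
  assumes "closed E"
  obtains N where "negligible N"
    "\<And>x \<eta>. x \<in> E - N \<Longrightarrow> 0 < \<eta> \<Longrightarrow>
       \<exists>r>0. \<forall>h. norm h < r \<longrightarrow> (\<exists>z\<in>E. norm (z - (x + h)) \<le> \<eta> * norm h)"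
proof -
  \<comment> \<open>For a sign vector \<open>s\<close> in \<open>\<Sigma>\<close> this is a linear
    isometry and its own inverse.\<close>
  define R where "R s x = (\<Sum>b\<in>Basis. (s b * (x \<bullet> b)) *\<^sub>R b)" for s and x :: 'a
  define \<Sigma> where "\<Sigma> = (PiE Basis (\<lambda>_. {1, -1}) :: ('a \<Rightarrow> real) set)"
  have fin: "finite \<Sigma>" unfolding \<Sigma>_def by (intro finite_PiE) auto
  have Rb: "R s x \<bullet> b = s b * (x \<bullet> b)" if "b \<in> Basis" for s x b
    using that by (simp add: R_def)
  have sq: "s b * s b = 1" if "s \<in> \<Sigma>" "b \<in> Basis" for s b
    using that by (auto simp: \<Sigma>_def PiE_iff)
  have RR: "R s (R s x) = x" if "s \<in> \<Sigma>" for s x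
    using sq[OF that] by (rule_tac euclidean_eqI) (metis Rb mult.assoc mult_1)
  have lin: "linear (R s)" for s
    by (rule linearI; rule euclidean_eqI) (simp_all add: Rb inner_simps distrib_left)
  have nR: "norm (R s x) = norm x" if "s \<in> \<Sigma>" for s x
  proof -
    have "(R s x \<bullet> b) * (R s x \<bullet> b) = (x \<bullet> b) * (x \<bullet> b)" if "b \<in> Basis" for b
      using sq[OF \<open>s \<in> \<Sigma>\<close> that] unfolding Rb[OF that] by algebra
    then have "R s x \<bullet> R s x = x \<bullet> x"
      by (subst (1 2) euclidean_inner) (auto intro!: sum.cong)
    then show ?thesis by (simp add: norm_eq_sqrt_inner)
  qed
  have "\<exists>N. \<forall>s\<in>\<Sigma>. negligible (N s) \<and> (\<forall>x \<eta>. x \<in> (R s -` E) - N s \<longrightarrow> 0 < \<eta> \<longrightarrow>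
       (\<exists>r>0. \<forall>h. norm h < r \<and> (\<forall>b\<in>Basis. h \<bullet> b \<ge> 0) \<longrightarrow> (\<exists>z\<in>R s -` E. norm (z - (x + h)) \<le> \<eta> * norm h)))"
  proof (rule bchoice, intro ballI)
    fix s assume "s \<in> \<Sigma>"
    have "closed (R s -` E)"
      using lin assms by (intro continuous_closed_vimage linear_continuous_at) (auto simp: linear_conv_bounded_linear)
    then show "\<exists>N. negligible N \<and> (\<forall>x \<eta>. x \<in> (R s -` E) - N \<longrightarrow> 0 < \<eta> \<longrightarrow>
       (\<exists>r>0. \<forall>h. norm h < r \<and> (\<forall>b\<in>Basis. h \<bullet> b \<ge> 0) \<longrightarrow> (\<exists>z\<in>R s -` E. norm (z - (x + h)) \<le> \<eta> * norm h)))"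
      using closed_density_orthant by (metis (no_types, lifting))
  qed
  then obtain N where N0: "\<forall>s\<in>\<Sigma>. negligible (N s) \<and> (\<forall>x \<eta>. x \<in> (R s -` E) - N s \<longrightarrow> 0 < \<eta> \<longrightarrow>
       (\<exists>r>0. \<forall>h. norm h < r \<and> (\<forall>b\<in>Basis. h \<bullet> b \<ge> 0) \<longrightarrow> (\<exists>z\<in>R s -` E. norm (z - (x + h)) \<le> \<eta> * norm h)))"
    by (rule exE)
  have N: "\<And>s. s \<in> \<Sigma> \<Longrightarrow> negligible (N s)" using N0 by simp
  have N2: "\<And>s x \<eta>. s \<in> \<Sigma> \<Longrightarrow> x \<in> (R s -` E) - N s \<Longrightarrow> 0 < \<eta> \<Longrightarrow>
       \<exists>r>0. \<forall>h. norm h < r \<and> (\<forall>b\<in>Basis. h \<bullet> b \<ge> 0) \<longrightarrow> (\<exists>z\<in>R s -` E. norm (z - (x + h)) \<le> \<eta> * norm h)"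
    using N0 by simp
  show thesis
  proof (rule that)
    show "negligible (\<Union>s\<in>\<Sigma>. R s ` N s)"
      by (intro negligible_Union) (auto intro!: finite_imageI fin negligible_differentiable_image_negligible linear_imp_differentiable_on lin N)
    fix x and \<eta> :: real assume x: "x \<in> E - (\<Union>s\<in>\<Sigma>. R s ` N s)" and \<eta>: "0 < \<eta>"
    have "\<forall>s\<in>\<Sigma>. \<exists>r>0. \<forall>h. norm h < r \<and> (\<forall>b\<in>Basis. h \<bullet> b \<ge> 0) \<longrightarrow>
        (\<exists>z\<in>R s -` E. norm (z - (R s x + h)) \<le> \<eta> * norm h)"
    proof
      fix s assume s: "s \<in> \<Sigma>"
      have "R s x \<in> (R s -` E) - N s"
        using x s RR[OF s] by (auto simp: image_iff) (metis)
      then show "\<exists>r>0. \<forall>h. norm h < r \<and> (\<forall>b\<in>Basis. h \<bullet> b \<ge> 0) \<longrightarrow>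
        (\<exists>z\<in>R s -` E. norm (z - (R s x + h)) \<le> \<eta> * norm h)"
        using N2[OF s _ \<eta>] by blast
    qed
    then obtain r where r: "\<And>s. s \<in> \<Sigma> \<Longrightarrow> r s > 0"
      "\<And>s h. s \<in> \<Sigma> \<Longrightarrow> norm h < r s \<Longrightarrow> (\<And>b. b \<in> Basis \<Longrightarrow> h \<bullet> b \<ge> 0) \<Longrightarrow>
        \<exists>z\<in>R s -` E. norm (z - (R s x + h)) \<le> \<eta> * norm h"
      using bchoice[of \<Sigma>] by (metis (no_types, lifting))
    have ne: "\<Sigma> \<noteq> {}" by (simp add: \<Sigma>_def PiE_eq_empty_iff)
    show "\<exists>r>0. \<forall>h. norm h < r \<longrightarrow> (\<exists>z\<in>E. norm (z - (x + h)) \<le> \<eta> * norm h)"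
    proof (intro exI[of _ "Min (r ` \<Sigma>)"] conjI allI impI)
      show "0 < Min (r ` \<Sigma>)" using fin ne r(1) by simp
      fix h :: 'a assume h: "norm h < Min (r ` \<Sigma>)"
      define s where "s = restrict (\<lambda>b. if h \<bullet> b \<ge> 0 then 1 else -1 :: real) Basis"
      have s: "s \<in> \<Sigma>" by (auto simp: s_def \<Sigma>_def)
      have "\<exists>z\<in>R s -` E. norm (z - (R s x + R s h)) \<le> \<eta> * norm (R s h)"
      proof (rule r(2)[OF s])
        show "norm (R s h) < r s" using h s fin ne by (simp add: nR[OF s])
        fix b :: 'a assume b: "b \<in> Basis"
        show "0 \<le> R s h \<bullet> b" unfolding Rb[OF b] using b by (simp add: s_def)
      qed
      then obtain z where z: "R s z \<in> E" "norm (z - (R s x + R s h)) \<le> \<eta> * norm h"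
        using nR[OF s] by auto
      have "R s z - (x + h) = R s (z - (R s x + R s h))"
        using lin[of s] RR[OF s] by (simp add: linear_diff linear_add)
      then have "norm (R s z - (x + h)) \<le> \<eta> * norm h"
        using z nR[OF s] by simp
      then show "\<exists>z\<in>E. norm (z - (x + h)) \<le> \<eta> * norm h" using z(1) by blast
    qed
  qed
qed

section \<open>Dini derivatives of Lipschitz functions of one variable\<close>

lemma descend_right:
  fixes \<Psi> :: "real \<Rightarrow> real"
  assumes ab: "a \<le> b" and cont: "continuous_on {a..b} \<Psi>"
    and step: "\<And>y d. a \<le> y \<Longrightarrow> y < b \<Longrightarrow> 0 < d \<Longrightarrow> \<exists>h. 0 < h \<and> h < d \<and> \<Psi> (y + h) \<le> \<Psi> y"
  shows "\<Psi> b \<le> \<Psi> a"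
proof -
  define S where "S = {y \<in> {a..b}. \<Psi> y \<le> \<Psi> a}"
  have "closed S"
    unfolding S_def using cont by (intro continuous_on_closed_Collect_le) (auto intro: continuous_intros)
  moreover have "bounded S" by (rule bounded_subset[of "{a..b}"]) (auto simp: S_def)
  ultimately have "compact S" by (simp add: compact_eq_bounded_closed)
  moreover have "a \<in> S" using ab by (simp add: S_def)
  \<comment> \<open>The last point at which \<open>\<Psi>\<close> is at most
    \<open>\<Psi> a\<close>; unless it is \<open>b\<close>, one more step to the right contradicts
    its choice.\<close>
  ultimately obtain m where m: "m \<in> S" "\<And>y. y \<in> S \<Longrightarrow> y \<le> m"
    using compact_attains_sup[of S] by blast
  have "m = b"
  proof (rule ccontr)
    assume "m \<noteq> b"
    then have "a \<le> m" "m < b" using m(1) by (auto simp: S_def)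
    from step[OF this, of "b - m"] \<open>m < b\<close>
    obtain h where h: "0 < h" "h < b - m" "\<Psi> (m + h) \<le> \<Psi> m" by auto
    then have "m + h \<in> S" using m(1) by (auto simp: S_def)
    with m(2)[of "m + h"] h show False by simp
  qed
  then show ?thesis using m(1) by (simp add: S_def)
qed

text \<open>The slope is at most \<open>L\<close> everywhere and about \<open>r\<close> at points of
  \<open>F\<close>, so each unit of measure of \<open>F\<close> saves \<open>L - r\<close>. At
  points of \<open>F\<close> only some arbitrarily short steps are known to be good, hence the
  descent argument for an auxiliary function.\<close>

lemma lipschitz_increment_le:
  fixes f :: "real \<Rightarrow> real"
  assumes lip: "L-lipschitz_on UNIV f" and F: "closed F" and rL: "r \<le> L" and ab: "a \<le> b"
    and low: "\<And>y e d. y \<in> F \<Longrightarrow> 0 < e \<Longrightarrow> 0 < d \<Longrightarrow> \<exists>h. 0 < h \<and> h < d \<and> f (y + h) - f y \<le> (r + e) * h"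
  shows "f b - f a \<le> L * (b - a) - (L - r) * measure lebesgue (F \<inter> {a..b})"
proof -
  define \<mu> where "\<mu> y = measure lebesgue (F \<inter> {a..y})" for y
  have meas: "F \<inter> {u..v} \<in> lmeasurable" for u v
    by (intro lmeasurable_compact closed_Int_compact F) simp
  have inc: "\<mu> y \<le> \<mu> z" "\<mu> z \<le> \<mu> y + measure lebesgue (F \<inter> {y..z})" if "y \<le> z" for y z
  proof -
    show "\<mu> y \<le> \<mu> z" unfolding \<mu>_def using that
      by (intro measure_mono_fmeasurable meas fmeasurableD[OF meas]) auto
    have "\<mu> z \<le> measure lebesgue ((F \<inter> {a..y}) \<union> (F \<inter> {y..z}))" unfolding \<mu>_def using that
      by (intro measure_mono_fmeasurable fmeasurable.Un meas fmeasurableD[OF meas]) auto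
    also have "\<dots> \<le> \<mu> y + measure lebesgue (F \<inter> {y..z})"
      unfolding \<mu>_def by (intro measure_Un_le fmeasurableD[OF meas])
    finally show "\<mu> z \<le> \<mu> y + measure lebesgue (F \<inter> {y..z})" .
  qed
  have small: "measure lebesgue (F \<inter> {y..z}) \<le> z - y" if "y \<le> z" for y z
  proof -
    have "measure lebesgue (F \<inter> {y..z}) \<le> measure lebesgue {y..z}"
      by (intro measure_mono_fmeasurable fmeasurableD[OF meas]) auto
    then show ?thesis using that by simp
  qed
  have "1-lipschitz_on UNIV \<mu>"
  proof (rule lipschitz_on_leI)
    fix x y :: real assume "x \<le> y"
    then show "dist (\<mu> x) (\<mu> y) \<le> 1 * dist x y"
      using inc[of x y] small[of x y] by (simp add: dist_real_def)
  qed simp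
  then have c\<mu>: "continuous_on S \<mu>" for S
    using lipschitz_on_continuous_on lipschitz_on_subset by blast
  have cf: "continuous_on S f" for S
    using lip lipschitz_on_continuous_on lipschitz_on_subset by blast
  have fle: "f z - f y \<le> L * (z - y)" if "y \<le> z" for y z
    using lipschitz_onD[OF lip, of z y] that by (simp add: dist_real_def)
  have "f b - f a \<le> L * (b - a) - (L - r) * \<mu> b + e" if e: "e > 0" for e
  proof -
    define k where "k = e / (b - a + 1)"
    have k: "k > 0" using e ab by (simp add: k_def)
    \<comment> \<open>The claimed bound as a function of the right end point. The slack
      \<open>k * y\<close> absorbs the error in \<open>low\<close>, and \<open>k\<close> is so small
      that the total slack on the interval is at most \<open>e\<close>.\<close>
    define \<Psi> where "\<Psi> y = f y - L * y + (L - r) * \<mu> y - k * y" for y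
    have "\<Psi> b \<le> \<Psi> a"
    proof (rule descend_right[OF ab])
      show "continuous_on {a..b} \<Psi>" unfolding \<Psi>_def by (intro continuous_intros c\<mu> cf)
      fix y d :: real assume y: "a \<le> y" "y < b" and d: "0 < d"
      show "\<exists>h. 0 < h \<and> h < d \<and> \<Psi> (y + h) \<le> \<Psi> y"
      proof (cases "y \<in> F")
        case True
        from low[OF True k d] obtain h where h: "0 < h" "h < d" "f (y + h) - f y \<le> (r + k) * h" by blast
        have "(L - r) * (\<mu> (y + h) - \<mu> y) \<le> (L - r) * h"
          using inc(2)[of y "y + h"] small[of y "y + h"] h rL by (intro mult_left_mono) auto
        with h have "\<Psi> (y + h) \<le> \<Psi> y" unfolding \<Psi>_def by (simp add: algebra_simps)
        with h show ?thesis by blast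
      next
        case False
        with F obtain \<rho> where \<rho>: "\<rho> > 0" "ball y \<rho> \<subseteq> - F"
          using openE[of "- F" y] by (auto simp: open_closed)
        define h where "h = min \<rho> d / 2"
        have h: "0 < h" "h < d" "h < \<rho>" using \<rho> d by (auto simp: h_def)
        have "{y..y + h} \<subseteq> ball y \<rho>" using h by (auto simp: dist_real_def)
        then have "F \<inter> {y..y + h} = {}" using \<rho> by blast
        then have "\<mu> (y + h) \<le> \<mu> y" using inc(2)[of y "y + h"] h by simp
        then have "(L - r) * \<mu> (y + h) \<le> (L - r) * \<mu> y" using rL by (intro mult_left_mono) auto
        with fle[of y "y + h"] h k have "\<Psi> (y + h) \<le> \<Psi> y" unfolding \<Psi>_def
          by (simp add: algebra_simps) (smt (verit) mult_pos_pos)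
        with h show ?thesis by blast
      qed
    qed
    moreover have "\<mu> a = 0"
    proof -
      have "\<mu> a \<le> a - a" using small[of a a] by (simp add: \<mu>_def)
      then show ?thesis by (simp add: \<mu>_def measure_le_0_iff)
    qed
    moreover have "k * (b - a) \<le> e"
      unfolding k_def using e ab by (simp add: field_simps)
    ultimately show ?thesis unfolding \<Psi>_def by (simp add: algebra_simps)
  qed
  then show ?thesis unfolding \<mu>_def by (rule field_le_epsilon)
qed

text \<open>Over a short interval to the right of a density point the increment would be at most
  about \<open>r * h\<close> and at least about \<open>s * h\<close>: the preceding estimate applies
  to \<open>f\<close> and to its negative.\<close>

lemma negligible_dini_gap_closed:
  fixes f :: "real \<Rightarrow> real"
  assumes lip: "L-lipschitz_on UNIV f" and F: "closed F" and rs: "r < s"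
    and low: "\<And>y d. y \<in> F \<Longrightarrow> 0 < d \<Longrightarrow> \<exists>h. 0 < h \<and> h < d \<and> f (y + h) - f y \<le> r * h"
    and high: "\<And>y d. y \<in> F \<Longrightarrow> 0 < d \<Longrightarrow> \<exists>h. 0 < h \<and> h < d \<and> f (y + h) - f y \<ge> s * h"
  shows "negligible F"
proof -
  define M where "M = \<bar>L\<bar> + \<bar>r\<bar> + \<bar>s\<bar>"
  have lipM: "M-lipschitz_on UNIV f"
    by (rule lipschitz_on_mono[OF lip]) (auto simp: M_def)
  then have lipM': "M-lipschitz_on UNIV (\<lambda>x. - f x)" by simp
  have M: "r \<le> M" "- s \<le> M" by (auto simp: M_def)
  obtain N where N: "negligible N"
    "\<And>x e. x \<in> F - N \<Longrightarrow> 0 < e \<Longrightarrow>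
       \<exists>d>0. \<forall>h. 0 < h \<and> h < d \<longrightarrow> measure lebesgue (F \<inter> cbox x (x + h *\<^sub>R One)) > (1 - e) * h ^ DIM(real)"
    using closed_density_box[OF F] by blast
  have "F \<subseteq> N"
  proof
    fix x assume x: "x \<in> F"
    show "x \<in> N"
    proof (rule ccontr)
      assume "x \<notin> N"
      define K where "K = (M - r) + (M + s)"
      have "M \<ge> 0" by (simp add: M_def)
      then have K: "K > 0" using rs unfolding K_def by linarith
      \<comment> \<open>The two estimates add up to \<open>K * m \<le> 2 * M * h\<close>, where
        \<open>K = 2 * M + (s - r)\<close>, while density gives \<open>m > (1 - e) * h\<close>. This
        \<open>e\<close> sacrifices half of the gap \<open>s - r\<close>.\<close>
      define e where "e = (s - r) / (2 * K)"
      have e: "e > 0" using K rs by (simp add: e_def)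
      obtain d where d: "d > 0" "\<And>h. 0 < h \<Longrightarrow> h < d \<Longrightarrow> measure lebesgue (F \<inter> {x..x + h}) > (1 - e) * h"
        using N(2)[of x e] x \<open>x \<notin> N\<close> e by auto
      define h where "h = d / 2"
      have h: "h > 0" "h < d" using d by (auto simp: h_def)
      define m where "m = measure lebesgue (F \<inter> {x..x + h})"
      have m: "m > (1 - e) * h" using d(2)[OF h] by (simp add: m_def)
      have "\<exists>h. 0 < h \<and> h < d \<and> f (y + h) - f y \<le> (r + e) * h" if "y \<in> F" "e > 0" "d > 0" for y e d
        using low[OF that(1,3)] that(2) by (smt (verit) mult_right_mono)
      then have "f (x + h) - f x \<le> M * h - (M - r) * m"
        using lipschitz_increment_le[OF lipM F M(1), of x "x + h"] h by (simp add: m_def)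
      moreover have "\<exists>h. 0 < h \<and> h < d \<and> - f (y + h) - - f y \<le> (- s + e) * h" if "y \<in> F" "e > 0" "d > 0" for y e d
        using high[OF that(1,3)] that(2) by (smt (verit) mult_right_mono minus_mult_left)
      then have "- f (x + h) - - f x \<le> M * h - (M - (- s)) * m"
        using lipschitz_increment_le[OF lipM' F M(2), of x "x + h"] h by (simp add: m_def)
      ultimately have "0 \<le> 2 * M * h - K * m" by (simp add: K_def algebra_simps)
      moreover have "K * m > K * ((1 - e) * h)" using m K by simp
      moreover have "K * ((1 - e) * h) = (K - (s - r) / 2) * h"
        using K by (simp add: e_def field_simps)
      ultimately have "(K - (s - r) / 2) * h < 2 * M * h" by simp
      then have "K - (s - r) / 2 < 2 * M" using h by simp
      moreover have "K = 2 * M + (s - r)" by (simp add: K_def)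
      moreover have "(s - r) / 2 < s - r" using rs by simp
      ultimately show False by linarith
    qed
  qed
  with N(1) show ?thesis by (rule negligible_subset)
qed

text \<open>The points at which the lower right derivative of \<open>f\<close> in direction \<open>u\<close> lies below \<open>r\<close> while the
  upper one lies above \<open>s\<close>.\<close>

definition dini_gap :: "('a::real_normed_vector \<Rightarrow> real) \<Rightarrow> 'a \<Rightarrow> real \<Rightarrow> real \<Rightarrow> 'a set" where
  "dini_gap f u r s =
     (\<Inter>m::nat. \<Union>h\<in>{0<..<1 / (m + 1)}. {x. f (x + h *\<^sub>R u) - f x < r * h}) \<inter>
     (\<Inter>m::nat. \<Union>h\<in>{0<..<1 / (m + 1)}. {x. f (x + h *\<^sub>R u) - f x > s * h})"

lemma dini_gap_borel:
  fixes f :: "'a::real_normed_vector \<Rightarrow> real"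
  assumes "continuous_on UNIV f"
  shows "dini_gap f u r s \<in> sets borel"
proof -
  have c: "continuous_on UNIV (\<lambda>x. f (x + h *\<^sub>R u))" for h
    by (rule continuous_on_compose2[OF assms]) (auto intro: continuous_intros)
  have "open {x. f (x + h *\<^sub>R u) - f x < r * h}" "open {x. f (x + h *\<^sub>R u) - f x > s * h}" for h
    by (intro open_Collect_less continuous_intros c assms)+
  then show ?thesis
    unfolding dini_gap_def by (intro sets.Int sets.countable_INT) (auto intro!: borel_open open_UN)
qed

lemma dini_gapD:
  assumes "x \<in> dini_gap f u r s" "d > 0"
  shows "\<exists>h. 0 < h \<and> h < d \<and> f (x + h *\<^sub>R u) - f x < r * h"
    and "\<exists>h. 0 < h \<and> h < d \<and> f (x + h *\<^sub>R u) - f x > s * h"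
proof -
  obtain m where m: "1 / (real m + 1) < d"
    using reals_Archimedean[OF assms(2)] by (auto simp: inverse_eq_divide add.commute)
  obtain h where "h \<in> {0<..<1 / (real m + 1)}" "f (x + h *\<^sub>R u) - f x < r * h"
    using assms(1) unfolding dini_gap_def by blast
  with m show "\<exists>h. 0 < h \<and> h < d \<and> f (x + h *\<^sub>R u) - f x < r * h" by force
  obtain h where "h \<in> {0<..<1 / (real m + 1)}" "f (x + h *\<^sub>R u) - f x > s * h"
    using assms(1) unfolding dini_gap_def by blast
  with m show "\<exists>h. 0 < h \<and> h < d \<and> f (x + h *\<^sub>R u) - f x > s * h" by force
qed

text \<open>The gap set is Borel, so closed subsets exhaust it up to arbitrarily small measure, and
  these are null by the closed case.\<close>

lemma negligible_dini_gap_real: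
  fixes f :: "real \<Rightarrow> real"
  assumes lip: "L-lipschitz_on UNIV f" and rs: "r < s"
  shows "dini_gap f 1 r s \<in> null_sets lborel"
proof -
  define E where "E = dini_gap f 1 r s"
  have E: "E \<in> sets borel"
    unfolding E_def by (intro dini_gap_borel lipschitz_on_continuous_on[OF lip])
  have "emeasure lebesgue E \<le> 0 + ennreal e'" if e': "e' > 0" for e' :: real
  proof -
    obtain F where F: "closed F" "F \<subseteq> E" "E - F \<in> lmeasurable" "emeasure lebesgue (E - F) < ennreal e'"
      using sets_lebesgue_inner_closed[of E e'] E e' by auto
    have "negligible F"
    proof (rule negligible_dini_gap_closed[OF lip F(1) rs])
      fix y d :: real assume "y \<in> F" "0 < d"
      then show "\<exists>h. 0 < h \<and> h < d \<and> f (y + h) - f y \<le> r * h"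
        and "\<exists>h. 0 < h \<and> h < d \<and> f (y + h) - f y \<ge> s * h"
        using dini_gapD[of y f 1 r s d] F(2) by (auto simp: E_def intro: less_imp_le)
    qed
    then have "emeasure lebesgue F = 0" by (simp add: negligible_iff_null_sets null_setsD1)
    moreover have "emeasure lebesgue E \<le> emeasure lebesgue F + emeasure lebesgue (E - F)"
      using F E by (metis (no_types, lifting) Un_Diff_cancel2 borel_closed emeasure_subadditive fmeasurableD
          sets_completionI_sets sets_lborel subset_Un_eq sup.commute Un_Diff_cancel)
    ultimately show ?thesis using F(4) e' by (auto intro: order_trans less_imp_le)
  qed
  then have "emeasure lebesgue E = 0"
    using ennreal_le_epsilon[of 0 "emeasure lebesgue E"] by simp
  then show ?thesis using E by (auto simp: E_def intro!: null_setsI)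
qed

text \<open>Fubini in the direction \<open>u\<close>: by translation invariance the measure of
  \<open>N\<close> is its average over the translates by \<open>t *\<^sub>R u\<close> with
  \<open>t\<close> in the unit interval, and exchanging the integrals leaves only null
  sections.\<close>

lemma null_set_lines:
  fixes N :: "'a::euclidean_space set"
  assumes N: "N \<in> sets borel" and sec: "\<And>x. {t. x + t *\<^sub>R u \<in> N} \<in> null_sets lborel"
  shows "N \<in> null_sets lborel"
proof -
  have [measurable]: "N \<in> sets borel" by fact
  have tr: "(\<integral>\<^sup>+ x. indicator N (x + t *\<^sub>R u) \<partial>lborel) = emeasure lborel N" for t :: real
  proof -
    have "emeasure lborel N = (\<integral>\<^sup>+ x. indicator N x \<partial>distr lborel borel ((+) (t *\<^sub>R u)))"
      by (simp add: lborel_distr_plus)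
    also have "\<dots> = (\<integral>\<^sup>+ x. indicator N (x + t *\<^sub>R u) \<partial>lborel)"
      by (subst nn_integral_distr) (auto simp: add.commute)
    finally show ?thesis by simp
  qed
  have "emeasure lborel N = (\<integral>\<^sup>+ t. emeasure lborel N * indicator {0..1::real} t \<partial>lborel)"
    by (subst nn_integral_cmult_indicator) auto
  also have "\<dots> = (\<integral>\<^sup>+ t. (\<integral>\<^sup>+ x. indicator N (x + t *\<^sub>R u) * indicator {0..1::real} t \<partial>lborel) \<partial>lborel)"
    by (subst nn_integral_multc) (auto simp: tr)
  also have "\<dots> = (\<integral>\<^sup>+ x. (\<integral>\<^sup>+ t. indicator N (x + t *\<^sub>R u) * indicator {0..1::real} t \<partial>lborel) \<partial>lborel)"
    by (rule lborel_pair.Fubini') measurable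
  also have "\<dots> = (\<integral>\<^sup>+ (x::'a). 0 \<partial>lborel)"
  proof (rule nn_integral_cong)
    fix x :: 'a
    have "AE t in lborel. indicator N (x + t *\<^sub>R u) * indicator {0..1::real} t = (0::ennreal)"
      using AE_not_in[OF sec[of x]] by eventually_elim auto
    then show "(\<integral>\<^sup>+ t. indicator N (x + t *\<^sub>R u) * indicator {0..1::real} t \<partial>lborel) = 0"
      by (simp add: nn_integral_cong_AE[where v = "\<lambda>_. 0"])
  qed
  finally show ?thesis using N by (auto intro!: null_setsI)
qed

text \<open>Along every line in direction \<open>u\<close> the gap set is that of a Lipschitz
  function of one variable.\<close>

lemma negligible_dini_gap:
  fixes f :: "'a::euclidean_space \<Rightarrow> real"
  assumes lip: "L-lipschitz_on UNIV f" and rs: "r < s"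
  shows "negligible (dini_gap f u r s)"
proof -
  have "dini_gap f u r s \<in> null_sets lborel"
  proof (rule null_set_lines[where u = u])
    show "dini_gap f u r s \<in> sets borel"
      by (intro dini_gap_borel lipschitz_on_continuous_on[OF lip])
    fix x
    have "(L * norm u)-lipschitz_on UNIV (\<lambda>t. f (x + t *\<^sub>R u))"
    proof (rule lipschitz_onI)
      fix t t' :: real
      have "dist (f (x + t *\<^sub>R u)) (f (x + t' *\<^sub>R u)) \<le> L * dist (x + t *\<^sub>R u) (x + t' *\<^sub>R u)"
        by (rule lipschitz_onD[OF lip]) auto
      also have "dist (x + t *\<^sub>R u) (x + t' *\<^sub>R u) = norm u * dist t t'"
        by (simp add: dist_norm scaleR_diff_left[symmetric] mult.commute)
      finally show "dist (f (x + t *\<^sub>R u)) (f (x + t' *\<^sub>R u)) \<le> L * norm u * dist t t'" by (simp add: mult.assoc)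
    qed (use lipschitz_on_nonneg[OF lip] in simp)
    from negligible_dini_gap_real[OF this rs]
    show "{t. x + t *\<^sub>R u \<in> dini_gap f u r s} \<in> null_sets lborel"
      by (simp add: dini_gap_def scaleR_add_left add.assoc Collect_conj_eq[symmetric] INTER_eq UNION_eq Int_def)
  qed
  then show ?thesis by (simp add: negligible_iff_null_sets null_sets_completionI)
qed

section \<open>One-sided directional derivatives and total differentiability almost
  everywhere\<close>

lemma AE_right_derivative:
  fixes f :: "'a::euclidean_space \<Rightarrow> real"
  assumes lip: "L-lipschitz_on UNIV f"
  obtains N where "negligible N"
    "\<And>x. x \<notin> N \<Longrightarrow> \<exists>g. \<forall>e>0. \<exists>d>0. \<forall>h. 0 < h \<and> h < d \<longrightarrow> \<bar>f (x + h *\<^sub>R u) - f x - h * g\<bar> \<le> e * h"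
proof (rule that)
  \<comment> \<open>Rational pairs separate distinct lower and upper right derivatives, so outside
    this countable union the two coincide.\<close>
  let ?N = "\<Union>(r, s)\<in>{(r, s). r \<in> \<rat> \<and> s \<in> \<rat> \<and> r < s}. dini_gap f u r s"
  have "{(r, s). r \<in> \<rat> \<and> s \<in> \<rat> \<and> r < (s::real)} \<subseteq> \<rat> \<times> \<rat>" by auto
  then have "countable {(r, s). r \<in> \<rat> \<and> s \<in> \<rat> \<and> r < (s::real)}"
    by (rule countable_subset) (auto simp: countable_rat)
  then show "negligible ?N"
    by (intro negligible_countable_Union) (auto intro!: negligible_dini_gap[OF lip])
  fix x assume x: "x \<notin> ?N"
  define C where "C = L * norm u"
  have bd: "\<bar>f (x + h *\<^sub>R u) - f x\<bar> \<le> C * h" if "h > 0" for h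
    using lipschitz_onD[OF lip, of "x + h *\<^sub>R u" x] that by (simp add: C_def dist_norm algebra_simps)
  \<comment> \<open>The slopes that bound the increment from below on some right neighbourhood;
    their supremum is the lower right derivative.\<close>
  define S where "S = {r. \<exists>d>0. \<forall>h. 0 < h \<and> h < d \<longrightarrow> r * h \<le> f (x + h *\<^sub>R u) - f x}"
  have S: "- C \<in> S" using bd by (auto simp: S_def intro!: exI[of _ 1]) (smt (verit))
  have Sle: "r \<le> C" if "r \<in> S" for r
  proof -
    obtain d where d: "d > 0" "\<And>h. 0 < h \<Longrightarrow> h < d \<Longrightarrow> r * h \<le> f (x + h *\<^sub>R u) - f x"
      using \<open>r \<in> S\<close> unfolding S_def by blast
    have "r * (d / 2) \<le> C * (d / 2)" using d(2)[of "d / 2"] d(1) bd[of "d / 2"] by linarith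
    then show ?thesis using d(1) by simp
  qed
  then have bdd: "bdd_above S" by (auto intro!: bdd_aboveI)
  define l where "l = Sup S"
  show "\<exists>g. \<forall>e>0. \<exists>d>0. \<forall>h. 0 < h \<and> h < d \<longrightarrow> \<bar>f (x + h *\<^sub>R u) - f x - h * g\<bar> \<le> e * h"
  proof (rule exI[of _ l], intro allI impI)
    fix e :: real assume e: "e > 0"
    have "\<exists>r\<in>S. l - e < r" using e S less_cSup_iff[of S "l - e"] bdd by (auto simp: l_def)
    then obtain r d where r: "l - e < r" "d > 0" "\<And>h. 0 < h \<Longrightarrow> h < d \<Longrightarrow> r * h \<le> f (x + h *\<^sub>R u) - f x"
      unfolding S_def by blast
    have "\<exists>d>0. \<forall>h. 0 < h \<and> h < d \<longrightarrow> f (x + h *\<^sub>R u) - f x < (l + e) * h"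
    proof (rule ccontr)
      assume A: "\<not> ?thesis"
      obtain p where p: "p \<in> \<rat>" "l < p" "p < l + e" using Rats_dense_in_real[of l "l + e"] e by auto
      obtain q where q: "q \<in> \<rat>" "p < q" "q < l + e" using Rats_dense_in_real[OF p(3)] by auto
      have "p \<notin> S" using p(2) bdd cSup_upper[of p S] by (auto simp: l_def)
      then have P: "\<exists>h. 0 < h \<and> h < d \<and> f (x + h *\<^sub>R u) - f x < p * h" if "d > 0" for d
        using that unfolding S_def by (auto simp: not_le)
      have Q: "\<exists>h. 0 < h \<and> h < d \<and> f (x + h *\<^sub>R u) - f x > q * h" if "d > 0" for d
      proof -
        obtain h where h: "0 < h" "h < d" "f (x + h *\<^sub>R u) - f x \<ge> (l + e) * h"
          using A \<open>d > 0\<close> not_less by blast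
        moreover have "(l + e) * h > q * h" using q h by simp
        ultimately show ?thesis by (meson less_le_trans)
      qed
      have "x \<in> dini_gap f u p q"
        unfolding dini_gap_def
        using P[of "1 / (real m + 1)" for m] Q[of "1 / (real m + 1)" for m] by fastforce
      then show False using x p q by auto
    qed
    then obtain d' where d': "d' > 0" "\<And>h. 0 < h \<Longrightarrow> h < d' \<Longrightarrow> f (x + h *\<^sub>R u) - f x < (l + e) * h"
      by blast
    show "\<exists>d>0. \<forall>h. 0 < h \<and> h < d \<longrightarrow> \<bar>f (x + h *\<^sub>R u) - f x - h * l\<bar> \<le> e * h"
    proof (intro exI[of _ "min d d'"] conjI allI impI)
      show "0 < min d d'" using r d' by simp
      fix h assume h: "0 < h \<and> h < min d d'"
      have "(l - e) * h \<le> r * h" using r(1) h by simp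
      then show "\<bar>f (x + h *\<^sub>R u) - f x - h * l\<bar> \<le> e * h"
        using r(3)[of h] d'(2)[of h] h by (simp add: abs_le_iff algebra_simps)
    qed
  qed
qed

text \<open>Right derivatives along the axes at one point say nothing about other directions. They
  become uniform on the closed sets \<open>E m v k\<close>; at a density point of such a set the
  path from \<open>x\<close> to \<open>x + h\<close> along the axes can be moved into it at a small
  Lipschitz cost.\<close>

theorem Rademacher_real:
  fixes f :: "'a::euclidean_space \<Rightarrow> real"
  assumes lip: "L-lipschitz_on UNIV f"
  obtains N where "negligible N" "\<And>x. x \<notin> N \<Longrightarrow> f differentiable (at x)"
proof -
  have L: "L \<ge> 0" using lip by (rule lipschitz_on_nonneg)
  have "\<forall>b::'a. \<exists>N. negligible N \<and> (\<forall>x. x \<notin> N \<longrightarrow> (\<exists>g. \<forall>e>0. \<exists>d>0. \<forall>h. 0 < h \<and> h < d \<longrightarrow>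
      \<bar>f (x + h *\<^sub>R b) - f x - h * g\<bar> \<le> e * h))"
    using AE_right_derivative[OF lip] by metis
  then obtain N1 where N1: "\<And>b. negligible (N1 b)"
    and der: "\<And>b x. x \<notin> N1 b \<Longrightarrow> \<exists>g. \<forall>e>0. \<exists>d>0. \<forall>h. 0 < h \<and> h < d \<longrightarrow>
      \<bar>f (x + h *\<^sub>R b) - f x - h * g\<bar> \<le> e * h"
    by (metis (no_types, lifting))
  obtain D where D: "countable D" "\<And>(v::'a) e. e > 0 \<Longrightarrow> \<exists>w\<in>D. dist w v < e"
    using countable_dense_setE[where 'a='a]
    by (metis (mono_tags, lifting) centre_in_ball ex_in_conv mem_ball dist_commute open_ball)
  \<comment> \<open>Here the right difference quotients along the axes, for all steps below
    \<open>1 / Suc m\<close>, match a single approximate gradient \<open>v\<close> up to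
    \<open>1 / Suc k\<close>. Restricting \<open>v\<close> to the countable dense set
    \<open>D\<close> keeps the number of exceptional sets countable.\<close>
  define E where "E m v k = {x. \<forall>b\<in>Basis. \<forall>t. 0 < t \<and> t < 1 / real (Suc m) \<longrightarrow>
      \<bar>f (x + t *\<^sub>R b) - f x - t * (v \<bullet> b)\<bar> \<le> t / real (Suc k)}" for m v k
  have ED: "\<bar>f (x + t *\<^sub>R b) - f x - t * (v \<bullet> b)\<bar> \<le> t * (1 / real (Suc k))"
    if "x \<in> E m v k" "b \<in> Basis" "0 < t" "t < 1 / real (Suc m)" for m v k x b t
    using that unfolding E_def times_divide_eq_right mult_1_right by blast
  have cont: "continuous_on UNIV (\<lambda>x. f (x + c))" for c
    by (rule continuous_on_compose2[OF lipschitz_on_continuous_on[OF lip]]) (auto intro: continuous_intros)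
  have closed: "closed (E m v k)" for m v k
  proof -
    have "E m v k = (\<Inter>b\<in>Basis. \<Inter>t\<in>{0<..<1 / real (Suc m)}.
        {x. \<bar>f (x + t *\<^sub>R b) - f x - t * (v \<bullet> b)\<bar> \<le> t / real (Suc k)})"
      by (auto simp: E_def)
    also have "closed \<dots>"
      using cont[of 0] by (intro closed_INT ballI closed_Collect_le continuous_intros cont) simp
    finally show ?thesis .
  qed
  have "\<exists>N. negligible N \<and> (\<forall>x\<in>E m v k - N. \<forall>\<eta>>0. \<exists>r>0. \<forall>h. norm h < r \<longrightarrow>
      (\<exists>z\<in>E m v k. norm (z - (x + h)) \<le> \<eta> * norm h))" for m v k
    using closed_density_points[OF closed] by metis
  then obtain N2 where N2: "\<And>m v k. negligible (N2 m v k)"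
    and dens: "\<And>m v k x \<eta>. x \<in> E m v k - N2 m v k \<Longrightarrow> \<eta> > 0 \<Longrightarrow> \<exists>r>0. \<forall>h. norm h < r \<longrightarrow>
      (\<exists>z\<in>E m v k. norm (z - (x + h)) \<le> \<eta> * norm h)"
    by (metis (no_types, lifting))
  define N where "N = (\<Union>b\<in>Basis. N1 b) \<union> (\<Union>(m, v, k)\<in>UNIV \<times> D \<times> UNIV. N2 m v k)"
  have "negligible N"
    unfolding N_def using D(1)
    by (intro negligible_Un negligible_Union negligible_countable_Union) (auto simp: N1 N2)
  moreover have "f differentiable (at x)" if x: "x \<notin> N" for x
  proof -
    have "\<exists>g. \<forall>b\<in>Basis. \<forall>e>0. \<exists>d>0. \<forall>h. 0 < h \<and> h < d \<longrightarrow> \<bar>f (x + h *\<^sub>R b) - f x - h * g b\<bar> \<le> e * h"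
      using x der by (intro bchoice ballI) (auto simp: N_def)
    then obtain g where g: "\<And>b e. b \<in> Basis \<Longrightarrow> e > 0 \<Longrightarrow>
        \<exists>d>0. \<forall>h. 0 < h \<and> h < d \<longrightarrow> \<bar>f (x + h *\<^sub>R b) - f x - h * g b\<bar> \<le> e * h" by blast
    define w where "w = (\<Sum>b\<in>Basis. g b *\<^sub>R b)"
    have wb: "w \<bullet> b = g b" if "b \<in> Basis" for b using that by (simp add: w_def)
    define n where "n = real DIM('a)"
    have n: "n \<ge> 1" unfolding n_def using DIM_ge_Suc0[where 'a='a] by linarith
    have "(f has_derivative (\<lambda>h. w \<bullet> h)) (at x)"
      unfolding has_derivative_at_alt
    proof (intro conjI allI impI bounded_linear_inner_right)
      fix e :: real assume e: "e > 0"
      \<comment> \<open>Each of the \<open>n\<close> axis steps costs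
        \<open>2 * \<epsilon> * norm h\<close>, and passing from \<open>v\<close> to
        \<open>w\<close> costs at most \<open>\<epsilon> * norm h\<close>. The total factor is at
        most \<open>4 * n * \<epsilon>\<close>, which is below \<open>e\<close>.\<close>
      obtain k where k: "1 / real (Suc k) < e / (4 * n)"
        using reals_Archimedean[of "e / (4 * n)"] e n by (auto simp: inverse_eq_divide)
      define \<epsilon> where "\<epsilon> = 1 / real (Suc k)"
      have \<epsilon>: "\<epsilon> > 0" "\<epsilon> < e / (4 * n)" using k by (auto simp: \<epsilon>_def)
      obtain v where v: "v \<in> D" "dist v w < \<epsilon> / 2" using D(2)[of "\<epsilon> / 2" w] \<epsilon> by auto
      have vw: "\<bar>(v - w) \<bullet> y\<bar> \<le> \<epsilon> / 2 * norm y" for y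
      proof -
        have "\<bar>(v - w) \<bullet> y\<bar> \<le> norm (v - w) * norm y" by (rule Cauchy_Schwarz_ineq2)
        also have "\<dots> \<le> \<epsilon> / 2 * norm y" using v(2) by (intro mult_right_mono) (auto simp: dist_norm)
        finally show ?thesis .
      qed
      have "\<forall>b\<in>Basis. \<exists>d>0. \<forall>h. 0 < h \<and> h < d \<longrightarrow> \<bar>f (x + h *\<^sub>R b) - f x - h * g b\<bar> \<le> \<epsilon> / 2 * h"
        using g[of _ "\<epsilon> / 2"] \<epsilon> by auto
      then obtain d where d: "\<And>b. b \<in> Basis \<Longrightarrow> d b > 0"
        "\<And>b h. b \<in> Basis \<Longrightarrow> 0 < h \<Longrightarrow> h < d b \<Longrightarrow> \<bar>f (x + h *\<^sub>R b) - f x - h * g b\<bar> \<le> \<epsilon> / 2 * h"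
        using bchoice[of Basis] by (metis (no_types, lifting))
      obtain m where m: "1 / real (Suc m) < Min (d ` Basis)"
        using reals_Archimedean[of "Min (d ` Basis)"] d(1) by (auto simp: inverse_eq_divide)
      have xE: "x \<in> E m v k"
        unfolding E_def
      proof (intro CollectI ballI allI impI)
        fix b t assume b: "b \<in> (Basis :: 'a set)" and t: "0 < t \<and> t < 1 / real (Suc m)"
        have "Min (d ` Basis) \<le> d b" using b by simp
        then have "\<bar>f (x + t *\<^sub>R b) - f x - t * g b\<bar> \<le> \<epsilon> / 2 * t" using t m by (intro d(2)[OF b]) linarith+
        moreover have "\<bar>t * g b - t * (v \<bullet> b)\<bar> \<le> \<epsilon> / 2 * t"
        proof -
          have "\<bar>t * g b - t * (v \<bullet> b)\<bar> = t * \<bar>(v - w) \<bullet> b\<bar>"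
            using t wb[OF b] by (simp add: abs_mult inner_diff_left right_diff_distrib[symmetric] abs_minus_commute)
          also have "\<dots> \<le> t * (\<epsilon> / 2 * norm b)" using t vw[of b] by (intro mult_left_mono) auto
          finally show ?thesis using b by (simp add: mult.commute)
        qed
        ultimately have "\<bar>f (x + t *\<^sub>R b) - f x - t * (v \<bullet> b)\<bar> \<le> \<epsilon> * t"
          by linarith
        then show "\<bar>f (x + t *\<^sub>R b) - f x - t * (v \<bullet> b)\<bar> \<le> t / real (Suc k)"
          by (simp add: \<epsilon>_def)
      qed
      \<comment> \<open>Replacing both end points of a step by nearby points costs
        \<open>2 * L * \<eta> * norm h\<close>, which this choice keeps below
        \<open>\<epsilon> * norm h\<close>.\<close>
      define \<eta> where "\<eta> = \<epsilon> / (2 * L + 1)"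
      have \<eta>: "\<eta> > 0" "2 * L * \<eta> \<le> \<epsilon>"
        using \<epsilon> L by (auto simp: \<eta>_def field_simps)
      have "x \<notin> N2 m v k" using x v by (auto simp: N_def)
      with xE obtain r where r: "r > 0"
        "\<And>h. norm h < r \<Longrightarrow> \<exists>z\<in>E m v k. norm (z - (x + h)) \<le> \<eta> * norm h"
        using dens[of x m v k \<eta>] \<eta> by auto
      define \<rho> where "\<rho> = min r (1 / real (Suc m))"
      show "\<exists>d>0. \<forall>y. norm (y - x) < d \<longrightarrow> norm (f y - f x - w \<bullet> (y - x)) \<le> e * norm (y - x)"
      proof (intro exI[of _ \<rho>] conjI allI impI)
        show "\<rho> > 0" using r by (simp add: \<rho>_def)
        fix y assume y: "norm (y - x) < \<rho>"
        define h where "h = y - x"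
        define H where "H B = (\<Sum>b\<in>B. (h \<bullet> b) *\<^sub>R b)" for B
        have nH: "norm (H B) \<le> norm h" if "B \<subseteq> Basis" for B
        proof -
          have fB: "finite B" using that finite_Basis finite_subset by blast
          have Hb: "H B \<bullet> b = (if b \<in> B then h \<bullet> b else 0)" if b: "b \<in> Basis" for b
          proof -
            have "H B \<bullet> b = (\<Sum>c\<in>B. (h \<bullet> c) * (if c = b then 1 else 0))"
              unfolding H_def inner_sum_left using b \<open>B \<subseteq> Basis\<close>
              by (intro sum.cong) (auto simp: inner_Basis subset_iff)
            also have "\<dots> = (\<Sum>c\<in>B. if c = b then h \<bullet> c else 0)" by (intro sum.cong) auto
            finally show ?thesis using fB by simp
          qed
          have sq: "norm y ^ 2 = (\<Sum>b\<in>Basis. (y \<bullet> b) ^ 2)" for y :: 'a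
            unfolding power2_norm_eq_inner by (subst euclidean_inner) (simp add: power2_eq_square)
          have "norm (H B) ^ 2 = (\<Sum>b\<in>Basis. (H B \<bullet> b) ^ 2)" by (rule sq)
          also have "\<dots> \<le> (\<Sum>b\<in>Basis. (h \<bullet> b) ^ 2)"
            by (intro sum_mono) (auto simp: Hb)
          also have "\<dots> = norm h ^ 2"
            by (rule sq[symmetric])
          finally show ?thesis by (simp add: power2_le_iff_abs_le)
        qed
        have hr: "norm h < r" "norm h < 1 / real (Suc m)" using y by (auto simp: h_def \<rho>_def)
        have near: "\<exists>z\<in>E m v k. norm (z - (x + H B)) \<le> \<eta> * norm h" if B: "B \<subseteq> Basis" for B
        proof -
          obtain z where "z \<in> E m v k" "norm (z - (x + H B)) \<le> \<eta> * norm (H B)"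
            using r(2)[of "H B"] nH[OF B] hr by force
          moreover have "\<eta> * norm (H B) \<le> \<eta> * norm h" using \<eta> nH[OF B] by simp
          ultimately show ?thesis by force
        qed
        have flip: "\<bar>f a - f b\<bar> \<le> L * (\<eta> * norm h)" if "norm (a - b) \<le> \<eta> * norm h" for a b
          using lipschitz_onD[OF lip, of a b] mult_left_mono[OF that L] by (simp add: dist_norm)
        have step: "\<bar>f (x + H (insert b B)) - f (x + H B) - (h \<bullet> b) * (v \<bullet> b)\<bar> \<le> 2 * \<epsilon> * norm h"
          if B: "B \<subseteq> Basis" and b: "b \<in> Basis" "b \<notin> B" for b B
        proof -
          have fB: "finite B" using B finite_Basis finite_subset by blast
          have HB: "H (insert b B) = H B + (h \<bullet> b) *\<^sub>R b"
            unfolding H_def using b fB by (simp add: add.commute)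
          have hb: "\<bar>h \<bullet> b\<bar> \<le> norm h" using b by (simp add: Basis_le_norm)
          have LL: "2 * (L * (\<eta> * norm h)) \<le> \<epsilon> * norm h"
            using mult_right_mono[OF \<eta>(2), of "norm h"] by (simp add: mult.assoc)
          consider "h \<bullet> b = 0" | "h \<bullet> b > 0" | "h \<bullet> b < 0" by linarith
          then show ?thesis
          proof cases
            case 1
            then show ?thesis using HB \<epsilon> by simp
          next
            case 2
            obtain z where z: "z \<in> E m v k" "norm (z - (x + H B)) \<le> \<eta> * norm h" using near[OF B] by blast
            have 3: "\<bar>f (z + (h \<bullet> b) *\<^sub>R b) - f z - (h \<bullet> b) * (v \<bullet> b)\<bar> \<le> (h \<bullet> b) * \<epsilon>"
              unfolding \<epsilon>_def using 2 hb hr by (intro ED[OF z(1) b(1)]) auto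
            have "(h \<bullet> b) * \<epsilon> \<le> \<epsilon> * norm h" using hb \<epsilon> by (simp add: mult.commute)
            moreover have "\<bar>f (z + (h \<bullet> b) *\<^sub>R b) - f (x + H (insert b B))\<bar> \<le> L * (\<eta> * norm h)"
              using z(2) by (intro flip) (simp add: HB algebra_simps)
            ultimately show ?thesis using 3 flip[OF z(2)] LL by linarith
          next
            \<comment> \<open>Only forward steps are controlled on \<open>E m v k\<close>, so a
              negative coordinate is traversed backwards, from a point of the set near the far end
              \<open>x + H (insert b B)\<close>.\<close>
            case 3
            obtain z where z: "z \<in> E m v k" "norm (z - (x + H (insert b B))) \<le> \<eta> * norm h"
              using near[of "insert b B"] B b by blast
            have 4: "\<bar>f (z + (- (h \<bullet> b)) *\<^sub>R b) - f z - (- (h \<bullet> b)) * (v \<bullet> b)\<bar> \<le> (- (h \<bullet> b)) * \<epsilon>"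
              unfolding \<epsilon>_def using 3 hb hr by (intro ED[OF z(1) b(1)]) auto
            have "(- (h \<bullet> b)) * \<epsilon> \<le> \<epsilon> * norm h"
              using mult_right_mono[of "- (h \<bullet> b)" "norm h" \<epsilon>] hb \<epsilon> by (simp add: mult.commute)
            moreover have "\<bar>f (z + (- (h \<bullet> b)) *\<^sub>R b) - f (x + H B)\<bar> \<le> L * (\<eta> * norm h)"
              using z(2) by (intro flip) (simp add: HB algebra_simps)
            moreover have "(- (h \<bullet> b)) * (v \<bullet> b) = - ((h \<bullet> b) * (v \<bullet> b))" by simp
            ultimately show ?thesis using 4 flip[OF z(2)] LL by linarith
          qed
        qed
        have "\<bar>f (x + H B) - f x - (\<Sum>b\<in>B. (h \<bullet> b) * (v \<bullet> b))\<bar> \<le> real (card B) * (2 * \<epsilon> * norm h)"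
          if "finite B" "B \<subseteq> Basis" for B
          using that
        proof (induction B)
          case empty then show ?case by (simp add: H_def)
        next
          case (insert b B)
          then have "\<bar>f (x + H B) - f x - (\<Sum>b\<in>B. (h \<bullet> b) * (v \<bullet> b))\<bar> \<le> real (card B) * (2 * \<epsilon> * norm h)"
            by simp
          moreover have "real (card (insert b B)) * (2 * \<epsilon> * norm h) = real (card B) * (2 * \<epsilon> * norm h) + 2 * \<epsilon> * norm h"
            using insert by (simp add: algebra_simps)
          moreover have "(\<Sum>c\<in>insert b B. (h \<bullet> c) * (v \<bullet> c)) = (h \<bullet> b) * (v \<bullet> b) + (\<Sum>c\<in>B. (h \<bullet> c) * (v \<bullet> c))"
            using insert by simp
          moreover have "\<bar>f (x + H (insert b B)) - f (x + H B) - (h \<bullet> b) * (v \<bullet> b)\<bar> \<le> 2 * \<epsilon> * norm h"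
            using step[of B b] insert by simp
          ultimately show ?case by linarith
        qed
        from this[of Basis] have *: "\<bar>f y - f x - v \<bullet> h\<bar> \<le> n * (2 * \<epsilon> * norm h)"
          by (simp add: H_def euclidean_representation n_def mult.commute h_def flip: euclidean_inner)
        have "\<bar>v \<bullet> h - w \<bullet> h\<bar> \<le> \<epsilon> / 2 * norm h" using vw[of h] by (simp add: inner_diff_left)
        with * have "\<bar>f y - f x - w \<bullet> h\<bar> \<le> n * (2 * \<epsilon> * norm h) + \<epsilon> * norm h"
          using \<epsilon>(1) mult_right_mono[of "\<epsilon> / 2" \<epsilon> "norm h"] by linarith
        also have "\<dots> = (2 * n + 1) * \<epsilon> * norm h" by (simp add: algebra_simps)
        also have "\<dots> \<le> (4 * n) * \<epsilon> * norm h" using n \<epsilon>(1) by (intro mult_right_mono) auto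
        also have "\<dots> \<le> e * norm h" using \<epsilon>(2) n by (intro mult_right_mono) (auto simp: field_simps)
        finally show "norm (f y - f x - w \<bullet> (y - x)) \<le> e * norm (y - x)" by (simp add: h_def)
      qed
    qed
    then show ?thesis by (auto simp: differentiable_def)
  qed
  ultimately show thesis by (rule that)
qed

theorem Rademacher:
  fixes f :: "'a::euclidean_space \<Rightarrow> 'b::euclidean_space"
  assumes lip: "L-lipschitz_on UNIV f"
  obtains N where "negligible N" "\<And>x. x \<notin> N \<Longrightarrow> f differentiable (at x)"
proof -
  have "\<exists>N. negligible N \<and> (\<forall>x. x \<notin> N \<longrightarrow> (\<lambda>y. f y \<bullet> b) differentiable (at x))" if b: "b \<in> Basis" for b
  proof -
    have "L-lipschitz_on UNIV (\<lambda>y. f y \<bullet> b)"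
    proof (rule lipschitz_onI)
      fix x y
      have "\<bar>(f x - f y) \<bullet> b\<bar> \<le> norm (f x - f y)" using b by (rule Basis_le_norm)
      then show "dist (f x \<bullet> b) (f y \<bullet> b) \<le> L * dist x y"
        using lipschitz_onD[OF lip, of x y] by (simp add: dist_norm inner_diff_left)
    qed (rule lipschitz_on_nonneg[OF lip])
    then show ?thesis using Rademacher_real by metis
  qed
  then obtain N where N: "\<And>b. b \<in> Basis \<Longrightarrow> negligible (N b)"
    "\<And>b x. b \<in> Basis \<Longrightarrow> x \<notin> N b \<Longrightarrow> (\<lambda>y. f y \<bullet> b) differentiable (at x)"
    by metis
  show thesis
  proof (rule that)
    show "negligible (\<Union>b\<in>Basis. N b)" by (intro negligible_Union) (auto simp: N)
    fix x assume "x \<notin> (\<Union>b\<in>Basis. N b)"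
    then show "f differentiable (at x)"
      using N(2) by (subst differentiable_componentwise_within) auto
  qed
qed

section \<open>Smooth functions on open sets\<close>

lemma frechet_derivative_cong_open:
  assumes "open S" "x \<in> S" "\<And>y. y \<in> S \<Longrightarrow> f y = g y"
  shows "frechet_derivative f (at x) = frechet_derivative g (at x)"
proof -
  have "(f has_derivative D) (at x) \<longleftrightarrow> (g has_derivative D) (at x)" for D
    using has_derivative_transform_within_open[of f D x UNIV S g]
      has_derivative_transform_within_open[of g D x UNIV S f] assms by auto
  then show ?thesis by (simp add: frechet_derivative_def)
qed

lemma differentiable_cong_open:
  assumes "open S" "x \<in> S" "\<And>y. y \<in> S \<Longrightarrow> f y = g y" "f differentiable (at x)"
  shows "g differentiable (at x)"
  using assms has_derivative_transform_within_open[of f _ x UNIV S g] unfolding differentiable_def by blast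

text \<open>Coinduction for smoothness: a class of differentiable functions closed under directional
  derivatives consists of smooth functions. The induction runs over all functions that agree on
  \<open>S\<close> with a member of the class, because formulas for derivatives hold on
  \<open>S\<close> only.\<close>

lemma smooth_on_coinduct:
  fixes f :: "'a::real_normed_vector \<Rightarrow> 'b::real_normed_vector"
  assumes "P f" "open S"
    and step: "\<And>f. P f \<Longrightarrow> f differentiable_on S \<and>
      (\<forall>u. \<exists>g. P g \<and> (\<forall>y\<in>S. frechet_derivative f (at y) u = g y))"
  shows "smooth_on S f"
  unfolding smooth_on_def
proof
  fix us
  have "\<forall>f g. P g \<and> (\<forall>y\<in>S. f y = g y) \<longrightarrow> iter_deriv us f differentiable_on S"
  proof (induction us)
    case Nil
    show ?case
    proof (intro allI impI)
      fix f g assume "P g \<and> (\<forall>y\<in>S. f y = g y)"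
      then show "iter_deriv [] f differentiable_on S"
        using step[of g] differentiable_cong_open[OF \<open>open S\<close>, of _ g f] \<open>open S\<close>
        by (auto simp: differentiable_on_eq_differentiable_at)
    qed
  next
    case (Cons u us)
    show ?case
    proof (intro allI impI)
      fix f g assume fg: "P g \<and> (\<forall>y\<in>S. f y = g y)"
      then obtain g' where g': "P g'" "\<forall>y\<in>S. frechet_derivative g (at y) u = g' y"
        using step by blast
      have "\<forall>y\<in>S. frechet_derivative f (at y) u = g' y"
        using frechet_derivative_cong_open[OF \<open>open S\<close>, of _ f g] fg g'(2) by simp
      with g'(1) have "iter_deriv us (\<lambda>y. frechet_derivative f (at y) u) differentiable_on S"
        by (intro Cons.IH[rule_format, of g']) simp
      then show "iter_deriv (u # us) f differentiable_on S" by simp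
    qed
  qed
  with \<open>P f\<close> show "iter_deriv us f differentiable_on S" by blast
qed

lemma smooth_on_differentiable:
  "smooth_on S f \<Longrightarrow> open S \<Longrightarrow> x \<in> S \<Longrightarrow> f differentiable (at x)"
  unfolding smooth_on_def differentiable_on_eq_differentiable_at by (metis iter_deriv.simps(1))

lemma smooth_on_has_derivative:
  "smooth_on S f \<Longrightarrow> open S \<Longrightarrow> x \<in> S \<Longrightarrow> (f has_derivative frechet_derivative f (at x)) (at x)"
  using smooth_on_differentiable frechet_derivative_works by blast

lemma smooth_on_continuous: "smooth_on S f \<Longrightarrow> open S \<Longrightarrow> continuous_on S f"
  by (meson continuous_at_imp_continuous_on differentiable_imp_continuous_within smooth_on_differentiable)

lemma smooth_on_deriv: "smooth_on S f \<Longrightarrow> smooth_on S (\<lambda>y. frechet_derivative f (at y) u)"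
  unfolding smooth_on_def by (metis iter_deriv.simps(2))

lemma smooth_on_cong:
  assumes "smooth_on S f" "open S" "\<And>y. y \<in> S \<Longrightarrow> g y = f y"
  shows "smooth_on S g"
proof (rule smooth_on_coinduct[where P = "\<lambda>g. \<exists>f. smooth_on S f \<and> (\<forall>y\<in>S. g y = f y)"])
  fix g assume "\<exists>f. smooth_on S f \<and> (\<forall>y\<in>S. g y = f y)"
  then obtain f where f: "smooth_on S f" "\<forall>y\<in>S. g y = f y" by blast
  then have "g differentiable_on S"
    using differentiable_cong_open[OF \<open>open S\<close>, of _ f g] smooth_on_differentiable[OF f(1) \<open>open S\<close>] \<open>open S\<close>
    by (simp add: differentiable_on_eq_differentiable_at)
  moreover have "\<exists>ga. (\<exists>f. smooth_on S f \<and> (\<forall>y\<in>S. ga y = f y)) \<and>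
      (\<forall>y\<in>S. frechet_derivative g (at y) u = ga y)" for u
  proof (intro exI conjI)
    show "\<forall>y\<in>S. frechet_derivative g (at y) u = frechet_derivative f (at y) u"
      using frechet_derivative_cong_open[OF \<open>open S\<close>, of _ g f] f(2) by simp
  qed (use smooth_on_deriv[OF f(1)] in auto)
  ultimately show "g differentiable_on S \<and> (\<forall>u. \<exists>ga. (\<exists>f. smooth_on S f \<and> (\<forall>y\<in>S. ga y = f y)) \<and>
      (\<forall>y\<in>S. frechet_derivative g (at y) u = ga y))" by simp
qed (use assms in auto)

lemma smooth_on_subset: "smooth_on S f \<Longrightarrow> T \<subseteq> S \<Longrightarrow> smooth_on T f"
  unfolding smooth_on_def using differentiable_on_subset by blast

lemma smooth_on_Union:
  assumes "\<And>i. i \<in> I \<Longrightarrow> smooth_on (S i) f" "\<And>i. i \<in> I \<Longrightarrow> open (S i)"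
  shows "smooth_on (\<Union>i\<in>I. S i) f"
proof -
  have "open (\<Union>i\<in>I. S i)" using assms(2) by auto
  with assms show ?thesis
    unfolding smooth_on_def by (auto simp: differentiable_on_eq_differentiable_at)
qed

lemma smooth_on_Un:
  assumes "smooth_on S f" "smooth_on T f" "open S" "open T"
  shows "smooth_on (S \<union> T) f"
proof -
  have "smooth_on (\<Union>b\<in>{True, False}. if b then S else T) f"
    using assms by (intro smooth_on_Union) auto
  then show ?thesis by (simp add: Un_commute)
qed

section \<open>Closure properties of smooth functions\<close>

lemma smooth_on_const: "open S \<Longrightarrow> smooth_on S (\<lambda>_. c)"
  by (rule smooth_on_coinduct[where P = "\<lambda>f. \<exists>c. f = (\<lambda>_. c)"]) (auto simp: frechet_derivative_const)

lemma smooth_on_linear: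
  fixes f :: "'a::real_normed_vector \<Rightarrow> 'b::real_normed_vector"
  assumes "bounded_linear f" "open S"
  shows "smooth_on S f"
proof (rule smooth_on_coinduct[where P = "\<lambda>g. (\<exists>c. g = (\<lambda>_. c)) \<or> g = f"])
  fix g assume "(\<exists>c. g = (\<lambda>_. c)) \<or> g = f"
  then show "g differentiable_on S \<and> (\<forall>u. \<exists>h. ((\<exists>c. h = (\<lambda>_. c)) \<or> h = f) \<and> (\<forall>y\<in>S. frechet_derivative g (at y) u = h y))"
  proof
    assume "g = f"
    then show ?thesis
      using frechet_derivative_at[OF bounded_linear_imp_has_derivative[OF assms(1)], symmetric] assms(1)
      by (auto intro!: bounded_linear_imp_differentiable_on)
  qed (auto simp: frechet_derivative_const)
qed (use assms in auto)

lemma smooth_on_inner: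
  fixes f :: "'a::real_normed_vector \<Rightarrow> 'b::euclidean_space"
  assumes "smooth_on S f" "open S"
  shows "smooth_on S (\<lambda>y. f y \<bullet> b)"
proof (rule smooth_on_coinduct[where P = "\<lambda>g. \<exists>f. smooth_on S f \<and> g = (\<lambda>y. f y \<bullet> b)"])
  fix g assume "\<exists>f. smooth_on S f \<and> g = (\<lambda>y. f y \<bullet> b)"
  then obtain f where f: "smooth_on S f" "g = (\<lambda>y. f y \<bullet> b)" by blast
  have d: "(g has_derivative (\<lambda>h. frechet_derivative f (at y) h \<bullet> b)) (at y)" if "y \<in> S" for y
    unfolding f(2) using smooth_on_has_derivative[OF f(1) assms(2) that] by (rule has_derivative_inner_left)
  then have "g differentiable_on S"
    by (meson differentiable_def differentiable_at_imp_differentiable_on)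
  moreover have "\<forall>y\<in>S. frechet_derivative g (at y) u = frechet_derivative f (at y) u \<bullet> b" for u
    using frechet_derivative_at[OF d] by metis
  ultimately show "g differentiable_on S \<and> (\<forall>u. \<exists>h. (\<exists>f. smooth_on S f \<and> h = (\<lambda>y. f y \<bullet> b)) \<and>
      (\<forall>y\<in>S. frechet_derivative g (at y) u = h y))"
    using smooth_on_deriv[OF f(1)] by blast
qed (use assms in auto)

text \<open>The functions obtained from smooth ones by sums, products and composition form a class that is
  closed under differentiation.\<close>

inductive smooth_closure ::
  "'a::real_normed_vector set \<Rightarrow> 'b::euclidean_space itself \<Rightarrow> ('a \<Rightarrow> real) \<Rightarrow> bool" for S \<tau> where
  base: "smooth_on S f \<Longrightarrow> smooth_closure S \<tau> f"
| add: "smooth_closure S \<tau> f \<Longrightarrow> smooth_closure S \<tau> g \<Longrightarrow> smooth_closure S \<tau> (\<lambda>y. f y + g y)"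
| mult: "smooth_closure S \<tau> f \<Longrightarrow> smooth_closure S \<tau> g \<Longrightarrow> smooth_closure S \<tau> (\<lambda>y. f y * g y)"
| comp: "smooth_on T (g :: 'b \<Rightarrow> real) \<Longrightarrow> open T \<Longrightarrow> F ` S \<subseteq> T \<Longrightarrow> (\<And>b. b \<in> Basis \<Longrightarrow> smooth_on S (\<lambda>y. F y \<bullet> b)) \<Longrightarrow>
    smooth_closure S \<tau> (\<lambda>y. g (F y))"

lemma smooth_closure_sum:
  "finite I \<Longrightarrow> open S \<Longrightarrow> (\<And>i. i \<in> I \<Longrightarrow> smooth_closure S \<tau> (f i)) \<Longrightarrow> smooth_closure S \<tau> (\<lambda>y. \<Sum>i\<in>I. f i y)"
  by (induction I rule: finite_induct) (auto intro: base smooth_on_const add)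

text \<open>In the composition case the chain rule gives a sum of products of a partial derivative
  of \<open>g\<close> composed with \<open>F\<close>, which is again of the form
  \<open>comp\<close>, and a derivative of a component of \<open>F\<close>, which is of the form
  \<open>base\<close>.\<close>

lemma smooth_closure_deriv:
  assumes "smooth_closure S \<tau> f" "open S"
  shows "\<exists>D. (\<forall>y\<in>S. (f has_derivative (\<lambda>u. D u y)) (at y)) \<and> (\<forall>u. smooth_closure S \<tau> (D u))"
  using assms(1)
proof induction
  case (base f)
  show ?case
    by (rule exI[of _ "\<lambda>u y. frechet_derivative f (at y) u"])
      (auto intro: smooth_closure.base smooth_on_deriv[OF base] smooth_on_has_derivative[OF base assms(2)])
next
  case (add f g)
  then obtain D E where D: "\<forall>y\<in>S. (f has_derivative (\<lambda>u. D u y)) (at y)" "\<forall>u. smooth_closure S \<tau> (D u)"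
    and E: "\<forall>y\<in>S. (g has_derivative (\<lambda>u. E u y)) (at y)" "\<forall>u. smooth_closure S \<tau> (E u)" by blast
  show ?case
    by (rule exI[of _ "\<lambda>u y. D u y + E u y"]) (use D E in \<open>auto intro: smooth_closure.add has_derivative_add\<close>)
next
  case (mult f g)
  then obtain D E where D: "\<forall>y\<in>S. (f has_derivative (\<lambda>u. D u y)) (at y)" "\<forall>u. smooth_closure S \<tau> (D u)"
    and E: "\<forall>y\<in>S. (g has_derivative (\<lambda>u. E u y)) (at y)" "\<forall>u. smooth_closure S \<tau> (E u)" by blast
  show ?case
  proof (intro exI[of _ "\<lambda>u y. f y * E u y + D u y * g y"] conjI allI ballI)
    show "smooth_closure S \<tau> (\<lambda>y. f y * E u y + D u y * g y)" for u
      using D(2) E(2) mult.hyps by (intro smooth_closure.add smooth_closure.mult) auto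
  qed (use D(1) E(1) has_derivative_mult in blast)
next
  case (comp T g F)
  let ?D = "\<lambda>u y. \<Sum>b\<in>Basis. frechet_derivative g (at (F y)) b * frechet_derivative (\<lambda>y. F y \<bullet> b) (at y) u"
  have "((\<lambda>y. g (F y)) has_derivative (\<lambda>u. ?D u y)) (at y)" if y: "y \<in> S" for y
  proof -
    have Fy: "F y \<in> T" using comp y by blast
    let ?F' = "\<lambda>u. \<Sum>b\<in>Basis. frechet_derivative (\<lambda>y. F y \<bullet> b) (at y) u *\<^sub>R b"
    have "(F has_derivative ?F') (at y)"
      by (subst has_derivative_componentwise_within)
        (use smooth_on_has_derivative[OF comp(4) assms(2) y] in auto)
    from has_derivative_compose[OF this smooth_on_has_derivative[OF comp(1,2) Fy]]
    have "((\<lambda>y. g (F y)) has_derivative (\<lambda>u. frechet_derivative g (at (F y)) (?F' u))) (at y)" .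
    moreover have "linear (frechet_derivative g (at (F y)))"
      using smooth_on_has_derivative[OF comp(1,2) Fy] has_derivative_linear by blast
    then have "frechet_derivative g (at (F y)) (?F' u) = ?D u y" for u
      by (simp add: linear_sum linear_scale mult.commute)
    ultimately show ?thesis by simp
  qed
  moreover have "smooth_closure S \<tau> (?D u)" for u
    using comp by (intro smooth_closure_sum assms(2) smooth_closure.mult smooth_closure.comp[of T _ F]
        smooth_closure.base[OF smooth_on_deriv[of S "\<lambda>y. F y \<bullet> b" for b]])
      (auto intro: smooth_on_deriv)
  ultimately show ?case by (intro exI[of _ ?D]) blast
qed

lemma smooth_closure_imp_smooth:
  assumes "smooth_closure S \<tau> f" "open S"
  shows "smooth_on S f"
proof (rule smooth_on_coinduct[where P = "smooth_closure S \<tau>"])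
  fix f assume "smooth_closure S \<tau> f"
  from smooth_closure_deriv[OF this assms(2)] obtain D where
    D: "\<And>y. y \<in> S \<Longrightarrow> (f has_derivative (\<lambda>u. D u y)) (at y)" "\<And>u. smooth_closure S \<tau> (D u)" by blast
  then have "f differentiable_on S" by (meson differentiable_def differentiable_at_imp_differentiable_on)
  moreover have "\<forall>y\<in>S. frechet_derivative f (at y) u = D u y" for u
    using frechet_derivative_at[OF D(1)] by metis
  ultimately show "f differentiable_on S \<and> (\<forall>u. \<exists>g. smooth_closure S \<tau> g \<and> (\<forall>y\<in>S. frechet_derivative f (at y) u = g y))"
    using D(2) by blast
qed (use assms in auto)

lemma smooth_on_add:
  fixes f g :: "'a::real_normed_vector \<Rightarrow> real"
  shows "smooth_on S f \<Longrightarrow> smooth_on S g \<Longrightarrow> open S \<Longrightarrow> smooth_on S (\<lambda>y. f y + g y)"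
  by (rule smooth_closure_imp_smooth[where \<tau> = "TYPE(real)"]) (auto intro: base add)

lemma smooth_on_mult:
  fixes f g :: "'a::real_normed_vector \<Rightarrow> real"
  shows "smooth_on S f \<Longrightarrow> smooth_on S g \<Longrightarrow> open S \<Longrightarrow> smooth_on S (\<lambda>y. f y * g y)"
  by (rule smooth_closure_imp_smooth[where \<tau> = "TYPE(real)"]) (auto intro: base mult)

lemma smooth_on_diff:
  fixes f g :: "'a::real_normed_vector \<Rightarrow> real"
  assumes "smooth_on S f" "smooth_on S g" "open S" shows "smooth_on S (\<lambda>y. f y - g y)"
  using smooth_on_add[OF assms(1) smooth_on_mult[OF smooth_on_const[OF assms(3), of "-1"] assms(2,3)] assms(3)]
  by simp

lemma smooth_on_sum:
  fixes f :: "'i \<Rightarrow> 'a::real_normed_vector \<Rightarrow> real"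
  shows "(\<And>i. i \<in> I \<Longrightarrow> smooth_on S (f i)) \<Longrightarrow> open S \<Longrightarrow> smooth_on S (\<lambda>y. \<Sum>i\<in>I. f i y)"
  by (induction I rule: infinite_finite_induct) (auto intro: smooth_on_const smooth_on_add)

lemma smooth_on_prod:
  fixes f :: "'i \<Rightarrow> 'a::real_normed_vector \<Rightarrow> real"
  shows "(\<And>i. i \<in> I \<Longrightarrow> smooth_on S (f i)) \<Longrightarrow> open S \<Longrightarrow> smooth_on S (\<lambda>y. \<Prod>i\<in>I. f i y)"
  by (induction I rule: infinite_finite_induct) (auto intro: smooth_on_const smooth_on_mult)

lemma smooth_on_compose:
  fixes g :: "'b::euclidean_space \<Rightarrow> real" and F :: "'a::real_normed_vector \<Rightarrow> 'b"
  assumes "smooth_on T g" "open T" "F ` S \<subseteq> T" "smooth_on S F" "open S"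
  shows "smooth_on S (\<lambda>y. g (F y))"
  by (rule smooth_closure_imp_smooth[where \<tau> = "TYPE('b)"], rule comp[OF assms(1-3)])
    (auto intro: smooth_on_inner assms)

lemma smooth_on_det:
  fixes M :: "'a::real_normed_vector \<Rightarrow> real ^ 'i ^ 'i"
  assumes "\<And>i j. smooth_on S (\<lambda>y. M y $ i $ j)" "open S"
  shows "smooth_on S (\<lambda>y. det (M y))"
  unfolding det_def by (intro smooth_on_sum smooth_on_mult smooth_on_prod smooth_on_const assms)

subsection \<open>A smooth step function\<close>

text \<open>The classical function \<open>exp (- 1 / t)\<close>, extended by zero, together with its
  multiples by negative powers of \<open>t\<close>, which its derivatives produce.\<close>

definition exp_flat :: "nat \<Rightarrow> real \<Rightarrow> real" where
  "exp_flat k t = (if t > 0 then inverse t ^ k * exp (- inverse t) else 0)"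

lemma exp_flat_limit: "(exp_flat k \<longlongrightarrow> 0) (at_right 0)"
proof -
  have "((\<lambda>x::real. x ^ k / exp x) \<longlongrightarrow> 0) at_top" by (rule tendsto_power_div_exp_0)
  then have "((\<lambda>t::real. inverse t ^ k / exp (inverse t)) \<longlongrightarrow> 0) (at_right 0)"
    using filterlim_inverse_at_top_right by (rule filterlim_compose)
  then show ?thesis
    by (rule Lim_transform_eventually)
      (auto simp: eventually_at_filter exp_flat_def exp_minus divide_inverse)
qed

lemma inverse_power_derivative:
  assumes "t > 0"
  shows "((\<lambda>t. inverse t ^ k) has_real_derivative - (real k * inverse t ^ Suc k)) (at t)"
proof (cases k)
  case (Suc m)
  then show ?thesis
    using DERIV_power[OF DERIV_inverse[of t], of k] assms by (simp add: mult_ac)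
qed simp

text \<open>At \<open>0\<close> the right difference quotient of \<open>exp_flat k\<close> is
  \<open>exp_flat (Suc k)\<close>, which tends to zero; elsewhere this is the product rule.\<close>

lemma exp_flat_derivative:
  "(exp_flat k has_real_derivative (exp_flat (k + 2) t - real k * exp_flat (k + 1) t)) (at t)"
proof -
  consider "t > 0" | "t < 0" | "t = 0" by linarith
  then show ?thesis
  proof cases
    case 1
    have "((\<lambda>t. exp (- inverse t)) has_real_derivative exp (- inverse t) * inverse t ^ 2) (at t)"
      using 1 by (auto intro!: derivative_eq_intros simp: power2_eq_square)
    from DERIV_mult[OF inverse_power_derivative[OF 1, of k] this]
    have "((\<lambda>t. inverse t ^ k * exp (- inverse t)) has_real_derivative
      (exp_flat (k + 2) t - real k * exp_flat (k + 1) t)) (at t)"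
      using 1 by (simp add: exp_flat_def power2_eq_square algebra_simps)
    then show ?thesis
      by (rule has_field_derivative_transform_within_open[of _ _ _ "{0<..}"]) (use 1 in \<open>auto simp: exp_flat_def\<close>)
  next
    case 2
    have "((\<lambda>t. 0) has_real_derivative (exp_flat (k + 2) t - real k * exp_flat (k + 1) t)) (at t)"
      using 2 by (simp add: exp_flat_def)
    then show ?thesis
      by (rule has_field_derivative_transform_within_open[of _ _ _ "{..<0}"]) (use 2 in \<open>auto simp: exp_flat_def\<close>)
  next
    case 3
    have "((\<lambda>h. (exp_flat k (0 + h) - exp_flat k 0) / h) \<longlongrightarrow> 0) (at 0)"
      unfolding filterlim_at_split
    proof
      show "((\<lambda>h. (exp_flat k (0 + h) - exp_flat k 0) / h) \<longlongrightarrow> 0) (at_left 0)"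
        by (rule Lim_transform_eventually[OF tendsto_const])
          (auto simp: eventually_at_filter exp_flat_def)
      show "((\<lambda>h. (exp_flat k (0 + h) - exp_flat k 0) / h) \<longlongrightarrow> 0) (at_right 0)"
        by (rule Lim_transform_eventually[OF exp_flat_limit[of "Suc k"]])
          (auto simp: eventually_at_filter exp_flat_def divide_inverse)
    qed
    then show ?thesis using 3 by (simp add: DERIV_def exp_flat_def)
  qed
qed

text \<open>The derivative in direction \<open>u\<close> is \<open>u\<close> times the ordinary one,
  hence the requirement that the class be closed under scaling.\<close>

lemma smooth_on_real_coinduct:
  fixes f :: "real \<Rightarrow> real"
  assumes "P f" "open S"
    and step: "\<And>f. P f \<Longrightarrow> \<exists>g. P g \<and> (\<forall>y\<in>S. (f has_real_derivative g y) (at y))"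
    and scale: "\<And>f c. P f \<Longrightarrow> P (\<lambda>y. c * f y)"
  shows "smooth_on S f"
proof (rule smooth_on_coinduct[of P])
  fix f assume "P f"
  then obtain g where g: "P g" "\<And>y. y \<in> S \<Longrightarrow> (f has_real_derivative g y) (at y)" using step by blast
  then have d: "(f has_derivative (\<lambda>u. u * g y)) (at y)" if "y \<in> S" for y
    using that by (simp add: has_field_derivative_def mult.commute[of _ "g y"])
  then have "f differentiable_on S" by (meson differentiable_def differentiable_at_imp_differentiable_on)
  moreover have "\<forall>y\<in>S. frechet_derivative f (at y) u = u * g y" for u
    using frechet_derivative_at[OF d] by metis
  ultimately show "f differentiable_on S \<and> (\<forall>u. \<exists>g. P g \<and> (\<forall>y\<in>S. frechet_derivative f (at y) u = g y))"
    using scale[OF g(1)] by meson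
qed (use assms in auto)

inductive exp_flat_span :: "(real \<Rightarrow> real) \<Rightarrow> bool" where
  exp_flat: "exp_flat_span (exp_flat k)"
| lincomb: "exp_flat_span f \<Longrightarrow> exp_flat_span g \<Longrightarrow> exp_flat_span (\<lambda>y. a * f y + b * g y)"

lemma smooth_exp_flat: "smooth_on UNIV (exp_flat k)"
proof (rule smooth_on_real_coinduct[of exp_flat_span])
  fix f assume "exp_flat_span f"
  then show "\<exists>g. exp_flat_span g \<and> (\<forall>y\<in>UNIV. (f has_real_derivative g y) (at y))"
  proof induction
    case (exp_flat k)
    have "exp_flat_span (\<lambda>y. 1 * exp_flat (k + 2) y + (- real k) * exp_flat (k + 1) y)"
      by (intro exp_flat_span.intros)
    then show ?case
      using exp_flat_derivative[of k] by (intro exI[of _ "\<lambda>y. 1 * exp_flat (k + 2) y + (- real k) * exp_flat (k + 1) y"]) simp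
  next
    case (lincomb f g a b)
    then obtain f' g' where "exp_flat_span f'" "\<forall>y. (f has_real_derivative f' y) (at y)"
      "exp_flat_span g'" "\<forall>y. (g has_real_derivative g' y) (at y)" by auto
    then show ?case
      by (intro exI[of _ "\<lambda>y. a * f' y + b * g' y"])
        (auto intro!: exp_flat_span.lincomb derivative_eq_intros)
  qed
next
  fix f c assume "exp_flat_span f"
  from exp_flat_span.lincomb[OF this this, of c 0] show "exp_flat_span (\<lambda>y. c * f y)" by simp
qed (auto intro: exp_flat_span.exp_flat)

lemma smooth_on_inverse: "smooth_on {0<..} (inverse :: real \<Rightarrow> real)"
proof (rule smooth_on_real_coinduct[where P = "\<lambda>f. \<exists>c k. f = (\<lambda>y. c * inverse y ^ k)"])
  show "\<exists>c k. (inverse :: real \<Rightarrow> real) = (\<lambda>y. c * inverse y ^ k)"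
    by (rule exI[of _ 1], rule exI[of _ 1]) auto
  fix f :: "real \<Rightarrow> real" assume "\<exists>c k. f = (\<lambda>y. c * inverse y ^ k)"
  then obtain c k where f: "f = (\<lambda>y. c * inverse y ^ k)" by blast
  have "(f has_real_derivative (- c * real k) * inverse y ^ Suc k) (at y)" if "y \<in> {0<..}" for y
    unfolding f using that DERIV_cmult[OF inverse_power_derivative[of y k], of c] by (simp add: mult_ac)
  then show "\<exists>g. (\<exists>c k. g = (\<lambda>y. c * inverse y ^ k)) \<and> (\<forall>y\<in>{0<..}. (f has_real_derivative g y) (at y))"
    by (intro exI[of _ "\<lambda>y. (- c * real k) * inverse y ^ Suc k"]) blast
next
  fix f :: "real \<Rightarrow> real" and c assume "\<exists>c k. f = (\<lambda>y. c * inverse y ^ k)"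
  then show "\<exists>d k. (\<lambda>y. c * f y) = (\<lambda>y. d * inverse y ^ k)" by (metis mult.assoc)
qed auto

definition smooth_step :: "real \<Rightarrow> real" where
  "smooth_step t = exp_flat 0 t * inverse (exp_flat 0 t + exp_flat 0 (1 - t))"

lemma exp_flat0: "exp_flat 0 t \<ge> 0" "exp_flat 0 t + exp_flat 0 (1 - t) > 0"
  by (auto simp: exp_flat_def add_pos_pos add_nonneg_pos)

lemma smooth_step_bounds: "0 \<le> smooth_step t" "smooth_step t \<le> 1"
  using exp_flat0[of t] exp_flat0(1)[of "1 - t"] by (auto simp: smooth_step_def field_simps)

lemma smooth_step_0: "t \<le> 0 \<Longrightarrow> smooth_step t = 0"
  and smooth_step_1: "t \<ge> 1 \<Longrightarrow> smooth_step t = 1"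
  by (auto simp: smooth_step_def exp_flat_def)

lemma smooth_smooth_step: "smooth_on UNIV smooth_step"
proof -
  have "smooth_on UNIV (\<lambda>t::real. 1 - t)"
    by (rule smooth_on_diff[OF smooth_on_const smooth_on_linear[OF bounded_linear_ident]]) auto
  then have m: "smooth_on UNIV (\<lambda>t. exp_flat 0 (1 - t))"
    by (intro smooth_on_compose[of UNIV "exp_flat 0" "\<lambda>t. 1 - t" UNIV] smooth_exp_flat) auto
  then have "smooth_on UNIV (\<lambda>t. exp_flat 0 t + exp_flat 0 (1 - t))"
    by (intro smooth_on_add smooth_exp_flat) auto
  then have "smooth_on UNIV (\<lambda>t. inverse (exp_flat 0 t + exp_flat 0 (1 - t)))"
    using exp_flat0(2) by (intro smooth_on_compose[OF smooth_on_inverse]) auto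
  then have "smooth_on UNIV (\<lambda>t. exp_flat 0 t * inverse (exp_flat 0 t + exp_flat 0 (1 - t)))"
    by (intro smooth_on_mult smooth_exp_flat) auto
  then show ?thesis by (simp add: smooth_step_def[abs_def])
qed

text \<open>Squared norms keep the argument of the step function polynomial in \<open>y\<close>,
  hence smooth at the centre too.\<close>

definition ball_bump :: "'a::euclidean_space \<Rightarrow> real \<Rightarrow> real \<Rightarrow> 'a \<Rightarrow> real" where
  "ball_bump a r R y = smooth_step ((R\<^sup>2 - (norm (y - a))\<^sup>2) / (R\<^sup>2 - r\<^sup>2))"

lemma ball_bump_bounds: "0 \<le> ball_bump a r R y" "ball_bump a r R y \<le> 1"
  by (simp_all add: ball_bump_def smooth_step_bounds)

lemma ball_bump_1: "0 \<le> r \<Longrightarrow> r < R \<Longrightarrow> norm (y - a) \<le> r \<Longrightarrow> ball_bump a r R y = 1"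
  unfolding ball_bump_def by (rule smooth_step_1) (simp add: power_strict_mono power_mono)

lemma ball_bump_0: "0 \<le> r \<Longrightarrow> r < R \<Longrightarrow> norm (y - a) \<ge> R \<Longrightarrow> ball_bump a r R y = 0"
  unfolding ball_bump_def
  by (rule smooth_step_0) (simp add: power_strict_mono power_mono divide_nonpos_pos)

lemma smooth_ball_bump: "smooth_on UNIV (ball_bump a r R)"
proof -
  have "smooth_on UNIV (\<lambda>y. (y - a) \<bullet> b)" for b
    using smooth_on_diff[OF smooth_on_linear[OF bounded_linear_inner_left[of b]] smooth_on_const, of UNIV "a \<bullet> b"]
    by (simp add: inner_diff_left)
  then have "smooth_on UNIV (\<lambda>y. \<Sum>b\<in>Basis. ((y - a) \<bullet> b) * ((y - a) \<bullet> b))"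
    by (intro smooth_on_sum smooth_on_mult) auto
  then have "smooth_on UNIV (\<lambda>y. (norm (y - a))\<^sup>2)"
    by (simp add: power2_norm_eq_inner flip: euclidean_inner)
  then have "smooth_on UNIV (\<lambda>y. (R\<^sup>2 - (norm (y - a))\<^sup>2) * (1 / (R\<^sup>2 - r\<^sup>2)))"
    by (intro smooth_on_mult smooth_on_diff smooth_on_const) auto
  then have "smooth_on UNIV (\<lambda>y. smooth_step ((R\<^sup>2 - (norm (y - a))\<^sup>2) * (1 / (R\<^sup>2 - r\<^sup>2))))"
    by (intro smooth_on_compose[OF smooth_smooth_step]) auto
  then show ?thesis by (simp add: ball_bump_def[abs_def])
qed

section \<open>Alternating forms and multivectors\<close>

lemma alt_form_linear: "alt_form \<alpha> \<Longrightarrow> linear (\<lambda>u. \<alpha> (v(i := u)))"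
  and alt_form_eq_0: "alt_form \<alpha> \<Longrightarrow> i \<noteq> j \<Longrightarrow> v i = v j \<Longrightarrow> \<alpha> v = 0"
  unfolding alt_form_def by blast+

text \<open>Polarization: filling both slots with \<open>v i + v j\<close> gives zero.\<close>

lemma alt_form_transpose:
  assumes \<alpha>: "alt_form \<alpha>" and ij: "i \<noteq> j"
  shows "\<alpha> (\<lambda>k. v (Transposition.transpose i j k)) = - \<alpha> v"
proof -
  define \<beta> where "\<beta> x y = \<alpha> (v(i := x, j := y))" for x y
  have l1: "linear (\<lambda>x. \<beta> x y)" for y
    using alt_form_linear[OF \<alpha>, of "v(j := y)" i] ij by (simp add: \<beta>_def fun_upd_twist)
  have l2: "linear (\<beta> x)" for x
    unfolding \<beta>_def by (rule alt_form_linear[OF \<alpha>])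
  have 0: "\<beta> x x = 0" for x unfolding \<beta>_def by (rule alt_form_eq_0[OF \<alpha> ij]) (use ij in simp)
  have "\<beta> (v i + v j) (v i + v j) = \<beta> (v i) (v i) + \<beta> (v i) (v j) + (\<beta> (v j) (v i) + \<beta> (v j) (v j))"
    by (simp add: linear_add[OF l1] linear_add[OF l2])
  then have "\<beta> (v j) (v i) = - \<beta> (v i) (v j)" unfolding 0 by linarith
  moreover have "v(i := v j, j := v i) = (\<lambda>k. v (Transposition.transpose i j k))"
    using ij by (auto simp: fun_eq_iff Transposition.transpose_def)
  moreover have "v(i := v i, j := v j) = v" by simp
  ultimately show ?thesis by (simp add: \<beta>_def)
qed

lemma alt_form_permute:
  fixes \<alpha> :: "('i::finite \<Rightarrow> real ^ 'n::finite) \<Rightarrow> real"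
  assumes \<alpha>: "alt_form \<alpha>" and p: "p permutes UNIV"
  shows "\<alpha> (\<lambda>k. v (p k)) = of_int (sign p) * \<alpha> v"
  using p finite[of "UNIV :: 'i set"]
proof (induction arbitrary: v rule: permutes_induct)
  case id then show ?case by simp
next
  case (swap a b p)
  have "permutation p" using swap by (auto simp: permutation_permutes)
  then have "sign (Transposition.transpose a b \<circ> p) = - sign p"
    using swap by (simp add: sign_compose permutation_swap_id sign_swap_id)
  moreover have "\<alpha> (\<lambda>k. v ((Transposition.transpose a b \<circ> p) k)) = of_int (sign p) * \<alpha> (\<lambda>k. v (Transposition.transpose a b k))"
    using swap.IH[of "\<lambda>k. v (Transposition.transpose a b k)"] by simp
  ultimately show ?case using alt_form_transpose[OF \<alpha> swap.hyps(3), of v] by (simp add: o_def)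
qed

text \<open>The arguments are expanded in the standard basis one slot at a time; the induction is
  over the set \<open>I\<close> of slots already expanded.\<close>

lemma multilinear_expand:
  fixes \<alpha> :: "('i::finite \<Rightarrow> real ^ 'n::finite) \<Rightarrow> real"
  assumes lin: "\<And>v i. linear (\<lambda>u. \<alpha> (v(i := u)))"
  shows "\<alpha> v = (\<Sum>h\<in>UNIV. (\<Prod>i\<in>UNIV. v i $ h i) * \<alpha> (\<lambda>i. axis (h i) 1))"
proof -
  have "\<alpha> v = (\<Sum>h\<in>PiE I (\<lambda>_. UNIV). (\<Prod>i\<in>I. v i $ h i) * \<alpha> (\<lambda>i. if i \<in> I then axis (h i) 1 else v i))"
    if "finite I" for I :: "'i set"
    using that
  proof (induction I)
    case empty then show ?case by simp
  next
    case (insert a I)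
    have step: "\<alpha> (\<lambda>i. if i \<in> I then axis (h i) 1 else v i) =
      (\<Sum>y\<in>UNIV. v a $ y * \<alpha> (\<lambda>i. if i \<in> insert a I then axis ((h(a := y)) i) 1 else v i))" for h
    proof -
      let ?w = "\<lambda>i. if i \<in> I then axis (h i) 1 else v i"
      have "\<alpha> ?w = \<alpha> (?w(a := \<Sum>y\<in>UNIV. v a $ y *\<^sub>R axis y 1))"
        using insert(2) by (intro arg_cong[of _ _ \<alpha>]) (auto simp: fun_eq_iff basis_expansion scalar_mult_eq_scaleR[symmetric])
      also have "\<dots> = (\<Sum>y\<in>UNIV. v a $ y * \<alpha> (?w(a := axis y 1)))"
        by (simp only: linear_sum[OF lin[of ?w a]] linear_scale[OF lin[of ?w a]] real_scaleR_def)
      also have "\<dots> = (\<Sum>y\<in>UNIV. v a $ y * \<alpha> (\<lambda>i. if i \<in> insert a I then axis ((h(a := y)) i) 1 else v i))"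
        using insert(2) by (intro sum.cong arg_cong2[of _ _ _ _ "(*)"] arg_cong[of _ _ \<alpha>]) (auto simp: fun_eq_iff)
      finally show ?thesis .
    qed
    have "(\<Sum>h\<in>PiE (insert a I) (\<lambda>_. UNIV). (\<Prod>i\<in>insert a I. v i $ h i) * \<alpha> (\<lambda>i. if i \<in> insert a I then axis (h i) 1 else v i))
      = (\<Sum>(y, h)\<in>UNIV \<times> PiE I (\<lambda>_. UNIV). (\<Prod>i\<in>insert a I. v i $ (h(a := y)) i) *
          \<alpha> (\<lambda>i. if i \<in> insert a I then axis ((h(a := y)) i) 1 else v i))"
      unfolding PiE_insert_eq by (subst sum.reindex[OF inj_combinator[OF insert(2)]]) (auto intro!: sum.cong)
    also have "\<dots> = (\<Sum>y\<in>UNIV. \<Sum>h\<in>PiE I (\<lambda>_. UNIV). (\<Prod>i\<in>insert a I. v i $ (h(a := y)) i) *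
          \<alpha> (\<lambda>i. if i \<in> insert a I then axis ((h(a := y)) i) 1 else v i))"
      by (simp add: sum.cartesian_product)
    also have "\<dots> = (\<Sum>h\<in>PiE I (\<lambda>_. UNIV). \<Sum>y\<in>UNIV. (\<Prod>i\<in>insert a I. v i $ (h(a := y)) i) *
          \<alpha> (\<lambda>i. if i \<in> insert a I then axis ((h(a := y)) i) 1 else v i))"
      by (rule sum.swap)
    also have "\<dots> = (\<Sum>h\<in>PiE I (\<lambda>_. UNIV). (\<Prod>i\<in>I. v i $ h i) * \<alpha> (\<lambda>i. if i \<in> I then axis (h i) 1 else v i))"
    proof (rule sum.cong[OF refl])
      fix h
      have "(\<Prod>i\<in>insert a I. v i $ (h(a := y)) i) = v a $ y * (\<Prod>i\<in>I. v i $ h i)" for y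
      proof -
        have "(\<Prod>i\<in>I. v i $ (h(a := y)) i) = (\<Prod>i\<in>I. v i $ h i)"
          using insert(2) by (intro prod.cong) auto
        then show ?thesis using insert by simp
      qed
      then show "(\<Sum>y\<in>UNIV. (\<Prod>i\<in>insert a I. v i $ (h(a := y)) i) *
          \<alpha> (\<lambda>i. if i \<in> insert a I then axis ((h(a := y)) i) 1 else v i)) =
          (\<Prod>i\<in>I. v i $ h i) * \<alpha> (\<lambda>i. if i \<in> I then axis (h i) 1 else v i)"
        unfolding step[of h] sum_distrib_left by (intro sum.cong) (simp_all only: mult_ac)
    qed
    finally show ?case using insert.IH by simp
  qed
  from this[of UNIV] show ?thesis by simp
qed

text \<open>The determinants in \<open>wedge v\<close> split the pairing into one sum for each
  permutation. Undoing the permutation in the arguments of \<open>\<alpha>\<close> cancels its sign,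
  so every such sum is \<open>\<alpha> v\<close>, and the factorial in \<open>pairing\<close> counts
  them.\<close>

lemma pairing_wedge:
  fixes \<alpha> :: "('i::finite \<Rightarrow> real ^ 'n::finite) \<Rightarrow> real"
  assumes \<alpha>: "alt_form \<alpha>"
  shows "pairing \<alpha> (wedge v) = \<alpha> v"
proof -
  let ?P = "{p. p permutes (UNIV :: 'i set)}"
  let ?e = "\<lambda>f. \<alpha> (\<lambda>i. axis (f i) 1)"
  have inner: "(\<Sum>f\<in>UNIV. (\<Prod>i\<in>UNIV. v i $ f (\<sigma> i)) * ?e f) = of_int (sign \<sigma>) * \<alpha> v"
    if \<sigma>: "\<sigma> permutes UNIV" for \<sigma>
  proof -
    have "(\<Sum>f\<in>UNIV. (\<Prod>i\<in>UNIV. v i $ f (\<sigma> i)) * ?e f) =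
        (\<Sum>h\<in>UNIV. (\<Prod>i\<in>UNIV. v i $ h i) * ?e (h \<circ> inv \<sigma>))"
      by (rule sum.reindex_bij_witness[of _ "\<lambda>h. h \<circ> inv \<sigma>" "\<lambda>f. f \<circ> \<sigma>"])
        (auto simp: fun_eq_iff permutes_inverses[OF \<sigma>] o_def)
    also have "\<dots> = (\<Sum>h\<in>UNIV. (\<Prod>i\<in>UNIV. v i $ h i) * (of_int (sign \<sigma>) * ?e h))"
    proof (intro sum.cong refl arg_cong2[of _ _ _ _ "(*)"])
      fix h :: "'i \<Rightarrow> 'n"
      have "sign (inv \<sigma>) = sign \<sigma>"
        by (rule sign_inverse, rule permutes_imp_permutation[OF _ \<sigma>]) simp
      then show "?e (h \<circ> inv \<sigma>) = of_int (sign \<sigma>) * ?e h"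
        using alt_form_permute[OF \<alpha> permutes_inv[OF \<sigma>], of "\<lambda>i. axis (h i) 1"] by simp
    qed
    also have "\<dots> = of_int (sign \<sigma>) * \<alpha> v"
      by (subst (2) multilinear_expand[OF alt_form_linear[OF \<alpha>]]) (simp add: sum_distrib_left mult_ac)
    finally show ?thesis .
  qed
  have "(\<Sum>f\<in>UNIV. wedge v $ f * ?e f) =
      (\<Sum>f\<in>UNIV. \<Sum>\<sigma>\<in>?P. of_int (sign \<sigma>) * ((\<Prod>i\<in>UNIV. v i $ f (\<sigma> i)) * ?e f))"
    by (simp add: wedge_def det_def sum_distrib_right mult.assoc)
  also have "\<dots> = (\<Sum>\<sigma>\<in>?P. of_int (sign \<sigma>) * (\<Sum>f\<in>UNIV. (\<Prod>i\<in>UNIV. v i $ f (\<sigma> i)) * ?e f))"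
    by (subst sum.swap) (simp add: sum_distrib_left)
  also have "\<dots> = (\<Sum>\<sigma>\<in>?P. \<alpha> v)"
  proof (rule sum.cong[OF refl])
    fix \<sigma> assume "\<sigma> \<in> ?P"
    then show "of_int (sign \<sigma>) * (\<Sum>f\<in>UNIV. (\<Prod>i\<in>UNIV. v i $ f (\<sigma> i)) * ?e f) = \<alpha> v"
      using inner[of \<sigma>] by (simp add: mult.assoc[symmetric] of_int_mult[symmetric] del: of_int_mult)
  qed
  also have "\<dots> = fact CARD('i) * \<alpha> v"
    by (simp add: card_permutations[of UNIV "CARD('i)"])
  finally show ?thesis by (simp add: pairing_def)
qed

lemma linear_pairing: "linear (pairing \<alpha>)"
  unfolding pairing_def[abs_def]
  by (rule linearI) (simp_all add: sum.distrib distrib_right add_divide_distrib sum_distrib_left mult.assoc)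

lemma pairing_scale_left: "pairing (\<lambda>v. c * \<alpha> v) \<xi> = c * pairing \<alpha> \<xi>"
  by (simp add: pairing_def sum_distrib_left mult_ac)

lemma pairing_scale_right: "pairing \<alpha> (c *\<^sub>R \<xi>) = c * pairing \<alpha> \<xi>"
  using linear_scale[OF linear_pairing] by simp

lemma alt_form_scale: "alt_form \<alpha> \<Longrightarrow> alt_form (\<lambda>v. c * \<alpha> v)"
proof -
  assume \<alpha>: "alt_form \<alpha>"
  have "linear (\<lambda>u. c * \<alpha> (v(i := u)))" for v i
    using linear_compose_scale_right[OF alt_form_linear[OF \<alpha>, of v i], of c] by simp
  then show ?thesis using \<alpha> by (auto simp: alt_form_def)
qed

text \<open>Serves both the components of \<open>wedge v\<close>, with coordinates for
  \<open>L j\<close>, and Gram determinants, with inner products for \<open>L j\<close>.\<close>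

lemma alt_form_det:
  fixes L :: "'i::finite \<Rightarrow> real ^ 'n::finite \<Rightarrow> real"
  assumes L: "\<And>j. linear (L j)"
  shows "alt_form (\<lambda>v. det (\<chi> i j. L j (v i)))"
  unfolding alt_form_def
proof (intro conjI allI impI)
  fix v :: "'i \<Rightarrow> real ^ 'n" and k
  have eq: "(\<chi> i j. L j ((v(k := u)) i)) = (\<chi> i. if i = k then (\<chi> j. L j u) else (\<chi> j. L j (v i)))" for u
    by (auto simp: vec_eq_iff)
  have 1: "(\<chi> j. L j (x + y)) = (\<chi> j. L j x) + (\<chi> j. L j y)" for x y
    using L by (simp add: vec_eq_iff linear_add)
  have 2: "(\<chi> j. L j (c *\<^sub>R x)) = c *s (\<chi> j. L j x)" for c x
    using L by (simp add: vec_eq_iff linear_scale)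
  show "linear (\<lambda>u. det (\<chi> i j. L j ((v(k := u)) i)))"
    by (intro linearI) (simp_all only: eq 1 2 det_row_add[of k] det_row_mul[of k] real_scaleR_def)
next
  fix v :: "'i \<Rightarrow> real ^ 'n" and i j assume "i \<noteq> j \<and> v i = v j"
  then show "det (\<chi> i j. L j (v i)) = 0"
    by (intro det_identical_rows[of i j]) (auto simp: row_def)
qed

lemma alt_form_wedge: "alt_form (\<lambda>v. wedge v $ f)"
proof -
  have "alt_form (\<lambda>v. det (\<chi> i j. v i $ f j))"
    by (rule alt_form_det[of "\<lambda>j u. u $ f j"]) (auto intro: linearI)
  then show ?thesis by (simp add: wedge_def)
qed

lemma wedge_linear_combination:
  assumes "\<And>i. v i = (\<Sum>j\<in>UNIV. M $ i $ j *\<^sub>R w j)"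
  shows "wedge v = det M *\<^sub>R wedge w"
proof -
  have eq: "(\<chi> i j. v i $ f j) = M ** (\<chi> i j. w i $ f j)" for f
    by (simp add: assms matrix_matrix_mult_def vec_eq_iff)
  have "wedge v $ f = (det M *\<^sub>R wedge w) $ f" for f
    by (simp add: wedge_def eq det_mul)
  then show ?thesis by (simp add: vec_eq_iff)
qed

lemma subspace_multivectors: "subspace multivectors"
  unfolding multivectors_def by (rule subspace_span)

lemma wedge_in_multivectors: "wedge v \<in> multivectors"
  unfolding multivectors_def by (rule span_base) simp

lemma alt_form_compose_linear:
  assumes "alt_form \<alpha>" "linear L"
  shows "alt_form (\<lambda>v. \<alpha> (\<lambda>i. L (v i)))"
  unfolding alt_form_def
proof (intro conjI allI impI)
  fix v and i :: 'a
  have "(\<lambda>k. L ((v(i := u)) k)) = (\<lambda>k. L (v k))(i := L u)" for u by auto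
  then show "linear (\<lambda>u. \<alpha> (\<lambda>k. L ((v(i := u)) k)))"
    using linear_compose[OF assms(2) alt_form_linear[OF assms(1), of "\<lambda>k. L (v k)" i]] by (simp add: o_def)
next
  fix v :: "'a \<Rightarrow> real ^ 'c" and i j :: 'a assume "i \<noteq> j \<and> v i = v j"
  then show "\<alpha> (\<lambda>k. L (v k)) = 0" by (intro alt_form_eq_0[OF assms(1), of i j]) auto
qed

text \<open>On \<open>t \<eta>\<close>, with \<open>\<eta>\<close> a space-like plane, this is \<open>t\<^sup>2\<close>. Being polynomial in the coordinates of
  \<open>\<xi>\<close> and of the metric, it shows that the mass norm is measurable along a simple multivector field.\<close>

definition gram_form :: "(real ^ 'n \<Rightarrow> real ^ 'n \<Rightarrow> real) \<Rightarrow> real ^ ('i::finite \<Rightarrow> 'n::finite) \<Rightarrow> real" where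
  "gram_form \<gamma> \<xi> = (\<Sum>f\<in>UNIV. \<Sum>h\<in>UNIV. \<xi> $ f * \<xi> $ h *
     (\<Prod>i\<in>UNIV. \<gamma> (axis (f i) 1) (axis (h i) 1))) / fact CARD('i)"

text \<open>One of the two sums collapses to a determinant that is alternating in the other family
  of arguments, so the remaining sum with its factorial is a \<open>pairing\<close> with
  \<open>wedge v\<close>.\<close>

lemma gram_form_wedge:
  fixes v :: "'i::finite \<Rightarrow> real ^ 'n::finite"
  assumes \<gamma>: "bilinear \<gamma>"
  shows "gram_form \<gamma> (wedge v) = det (\<chi> i j. \<gamma> (v i) (v j))"
proof -
  let ?P = "{p. p permutes (UNIV :: 'i set)}"
  have lr: "linear (\<gamma> u)" and ll: "linear (\<lambda>u. \<gamma> u w)" for u w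
    using \<gamma> by (auto simp: bilinear_def)
  have exp: "(\<Sum>k\<in>UNIV. w $ k * \<gamma> u (axis k 1)) = \<gamma> u w" for u w
  proof -
    have "\<gamma> u w = \<gamma> u (\<Sum>k\<in>UNIV. w $ k *\<^sub>R axis k 1)"
      by (simp add: basis_expansion scalar_mult_eq_scaleR[symmetric])
    also have "\<dots> = (\<Sum>k\<in>UNIV. w $ k * \<gamma> u (axis k 1))"
      using lr[of u] by (simp add: linear_sum linear_scale)
    finally show ?thesis by simp
  qed
  have inner: "(\<Sum>h\<in>UNIV. wedge v $ h * (\<Prod>i\<in>UNIV. \<gamma> (axis (f i) 1) (axis (h i) 1)))
      = det (\<chi> i j. \<gamma> (axis (f i) 1) (v j))" for f :: "'i \<Rightarrow> 'n"
  proof -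
    let ?a = "\<lambda>i. axis (f i) (1::real)"
    have "(\<Sum>h\<in>UNIV. wedge v $ h * (\<Prod>i\<in>UNIV. \<gamma> (?a i) (axis (h i) 1))) =
        (\<Sum>h\<in>UNIV. \<Sum>\<sigma>\<in>?P. of_int (sign \<sigma>) * (\<Prod>i\<in>UNIV. v i $ h (\<sigma> i)) * (\<Prod>i\<in>UNIV. \<gamma> (?a i) (axis (h i) 1)))"
      by (simp add: wedge_def det_def sum_distrib_right)
    also have "\<dots> = (\<Sum>\<sigma>\<in>?P. of_int (sign \<sigma>) * (\<Sum>h\<in>UNIV. \<Prod>i\<in>UNIV. v i $ h (\<sigma> i) * \<gamma> (?a (\<sigma> i)) (axis (h (\<sigma> i)) 1)))"
    proof (subst sum.swap, rule sum.cong[OF refl])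
      fix \<sigma> assume "\<sigma> \<in> ?P"
      then have \<sigma>: "\<sigma> permutes UNIV" by simp
      have "(\<Prod>i\<in>UNIV. \<gamma> (?a i) (axis (h i) 1)) = (\<Prod>i\<in>UNIV. \<gamma> (?a (\<sigma> i)) (axis (h (\<sigma> i)) 1))" for h :: "'i \<Rightarrow> 'n"
        using prod.permute[OF \<sigma>, of "\<lambda>i. \<gamma> (?a i) (axis (h i) 1)"] by (simp add: o_def)
      then show "(\<Sum>h\<in>UNIV. of_int (sign \<sigma>) * (\<Prod>i\<in>UNIV. v i $ h (\<sigma> i)) * (\<Prod>i\<in>UNIV. \<gamma> (?a i) (axis (h i) 1))) =
        of_int (sign \<sigma>) * (\<Sum>h\<in>UNIV. \<Prod>i\<in>UNIV. v i $ h (\<sigma> i) * \<gamma> (?a (\<sigma> i)) (axis (h (\<sigma> i)) 1))"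
        by (simp only: prod.distrib sum_distrib_left mult.assoc)
    qed
    also have "\<dots> = (\<Sum>\<sigma>\<in>?P. of_int (sign \<sigma>) * (\<Prod>i\<in>UNIV. \<gamma> (?a (\<sigma> i)) (v i)))"
    proof (rule sum.cong[OF refl])
      fix \<sigma> assume "\<sigma> \<in> ?P"
      then have \<sigma>: "\<sigma> permutes UNIV" by simp
      have "(\<Sum>h\<in>UNIV. \<Prod>i\<in>UNIV. v i $ h (\<sigma> i) * \<gamma> (?a (\<sigma> i)) (axis (h (\<sigma> i)) 1)) =
          (\<Sum>h\<in>UNIV. \<Prod>i\<in>UNIV. v i $ h i * \<gamma> (?a (\<sigma> i)) (axis (h i) 1))"
        by (rule sum.reindex_bij_witness[of _ "\<lambda>h. h \<circ> inv \<sigma>" "\<lambda>f. f \<circ> \<sigma>"])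
          (auto simp: fun_eq_iff permutes_inverses[OF \<sigma>] o_def)
      also have "\<dots> = (\<Prod>i\<in>UNIV. \<Sum>k\<in>UNIV. v i $ k * \<gamma> (?a (\<sigma> i)) (axis k 1))"
        using prod_sum_PiE[of "UNIV :: 'i set" "\<lambda>_. UNIV" "\<lambda>i k. v i $ k * \<gamma> (?a (\<sigma> i)) (axis k 1)"] by simp
      also have "\<dots> = (\<Prod>i\<in>UNIV. \<gamma> (?a (\<sigma> i)) (v i))" by (simp add: exp)
      finally show "of_int (sign \<sigma>) * (\<Sum>h\<in>UNIV. \<Prod>i\<in>UNIV. v i $ h (\<sigma> i) * \<gamma> (?a (\<sigma> i)) (axis (h (\<sigma> i)) 1)) =
        of_int (sign \<sigma>) * (\<Prod>i\<in>UNIV. \<gamma> (?a (\<sigma> i)) (v i))" by simp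
    qed
    also have "\<dots> = det (transpose (\<chi> i j. \<gamma> (?a i) (v j)))"
      by (simp add: det_def transpose_def)
    finally show ?thesis by simp
  qed
  have "gram_form \<gamma> (wedge v) = (\<Sum>f\<in>UNIV. wedge v $ f * det (\<chi> i j. \<gamma> (axis (f i) 1) (v j))) / fact CARD('i)"
    unfolding gram_form_def inner[symmetric] by (simp add: sum_distrib_left mult.assoc)
  also have "\<dots> = pairing (\<lambda>u. det (\<chi> i j. \<gamma> (u i) (v j))) (wedge v)"
    by (simp add: pairing_def)
  also have "\<dots> = det (\<chi> i j. \<gamma> (v i) (v j))"
    by (rule pairing_wedge, rule alt_form_det) (rule ll)
  finally show ?thesis .
qed

lemma gram_form_scale: "gram_form \<gamma> (c *\<^sub>R \<xi>) = c\<^sup>2 * gram_form \<gamma> \<xi>"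
  by (simp add: gram_form_def sum_distrib_left power2_eq_square mult_ac)

text \<open>The powers of the inverse do not increase norms, so their entries are bounded by 1 and
  their determinants by the number of permutations. A determinant of the inverse larger than 1 in
  absolute value would have unbounded powers.\<close>

lemma abs_det_ge_1:
  fixes M :: "real ^ 'i ^ 'i::finite"
  assumes M: "\<And>x. norm (M *v x) \<ge> norm x"
  shows "\<bar>det M\<bar> \<ge> 1"
proof -
  have "inj ((*v) M)"
  proof (rule injI)
    fix x y assume "M *v x = M *v y"
    then have "norm (x - y) \<le> 0" using M[of "x - y"] by (simp add: matrix_vector_mult_diff_distrib)
    then show "x = y" by simp
  qed
  then obtain N where "N ** M = mat 1" by (auto simp flip: matrix_left_invertible_injective)
  then have N: "M ** N = mat 1" by (simp add: matrix_left_right_inverse)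
  have nN: "norm (N *v x) \<le> norm x" for x
    using M[of "N *v x"] by (simp add: matrix_vector_mul_assoc N)
  define P where "P k = ((**) N ^^ k) (mat 1)" for k
  have nP: "norm (P k *v x) \<le> norm x" for k x
    by (induction k) (auto simp: P_def matrix_vector_mul_assoc[symmetric] intro: order_trans[OF nN])
  have "\<bar>P k $ i $ j\<bar> \<le> 1" for k i j
  proof -
    have "\<bar>P k $ i $ j\<bar> = \<bar>(P k *v axis j 1) $ i\<bar>" by (simp add: matrix_vector_mul_component column_def inner_axis)
    also have "\<dots> \<le> norm (P k *v axis j 1)" by (rule component_le_norm_cart)
    also have "\<dots> \<le> 1" using nP[of k "axis j 1"] by simp
    finally show ?thesis .
  qed
  then have "\<bar>\<Prod>i\<in>UNIV. P k $ i $ p i\<bar> \<le> 1" for k p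
    by (auto simp: abs_prod intro!: prod_le_1)
  then have "\<bar>det (P k)\<bar> \<le> real (card {p. p permutes (UNIV :: 'i set)})" for k
    unfolding det_def by (intro order_trans[OF sum_abs] order_trans[OF sum_bounded_above[of _ _ 1]])
      (auto simp: abs_mult sign_def)
  moreover have "det (P k) = det N ^ k" for k
    by (induction k) (auto simp: P_def det_mul)
  ultimately have bd: "\<bar>det N\<bar> ^ k \<le> real (card {p. p permutes (UNIV :: 'i set)})" for k
    by (metis power_abs)
  have N1: "\<bar>det N\<bar> \<le> 1"
  proof (rule ccontr)
    assume "\<not> ?thesis"
    then obtain k where "real (card {p. p permutes (UNIV :: 'i set)}) < \<bar>det N\<bar> ^ k"
      using real_arch_pow[of "\<bar>det N\<bar>"] by auto
    with bd[of k] show False by simp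
  qed
  have "\<bar>det M\<bar> * \<bar>det N\<bar> = 1" using arg_cong[OF N, of det] by (simp add: det_mul abs_mult[symmetric])
  moreover have "\<bar>det M\<bar> * \<bar>det N\<bar> \<le> \<bar>det M\<bar> * 1" using N1 by (intro mult_left_mono) auto
  ultimately show ?thesis by simp
qed

text \<open>If the interior is empty, the set lies in a hyperplane, and the sign of the normal is
  chosen according to the side of \<open>x\<close>. Otherwise the point is separated from the
  interior, whose closure contains the set.\<close>

lemma convex_not_interior_hyperplane:
  fixes x :: "'a::euclidean_space"
  assumes S: "convex S" and x: "x \<notin> interior S"
  obtains a where "a \<noteq> 0" "\<And>y. y \<in> S \<Longrightarrow> a \<bullet> x \<le> a \<bullet> y"
proof (cases "interior S = {}")
  case True
  obtain a b where a: "a \<noteq> 0" "S \<subseteq> {x. a \<bullet> x = b}"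
    using empty_interior_subset_hyperplane[OF S True] by blast
  show thesis
  proof (cases "a \<bullet> x \<le> b")
    case True then show thesis using a by (intro that[of a]) auto
  next
    case False then show thesis using a by (intro that[of "- a"]) auto
  qed
next
  case False
  have "\<exists>a b. a \<noteq> 0 \<and> (\<forall>y\<in>{x}. a \<bullet> y \<le> b) \<and> (\<forall>y\<in>interior S. a \<bullet> y \<ge> b)"
    using S x False by (intro separating_hyperplane_sets) (auto simp: convex_interior)
  then obtain a b where ab: "a \<noteq> 0" "a \<bullet> x \<le> b" "\<And>y. y \<in> interior S \<Longrightarrow> a \<bullet> y \<ge> b" by auto
  have "closure (interior S) \<subseteq> {y. a \<bullet> y \<ge> b}"
    using ab(3) by (intro closure_minimal) (auto simp: closed_halfspace_ge)
  then have "S \<subseteq> {y. a \<bullet> y \<ge> b}"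
    using convex_closure_interior[OF S False] closure_subset[of S] by blast
  then show thesis using ab by (intro that[of a]) force+
qed

section \<open>Space-like planes in a vector space\<close>

lemma sum_delta_mult:
  fixes c :: "'i::finite \<Rightarrow> real"
  shows "(\<Sum>i\<in>UNIV. \<Sum>j\<in>UNIV. c i * d j * (if i = j then k else 0)) = k * (\<Sum>i\<in>UNIV. c i * d i)"
proof -
  have "(\<Sum>j\<in>UNIV. c i * d j * (if i = j then k else 0)) = k * (c i * d i)" for i
    by (subst sum.remove[of UNIV i]) (auto intro!: sum.neutral)
  then show ?thesis by (simp add: sum_distrib_left)
qed

section \<open>Gram determinants and orthonormalization for a symmetric bilinear form\<close>

locale symmetric_form =
  fixes \<gamma> :: "real ^ 'n::finite \<Rightarrow> real ^ 'n \<Rightarrow> real"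
  assumes bil: "bilinear \<gamma>" and sym: "\<gamma> u v = \<gamma> v u"
begin

definition frame :: "('p::finite \<Rightarrow> real ^ 'n) \<Rightarrow> bool" where
  "frame e \<longleftrightarrow> (\<forall>i j. \<gamma> (e i) (e j) = (if i = j then 1 else 0))"

text \<open>The bilinear form that \<open>\<gamma>\<close> induces on multivectors, evaluated at
  \<open>wedge v\<close> and \<open>wedge w\<close>.\<close>

definition ip :: "('p::finite \<Rightarrow> real ^ 'n) \<Rightarrow> ('p \<Rightarrow> real ^ 'n) \<Rightarrow> real" where
  "ip v w = det (\<chi> i j. \<gamma> (v i) (w j))"

lemma lin: "linear (\<gamma> u)" "linear (\<lambda>u. \<gamma> u v)"
  using bil by (auto simp: bilinear_def)

lemmas add = linear_add[OF lin(1)] linear_add[OF lin(2)]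
lemmas diff = linear_diff[OF lin(1)] linear_diff[OF lin(2)]
lemmas scale = linear_scale[OF lin(1)] linear_scale[OF lin(2)]
lemmas zero = linear_0[OF lin(1)] linear_0[OF lin(2)]
lemmas neg = linear_neg[OF lin(1)] linear_neg[OF lin(2)]

lemma sum_left: "\<gamma> (\<Sum>i\<in>I. c i *\<^sub>R v i) u = (\<Sum>i\<in>I. c i * \<gamma> (v i) u)"
  by (simp add: linear_sum[OF lin(2)] scale)

lemma sum_right: "\<gamma> u (\<Sum>i\<in>I. c i *\<^sub>R v i) = (\<Sum>i\<in>I. c i * \<gamma> u (v i))"
  by (simp add: linear_sum[OF lin(1)] scale)

lemma frame_coeff:
  assumes "frame e" shows "\<gamma> (\<Sum>i\<in>UNIV. c i *\<^sub>R e i) (e j) = c j"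
proof -
  have "\<gamma> (\<Sum>i\<in>UNIV. c i *\<^sub>R e i) (e j) = (\<Sum>i\<in>UNIV. if i = j then c i else 0)"
    unfolding sum_left using assms by (intro sum.cong) (auto simp: frame_def)
  then show ?thesis by simp
qed

lemma frame_norm: "frame e \<Longrightarrow> \<gamma> (\<Sum>i\<in>UNIV. c i *\<^sub>R e i) (\<Sum>i\<in>UNIV. d i *\<^sub>R e i) = (\<Sum>i\<in>UNIV. c i * d i)"
  unfolding sum_right by (simp only: frame_coeff mult.commute)

lemma ip_sym: "ip v w = ip w v"
proof -
  have "(\<chi> i j. \<gamma> (w i) (v j)) = transpose (\<chi> i j. \<gamma> (v i) (w j))"
    by (simp add: transpose_def vec_eq_iff sym)
  then show ?thesis by (simp add: ip_def)
qed

lemma alt_form_ip: "alt_form (\<lambda>v. ip v w)"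
  unfolding ip_def by (rule alt_form_det) (rule lin)

lemma pairing_ip: "pairing (\<lambda>v. ip v w) (wedge v) = ip v w"
  by (rule pairing_wedge[OF alt_form_ip])

lemma pairing_ip': "ip v w = pairing (\<lambda>u. ip u w) (wedge v)"
  by (simp add: pairing_ip)

lemma ip_frame: "frame e \<Longrightarrow> ip e e = 1"
proof -
  assume "frame e"
  then have "(\<chi> i j. \<gamma> (e i) (e j)) = mat 1" by (simp add: frame_def mat_def vec_eq_iff)
  then show ?thesis by (simp add: ip_def)
qed

lemma span_range_sum: "u \<in> span (range v) \<Longrightarrow> \<exists>c. u = (\<Sum>i\<in>UNIV. c i *\<^sub>R v i)"
  for v :: "'p::finite \<Rightarrow> real ^ 'n"
proof (induction rule: span_induct_alt)
  case base show ?case by (rule exI[of _ "\<lambda>_. 0"]) simp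
next
  case (step k x y)
  then obtain c i where "y = (\<Sum>i\<in>UNIV. c i *\<^sub>R v i)" "x = v i" by blast
  then have "k *\<^sub>R x + y = (\<Sum>j\<in>UNIV. (c j + (if j = i then k else 0)) *\<^sub>R v j)"
    by (simp add: scaleR_left_distrib sum.distrib if_distrib[of "\<lambda>c. c *\<^sub>R _"] cong: if_cong)
  then show ?case by (rule exI[of _ "\<lambda>j. c j + (if j = i then k else 0)"])
qed

text \<open>Stated in coefficients, so that it includes linear independence of \<open>v\<close>
  besides definiteness on the span.\<close>

definition positive :: "('p::finite \<Rightarrow> real ^ 'n) \<Rightarrow> bool" where
  "positive v \<longleftrightarrow> (\<forall>c. c \<noteq> (\<lambda>_. 0) \<longrightarrow> \<gamma> (\<Sum>i\<in>UNIV. c i *\<^sub>R v i) (\<Sum>i\<in>UNIV. c i *\<^sub>R v i) > 0)"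

lemma frame_flip:
  assumes "frame e"
  shows "frame (e(a := - e a))" and "wedge (e(a := - e a)) = - wedge e"
    and "ip (e(a := - e a)) w = - ip e w"
proof -
  show "frame (e(a := - e a))" using assms by (auto simp: frame_def neg)
  have 1: "linear (\<lambda>u. wedge (e(a := u)) $ f)" for f by (rule alt_form_linear[OF alt_form_wedge])
  have "wedge (e(a := - e a)) $ f = - (wedge e $ f)" for f
    using linear_neg[OF 1, of "e a"] by simp
  then show "wedge (e(a := - e a)) = - wedge e" by (simp add: vec_eq_iff)
  show "ip (e(a := - e a)) w = - ip e w"
    using linear_neg[OF alt_form_linear[OF alt_form_ip[of w], of e a], of "e a"] by simp
qed

text \<open>Gram-Schmidt. The change of basis enters only through a nonzero factor \<open>m\<close>,
  and a negative factor is corrected by reversing one vector of the frame.\<close>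

lemma orthonormalize:
  fixes v :: "'p::finite \<Rightarrow> real ^ 'n"
  assumes v: "positive v"
  obtains e :: "'p \<Rightarrow> real ^ 'n" and m where "frame e" "m > 0" "wedge v = m *\<^sub>R wedge e" "\<And>i. e i \<in> span (range v)"
proof -
  have pos: "\<gamma> u u > 0" if "u \<in> span (range v)" "u \<noteq> 0" for u
  proof -
    obtain c where c: "u = (\<Sum>i\<in>UNIV. c i *\<^sub>R v i)" using span_range_sum[OF \<open>u \<in> _\<close>] by blast
    have "c \<noteq> (\<lambda>_. 0)" using c \<open>u \<noteq> 0\<close> by auto
    then show ?thesis using v c unfolding positive_def by blast
  qed
  have ind: "v a \<notin> span (v ` I)" if aI: "a \<notin> I" for a I
  proof
    assume A: "v a \<in> span (v ` I)"
    have "\<exists>c. x = (\<Sum>i\<in>UNIV. c i *\<^sub>R v i) \<and> (\<forall>i. i \<notin> I \<longrightarrow> c i = 0)" if "x \<in> span (v ` I)" for x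
      using that
    proof (induction rule: span_induct_alt)
      case base show ?case by (rule exI[of _ "\<lambda>_. 0"]) simp
    next
      case (step k x y)
      then obtain c i where c: "y = (\<Sum>i\<in>UNIV. c i *\<^sub>R v i)" "\<forall>i. i \<notin> I \<longrightarrow> c i = 0" "x = v i" "i \<in> I" by blast
      then have "k *\<^sub>R x + y = (\<Sum>j\<in>UNIV. (c j + (if j = i then k else 0)) *\<^sub>R v j)"
        by (simp add: scaleR_left_distrib sum.distrib if_distrib[of "\<lambda>c. c *\<^sub>R _"] cong: if_cong)
      with c show ?case by (intro exI[of _ "\<lambda>j. c j + (if j = i then k else 0)"]) auto
    qed
    from this[OF A] obtain c where c: "v a = (\<Sum>i\<in>UNIV. c i *\<^sub>R v i)" "c a = 0" using aI by blast
    define d where "d j = c j - (if j = a then 1 else 0)" for j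
    have "(\<Sum>i\<in>UNIV. d i *\<^sub>R v i) = 0"
      by (simp add: d_def scaleR_left_diff_distrib sum_subtractf c(1)[symmetric] if_distrib[of "\<lambda>c. c *\<^sub>R _"] cong: if_cong)
    moreover have "d a \<noteq> 0" using c by (simp add: d_def)
    then have "d \<noteq> (\<lambda>_. 0)" by auto
    with v have "\<gamma> (\<Sum>i\<in>UNIV. d i *\<^sub>R v i) (\<Sum>i\<in>UNIV. d i *\<^sub>R v i) > 0"
      unfolding positive_def by blast
    ultimately show False by (simp add: zero)
  qed
  have "\<exists>e :: 'p \<Rightarrow> real ^ 'n. (\<forall>i\<in>I. \<forall>j\<in>I. \<gamma> (e i) (e j) = (if i = j then 1 else 0)) \<and> (\<forall>i\<in>I. e i \<in> span (v ` I))"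
    if "finite I" for I :: "'p set"
    using that
  proof (induction I)
    case empty then show ?case by simp
  next
    case (insert a I)
    then obtain e where e: "\<And>i j. i \<in> I \<Longrightarrow> j \<in> I \<Longrightarrow> \<gamma> (e i) (e j) = (if i = j then 1 else 0)"
      "\<And>i. i \<in> I \<Longrightarrow> e i \<in> span (v ` I)" by blast
    define s where "s = (\<Sum>i\<in>I. \<gamma> (v a) (e i) *\<^sub>R e i)"
    define u where "u = v a - s"
    have s: "s \<in> span (v ` I)" unfolding s_def by (intro span_sum span_scale e(2))
    have "u \<noteq> 0" using ind[OF insert(2)] s by (auto simp: u_def)
    have mono: "span (v ` I) \<subseteq> span (v ` insert a I)" "span (v ` insert a I) \<subseteq> span (range v)"
      by (intro span_mono; blast)+
    have u: "u \<in> span (v ` insert a I)" unfolding u_def using s mono(1)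
      by (intro span_diff) (auto intro: span_base)
    have pu: "\<gamma> u u > 0" using pos[OF _ \<open>u \<noteq> 0\<close>] u mono(2) by blast
    have ue: "\<gamma> u (e i) = 0" if "i \<in> I" for i
    proof -
      have "\<gamma> s (e i) = (\<Sum>j\<in>I. \<gamma> (v a) (e j) * (if j = i then 1 else 0))"
        unfolding s_def sum_left using e(1) that by (intro sum.cong) auto
      also have "\<dots> = \<gamma> (v a) (e i)" using insert(1) that by (simp add: if_distrib cong: if_cong)
      finally show ?thesis by (simp add: u_def diff)
    qed
    define n where "n = (1 / sqrt (\<gamma> u u)) *\<^sub>R u"
    have n1: "\<gamma> n n = 1" using pu by (simp add: n_def scale)
    have n2: "\<gamma> n (e i) = 0" "\<gamma> (e i) n = 0" if "i \<in> I" for i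
      using ue[OF that] sym[of "e i" u] by (simp_all add: n_def scale)
    have n3: "n \<in> span (v ` insert a I)" unfolding n_def by (intro span_scale u)
    show ?case
    proof (intro exI[of _ "e(a := n)"] conjI ballI)
      fix i j assume "i \<in> insert a I" "j \<in> insert a I"
      then show "\<gamma> ((e(a := n)) i) ((e(a := n)) j) = (if i = j then 1 else 0)"
        using insert(2) n1 n2 e(1) by (auto simp: sym)
    next
      fix i assume "i \<in> insert a I"
      then show "(e(a := n)) i \<in> span (v ` insert a I)"
        using n3 e(2) mono(1) by auto
    qed
  qed
  from this[of UNIV] obtain e :: "'p \<Rightarrow> real ^ 'n" where e: "frame e" "\<And>i. e i \<in> span (range v)"
    by (auto simp: frame_def)
  have "\<forall>i. \<exists>c. e i = (\<Sum>j\<in>UNIV. c j *\<^sub>R v j)" using span_range_sum[OF e(2)] by blast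
  then obtain C where C: "\<And>i. e i = (\<Sum>j\<in>UNIV. C i j *\<^sub>R v j)" by metis
  have "wedge e = det (\<chi> i j. C i j) *\<^sub>R wedge v"
    by (rule wedge_linear_combination) (simp add: C)
  moreover have "wedge e \<noteq> 0"
    using ip_frame[OF e(1)] pairing_ip'[of e e] linear_0[OF linear_pairing] by (metis zero_neq_one)
  ultimately have "det (\<chi> i j. C i j) \<noteq> 0" "wedge v = (1 / det (\<chi> i j. C i j)) *\<^sub>R wedge e" by auto
  then obtain m where m: "m \<noteq> 0" "wedge v = m *\<^sub>R wedge e"
    by (metis divide_eq_0_iff one_neq_zero)
  show thesis
  proof (cases "m > 0")
    case True then show thesis using that[OF e(1) _ m(2) e(2)] by blast
  next
    case False
    \<comment> \<open>\<open>undefined\<close> stands for an arbitrary element of the index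
      type.\<close>
    show thesis
    proof (rule that[of "e(undefined := - e undefined)" "- m"])
      show "wedge v = - m *\<^sub>R wedge (e(undefined := - e undefined))" using m(2) by (simp add: frame_flip[OF e(1)])
      show "(e(undefined := - e undefined)) i \<in> span (range v)" for i using e(2) span_neg by auto
    qed (use m False frame_flip[OF e(1)] in auto)
  qed
qed

text \<open>The coefficients \<open>c\<close> form a nonzero vector in the kernel of the transposed
  Gram matrix.\<close>

lemma ip_dependent:
  assumes c: "c \<noteq> (\<lambda>_. 0)" and z: "\<And>j. \<gamma> (\<Sum>i\<in>UNIV. c i *\<^sub>R v i) (w j) = 0"
  shows "ip v w = 0"
proof (rule ccontr)
  assume "ip v w \<noteq> 0"
  define A where "A = (\<chi> i j. \<gamma> (v i) (w j))"
  have "det (transpose A) \<noteq> 0" using \<open>ip v w \<noteq> 0\<close> by (simp add: A_def ip_def)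
  then have "invertible (transpose A)" by (simp add: invertible_det_nz)
  then obtain B where B: "B ** transpose A = mat 1" by (auto simp: invertible_def)
  have "(transpose A *v (\<chi> i. c i)) $ j = 0" for j
    using z[of j] by (simp add: A_def transpose_def matrix_vector_mult_def sum_left mult.commute)
  then have "transpose A *v (\<chi> i. c i) = 0" by (simp add: vec_eq_iff)
  then have "(B ** transpose A) *v (\<chi> i. c i) = 0"
    by (simp only: matrix_vector_mul_assoc[symmetric] matrix_vector_mult_0_right)
  then have "(\<chi> i. c i) = 0" by (simp only: B matrix_vector_mul_lid)
  then show False using c by (auto simp: vec_eq_iff fun_eq_iff)
qed

end

section \<open>Signature (p,q): orthogonal complements and the reverse Cauchy-Schwarz
  inequality\<close>

locale space_like_form = symmetric_form \<gamma>
  for \<gamma> :: "real ^ ('p::finite + 'q::finite) \<Rightarrow> real ^ ('p + 'q) \<Rightarrow> real" +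
  assumes signature: "\<exists>b :: 'p + 'q \<Rightarrow> real ^ ('p + 'q).
        \<forall>i j. \<gamma> (b i) (b j) = (if i \<noteq> j then 0 else if i \<in> range Inl then 1 else - 1)"
begin

definition planes :: "(real ^ ('p \<Rightarrow> 'p + 'q)) set" where
  "planes = {wedge e | e. frame e}"

text \<open>A dimension count: the frame, \<open>v\<close> and the negative vectors of a basis are
  \<open>p + 1 + q\<close> vectors, so they satisfy a nontrivial relation. If \<open>v\<close> were
  not negative, the form would be nonnegative on one side of the relation and nonpositive on the
  other, which forces all coefficients to vanish.\<close>

lemma negative_complement:
  fixes e :: "'p \<Rightarrow> real ^ ('p + 'q)"
  assumes e: "frame e" and v: "\<And>i. \<gamma> v (e i) = 0" "v \<noteq> 0"
  shows "\<gamma> v v < 0"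
proof (rule ccontr)
  assume "\<not> ?thesis"
  then have nn: "\<gamma> v v \<ge> 0" by simp
  obtain b :: "'p + 'q \<Rightarrow> real ^ ('p + 'q)" where
    b: "\<And>i j. \<gamma> (b i) (b j) = (if i \<noteq> j then 0 else if i \<in> range Inl then 1 else - 1)"
    using signature by blast
  define L where "L = (\<lambda>((c, d), a). (\<Sum>i\<in>UNIV. c $ i *\<^sub>R e i) + d *\<^sub>R v - (\<Sum>j\<in>UNIV. a $ j *\<^sub>R b (Inr j))
    :: real ^ ('p + 'q))" for c :: "real ^ 'p" and d :: real and a :: "real ^ 'q"
  have "linear L"
    by (rule linearI) (auto simp: L_def algebra_simps sum.distrib scaleR_sum_right)
  moreover have "\<not> inj L"
  proof
    assume "inj L"
    then have "DIM(((real ^ 'p) \<times> real) \<times> (real ^ 'q)) \<le> DIM(real ^ ('p + 'q))"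
      using \<open>linear L\<close> by (metis dim_UNIV dim_image_eq dim_subset_UNIV inj_on_subset subset_UNIV span_UNIV)
    then show False by (simp add: card_UNIV_sum)
  qed
  ultimately obtain z where z: "L z = 0" "z \<noteq> 0"
    by (metis linear_injective_0)
  obtain c d a where zz: "z = ((c, d), a)" by (metis surj_pair)
  define w where "w = (\<Sum>i\<in>UNIV. c $ i *\<^sub>R e i) + d *\<^sub>R v"
  have w: "w = (\<Sum>j\<in>UNIV. a $ j *\<^sub>R b (Inr j))" using z(1) by (simp add: L_def zz w_def)
  have "\<gamma> (\<Sum>i\<in>UNIV. c $ i *\<^sub>R e i) v = 0" by (simp add: sum_left v sym[of "e _" v])
  then have w1: "\<gamma> w w = (\<Sum>i\<in>UNIV. c $ i * c $ i) + d * d * \<gamma> v v"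
    using frame_norm[OF e, of "($) c" "($) c"] sym[of v "\<Sum>i\<in>UNIV. c $ i *\<^sub>R e i"]
    by (simp add: w_def add scale)
  have "\<gamma> w w = (\<Sum>i\<in>UNIV. \<Sum>j\<in>UNIV. a $ i * a $ j * (if i = j then - 1 else 0))"
    unfolding w sum_left sum_right by (simp add: b sum_distrib_left mult.assoc) (intro sum.cong, auto)
  also have "\<dots> = - (\<Sum>j\<in>UNIV. a $ j * a $ j)" by (subst sum_delta_mult) simp
  finally have w2: "\<gamma> w w = - (\<Sum>j\<in>UNIV. a $ j * a $ j)" .
  have p1: "(\<Sum>i\<in>UNIV. c $ i * c $ i) \<ge> 0" "(\<Sum>j\<in>UNIV. a $ j * a $ j) \<ge> 0" "d * d * \<gamma> v v \<ge> 0"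
    using nn by (auto intro: sum_nonneg)
  then have "(\<Sum>i\<in>UNIV. c $ i * c $ i) = 0" "(\<Sum>j\<in>UNIV. a $ j * a $ j) = 0" using w1 w2 by linarith+
  then have ca: "c = 0" "a = 0" by (auto simp: sum_nonneg_eq_0_iff vec_eq_iff)
  then have "d *\<^sub>R v = 0" using w by (simp add: w_def)
  then have "d = 0" using v by simp
  then show False using z(2) ca zz by (simp add: zero_prod_def)
qed

lemma nonpos_complement:
  fixes e :: "'p \<Rightarrow> real ^ ('p + 'q)"
  shows "frame e \<Longrightarrow> (\<And>i. \<gamma> v (e i) = 0) \<Longrightarrow> \<gamma> v v \<le> 0"
  using negative_complement[of e v] by (cases "v = 0") (auto simp: zero)

definition proj :: "('p \<Rightarrow> real ^ ('p + 'q)) \<Rightarrow> real ^ ('p + 'q) \<Rightarrow> real ^ ('p + 'q)" where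
  "proj w u = (\<Sum>j\<in>UNIV. \<gamma> u (w j) *\<^sub>R w j)"

lemma proj_orth: "frame w \<Longrightarrow> \<gamma> (u - proj w u) (w i) = 0"
  using frame_coeff[of w "\<lambda>j. \<gamma> u (w j)" i] by (simp add: diff proj_def)

lemma proj_norm: "frame w \<Longrightarrow> \<gamma> (proj w u) (proj w u) = (\<Sum>j\<in>UNIV. (\<gamma> u (w j))\<^sup>2)"
  unfolding proj_def by (subst frame_norm) (auto simp: power2_eq_square)

lemma proj_decomp:
  assumes w: "frame w"
  shows "\<gamma> (proj w u + t *\<^sub>R (u - proj w u)) (proj w u + t *\<^sub>R (u - proj w u)) =
    \<gamma> (proj w u) (proj w u) + t\<^sup>2 * \<gamma> (u - proj w u) (u - proj w u)"
proof -
  have 0: "\<gamma> (u - proj w u) (proj w u) = 0"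
    by (subst (2) proj_def) (simp add: sum_right proj_orth[OF w])
  then have "\<gamma> (proj w u) (u - proj w u) = 0" using sym by simp
  with 0 show ?thesis by (simp only: add scale) (simp add: power2_eq_square)
qed

text \<open>The part of \<open>u\<close> orthogonal to the frame contributes a nonpositive amount,
  so shrinking it cannot decrease the value of the form.\<close>

lemma proj_ineq:
  assumes w: "frame w" and t: "t\<^sup>2 \<le> 1"
  shows "\<gamma> (proj w u + t *\<^sub>R (u - proj w u)) (proj w u + t *\<^sub>R (u - proj w u)) \<ge> \<gamma> u u"
proof -
  have np: "\<gamma> (u - proj w u) (u - proj w u) \<le> 0"
    by (rule nonpos_complement[OF w]) (rule proj_orth[OF w])
  have "\<gamma> u u = \<gamma> (proj w u) (proj w u) + \<gamma> (u - proj w u) (u - proj w u)"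
    using proj_decomp[OF w, of u 1] by simp
  moreover have "t\<^sup>2 * \<gamma> (u - proj w u) (u - proj w u) \<ge> 1 * \<gamma> (u - proj w u) (u - proj w u)"
    using np t by (intro mult_right_mono_neg) auto
  ultimately show ?thesis using proj_decomp[OF w, of u t] by simp
qed

text \<open>Projecting one space-like plane onto another discards a nonpositive part and hence does
  not shrink lengths. The determinant of the projection in the two frames is \<open>ip e w\<close>
  up to transposition.\<close>

lemma reverse_Cauchy_Schwarz:
  fixes e w :: "'p \<Rightarrow> real ^ ('p + 'q)"
  assumes e: "frame e" and w: "frame w"
  shows "\<bar>ip e w\<bar> \<ge> 1"
proof -
  define M where "M = (\<chi> j i. \<gamma> (e i) (w j))"
  have "norm (M *v x) \<ge> norm x" for x
  proof -
    define u where "u = (\<Sum>i\<in>UNIV. x $ i *\<^sub>R e i)"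
    have "(M *v x) $ j = \<gamma> u (w j)" for j
      by (simp add: M_def matrix_vector_mult_def u_def sum_left mult.commute)
    then have "norm (M *v x) ^ 2 = \<gamma> (proj w u) (proj w u)"
      unfolding power2_norm_eq_inner proj_norm[OF w] by (simp add: inner_vec_def power2_eq_square)
    also have "\<dots> \<ge> \<gamma> u u" using proj_ineq[OF w, of 0 u] by simp
    also have "\<gamma> u u = norm x ^ 2"
      unfolding u_def frame_norm[OF e] power2_norm_eq_inner by (simp add: inner_vec_def)
    finally show ?thesis by (simp add: power2_le_iff_abs_le)
  qed
  then have "\<bar>det M\<bar> \<ge> 1" by (rule abs_det_ge_1)
  moreover have "M = transpose (\<chi> i j. \<gamma> (e i) (w j))" by (simp add: M_def transpose_def vec_eq_iff)
  ultimately show ?thesis by (simp add: ip_def)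
qed

text \<open>Since \<open>\<gamma> u u < 0\<close>, removing the \<open>u\<close> component from the
  positive vectors of a basis can only increase the form on their span. The corrected vectors are
  therefore still \<open>positive\<close> and can be orthonormalized.\<close>

lemma orthogonal_frame:
  assumes u: "\<gamma> u u < 0"
  obtains e :: "'p \<Rightarrow> real ^ ('p + 'q)" where "frame e" "\<And>i. \<gamma> u (e i) = 0"
proof -
  obtain b :: "'p + 'q \<Rightarrow> real ^ ('p + 'q)" where
    b: "\<And>i j. \<gamma> (b i) (b j) = (if i \<noteq> j then 0 else if i \<in> range Inl then 1 else - 1)"
    using signature by blast
  define b' where "b' i = b (Inl i) - (\<gamma> (b (Inl i)) u / \<gamma> u u) *\<^sub>R u" for i :: 'p
  have fb: "frame (\<lambda>i. b (Inl i))" by (simp add: frame_def b)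
  have "positive b'"
    unfolding positive_def
  proof (intro allI impI)
    fix c :: "'p \<Rightarrow> real" assume c: "c \<noteq> (\<lambda>_. 0)"
    define y where "y = (\<Sum>i\<in>UNIV. c i *\<^sub>R b (Inl i))"
    have "\<gamma> y u = (\<Sum>i\<in>UNIV. c i * \<gamma> (b (Inl i)) u)" by (simp add: y_def sum_left)
    then have y': "(\<Sum>i\<in>UNIV. c i *\<^sub>R b' i) = y - (\<gamma> y u / \<gamma> u u) *\<^sub>R u"
      by (simp add: b'_def scaleR_diff_right sum_subtractf y_def scaleR_sum_left sum_divide_distrib)
    obtain i0 where "c i0 \<noteq> 0" using c by auto
    then have "(\<Sum>i\<in>UNIV. c i * c i) > 0"
      by (intro sum_pos2[of _ i0]) (auto simp: zero_less_mult_iff linorder_neq_iff)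
    then have "\<gamma> y y > 0" using frame_norm[OF fb, of c c] by (simp add: y_def)
    moreover have "\<gamma> (y - (\<gamma> y u / \<gamma> u u) *\<^sub>R u) (y - (\<gamma> y u / \<gamma> u u) *\<^sub>R u) = \<gamma> y y - (\<gamma> y u)\<^sup>2 / \<gamma> u u"
    proof -
      define r where "r = \<gamma> y u / \<gamma> u u"
      have r: "r * \<gamma> u u = \<gamma> y u" using u by (simp add: r_def)
      have "\<gamma> (y - r *\<^sub>R u) (y - r *\<^sub>R u) = \<gamma> y y - r * \<gamma> u y - r * (\<gamma> y u - r * \<gamma> u u)"
        by (simp only: diff scale real_scaleR_def)
      also have "\<dots> = \<gamma> y y - r * \<gamma> y u - r * (\<gamma> y u - r * \<gamma> u u)"
        by (simp only: sym[of u y])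
      also have "\<dots> = \<gamma> y y - r * \<gamma> y u" by (simp add: r)
      finally show ?thesis by (simp add: r_def power2_eq_square)
    qed
    moreover have "(\<gamma> y u)\<^sup>2 / \<gamma> u u \<le> 0" using u by (intro divide_nonneg_neg) auto
    ultimately show "\<gamma> (\<Sum>i\<in>UNIV. c i *\<^sub>R b' i) (\<Sum>i\<in>UNIV. c i *\<^sub>R b' i) > 0" by (simp add: y')
  qed
  then obtain e :: "'p \<Rightarrow> real ^ ('p + 'q)" and m where e: "frame e" "\<And>i. e i \<in> span (range b')" by (rule orthonormalize) blast
  have "\<gamma> u x = 0" if "x \<in> span (range b')" for x
    using that
  proof (induction rule: span_induct_alt)
    case (step c x y)
    then obtain i where i: "x = b' i" by blast
    have "\<gamma> u (b' i) = \<gamma> u (b (Inl i)) - (\<gamma> (b (Inl i)) u / \<gamma> u u) * \<gamma> u u"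
      by (simp only: b'_def diff scale real_scaleR_def)
    also have "\<dots> = 0" using u sym[of u "b (Inl i)"] by simp
    finally show ?case using step by (simp add: i add scale)
  qed (simp add: zero)
  then show thesis using e by (intro that[of e]) auto
qed

text \<open>Since \<open>CARD('q)\<close> is at least 1, some nonzero vector is orthogonal to the
  frame; it is negative and can be normalized.\<close>

lemma orthogonal_unit:
  fixes e :: "'p \<Rightarrow> real ^ ('p + 'q)"
  assumes e: "frame e"
  obtains f where "\<And>i. \<gamma> f (e i) = 0" "\<gamma> f f = - 1"
proof -
  define L where "L u = (\<chi> i. \<gamma> u (e i))" for u
  have "linear L" by (rule linearI) (auto simp: L_def add scale vec_eq_iff)
  moreover have "\<not> inj L"
  proof
    assume "inj L"
    then have "DIM(real ^ ('p + 'q)) \<le> DIM(real ^ 'p)"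
      using \<open>linear L\<close> by (metis dim_UNIV dim_image_eq dim_subset_UNIV inj_on_subset subset_UNIV span_UNIV)
    then show False by (simp add: card_UNIV_sum)
  qed
  ultimately obtain z where z: "L z = 0" "z \<noteq> 0" by (metis linear_injective_0)
  then have ze: "\<gamma> z (e i) = 0" for i by (auto simp: L_def vec_eq_iff)
  have "\<gamma> z z < 0" using negative_complement[OF e ze z(2)] .
  then show thesis
    by (intro that[of "(1 / sqrt (- \<gamma> z z)) *\<^sub>R z"])
      (auto simp: scale ze real_sqrt_mult_self field_simps real_sqrt_mult[symmetric])
qed

lemma wedge_path_continuous:
  fixes S :: "real set"
  assumes "\<And>i. continuous_on S (\<lambda>t. v t i)"
  shows "continuous_on S (\<lambda>t. wedge (v t))" and "continuous_on S (\<lambda>t. ip (v t) (v t))" and "continuous_on S (\<lambda>t. ip (v t) w)"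
proof -
  show "continuous_on S (\<lambda>t. wedge (v t))"
    unfolding wedge_def det_def by (intro continuous_intros continuous_on_vec_lambda) (auto intro!: continuous_intros assms)
  have c: "continuous_on S (\<lambda>t. \<gamma> (a t) (b t))" if "continuous_on S a" "continuous_on S b" for a b
    by (rule bilinear_continuous_on_compose[OF that bil])
  show "continuous_on S (\<lambda>t. ip (v t) (v t))" "continuous_on S (\<lambda>t. ip (v t) w)"
    unfolding ip_def det_def by (auto intro!: continuous_intros c assms)
qed

text \<open>The factor produced by orthonormalization is \<open>sqrt (ip v v)\<close>.\<close>

lemma normalized_plane:
  assumes "positive v"
  shows "ip v v > 0" and "(1 / sqrt (ip v v)) *\<^sub>R wedge v \<in> planes"
proof -
  obtain e m where e: "frame e" "m > 0" "wedge v = m *\<^sub>R wedge e" using orthonormalize[OF assms] by metis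
  have "ip v w = m * ip e w" for w
    using pairing_ip'[of v w] pairing_ip'[of e w] by (simp add: e(3) pairing_scale_right)
  then have "ip v v = m * m" using ip_sym[of e v] ip_sym[of v e] ip_frame[OF e(1)] by simp
  then have "sqrt (ip v v) = m" "ip v v > 0" using e(2) by auto
  then show "ip v v > 0" "(1 / sqrt (ip v v)) *\<^sub>R wedge v \<in> planes"
    using e by (auto simp: planes_def)
qed

section \<open>One component of the space-like planes and its convex hull\<close>

context
  fixes G assumes G: "G \<in> components planes"
begin

lemma G_subset: "G \<subseteq> planes" and G_connected: "connected G" and G_nonempty: "G \<noteq> {}"
  using in_components_subset[OF G] in_components_connected[OF G] in_components_nonempty[OF G] by auto

text \<open>By the reverse Cauchy-Schwarz inequality the pairing avoids the open interval between -1
  and 1 on the connected set \<open>G\<close>, and it equals 1 at \<open>wedge w\<close>.\<close>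

lemma G_pairing:
  assumes \<xi>: "\<xi> \<in> G" and w: "frame w" "wedge w \<in> G"
  shows "pairing (\<lambda>v. ip v w) \<xi> \<ge> 1"
proof -
  let ?f = "pairing (\<lambda>v. ip v w)"
  have abs: "\<bar>?f \<eta>\<bar> \<ge> 1" if \<eta>: "\<eta> \<in> G" for \<eta>
  proof -
    obtain e where "\<eta> = wedge e" "frame e" using \<eta> G_subset unfolding planes_def by blast
    then show ?thesis using reverse_Cauchy_Schwarz[of e w] w by (simp add: pairing_ip)
  qed
  have "continuous_on G ?f" by (rule linear_continuous_on) (simp add: linear_pairing linear_conv_bounded_linear[symmetric])
  then have "connected (?f ` G)" using G_connected by (rule connected_continuous_image)
  moreover have "1 \<in> ?f ` G" using pairing_ip'[of w w] ip_frame[OF w(1)] w(2) by (metis image_eqI)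
  ultimately have "0 \<in> ?f ` G" if "?f \<xi> \<le> 0"
    using connectedD_interval[of "?f ` G" "?f \<xi>" 1 0] \<xi> that by auto
  then show ?thesis using abs abs[OF \<xi>] by force
qed

text \<open>Shrinking the part of \<open>e\<close> orthogonal to \<open>w\<close> deforms
  \<open>e\<close>, through \<open>positive\<close> tuples, to its projection, whose wedge is
  \<open>ip e w\<close> times \<open>wedge w\<close>. After normalization this is a path of planes
  from \<open>wedge w\<close> to \<open>wedge e\<close>, and it stays in the component
  \<open>G\<close>.\<close>

lemma G_memI:
  assumes e: "frame e" and w: "frame w" "wedge w \<in> G" and pos: "ip e w > 0"
  shows "wedge e \<in> G"
proof -
  define v where "v t i = proj w (e i) + t *\<^sub>R (e i - proj w (e i))" for t i
  have vsum: "(\<Sum>i\<in>UNIV. c i *\<^sub>R v t i) = proj w (\<Sum>i\<in>UNIV. c i *\<^sub>R e i) +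
      t *\<^sub>R ((\<Sum>i\<in>UNIV. c i *\<^sub>R e i) - proj w (\<Sum>i\<in>UNIV. c i *\<^sub>R e i))" for c t
  proof -
    have "linear (proj w)" unfolding proj_def
      by (intro linearI) (auto simp: add scale scaleR_left_distrib sum.distrib scaleR_sum_right)
    then have "proj w (\<Sum>i\<in>UNIV. c i *\<^sub>R e i) = (\<Sum>i\<in>UNIV. c i *\<^sub>R proj w (e i))"
      by (simp add: linear_sum linear_scale)
    then show ?thesis
      by (simp add: v_def scaleR_right_distrib scaleR_diff_right sum.distrib sum_subtractf scaleR_sum_right mult.commute)
  qed
  have posv: "positive (v t)" if t: "t \<in> {0..1}" for t
    unfolding positive_def vsum
  proof (intro allI impI)
    fix c :: "'p \<Rightarrow> real" assume c: "c \<noteq> (\<lambda>_. 0)"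
    obtain i0 where "c i0 \<noteq> 0" using c by auto
    then have "(\<Sum>i\<in>UNIV. c i * c i) > 0"
      by (intro sum_pos2[of _ i0]) (auto simp: zero_less_mult_iff linorder_neq_iff)
    moreover have "t\<^sup>2 \<le> 1" using t by (simp add: power_le_one)
    ultimately show "\<gamma> (proj w (\<Sum>i\<in>UNIV. c i *\<^sub>R e i) + t *\<^sub>R ((\<Sum>i\<in>UNIV. c i *\<^sub>R e i) - proj w (\<Sum>i\<in>UNIV. c i *\<^sub>R e i)))
      (proj w (\<Sum>i\<in>UNIV. c i *\<^sub>R e i) + t *\<^sub>R ((\<Sum>i\<in>UNIV. c i *\<^sub>R e i) - proj w (\<Sum>i\<in>UNIV. c i *\<^sub>R e i))) > 0"
      using proj_ineq[OF w(1), of t "\<Sum>i\<in>UNIV. c i *\<^sub>R e i"] frame_norm[OF e, of c c] by linarith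
  qed
  define P where "P t = (1 / sqrt (ip (v t) (v t))) *\<^sub>R wedge (v t)" for t
  have cv: "continuous_on {0..1} (\<lambda>t. v t i)" for i unfolding v_def by (intro continuous_intros)
  have ne: "sqrt (ip (v t) (v t)) \<noteq> 0" if "t \<in> {0..1}" for t
    using normalized_plane(1)[OF posv[OF that]] by simp
  have "continuous_on {0..1} P"
    unfolding P_def by (intro continuous_intros wedge_path_continuous cv ballI ne)
  then have "connected (P ` {0..1})" by (rule connected_continuous_image) simp
  moreover have "P ` {0..1} \<subseteq> planes" unfolding P_def using normalized_plane(2)[OF posv] by blast
  moreover have "P 0 = wedge w"
  proof -
    have v0: "wedge (v 0) = ip e w *\<^sub>R wedge w"
      unfolding ip_def by (rule wedge_linear_combination) (simp add: v_def proj_def)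
    have "ip (v 0) u = ip e w * ip w u" for u
      using pairing_ip'[of "v 0" u] pairing_ip'[of w u] by (simp add: v0 pairing_scale_right)
    then have "ip (v 0) (v 0) = ip e w * ip e w"
      using ip_sym[of w "v 0"] ip_frame[OF w(1)] by simp
    then show ?thesis using pos by (simp add: P_def v0)
  qed
  moreover have "P 1 = wedge e"
  proof -
    have "v 1 = e" by (auto simp: v_def)
    then show ?thesis by (simp add: P_def ip_frame[OF e])
  qed
  moreover have "P 0 \<in> P ` {0..1}" by simp
  ultimately have "P ` {0..1} \<subseteq> G"
    using components_maximal[OF G, of "P ` {0..1}"] w(2) by (metis disjoint_iff)
  moreover have "P 1 \<in> P ` {0..1}" by simp
  ultimately show ?thesis using \<open>P 1 = wedge e\<close> by auto
qed

lemma G_or_flip: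
  assumes e: "frame e"
  obtains e' where "frame e'" "wedge e' \<in> G" "e' = e \<or> e' = e(a := - e a)"
proof -
  obtain w where w: "frame w" "wedge w \<in> G" using G_nonempty G_subset unfolding planes_def by blast
  show thesis
  proof (cases "ip e w > 0")
    case True
    then show thesis using that[OF e G_memI[OF e w True]] by blast
  next
    case False
    then have "ip (e(a := - e a)) w > 0" using reverse_Cauchy_Schwarz[OF e w(1)] by (simp add: frame_flip[OF e])
    from that[OF frame_flip(1)[OF e] G_memI[OF frame_flip(1)[OF e] w this]] show thesis by blast
  qed
qed

lemma hull_pairing:
  assumes b: "b \<in> convex hull G" and w: "frame w" "wedge w \<in> G"
  shows "pairing (\<lambda>v. ip v w) b \<ge> 1"
proof -
  have "convex (pairing (\<lambda>v. ip v w) -` {1..})"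
    by (intro convex_linear_vimage linear_pairing) simp
  then have "convex hull G \<subseteq> pairing (\<lambda>v. ip v w) -` {1..}"
    using G_pairing[OF _ w] by (intro hull_minimal) auto
  then show ?thesis using b by auto
qed

text \<open>A simple element of the cone has positive \<open>ip\<close> with every plane in
  \<open>G\<close>. A negative vector in the span of \<open>v\<close> would be orthogonal to one of
  these planes. A null vector would, the form being nonnegative there, be orthogonal to the whole
  span, against \<open>ip v v > 0\<close>. So \<open>v\<close> is \<open>positive\<close> and can be
  orthonormalized.\<close>

lemma simple_in_cone:
  assumes t: "t > 0" and b: "b \<in> convex hull G" and v: "wedge v = t *\<^sub>R b"
  obtains m e where "m > 0" "frame e" "wedge e \<in> G" "wedge v = m *\<^sub>R wedge e"
proof -
  have ipv: "ip v w > 0" if w: "frame w" "wedge w \<in> G" for w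
  proof -
    have "ip v w = t * pairing (\<lambda>v. ip v w) b" using pairing_ip'[of v w] by (simp add: v pairing_scale_right)
    then show ?thesis using hull_pairing[OF b w] t by simp
  qed
  \<comment> \<open>Positivity of the pairing with \<open>v\<close> passes from \<open>G\<close> to
    its convex hull, and the hull contains a positive multiple of \<open>wedge v\<close>
    itself.\<close>
  have ipvv: "ip v v > 0"
  proof -
    have "convex (pairing (\<lambda>u. ip u v) -` {0<..})"
      by (intro convex_linear_vimage linear_pairing) simp
    moreover have "G \<subseteq> pairing (\<lambda>u. ip u v) -` {0<..}"
    proof
      fix \<eta> assume \<eta>: "\<eta> \<in> G"
      then obtain w where w: "frame w" "\<eta> = wedge w" using G_subset unfolding planes_def by blast
      then show "\<eta> \<in> pairing (\<lambda>u. ip u v) -` {0<..}"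
        using ipv[of w] \<eta> ip_sym[of v w] pairing_ip'[of w v] by simp
    qed
    ultimately have "convex hull G \<subseteq> pairing (\<lambda>u. ip u v) -` {0<..}" by (rule hull_minimal[rotated])
    then show ?thesis using b t pairing_ip'[of v v] by (auto simp: v pairing_scale_right)
  qed
  have "positive v"
    unfolding positive_def
  proof (intro allI impI)
    fix c :: "'p \<Rightarrow> real" assume c: "c \<noteq> (\<lambda>_. 0)"
    have nonneg: "\<gamma> (\<Sum>i\<in>UNIV. d i *\<^sub>R v i) (\<Sum>i\<in>UNIV. d i *\<^sub>R v i) \<ge> 0" for d
    proof (rule ccontr)
      assume "\<not> ?thesis"
      then have lt: "\<gamma> (\<Sum>i\<in>UNIV. d i *\<^sub>R v i) (\<Sum>i\<in>UNIV. d i *\<^sub>R v i) < 0" by simp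
      then obtain e :: "'p \<Rightarrow> real ^ ('p + 'q)" where e: "frame e" "\<And>i. \<gamma> (\<Sum>i\<in>UNIV. d i *\<^sub>R v i) (e i) = 0" by (rule orthogonal_frame) blast
      obtain e' where e': "frame e'" "wedge e' \<in> G" "e' = e \<or> e' = e(undefined := - e undefined)"
        using G_or_flip[OF e(1)] by blast
      then have "\<gamma> (\<Sum>i\<in>UNIV. d i *\<^sub>R v i) (e' i) = 0" for i using e(2) by (auto simp: neg)
      moreover have "d \<noteq> (\<lambda>_. 0)" using lt by (auto simp: zero)
      ultimately have "ip v e' = 0" by (intro ip_dependent[of d]) auto
      then show False using ipv[OF e'(1,2)] by simp
    qed
    show "\<gamma> (\<Sum>i\<in>UNIV. c i *\<^sub>R v i) (\<Sum>i\<in>UNIV. c i *\<^sub>R v i) > 0"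
    proof (rule ccontr)
      assume "\<not> ?thesis"
      then have z: "\<gamma> (\<Sum>i\<in>UNIV. c i *\<^sub>R v i) (\<Sum>i\<in>UNIV. c i *\<^sub>R v i) = 0" using nonneg[of c] by simp
      define u where "u = (\<Sum>i\<in>UNIV. c i *\<^sub>R v i)"
      have "\<gamma> u (v j) = 0" for j
      proof (rule ccontr)
        assume nz: "\<gamma> u (v j) \<noteq> 0"
        \<comment> \<open>First variation of a nonnegative form at its null vector
          \<open>u\<close>.\<close>
        have q: "2 * s * \<gamma> u (v j) + s\<^sup>2 * \<gamma> (v j) (v j) \<ge> 0" for s
        proof -
          have "(\<Sum>i\<in>UNIV. (c i + (if i = j then s else 0)) *\<^sub>R v i) = u + s *\<^sub>R v j"
            by (simp add: u_def scaleR_left_distrib sum.distrib if_distrib[of "\<lambda>c. c *\<^sub>R _"] cong: if_cong)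
          then have "\<gamma> (u + s *\<^sub>R v j) (u + s *\<^sub>R v j) \<ge> 0"
            using nonneg[of "\<lambda>i. c i + (if i = j then s else 0)"] by simp
          then show ?thesis using z sym[of "v j" u] by (simp add: u_def[symmetric] add scale power2_eq_square algebra_simps)
        qed
        define k where "k = \<bar>\<gamma> (v j) (v j)\<bar> + 1"
        have k: "k > 0" "\<gamma> (v j) (v j) < k" by (auto simp: k_def)
        have "2 * (- \<gamma> u (v j) / k) * \<gamma> u (v j) + (- \<gamma> u (v j) / k)\<^sup>2 * \<gamma> (v j) (v j) \<le>
            2 * (- \<gamma> u (v j) / k) * \<gamma> u (v j) + (- \<gamma> u (v j) / k)\<^sup>2 * k"
          using k by (intro add_left_mono mult_left_mono) auto
        also have "\<dots> = - (\<gamma> u (v j))\<^sup>2 / k" using k by (simp add: power2_eq_square field_simps)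
        also have "\<dots> < 0" using k nz by simp
        finally show False using q[of "- \<gamma> u (v j) / k"] by simp
      qed
      then have "ip v v = 0" using c by (intro ip_dependent[of c]) (auto simp: u_def)
      then show False using ipvv by simp
    qed
  qed
  then obtain e m where e: "frame e" "m > 0" "wedge v = m *\<^sub>R wedge e" using orthonormalize by metis
  obtain w where w: "frame w" "wedge w \<in> G" using G_nonempty G_subset unfolding planes_def by blast
  have "ip v w = m * ip e w"
    using pairing_ip'[of v w] pairing_ip'[of e w] by (simp add: e(3) pairing_scale_right)
  then have "ip e w > 0" using ipv[OF w] e(2) by (simp add: zero_less_mult_iff)
  from that[OF e(2,1) G_memI[OF e(1) w this] e(3)] show thesis .
qed

lemma linear_wedge: "linear (\<lambda>u. a \<bullet> wedge (v(i := u)))"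
proof -
  have 1: "linear (\<lambda>u. wedge (v(i := u)) $ f)" for f by (rule alt_form_linear[OF alt_form_wedge])
  have "wedge (v(i := x + y)) = wedge (v(i := x)) + wedge (v(i := y))"
    "wedge (v(i := c *\<^sub>R x)) = c *\<^sub>R wedge (v(i := x))" for c x y
    using linear_add[OF 1] linear_scale[OF 1] by (simp_all add: vec_eq_iff)
  then show ?thesis by (intro linearI) (simp_all add: inner_right_distrib)
qed

text \<open>Openness of positivity. The coefficients \<open>c\<close> are unrestricted, so the
  perturbation must be bounded by a multiple of the sum of their squares.\<close>

lemma positive_near_frame:
  fixes w :: "'p \<Rightarrow> real ^ ('p + 'q)"
  assumes w: "frame w"
  obtains \<delta> where "\<delta> > 0" "\<And>v :: 'p \<Rightarrow> real ^ ('p + 'q). (\<And>i. norm (v i - w i) < \<delta>) \<Longrightarrow> positive v"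
proof -
  obtain K where K: "K > 0" "\<And>x y. \<bar>\<gamma> x y\<bar> \<le> K * norm x * norm y"
    using bilinear_bounded_pos[OF bil] by auto
  define M where "M = (\<Sum>i\<in>UNIV. norm (w i))"
  have M: "norm (w i) \<le> M" "M \<ge> 0" for i unfolding M_def by (auto intro: member_le_sum sum_nonneg)
  define p where "p = real CARD('p)"
  have p: "p > 0" by (simp add: p_def)
  \<comment> \<open>The perturbation terms sum to at most
    \<open>K * p * (2 * M + 1) * \<delta>\<close> times \<open>N\<close>, by
    \<open>S\<^sup>2 \<le> p * N\<close> for the sum \<open>S\<close> of the absolute values and the
    sum \<open>N\<close> of the squares of the coefficients. This \<open>\<delta>\<close> makes the
    factor less than 1.\<close>
  define \<delta> where "\<delta> = 1 / (K * p * (2 * M + 1) + 1)"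
  have C: "K * p * (2 * M + 1) > 0" using K p M by simp
  have \<delta>: "\<delta> > 0" "\<delta> \<le> 1" "K * p * (2 * M + 1) * \<delta> < 1" using C by (auto simp: \<delta>_def field_simps)
  show thesis
  proof (rule that[OF \<delta>(1)])
    fix v assume v: "\<And>i. norm (v i - w i) < \<delta>"
    show "positive v"
      unfolding positive_def
    proof (intro allI impI)
      fix c :: "'p \<Rightarrow> real" assume c: "c \<noteq> (\<lambda>_. 0)"
      define S where "S = (\<Sum>i\<in>UNIV. \<bar>c i\<bar>)"
      define N where "N = (\<Sum>i\<in>UNIV. (c i)\<^sup>2)"
      define y where "y = (\<Sum>i\<in>UNIV. c i *\<^sub>R w i)"
      define d where "d = (\<Sum>i\<in>UNIV. c i *\<^sub>R (v i - w i))"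
      have S: "S \<ge> 0" by (auto simp: S_def intro: sum_nonneg)
      have SN: "S\<^sup>2 \<le> p * N"
        using sum_squared_le_sum_of_squares[of "\<lambda>i. \<bar>c i\<bar>" UNIV] by (simp add: S_def N_def p_def mult.commute)
      obtain i0 where "c i0 \<noteq> 0" using c by auto
      then have N: "N > 0" unfolding N_def by (intro sum_pos2[of _ i0]) auto
      have nd: "norm d \<le> \<delta> * S"
        unfolding d_def S_def sum_distrib_left
        by (rule sum_norm_le) (use less_imp_le[OF v] in \<open>auto simp: mult.commute[of \<delta>] intro!: mult_left_mono\<close>)
      have ny: "norm y \<le> M * S"
        unfolding y_def S_def sum_distrib_left
        by (rule sum_norm_le) (use M in \<open>auto simp: mult.commute[of M] intro!: mult_left_mono\<close>)
      have e: "(\<Sum>i\<in>UNIV. c i *\<^sub>R v i) = y + d"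
        by (simp add: y_def d_def scaleR_diff_right sum_subtractf)
      have yy: "\<gamma> y y = N" unfolding y_def frame_norm[OF w] by (simp add: N_def power2_eq_square)
      have b1: "\<bar>\<gamma> y d\<bar> \<le> K * (M * S) * (\<delta> * S)" "\<bar>\<gamma> d y\<bar> \<le> K * (\<delta> * S) * (M * S)" "\<bar>\<gamma> d d\<bar> \<le> K * (\<delta> * S) * (\<delta> * S)"
        using nd ny K(1) M(2) S \<delta>(1)
        by (auto intro!: order_trans[OF K(2)] mult_mono)
      have "K * (M * S) * (\<delta> * S) + K * (\<delta> * S) * (M * S) + K * (\<delta> * S) * (\<delta> * S) = K * (2 * M + \<delta>) * \<delta> * S\<^sup>2"
        by (simp add: power2_eq_square algebra_simps)
      also have "\<dots> \<le> K * (2 * M + 1) * \<delta> * (p * N)"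
        using K(1) M(2) \<delta> SN N p by (intro mult_mono) auto
      also have "\<dots> = (K * p * (2 * M + 1) * \<delta>) * N" by (simp add: mult_ac)
      also have "\<dots> < 1 * N" using \<delta>(3) N by (intro mult_strict_right_mono)
      finally have "K * (M * S) * (\<delta> * S) + K * (\<delta> * S) * (M * S) + K * (\<delta> * S) * (\<delta> * S) < N" by simp
      moreover have "\<gamma> (y + d) (y + d) = N + \<gamma> y d + \<gamma> d y + \<gamma> d d" by (simp add: add yy)
      ultimately show "\<gamma> (\<Sum>i\<in>UNIV. c i *\<^sub>R v i) (\<Sum>i\<in>UNIV. c i *\<^sub>R v i) > 0"
        unfolding e using b1 by linarith
    qed
  qed
qed

text \<open>The multilinear function \<open>a \<bullet> wedge v\<close> attains its minimum 0 over a neighbourhood of the frame \<open>w\<close>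
  at \<open>w\<close>.\<close>

lemma functional_vanishes:
  assumes nn: "\<And>b. b \<in> G \<Longrightarrow> a \<bullet> b \<ge> 0" and w: "frame w" "wedge w \<in> G" and 0: "a \<bullet> wedge w = 0"
  shows "a \<bullet> wedge v = 0"
proof -
  obtain \<delta> where \<delta>: "\<delta> > 0" "\<And>v. (\<And>i. norm (v i - w i) < \<delta>) \<Longrightarrow> positive v"
    using positive_near_frame[OF w(1)] by blast
  \<comment> \<open>Along the segment from \<open>w\<close> to \<open>v\<close> the tuples stay
    \<open>positive\<close> and \<open>ip (u t) w\<close> never vanishes, so \<open>v\<close> keeps
    the orientation of \<open>w\<close>.\<close>
  have nonneg: "a \<bullet> wedge v \<ge> 0" if v: "\<And>i. norm (v i - w i) < \<delta>" for v
  proof -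
    define u where "u t i = w i + t *\<^sub>R (v i - w i)" for t i
    have pos: "positive (u t)" if "t \<in> {0..1}" for t
    proof (rule \<delta>(2))
      fix i
      have "norm (u t i - w i) = t * norm (v i - w i)" using that by (simp add: u_def)
      also have "\<dots> \<le> 1 * norm (v i - w i)" using that by (intro mult_right_mono) auto
      finally show "norm (u t i - w i) < \<delta>" using v[of i] by simp
    qed
    have ne: "ip (u t) w \<noteq> 0" if t: "t \<in> {0..1}" for t
    proof -
      obtain e m where e: "frame e" "m > 0" "wedge (u t) = m *\<^sub>R wedge e" using orthonormalize[OF pos[OF t]] by metis
      have "ip (u t) w = m * ip e w"
        using pairing_ip'[of "u t" w] pairing_ip'[of e w] by (simp add: e(3) pairing_scale_right)
      then show ?thesis using reverse_Cauchy_Schwarz[OF e(1) w(1)] e(2) by auto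
    qed
    have "connected ((\<lambda>t. ip (u t) w) ` {0..1})"
      by (intro connected_continuous_image wedge_path_continuous(3)) (auto simp: u_def intro!: continuous_intros)
    moreover have "u 0 = w" "u 1 = v" by (auto simp: u_def)
    then have "ip (u 0) w = 1" "u 1 = v" using ip_frame[OF w(1)] by auto
    moreover have "ip (u 0) w \<in> (\<lambda>t. ip (u t) w) ` {0..1}" "ip (u 1) w \<in> (\<lambda>t. ip (u t) w) ` {0..1}"
      by auto
    ultimately have "0 \<in> (\<lambda>t. ip (u t) w) ` {0..1}" if "ip v w \<le> 0"
      using connectedD_interval[of "(\<lambda>t. ip (u t) w) ` {0..1}" "ip v w" 1 0] that by simp
    then have "ip v w > 0" using ne by fastforce
    obtain e m where e: "frame e" "m > 0" "wedge v = m *\<^sub>R wedge e"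
      using orthonormalize[OF \<delta>(2)[OF v]] by metis
    have "ip v w = m * ip e w"
      using pairing_ip'[of v w] pairing_ip'[of e w] by (simp add: e(3) pairing_scale_right)
    then have "ip e w > 0" using \<open>ip v w > 0\<close> e(2) by (simp add: zero_less_mult_iff)
    then have "a \<bullet> wedge e \<ge> 0" using nn G_memI[OF e(1) w] by blast
    then show ?thesis using e by simp
  qed
  \<comment> \<open>One slot moves at a time. In that slot the functional is linear, zero at
    \<open>w k\<close> and nonnegative near \<open>w k\<close>, so it vanishes on the displacement
    as well as on its negative.\<close>
  have near0: "a \<bullet> wedge v = 0"
    if "finite I" "\<And>i. norm (v i - w i) < \<delta>" "\<And>i. i \<notin> I \<Longrightarrow> v i = w i" for I v
    using that
  proof (induction I arbitrary: v)
    case empty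
    then have "v = w" by auto
    then show ?case using 0 by simp
  next
    case (insert k I)
    let ?h = "\<lambda>u. a \<bullet> wedge (v(k := u))"
    have lh: "linear ?h" by (rule linear_wedge)
    have h0: "?h (w k) = 0"
      using insert.prems \<delta>(1) by (intro insert.IH) auto
    have hn: "?h u \<ge> 0" if "norm (u - w k) < \<delta>" for u
      using insert.prems that by (intro nonneg) auto
    have "?h (v k - w k) \<ge> 0"
      using hn[of "w k + (v k - w k)"] insert.prems(1)[of k] h0 linear_add[OF lh, of "w k" "v k - w k"] by simp
    moreover have "- ?h (v k - w k) \<ge> 0"
      using hn[of "w k + - (v k - w k)"] insert.prems(1)[of k] h0 linear_add[OF lh, of "w k" "- (v k - w k)"]
        linear_neg[OF lh, of "v k - w k"] by (simp add: norm_minus_commute)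
    ultimately have "?h (v k - w k) = 0" by simp
    then show ?case using linear_diff[OF lh, of "v k" "w k"] h0 by simp
  qed
  \<comment> \<open>The slots are now released from the neighbourhood of \<open>w\<close>: a linear
    function that vanishes on a ball about \<open>w k\<close> is zero.\<close>
  have "a \<bullet> wedge v = 0"
    if "finite J" "\<And>i. i \<notin> J \<Longrightarrow> norm (v i - w i) < \<delta>" for J v
    using that
  proof (induction J arbitrary: v)
    case empty
    then show ?case by (intro near0[of UNIV]) auto
  next
    case (insert k J)
    let ?h = "\<lambda>u. a \<bullet> wedge (v(k := u))"
    have lh: "linear ?h" by (rule linear_wedge)
    have h0: "?h u = 0" if "norm (u - w k) < \<delta>" for u
      using insert.prems that by (intro insert.IH) auto
    define s where "s = \<delta> / (2 * (norm (v k) + 1))"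
    have s: "s > 0" using \<delta>(1) by (simp add: s_def add_nonneg_pos)
    have "norm (s *\<^sub>R v k) < \<delta>"
    proof -
      have "norm (s *\<^sub>R v k) = \<delta> * (norm (v k) / (2 * (norm (v k) + 1)))" using \<delta>(1) by (simp add: s_def)
      also have "\<dots> < \<delta> * 1"
      proof (intro mult_strict_left_mono \<delta>(1))
        have "norm (v k) < 2 * (norm (v k) + 1)" using norm_ge_zero[of "v k"] unfolding distrib_left by linarith
        then show "norm (v k) / (2 * (norm (v k) + 1)) < 1"
          by (subst divide_less_eq_1_pos) (auto simp: add_nonneg_pos)
      qed
      finally show ?thesis by simp
    qed
    then have "?h (w k + s *\<^sub>R v k) = 0" "?h (w k) = 0" using \<delta>(1) by (auto intro: h0)
    then have "s * ?h (v k) = 0" by (simp only: linear_add[OF lh] linear_scale[OF lh]) simp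
    then show ?case using s by simp
  qed
  from this[of UNIV] show ?thesis by simp
qed

text \<open>The pairing with \<open>w\<close> is at least 1 on the hull; this excludes multiples
  below 1 from the closure and \<open>wedge w\<close> from the interior. Multiples
  \<open>l > 1\<close> are interior relative to the multivectors: hyperbolic rotations of
  \<open>w\<close> violate the bound of a supporting functional there, unless it vanishes at
  \<open>wedge w\<close> and then on all multivectors.\<close>

lemma frontier_hull:
  assumes w: "frame w" "wedge w \<in> G" and l: "l > 0"
  shows "l *\<^sub>R wedge w \<in> (top_of_set multivectors) frontier_of (convex hull G) \<longleftrightarrow> l = 1"
proof -
  let ?V = "multivectors :: (real ^ ('p \<Rightarrow> 'p + 'q)) set" and ?\<eta> = "wedge w"
  let ?B = "convex hull G"
  let ?f = "pairing (\<lambda>v. ip v w)"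
  have GV: "G \<subseteq> ?V" using G_subset unfolding planes_def by (auto intro: wedge_in_multivectors)
  have BV: "?B \<subseteq> ?V" using GV by (intro hull_minimal subspace_imp_convex subspace_multivectors)
  have f1: "?f ?\<eta> = 1" using pairing_ip'[of w w] ip_frame[OF w(1)] by simp
  have cf: "continuous_on UNIV ?f"
    by (intro linear_continuous_on) (simp add: linear_pairing linear_conv_bounded_linear[symmetric])
  have lV: "l *\<^sub>R ?\<eta> \<in> ?V" for l by (intro subspace_scale subspace_multivectors wedge_in_multivectors)
  have \<eta>B: "?\<eta> \<in> ?B" using w(2) by (simp add: hull_inc)
  show ?thesis
  proof (rule linorder_cases[of l 1])
    assume l1: "l < 1"
    have "closed {x. ?f x \<ge> 1}" using cf by (intro closed_Collect_le) auto
    then have "closure ?B \<subseteq> {x. ?f x \<ge> 1}" using hull_pairing[OF _ w] by (intro closure_minimal) auto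
    then have "l *\<^sub>R ?\<eta> \<notin> closure ?B" using l1 f1 by (auto simp: pairing_scale_right)
    then have "l *\<^sub>R ?\<eta> \<notin> (top_of_set ?V) closure_of ?B"
      using closure_of_subtopology_subset[of euclidean ?V ?B] by auto
    then show ?thesis using l1 by (auto simp: frontier_of_def)
  next
    assume l1: "l = 1"
    have "?\<eta> \<in> (top_of_set ?V) closure_of ?B"
      using closure_of_subset[of ?B "top_of_set ?V"] BV \<eta>B by auto
    moreover have "?\<eta> \<notin> (top_of_set ?V) interior_of ?B"
    proof
      assume "?\<eta> \<in> (top_of_set ?V) interior_of ?B"
      then obtain T where T: "openin (top_of_set ?V) T" "?\<eta> \<in> T" "T \<subseteq> ?B"
        by (auto simp: interior_of_def)
      then obtain U where U: "open U" "T = U \<inter> ?V" by (auto simp: openin_open)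
      have "((\<lambda>t. t *\<^sub>R ?\<eta>) \<longlongrightarrow> 1 *\<^sub>R ?\<eta>) (at_left (1::real))"
        by (intro tendsto_intros)
      then have "eventually (\<lambda>t. t *\<^sub>R ?\<eta> \<in> U) (at_left (1::real))"
        using U T(2) by (auto elim!: topological_tendstoD)
      moreover have "eventually (\<lambda>t. t < (1::real)) (at_left 1)" by (simp add: eventually_at_filter)
      ultimately have "eventually (\<lambda>t. t < 1 \<and> t *\<^sub>R ?\<eta> \<in> U) (at_left (1::real))" by eventually_elim simp
      then obtain t :: real where t: "t < 1" "t *\<^sub>R ?\<eta> \<in> U"
        using eventually_happens'[OF trivial_limit_at_left_real] by blast
      then have "t *\<^sub>R ?\<eta> \<in> ?B" using T(3) U(2) lV by blast
      then have "?f (t *\<^sub>R ?\<eta>) \<ge> 1" using hull_pairing[OF _ w] by blast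
      then show False using t f1 by (simp add: pairing_scale_right)
    qed
    ultimately show ?thesis using l1 by (simp add: frontier_of_def)
  next
    assume l1: "l > 1"
    define Oc where "Oc = {n. \<forall>y\<in>?V. n \<bullet> y = 0}"
    \<comment> \<open>Adding the orthogonal complement \<open>Oc\<close> of the multivectors turns a
      relative interior into an ordinary one, to which separation by a hyperplane applies.\<close>
    define W where "W = (\<Union>b\<in>?B. \<Union>n\<in>Oc. {b + n})"
    have Osub: "subspace Oc" by (auto simp: Oc_def subspace_def inner_left_distrib)
    have "convex W"
      unfolding W_def by (intro convex_sums convex_convex_hull subspace_imp_convex[OF Osub])
    have "l *\<^sub>R ?\<eta> \<in> interior W"
    proof (rule ccontr)
      assume "l *\<^sub>R ?\<eta> \<notin> interior W"
      then obtain a where a: "a \<noteq> 0" "\<And>y. y \<in> W \<Longrightarrow> a \<bullet> (l *\<^sub>R ?\<eta>) \<le> a \<bullet> y"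
        using convex_not_interior_hyperplane[OF \<open>convex W\<close>] by metis
      have aB: "a \<bullet> (l *\<^sub>R ?\<eta>) \<le> a \<bullet> b" if "b \<in> ?B" for b
proof -
        have "b + 0 \<in> W" unfolding W_def using that subspace_0[OF Osub] by blast
        from a(2)[OF this] show ?thesis by simp
      qed
      \<comment> \<open>Since \<open>W\<close> is invariant under translation by \<open>Oc\<close>,
        a functional bounded below on \<open>W\<close> vanishes on \<open>Oc\<close>.\<close>
      have aO: "a \<bullet> n = 0" if n: "n \<in> Oc" for n
      proof (rule ccontr)
        assume nz: "a \<bullet> n \<noteq> 0"
        define s where "s = - (a \<bullet> ?\<eta> - a \<bullet> (l *\<^sub>R ?\<eta>) + 1) / (a \<bullet> n)"
        have "?\<eta> + s *\<^sub>R n \<in> W" unfolding W_def using \<eta>B subspace_scale[OF Osub n] by blast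
        from a(2)[OF this] have "a \<bullet> (l *\<^sub>R ?\<eta>) \<le> a \<bullet> ?\<eta> + s * (a \<bullet> n)" by (simp add: inner_right_distrib)
        also have "s * (a \<bullet> n) = - (a \<bullet> ?\<eta> - a \<bullet> (l *\<^sub>R ?\<eta>) + 1)" using nz by (simp add: s_def)
        finally show False by simp
      qed
      have k0: "a \<bullet> ?\<eta> \<le> 0"
      proof -
        have "(l - 1) * (a \<bullet> ?\<eta>) \<le> 0" using aB[OF \<eta>B] by (simp add: algebra_simps)
        then show ?thesis using l1 by (simp add: mult_le_0_iff)
      qed
      have "a \<bullet> ?\<eta> = 0"
      proof (rule ccontr)
        assume "a \<bullet> ?\<eta> \<noteq> 0"
        then have kneg: "a \<bullet> ?\<eta> < 0" using k0 by simp
        obtain f where f: "\<And>i. \<gamma> f (w i) = 0" "\<gamma> f f = - 1" using orthogonal_unit[OF w(1)] by blast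
        define i where "i = (undefined :: 'p)"
        \<comment> \<open>Hyperbolic rotation of \<open>w i\<close> towards the negative unit vector
          \<open>f\<close>, which stays in \<open>G\<close>. Adding the bounds for \<open>s\<close>
          and \<open>- s\<close> removes the \<open>sinh\<close> terms and would bound
          \<open>cosh s\<close> by \<open>l\<close> for all \<open>s\<close>.\<close>
        define v where "v s = w(i := cosh s *\<^sub>R w i + sinh s *\<^sub>R f)" for s :: real
        have f': "\<gamma> (w j) f = 0" for j using f(1) sym by metis
        have "cosh s * cosh s - sinh s * sinh s = 1" for s :: real
          using hyperbolic_pythagoras[of s] by (simp add: power2_eq_square)
        then have fv: "frame (v s)" for s
          using w(1) f f' by (auto simp: frame_def v_def add scale)
        have lw: "linear (\<lambda>u. a \<bullet> wedge (w(i := u)))" by (rule linear_wedge)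
        have li: "linear (\<lambda>u. ip (w(i := u)) w)" by (rule alt_form_linear[OF alt_form_ip])
        have "ip (w(i := f)) w = 0"
        proof -
          have "(\<Sum>j\<in>UNIV. (if j = i then 1 else 0) *\<^sub>R (w(i := f)) j) = f"
            by (simp add: if_distrib[of "\<lambda>c. c *\<^sub>R _"] cong: if_cong)
          then show ?thesis
            by (intro ip_dependent[of "\<lambda>j. if j = i then 1 else 0"]) (auto simp: f fun_eq_iff)
        qed
        then have "ip (v s) w = cosh s" for s
          unfolding v_def linear_add[OF li] linear_scale[OF li] using ip_frame[OF w(1)] by simp
        then have vG: "wedge (v s) \<in> G" for s
          using G_memI[OF fv w] cosh_real_pos by metis
        have av: "a \<bullet> wedge (v s) = cosh s * (a \<bullet> ?\<eta>) + sinh s * (a \<bullet> wedge (w(i := f)))" for s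
          unfolding v_def linear_add[OF lw] linear_scale[OF lw] by simp
        have ge: "l * (a \<bullet> ?\<eta>) \<le> a \<bullet> wedge (v s)" for s using aB[OF hull_inc[OF vG]] by simp
        have "l * (a \<bullet> ?\<eta>) \<le> cosh s * (a \<bullet> ?\<eta>)" for s
          using ge[of s] ge[of "- s"] unfolding av by simp
        then have le: "cosh s \<le> l" for s :: real using kneg by simp
        have "eventually (\<lambda>s::real. cosh s \<ge> l + 1) at_top"
          using cosh_real_at_top by (simp add: filterlim_at_top)
        then obtain s :: real where "cosh s \<ge> l + 1" by (auto simp: eventually_at_top_linorder)
        then show False using le[of s] by simp
      qed
      then have "a \<bullet> b \<ge> 0" if "b \<in> G" for b using aB[OF hull_inc[OF that]] by simp
      then have aw: "a \<bullet> wedge v = 0" for v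
        using functional_vanishes[OF _ w \<open>a \<bullet> ?\<eta> = 0\<close>] by blast
      have "a \<bullet> y = 0" if "y \<in> ?V" for y
        using that unfolding multivectors_def
        by (induction rule: span_induct_alt) (auto simp: inner_right_distrib aw)
      then have "a \<in> Oc" by (simp add: Oc_def)
      then show False using aO a(1) by force
    qed
    then obtain U where U: "open U" "l *\<^sub>R ?\<eta> \<in> U" "U \<subseteq> W" by (auto simp: interior_def)
    have "U \<inter> ?V \<subseteq> ?B"
    proof
      fix y assume y: "y \<in> U \<inter> ?V"
      then obtain b n where bn: "y = b + n" "b \<in> ?B" "n \<in> Oc" using U(3) unfolding W_def by blast
      have "n = y - b" using bn by simp
      then have "n \<in> ?V" using subspace_diff[OF subspace_multivectors, of y b] y bn BV by auto
      then have "n = 0" using bn(3) by (auto simp: Oc_def)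
      then show "y \<in> ?B" using bn by simp
    qed
    then have "l *\<^sub>R ?\<eta> \<in> (top_of_set ?V) interior_of ?B"
      using U lV unfolding interior_of_def by (auto intro!: exI[of _ "U \<inter> ?V"] openin_open_Int simp: Int_commute)
    then show ?thesis using l1 by (simp add: frontier_of_def)
  qed
qed

end

end

section \<open>Charts, test forms and currents\<close>

locale smooth_manifold =
  fixes A :: "('x::{t2_space,second_countable_topology}, 'n::finite) chart set"
  assumes atlas: "smooth_atlas A"
begin

lemma chart_open: "c \<in> A \<Longrightarrow> open (fst c)" "c \<in> A \<Longrightarrow> open (chart_img c)"
  and chart_homeo: "c \<in> A \<Longrightarrow> homeomorphism (fst c) (chart_img c) (snd c) (chart_inv c)"
  and chart_cover: "\<exists>c\<in>A. x \<in> fst c"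
  using atlas unfolding smooth_atlas_def by blast+

lemma chart_inv_chart: "c \<in> A \<Longrightarrow> x \<in> fst c \<Longrightarrow> chart_inv c (snd c x) = x"
  and chart_chart_inv: "c \<in> A \<Longrightarrow> y \<in> chart_img c \<Longrightarrow> snd c (chart_inv c y) = y"
  and chart_inv_mem: "c \<in> A \<Longrightarrow> y \<in> chart_img c \<Longrightarrow> chart_inv c y \<in> fst c"
  and chart_mem: "c \<in> A \<Longrightarrow> x \<in> fst c \<Longrightarrow> snd c x \<in> chart_img c"
  and chart_continuous: "c \<in> A \<Longrightarrow> continuous_on (fst c) (snd c)" "c \<in> A \<Longrightarrow> continuous_on (chart_img c) (chart_inv c)"
  using chart_homeo[of c] unfolding homeomorphism_def by auto

lemma open_overlap: "c \<in> A \<Longrightarrow> open U \<Longrightarrow> open (chart_img c \<inter> chart_inv c -` U)"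
  by (rule continuous_open_preimage[OF chart_continuous(2) chart_open(2)])

lemma overlap_eq: "c \<in> A \<Longrightarrow> snd c ` (fst c \<inter> U) = chart_img c \<inter> chart_inv c -` U"
proof (intro equalityI subsetI)
  fix y assume "c \<in> A" "y \<in> chart_img c \<inter> chart_inv c -` U"
  then show "y \<in> snd c ` (fst c \<inter> U)"
    using chart_chart_inv[of c y] chart_inv_mem[of c y] by (intro image_eqI[of _ _ "chart_inv c y"]) auto
qed (use chart_inv_chart[of c] chart_mem[of c] in auto)

lemma chart_image_open: "c \<in> A \<Longrightarrow> open U \<Longrightarrow> open (snd c ` (fst c \<inter> U))"
  by (simp add: overlap_eq open_overlap)

definition trans :: "('x, 'n) chart \<Rightarrow> ('x, 'n) chart \<Rightarrow> real ^ 'n \<Rightarrow> real ^ 'n" where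
  "trans c d = snd d \<circ> chart_inv c"

text \<open>Indexed by the point of the manifold instead of its coordinates, so that the chain rule
  becomes a cocycle identity at one point.\<close>

definition dtrans :: "('x, 'n) chart \<Rightarrow> ('x, 'n) chart \<Rightarrow> 'x \<Rightarrow> real ^ 'n \<Rightarrow> real ^ 'n" where
  "dtrans c d x = frechet_derivative (trans c d) (at (snd c x))"

lemma trans_smooth: "c \<in> A \<Longrightarrow> d \<in> A \<Longrightarrow> smooth_on (snd c ` (fst c \<inter> fst d)) (trans c d)"
  using atlas unfolding smooth_atlas_def trans_def by blast

lemma trans_derivative:
  assumes "c \<in> A" "d \<in> A" "x \<in> fst c" "x \<in> fst d"
  shows "(trans c d has_derivative dtrans c d x) (at (snd c x))"
  unfolding dtrans_def
  by (rule smooth_on_has_derivative[OF trans_smooth[OF assms(1,2)] chart_image_open[OF assms(1) chart_open(1)[OF assms(2)]]])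
    (use assms(3,4) in blast)

lemma linear_dtrans: "c \<in> A \<Longrightarrow> d \<in> A \<Longrightarrow> x \<in> fst c \<Longrightarrow> x \<in> fst d \<Longrightarrow> linear (dtrans c d x)"
  using trans_derivative has_derivative_linear by blast

lemma dtrans_compose:
  assumes "c \<in> A" "d \<in> A" "e \<in> A" "x \<in> fst c" "x \<in> fst d" "x \<in> fst e"
  shows "dtrans d e x (dtrans c d x u) = dtrans c e x u"
proof -
  have tx: "trans c d (snd c x) = snd d x" using assms by (simp add: trans_def chart_inv_chart)
  have h1: "((trans d e \<circ> trans c d) has_derivative dtrans d e x \<circ> dtrans c d x) (at (snd c x))"
    using trans_derivative[OF assms(1,2,4,5)] trans_derivative[OF assms(2,3,5,6)]
    by (intro diff_chain_at) (simp_all add: tx)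
  have h2: "(trans d e \<circ> trans c d) y = trans c e y" if "y \<in> snd c ` (fst c \<inter> fst d)" for y
    using that assms by (auto simp: trans_def chart_inv_chart)
  have h3: "open (snd c ` (fst c \<inter> fst d))" by (rule chart_image_open[OF assms(1) chart_open(1)[OF assms(2)]])
  have "(trans c e has_derivative dtrans d e x \<circ> dtrans c d x) (at (snd c x))"
    by (rule has_derivative_transform_within_open[OF h1 h3 _ h2]) (use assms in auto)
  with trans_derivative[of c e x] assms have "dtrans d e x \<circ> dtrans c d x = dtrans c e x"
    using has_derivative_unique by blast
  then show ?thesis by (metis comp_apply)
qed

lemma dtrans_id:
  assumes "c \<in> A" "x \<in> fst c" shows "dtrans c c x u = u"
proof -
  have "(trans c c has_derivative (\<lambda>u. u)) (at (snd c x))"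
    by (rule has_derivative_transform_within_open[OF has_derivative_ident chart_open(2)[OF assms(1)] chart_mem[OF assms]])
      (simp add: trans_def chart_chart_inv[OF assms(1)])
  with trans_derivative[of c c x] assms have "dtrans c c x = (\<lambda>u. u)"
    using has_derivative_unique by blast
  then show ?thesis by simp
qed

lemma dtrans_inverse:
  "c \<in> A \<Longrightarrow> d \<in> A \<Longrightarrow> x \<in> fst c \<Longrightarrow> x \<in> fst d \<Longrightarrow> dtrans d c x (dtrans c d x u) = u"
  by (simp add: dtrans_compose dtrans_id)

lemma chart_at: "chart_at A x \<in> A" "x \<in> fst (chart_at A x)"
  unfolding chart_at_def using someI_ex[of "\<lambda>c. c \<in> A \<and> x \<in> fst c"] chart_cover[of x] by blast+

lemma from_chart_eq: "from_chart A c x = dtrans c (chart_at A x) x"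
  by (simp add: from_chart_def dtrans_def trans_def)

text \<open>The differential of \<open>c\<close> at \<open>x\<close> on the fixed model of the
  tangent space, inverse to \<open>from_chart A c x\<close>.\<close>

definition to_chart :: "('x, 'n) chart \<Rightarrow> 'x \<Rightarrow> real ^ 'n \<Rightarrow> real ^ 'n" where
  "to_chart c x = dtrans (chart_at A x) c x"

lemma to_from_chart: "c \<in> A \<Longrightarrow> x \<in> fst c \<Longrightarrow> to_chart c x (from_chart A c x u) = u"
  and from_to_chart: "c \<in> A \<Longrightarrow> x \<in> fst c \<Longrightarrow> from_chart A c x (to_chart c x u) = u"
  and linear_to_chart: "c \<in> A \<Longrightarrow> x \<in> fst c \<Longrightarrow> linear (to_chart c x)"
  and linear_from_chart: "c \<in> A \<Longrightarrow> x \<in> fst c \<Longrightarrow> linear (from_chart A c x)"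
  and from_chart_dtrans: "c \<in> A \<Longrightarrow> d \<in> A \<Longrightarrow> x \<in> fst c \<Longrightarrow> x \<in> fst d \<Longrightarrow> from_chart A d x (dtrans c d x u) = from_chart A c x u"
  and to_chart_from_chart: "c \<in> A \<Longrightarrow> d \<in> A \<Longrightarrow> x \<in> fst c \<Longrightarrow> x \<in> fst d \<Longrightarrow> to_chart d x (from_chart A c x u) = dtrans c d x u"
  by (simp_all add: to_chart_def from_chart_eq dtrans_inverse dtrans_compose chart_at linear_dtrans)

lemma from_chart_at: "from_chart A (chart_at A x) x u = u"
  by (simp add: from_chart_eq dtrans_id chart_at)

subsection \<open>Smooth functions and cutoffs\<close>

definition smooth_fun :: "('x \<Rightarrow> real) \<Rightarrow> bool" where
  "smooth_fun \<psi> \<longleftrightarrow> (\<forall>c\<in>A. smooth_on (chart_img c) (\<lambda>y. \<psi> (chart_inv c y)))"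

definition dfun :: "('x \<Rightarrow> real) \<Rightarrow> 'x \<Rightarrow> real ^ 'n \<Rightarrow> real" where
  "dfun \<psi> x = frechet_derivative (\<lambda>y. \<psi> (chart_inv (chart_at A x) y)) (at (snd (chart_at A x) x))"

lemma smooth_fun_derivative:
  assumes "smooth_fun \<psi>" "c \<in> A" "x \<in> fst c"
  shows "((\<lambda>y. \<psi> (chart_inv c y)) has_derivative frechet_derivative (\<lambda>y. \<psi> (chart_inv c y)) (at (snd c x))) (at (snd c x))"
  using assms(1,2)
  by (intro smooth_on_has_derivative[OF _ chart_open(2)[OF assms(2)] chart_mem[OF assms(2,3)]]) (simp add: smooth_fun_def)

lemma linear_dfun: "smooth_fun \<psi> \<Longrightarrow> linear (dfun \<psi> x)"
  unfolding dfun_def using smooth_fun_derivative[OF _ chart_at] has_derivative_linear by blast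

lemma dfun_from_chart:
  assumes "smooth_fun \<psi>" "c \<in> A" "x \<in> fst c"
  shows "dfun \<psi> x (from_chart A c x u) = frechet_derivative (\<lambda>y. \<psi> (chart_inv c y)) (at (snd c x)) u"
proof -
  let ?d = "chart_at A x"
  have tx: "trans c ?d (snd c x) = snd ?d x" using assms by (simp add: trans_def chart_inv_chart)
  have h1: "(((\<lambda>y. \<psi> (chart_inv ?d y)) \<circ> trans c ?d) has_derivative dfun \<psi> x \<circ> dtrans c ?d x) (at (snd c x))"
    using trans_derivative[OF assms(2) chart_at(1) assms(3) chart_at(2)]
      smooth_fun_derivative[OF assms(1) chart_at, of x]
    by (intro diff_chain_at) (simp_all add: tx dfun_def)
  have h2: "((\<lambda>y. \<psi> (chart_inv ?d y)) \<circ> trans c ?d) y = \<psi> (chart_inv c y)" if "y \<in> snd c ` (fst c \<inter> fst ?d)" for y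
    using that assms chart_at[of x] by (auto simp: trans_def chart_inv_chart)
  have h3: "open (snd c ` (fst c \<inter> fst ?d))" by (rule chart_image_open[OF assms(2) chart_open(1)[OF chart_at(1)]])
  have "((\<lambda>y. \<psi> (chart_inv c y)) has_derivative dfun \<psi> x \<circ> dtrans c ?d x) (at (snd c x))"
    by (rule has_derivative_transform_within_open[OF h1 h3 _ h2]) (use assms chart_at(2)[of x] in auto)
  with smooth_fun_derivative[OF assms] have "dfun \<psi> x \<circ> dtrans c ?d x = frechet_derivative (\<lambda>y. \<psi> (chart_inv c y)) (at (snd c x))"
    using has_derivative_unique by blast
  then show ?thesis by (metis comp_apply from_chart_eq)
qed

lemma smooth_fun_const: "smooth_fun (\<lambda>_. c)"
  and smooth_fun_mult: "smooth_fun f \<Longrightarrow> smooth_fun g \<Longrightarrow> smooth_fun (\<lambda>x. f x * g x)"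
  and smooth_fun_diff: "smooth_fun f \<Longrightarrow> smooth_fun g \<Longrightarrow> smooth_fun (\<lambda>x. f x - g x)"
  by (auto simp: smooth_fun_def intro!: smooth_on_const smooth_on_mult smooth_on_diff chart_open)

lemma smooth_fun_prod: "finite I \<Longrightarrow> (\<And>i. i \<in> I \<Longrightarrow> smooth_fun (f i)) \<Longrightarrow> smooth_fun (\<lambda>x. \<Prod>i\<in>I. f i x)"
  by (induction I rule: finite_induct) (auto intro: smooth_fun_const smooth_fun_mult)

lemma smooth_fun_continuous:
  assumes "smooth_fun \<psi>" shows "continuous_on UNIV \<psi>"
proof -
  have "continuous_on (fst c) \<psi>" if c: "c \<in> A" for c
  proof -
    have "continuous_on (chart_img c) (\<lambda>y. \<psi> (chart_inv c y))"
      using assms c by (intro smooth_on_continuous chart_open(2)) (simp add: smooth_fun_def)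
    then have "continuous_on (fst c) (\<lambda>x. \<psi> (chart_inv c (snd c x)))"
      by (rule continuous_on_compose2) (use chart_continuous(1)[OF c] chart_mem[OF c] in auto)
    then show ?thesis by (rule continuous_on_eq) (simp add: c chart_inv_chart)
  qed
  then have "continuous_on (\<Union>c\<in>A. fst c) \<psi>"
    by (intro continuous_on_open_UN) (auto intro: chart_open)
  moreover have "(\<Union>c\<in>A. fst c) = UNIV" using chart_cover by blast
  ultimately show ?thesis by simp
qed

definition cutoff :: "('x \<Rightarrow> real) \<Rightarrow> 'x set \<Rightarrow> bool" where
  "cutoff \<psi> K \<longleftrightarrow> smooth_fun \<psi> \<and> compact K \<and> (\<forall>x. 0 \<le> \<psi> x \<and> \<psi> x \<le> 1) \<and> (\<forall>x. x \<notin> K \<longrightarrow> \<psi> x = 0)"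

text \<open>A bump on a ball in chart coordinates, extended by zero. In another chart it is smooth
  on the overlap and on the preimage of the complement of \<open>K\<close>. The latter is open
  because \<open>K\<close> is compact in a Hausdorff space, and the two cover because
  \<open>K\<close> lies in the domain of the first chart.\<close>

lemma local_cutoff:
  assumes U: "open U" "x \<in> U"
  obtains \<psi> K V where "cutoff \<psi> K" "K \<subseteq> U" "open V" "x \<in> V" "\<And>y. y \<in> V \<Longrightarrow> \<psi> y = 1"
proof -
  obtain c where c: "c \<in> A" "x \<in> fst c" using chart_cover by blast
  have "open (snd c ` (fst c \<inter> U))" by (rule chart_image_open[OF c(1) U(1)])
  moreover have "snd c x \<in> snd c ` (fst c \<inter> U)" using c U by blast
  ultimately obtain R where R: "R > 0" "cball (snd c x) R \<subseteq> snd c ` (fst c \<inter> U)"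
    using open_contains_cball by blast
  define B where "B = ball_bump (snd c x) (R / 2) R"
  define K where "K = chart_inv c ` cball (snd c x) R"
  define \<psi> where "\<psi> y = (if y \<in> fst c then B (snd c y) else 0)" for y
  have sub: "snd c ` (fst c \<inter> U) \<subseteq> chart_img c" by (auto simp: chart_img_def)
  have KU: "K \<subseteq> U"
  proof
    fix z assume "z \<in> K"
    then obtain y where y: "y \<in> cball (snd c x) R" "z = chart_inv c y" unfolding K_def by blast
    then obtain x' where "x' \<in> fst c \<inter> U" "y = snd c x'" using R(2) by blast
    then show "z \<in> U" using y(2) chart_inv_chart[OF c(1)] by simp
  qed
  have "continuous_on (cball (snd c x) R) (chart_inv c)"
    using continuous_on_subset[OF chart_continuous(2)[OF c(1)]] R(2) sub by blast
  then have K: "compact K" unfolding K_def by (intro compact_continuous_image) auto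
  have \<psi>0: "\<psi> y = 0" if "y \<notin> K" for y
  proof (cases "y \<in> fst c")
    case True
    then have "snd c y \<notin> cball (snd c x) R" using that c chart_inv_chart[OF c(1) True] unfolding K_def by (metis image_eqI)
    then show ?thesis using R(1) by (simp add: \<psi>_def B_def ball_bump_0 dist_norm norm_minus_commute)
  qed (simp add: \<psi>_def)
  have "smooth_fun \<psi>"
    unfolding smooth_fun_def
  proof
    fix d assume d: "d \<in> A"
    let ?P = "snd d ` (fst d \<inter> fst c)" and ?Q = "chart_img d \<inter> chart_inv d -` (- K)"
    have o: "open ?P" "open ?Q"
      using chart_image_open[OF d chart_open(1)[OF c(1)]] open_overlap[OF d, of "- K"] compact_imp_closed[OF K]
      by (auto simp: open_Compl)
    have "smooth_on ?P (\<lambda>y. B (trans d c y))"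
      using trans_smooth[OF d c(1)] o unfolding B_def by (intro smooth_on_compose[OF smooth_ball_bump]) auto
    then have "smooth_on ?P (\<lambda>y. \<psi> (chart_inv d y))"
      by (rule smooth_on_cong[OF _ o(1)]) (use d in \<open>auto simp: \<psi>_def trans_def chart_inv_chart\<close>)
    moreover have "smooth_on ?Q (\<lambda>y. \<psi> (chart_inv d y))"
      by (rule smooth_on_cong[OF smooth_on_const[OF o(2), of 0] o(2)]) (use \<psi>0 in auto)
    ultimately have "smooth_on (?P \<union> ?Q) (\<lambda>y. \<psi> (chart_inv d y))" using o by (intro smooth_on_Un)
    moreover have "chart_img d \<subseteq> ?P \<union> ?Q"
    proof
      fix y assume y: "y \<in> chart_img d"
      have "K \<subseteq> fst c" unfolding K_def using R(2) sub chart_inv_mem[OF c(1)] by blast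
      then show "y \<in> ?P \<union> ?Q" unfolding overlap_eq[OF d] using y by blast
    qed
    ultimately show "smooth_on (chart_img d) (\<lambda>y. \<psi> (chart_inv d y))" by (rule smooth_on_subset)
  qed
  then have "cutoff \<psi> K"
    using K \<psi>0 by (auto simp: cutoff_def \<psi>_def B_def ball_bump_bounds)
  moreover define V where "V = fst c \<inter> snd c -` ball (snd c x) (R / 2)"
  have "open V" unfolding V_def
    by (rule continuous_open_preimage[OF chart_continuous(1)[OF c(1)] chart_open(1)[OF c(1)]]) simp
  moreover have "x \<in> V" using c R by (simp add: V_def)
  moreover have "\<psi> y = 1" if "y \<in> V" for y
    using that R(1) by (auto simp: V_def \<psi>_def B_def dist_norm norm_minus_commute intro!: ball_bump_1)
  ultimately show thesis using that KU by blast
qed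

text \<open>For a finite subcover, \<open>1 - (\<Prod>x\<in>D. (1 - \<psi> x y))\<close> is 1 as
  soon as one of the local cutoffs is, and 0 when all of them are.\<close>

lemma compact_cutoff:
  assumes K: "compact K" "K \<subseteq> U" and U: "open U"
  obtains \<psi> L V where "cutoff \<psi> L" "L \<subseteq> U" "open V" "K \<subseteq> V" "\<And>y. y \<in> V \<Longrightarrow> \<psi> y = 1"
proof -
  have "\<forall>x\<in>K. \<exists>\<psi> L V. cutoff \<psi> L \<and> L \<subseteq> U \<and> open V \<and> x \<in> V \<and> (\<forall>y\<in>V. \<psi> y = 1)"
    using local_cutoff[OF U] K(2) by (metis subsetD)
  then obtain \<psi> L V where X: "\<And>x. x \<in> K \<Longrightarrow> cutoff (\<psi> x) (L x) \<and> L x \<subseteq> U \<and> open (V x) \<and> x \<in> V x \<and> (\<forall>y\<in>V x. \<psi> x y = 1)"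
    by metis
  have "K \<subseteq> (\<Union>x\<in>K. V x)" using X by blast
  then obtain D where D: "D \<subseteq> K" "finite D" "K \<subseteq> (\<Union>x\<in>D. V x)"
    using compactE_image[OF K(1), of K V] X by metis
  define f where "f y = 1 - (\<Prod>x\<in>D. (1 - \<psi> x y))" for y
  have XD: "cutoff (\<psi> x) (L x)" "L x \<subseteq> U" "open (V x)" "\<And>y. y \<in> V x \<Longrightarrow> \<psi> x y = 1" if "x \<in> D" for x
    using X D(1) that by auto
  have "smooth_fun f" unfolding f_def
    using XD(1) D(2) by (intro smooth_fun_diff smooth_fun_const smooth_fun_prod) (auto simp: cutoff_def)
  moreover have "compact (\<Union>x\<in>D. L x)" using XD(1) D(2) by (intro compact_UN) (auto simp: cutoff_def)
  moreover have "0 \<le> f y \<and> f y \<le> 1" for y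
    using XD(1) unfolding f_def cutoff_def by (auto intro!: prod_le_1 prod_nonneg)
  moreover have "f y = 0" if "y \<notin> (\<Union>x\<in>D. L x)" for y
    using XD(1) that unfolding f_def cutoff_def by auto
  ultimately have "cutoff f (\<Union>x\<in>D. L x)" by (simp add: cutoff_def)
  moreover have "f y = 1" if y: "y \<in> (\<Union>x\<in>D. V x)" for y
  proof -
    obtain x where "x \<in> D" "y \<in> V x" using y by blast
    then show ?thesis using XD(4) D(2) unfolding f_def by (auto simp: prod_zero_iff)
  qed
  moreover have "(\<Union>x\<in>D. L x) \<subseteq> U" "open (\<Union>x\<in>D. V x)" using XD by auto
  ultimately show thesis using that D(3) by metis
qed

subsection \<open>Test forms\<close>

lemma form_in_chart_mult: "form_in_chart A c (\<lambda>x v. \<psi> x * \<omega> x v) y v = \<psi> (chart_inv c y) * form_in_chart A c \<omega> y v"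
  by (simp add: form_in_chart_def)

lemma smooth_form_mult:
  assumes "smooth_fun \<psi>" "smooth_form A \<omega>" shows "smooth_form A (\<lambda>x v. \<psi> x * \<omega> x v)"
  using assms by (auto simp: smooth_form_def form_in_chart_mult smooth_fun_def alt_form_scale
      intro!: smooth_on_mult chart_open)

lemma form_support_subset:
  fixes K :: "'x set"
  assumes "compact K" "\<And>x v. x \<notin> K \<Longrightarrow> \<omega> x v = 0"
  shows "form_support \<omega> \<subseteq> K" "compact (form_support \<omega>)"
proof -
  show "form_support \<omega> \<subseteq> K" unfolding form_support_def
    using assms compact_imp_closed by (intro closure_minimal) auto
  then show "compact (form_support \<omega>)"
    using compact_Int_closed[OF assms(1), of "form_support \<omega>"] by (simp add: form_support_def Int_absorb1)
qed

lemma test_form_mult: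
  assumes "cutoff \<psi> K" "smooth_form A \<omega>" shows "test_form A (\<lambda>x v. \<psi> x * \<omega> x v)"
    and "form_support (\<lambda>x v. \<psi> x * \<omega> x v) \<subseteq> K"
  using assms form_support_subset[of K "\<lambda>x v. \<psi> x * \<omega> x v"] smooth_form_mult
  by (auto simp: test_form_def cutoff_def)

lemma form_support_mult: "form_support (\<lambda>x v. \<psi> x * \<omega> x v) \<subseteq> form_support \<omega>"
  unfolding form_support_def by (intro closure_mono) auto

lemma test_form_mult_test:
  assumes "smooth_fun \<psi>" "test_form A \<omega>" shows "test_form A (\<lambda>x v. \<psi> x * \<omega> x v)"
proof -
  let ?\<eta> = "\<lambda>x v. \<psi> x * \<omega> x v"
  have "form_support ?\<eta> = form_support \<omega> \<inter> form_support ?\<eta>" using form_support_mult[of \<psi> \<omega>] by blast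
  also have "compact \<dots>" using assms(2) by (intro compact_Int_closed) (auto simp: test_form_def form_support_def)
  finally show ?thesis using assms smooth_form_mult by (auto simp: test_form_def)
qed

lemma form_eq_0: "x \<notin> form_support \<omega> \<Longrightarrow> \<omega> x v = 0"
  unfolding form_support_def using closure_subset[of "{x. \<exists>v. \<omega> x v \<noteq> 0}"] by blast

section \<open>Vanishing of a current off its support\<close>

lemma current_add:
  "is_current A T \<Longrightarrow> test_form A \<omega> \<Longrightarrow> test_form A \<eta> \<Longrightarrow> T (\<lambda>x v. \<omega> x v + \<eta> x v) = T \<omega> + T \<eta>"
  by (simp add: is_current_def)

lemma current_zero: "is_current A T \<Longrightarrow> T (\<lambda>x v. 0) = 0"
proof -
  assume T: "is_current A T"
  have "test_form A (\<lambda>x v. 0)"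
    by (auto simp: test_form_def smooth_form_def alt_form_def form_in_chart_def form_support_def linear_zero
        intro: smooth_on_const chart_open)
  with T have "T (\<lambda>x v. 0 * 0) = 0 * T (\<lambda>x v. 0)" unfolding is_current_def by blast
  then show ?thesis by simp
qed

text \<open>Finitely many open sets on which \<open>T\<close> vanishes cover the support of
  \<open>\<omega>\<close>. The parts of the form carried by the corresponding cutoffs are peeled off
  one at a time, and the factor that remains, the product of all \<open>1 - \<psi> a\<close>, is
  zero on the support.\<close>

lemma current_eq_0:
  assumes T: "is_current A T" and \<omega>: "test_form A \<omega>" and disj: "form_support \<omega> \<inter> current_support A T = {}"
  shows "T \<omega> = 0"
proof -
  let ?K = "form_support \<omega>"
  have K: "compact ?K" using \<omega> by (simp add: test_form_def)
  have "\<forall>x\<in>?K. \<exists>U. open U \<and> x \<in> U \<and> (\<forall>\<eta>. test_form A \<eta> \<and> form_support \<eta> \<subseteq> U \<longrightarrow> T \<eta> = 0)"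
  proof
    fix x assume "x \<in> ?K"
    then have "x \<notin> current_support A T" using disj by blast
    then show "\<exists>U. open U \<and> x \<in> U \<and> (\<forall>\<eta>. test_form A \<eta> \<and> form_support \<eta> \<subseteq> U \<longrightarrow> T \<eta> = 0)"
      by (simp add: current_support_def) metis
  qed
  then obtain U where U: "\<And>x. x \<in> ?K \<Longrightarrow> open (U x) \<and> x \<in> U x \<and> (\<forall>\<eta>. test_form A \<eta> \<and> form_support \<eta> \<subseteq> U x \<longrightarrow> T \<eta> = 0)"
    by metis
  have "\<forall>x\<in>?K. \<exists>\<psi> L V. cutoff \<psi> L \<and> L \<subseteq> U x \<and> open V \<and> x \<in> V \<and> (\<forall>y\<in>V. \<psi> y = 1)"
    using local_cutoff U by metis
  then obtain \<psi> L V where X: "\<And>x. x \<in> ?K \<Longrightarrow> cutoff (\<psi> x) (L x) \<and> L x \<subseteq> U x \<and> open (V x) \<and> x \<in> V x \<and> (\<forall>y\<in>V x. \<psi> x y = 1)"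
    by metis
  have "?K \<subseteq> (\<Union>x\<in>?K. V x)" using X by blast
  then obtain D where D: "D \<subseteq> ?K" "finite D" "?K \<subseteq> (\<Union>x\<in>D. V x)"
    using compactE_image[OF K, of ?K V] X by metis
  define f where "f E y = (\<Prod>x\<in>E. (1 - \<psi> x y))" for E y
  have "T (\<lambda>x v. f E x * \<omega> x v) = T \<omega>" if "finite E" "E \<subseteq> D" for E
    using that
  proof (induction E)
    case empty then show ?case by (simp add: f_def)
  next
    case (insert a E)
    have aK: "a \<in> ?K" using insert D by auto
    have sm: "smooth_fun (\<psi> a)" using X[OF aK] by (simp add: cutoff_def)
    have "smooth_fun (f E)" unfolding f_def
      using insert D X by (intro smooth_fun_prod smooth_fun_diff smooth_fun_const) (auto simp: cutoff_def)
    then have t: "test_form A (\<lambda>x v. f E x * \<omega> x v)" by (rule test_form_mult_test[OF _ \<omega>])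
    let ?\<eta> = "\<lambda>x v. \<psi> a x * (f E x * \<omega> x v)" and ?\<zeta> = "\<lambda>x v. (1 - \<psi> a x) * (f E x * \<omega> x v)"
    have t1: "test_form A ?\<eta>" by (rule test_form_mult_test[OF sm t])
    have t2: "test_form A ?\<zeta>" by (rule test_form_mult_test[OF smooth_fun_diff[OF smooth_fun_const sm] t])
    have "form_support ?\<eta> \<subseteq> L a"
      using X[OF aK] by (intro form_support_subset) (auto simp: cutoff_def)
    then have "T ?\<eta> = 0" using U[OF aK] X[OF aK] t1 by blast
    moreover have "T (\<lambda>x v. f E x * \<omega> x v) = T ?\<eta> + T ?\<zeta>"
      unfolding current_add[OF T t1 t2, symmetric] by (rule arg_cong[of _ _ T]) (simp add: algebra_simps)
    moreover have "?\<zeta> = (\<lambda>x v. f (insert a E) x * \<omega> x v)"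
      using insert(1,2) by (simp add: f_def mult.assoc)
    ultimately show ?case using insert by simp
  qed
  from this[of D] have "T \<omega> = T (\<lambda>x v. f D x * \<omega> x v)" using D by simp
  also have "(\<lambda>x v. f D x * \<omega> x v) = (\<lambda>x v. 0)"
  proof (intro ext)
    fix x v
    show "f D x * \<omega> x v = 0"
    proof (cases "x \<in> ?K")
      case True
      then obtain a where "a \<in> D" "x \<in> V a" using D(3) by blast
      then have "f D x = 0" unfolding f_def using X D by (auto simp: prod_zero_iff)
      then show ?thesis by simp
    qed (simp add: form_eq_0)
  qed
  finally show ?thesis using current_zero[OF T] by simp
qed

end

section \<open>Exterior product with a one-form and the product rule\<close>

lemma alt_form_smult_linear: "linear D \<Longrightarrow> linear (\<lambda>u. c * D u)" for D :: "'a::real_vector \<Rightarrow> real"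
  using linear_compose_scale_right[of D c] by simp

lemma linear_mult_const: "linear D \<Longrightarrow> linear (\<lambda>u. D u * c)" for D :: "'a::real_vector \<Rightarrow> real"
  using alt_form_smult_linear[of D c] by (simp add: mult.commute)

text \<open>The exterior product of \<open>D\<close> and \<open>\<alpha>\<close> in the sign
  convention of \<open>ext_deriv\<close>: the slot \<open>None\<close> comes first, and exchanging
  it with another slot costs a minus sign.\<close>

definition wedge_one ::
  "(real ^ 'n \<Rightarrow> real) \<Rightarrow> (('i::finite \<Rightarrow> real ^ 'n) \<Rightarrow> real) \<Rightarrow> ('i option \<Rightarrow> real ^ 'n) \<Rightarrow> real" where
  "wedge_one D \<alpha> v = D (v None) * \<alpha> (v \<circ> Some) - (\<Sum>i\<in>UNIV. D (v (Some i)) * \<alpha> ((v \<circ> Some)(i := v None)))"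

text \<open>If \<open>None\<close> and \<open>Some j\<close> carry equal vectors, only the summand
  of \<open>j\<close> survives and cancels the leading term. If \<open>Some j\<close> and
  \<open>Some k\<close> do, the leading term vanishes and the summands of \<open>j\<close> and
  \<open>k\<close> differ by a transposition.\<close>

lemma alt_form_wedge_one:
  fixes \<alpha> :: "('i::finite \<Rightarrow> real ^ 'n::finite) \<Rightarrow> real"
  assumes D: "linear D" and \<alpha>: "alt_form \<alpha>"
  shows "alt_form (wedge_one D \<alpha>)"
  unfolding alt_form_def
proof (intro conjI allI impI)
  fix v :: "'i option \<Rightarrow> real ^ 'n" and k :: "'i option"
  let ?s = "v \<circ> Some"
  show "linear (\<lambda>u. wedge_one D \<alpha> (v(k := u)))"
  proof (cases k)
    case None
    have "(v(None := u)) \<circ> Some = ?s" for u by (auto simp: fun_eq_iff)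
    then have "wedge_one D \<alpha> (v(k := u)) = D u * \<alpha> ?s - (\<Sum>i\<in>UNIV. D (?s i) * \<alpha> (?s(i := u)))" for u
      by (simp add: wedge_one_def None)
    then show ?thesis
      by (auto intro!: linear_compose_sub linear_compose_sum linear_mult_const alt_form_smult_linear D alt_form_linear[OF \<alpha>])
  next
    case (Some j)
    have e: "(v(Some j := u)) \<circ> Some = ?s(j := u)" for u by (auto simp: fun_eq_iff)
    have "linear (\<lambda>u. D ((v(Some j := u)) (Some i)) * \<alpha> ((?s(j := u))(i := v None)))" for i
    proof (cases "i = j")
      case True then show ?thesis by (simp add: linear_mult_const D)
    next
      case False
      then have "(?s(j := u))(i := v None) = (?s(i := v None))(j := u)" for u by (simp add: fun_upd_twist)
      with False show ?thesis by (simp add: alt_form_smult_linear alt_form_linear[OF \<alpha>])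
    qed
    then show ?thesis
      unfolding wedge_one_def Some e
      by (auto intro!: linear_compose_sub linear_compose_sum alt_form_smult_linear alt_form_linear[OF \<alpha>])
  qed
next
  fix v :: "'i option \<Rightarrow> real ^ 'n" and a b :: "'i option"
  assume ab: "a \<noteq> b \<and> v a = v b"
  define s where "s = v \<circ> Some"
  let ?w = "v None"
  have W: "wedge_one D \<alpha> v = D ?w * \<alpha> s - (\<Sum>i\<in>UNIV. D (s i) * \<alpha> (s(i := ?w)))"
    by (simp add: wedge_one_def s_def)
  have 1: "wedge_one D \<alpha> v = 0" if j: "?w = s j" for j
  proof -
    have "\<alpha> (s(i := ?w)) = 0" if "i \<in> UNIV - {j}" for i
      using that by (intro alt_form_eq_0[OF \<alpha>, of i j]) (use j in auto)
    then have "(\<Sum>i\<in>UNIV - {j}. D (s i) * \<alpha> (s(i := ?w))) = 0" by (intro sum.neutral) simp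
    moreover have "s(j := ?w) = s" using j by (auto simp: fun_eq_iff)
    ultimately have "(\<Sum>i\<in>UNIV. D (s i) * \<alpha> (s(i := ?w))) = D (s j) * \<alpha> s"
      by (subst sum.remove[of UNIV j]) simp_all
    then show ?thesis using j by (simp add: W)
  qed
  have 2: "wedge_one D \<alpha> v = 0" if jk: "j \<noteq> k" "s j = s k" for j k
  proof -
    have "\<alpha> (s(i := ?w)) = 0" if "i \<in> UNIV - {j} - {k}" for i
      using that by (intro alt_form_eq_0[OF \<alpha> jk(1)]) (use jk in auto)
    then have "(\<Sum>i\<in>UNIV - {j} - {k}. D (s i) * \<alpha> (s(i := ?w))) = 0" by (intro sum.neutral) simp
    moreover have "s(k := ?w) = (\<lambda>l. (s(j := ?w)) (Transposition.transpose j k l))"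
      using jk by (auto simp: fun_eq_iff Transposition.transpose_def)
    then have "\<alpha> (s(k := ?w)) = - \<alpha> (s(j := ?w))"
      using alt_form_transpose[OF \<alpha> jk(1), of "s(j := ?w)"] by simp
    moreover have "k \<in> UNIV - {j}" using jk(1) by simp
    ultimately have "(\<Sum>i\<in>UNIV. D (s i) * \<alpha> (s(i := ?w))) = 0"
      using jk(2) by (subst sum.remove[of UNIV j], simp, simp, subst sum.remove[of "UNIV - {j}" k]) simp_all
    moreover have "\<alpha> s = 0" by (rule alt_form_eq_0[OF \<alpha> jk])
    ultimately show ?thesis by (simp add: W)
  qed
  show "wedge_one D \<alpha> v = 0"
    using ab by (cases a; cases b) (auto simp: s_def intro: 1 1[OF sym] 2)
qed

context smooth_manifold
begin

lemma form_in_chart_derivative: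
  assumes "smooth_form A \<omega>" "c \<in> A" "x \<in> fst c"
  shows "((\<lambda>y. form_in_chart A c \<omega> y w) has_derivative
    frechet_derivative (\<lambda>y. form_in_chart A c \<omega> y w) (at (snd c x))) (at (snd c x))"
  using assms(1,2)
  by (intro smooth_on_has_derivative[OF _ chart_open(2)[OF assms(2)] chart_mem[OF assms(2,3)]]) (simp add: smooth_form_def)

lemma ext_deriv_mult:
  assumes \<psi>: "smooth_fun \<psi>" and \<phi>: "smooth_form A \<phi>"
  shows "ext_deriv A (\<lambda>x v. \<psi> x * \<phi> x v) x v = \<psi> x * ext_deriv A \<phi> x v + wedge_one (dfun \<psi> x) (\<phi> x) v"
proof -
  let ?c = "chart_at A x"
  let ?y = "snd ?c x"
  have xy: "chart_inv ?c ?y = x" by (rule chart_inv_chart[OF chart_at])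
  let ?D = "\<lambda>u w. frechet_derivative (\<lambda>y. form_in_chart A ?c \<phi> y w) (at ?y) u"
  have D: "frechet_derivative (\<lambda>y. form_in_chart A ?c (\<lambda>x v. \<psi> x * \<phi> x v) y w) (at ?y) u = \<psi> x * ?D u w + dfun \<psi> x u * \<phi> x w" for u w
  proof -
    have "((\<lambda>y. \<psi> (chart_inv ?c y) * form_in_chart A ?c \<phi> y w) has_derivative
      (\<lambda>u. \<psi> (chart_inv ?c ?y) * ?D u w + dfun \<psi> x u * form_in_chart A ?c \<phi> ?y w)) (at ?y)"
      unfolding dfun_def
      by (rule has_derivative_mult[OF smooth_fun_derivative[OF \<psi> chart_at] form_in_chart_derivative[OF \<phi> chart_at]])
    from frechet_derivative_at[OF this] show ?thesis
      by (simp add: form_in_chart_mult xy) (simp add: form_in_chart_def xy from_chart_at fun_eq_iff)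
  qed
  show ?thesis
    unfolding ext_deriv_def Let_def D wedge_one_def
    by (simp add: sum.distrib sum_distrib_left right_diff_distrib)
qed

lemma dfun_eq_0:
  assumes "open V" "x \<in> V" "\<And>y. y \<in> V \<Longrightarrow> \<psi> y = k"
  shows "dfun \<psi> x u = 0"
proof -
  let ?c = "chart_at A x"
  have "frechet_derivative (\<lambda>y. \<psi> (chart_inv ?c y)) (at (snd ?c x)) = frechet_derivative (\<lambda>y. k) (at (snd ?c x))"
    using assms chart_at[of x] chart_inv_chart[OF chart_at, of x] chart_mem[OF chart_at, of x]
    by (intro frechet_derivative_cong_open[OF open_overlap[OF chart_at(1) assms(1)]]) auto
  then show ?thesis by (simp add: dfun_def)
qed

lemma form_in_chart_wedge_one:
  assumes \<psi>: "smooth_fun \<psi>" and c: "c \<in> A" "y \<in> chart_img c"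
  shows "form_in_chart A c (\<lambda>x. wedge_one (dfun \<psi> x) (\<phi> x)) y v =
    wedge_one (frechet_derivative (\<lambda>y. \<psi> (chart_inv c y)) (at y)) (form_in_chart A c \<phi> y) v"
proof -
  let ?x = "chart_inv c y"
  have x: "?x \<in> fst c" "snd c ?x = y" using c by (auto intro: chart_inv_mem chart_chart_inv)
  have u: "(\<lambda>k. from_chart A c ?x (((v \<circ> Some)(i := w)) k)) = ((\<lambda>k. from_chart A c ?x (v k)) \<circ> Some)(i := from_chart A c ?x w)" for i w
    by (auto simp: fun_eq_iff)
  show ?thesis
    unfolding form_in_chart_def wedge_one_def dfun_from_chart[OF \<psi> c(1) x(1)] x(2) u
    by (simp add: o_def)
qed

lemma test_form_wedge_one:
  assumes \<psi>: "cutoff \<psi> K" and \<phi>: "smooth_form A \<phi>"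
  shows "test_form A (\<lambda>x. wedge_one (dfun \<psi> x) (\<phi> x))"
proof -
  have sm: "smooth_fun \<psi>" using \<psi> by (simp add: cutoff_def)
  have "smooth_on (chart_img c) (\<lambda>y. form_in_chart A c (\<lambda>x. wedge_one (dfun \<psi> x) (\<phi> x)) y v)" if c: "c \<in> A" for c v
  proof (rule smooth_on_cong[OF _ chart_open(2)[OF c] form_in_chart_wedge_one[OF sm c]])
    have 1: "smooth_on (chart_img c) (\<lambda>y. frechet_derivative (\<lambda>y. \<psi> (chart_inv c y)) (at y) u)" for u
      using sm c by (intro smooth_on_deriv) (simp add: smooth_fun_def)
    have 2: "smooth_on (chart_img c) (\<lambda>y. form_in_chart A c \<phi> y w)" for w
      using \<phi> c by (simp add: smooth_form_def)
    show "smooth_on (chart_img c) (\<lambda>y. wedge_one (frechet_derivative (\<lambda>y. \<psi> (chart_inv c y)) (at y)) (form_in_chart A c \<phi> y) v)"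
      unfolding wedge_one_def by (intro smooth_on_diff smooth_on_sum smooth_on_mult 1 2 chart_open(2) c)
  qed
  then have "smooth_form A (\<lambda>x. wedge_one (dfun \<psi> x) (\<phi> x))"
    using linear_dfun[OF sm] \<phi> by (simp add: smooth_form_def alt_form_wedge_one)
  moreover have "compact (form_support (\<lambda>x. wedge_one (dfun \<psi> x) (\<phi> x)))"
  proof (rule form_support_subset(2))
    show K: "compact K" using \<psi> by (simp add: cutoff_def)
    fix x v assume "x \<notin> K"
    then have "dfun \<psi> x u = 0" for u
      using \<psi> compact_imp_closed[OF K] by (intro dfun_eq_0[of "- K" x \<psi> 0]) (auto simp: cutoff_def)
    then show "wedge_one (dfun \<psi> x) (\<phi> x) v = 0" by (simp add: wedge_one_def)
  qed
  ultimately show ?thesis by (simp add: test_form_def)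
qed

text \<open>The only use of Stokes' theorem: \<open>d(\<psi> \<phi>) = d\<psi> \<and> \<phi>\<close> vanishes where \<open>\<psi> = 1\<close>.\<close>

lemma homologous_closed_form:
  assumes hom: "homologous A S T" and \<phi>: "smooth_form A \<phi>" and closed: "\<And>x v. ext_deriv A \<phi> x v = 0"
  obtains K where "compact K"
    "\<And>\<psi> L V. cutoff \<psi> L \<Longrightarrow> open V \<Longrightarrow> K \<subseteq> V \<Longrightarrow> (\<And>y. y \<in> V \<Longrightarrow> \<psi> y = 1) \<Longrightarrow>
       S (\<lambda>x v. \<psi> x * \<phi> x v) = T (\<lambda>x v. \<psi> x * \<phi> x v)"
proof -
  obtain R where R: "is_current A R" "compact (current_support A R)"
    "\<And>\<omega>. test_form A \<omega> \<Longrightarrow> S \<omega> = T \<omega> + boundary A R \<omega>"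
    using hom unfolding homologous_def by blast
  show thesis
  proof (rule that[OF R(2)])
    fix \<psi> L V assume \<psi>: "cutoff \<psi> L" and V: "open V" "current_support A R \<subseteq> V" "\<And>y. y \<in> V \<Longrightarrow> \<psi> y = 1"
    let ?\<eta> = "\<lambda>x. wedge_one (dfun \<psi> x) (\<phi> x)"
    have sm: "smooth_fun \<psi>" using \<psi> by (simp add: cutoff_def)
    have "ext_deriv A (\<lambda>x v. \<psi> x * \<phi> x v) = ?\<eta>"
      by (intro ext) (simp add: ext_deriv_mult[OF sm \<phi>] closed)
    then have "boundary A R (\<lambda>x v. \<psi> x * \<phi> x v) = R ?\<eta>" by (simp add: boundary_def)
    also have "R ?\<eta> = 0"
    proof (rule current_eq_0[OF R(1) test_form_wedge_one[OF \<psi> \<phi>]])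
      have "{x. \<exists>v. ?\<eta> x v \<noteq> 0} \<subseteq> - V"
        using dfun_eq_0[OF V(1) _ V(3)] by (auto simp: wedge_one_def)
      then have "form_support ?\<eta> \<subseteq> - V"
        unfolding form_support_def using V(1) by (intro closure_minimal) auto
      then show "form_support ?\<eta> \<inter> current_support A R = {}" using V(2) by blast
    qed
    finally show "S (\<lambda>x v. \<psi> x * \<phi> x v) = T (\<lambda>x v. \<psi> x * \<phi> x v)"
      using R(3)[OF test_form_mult(1)[OF \<psi> \<phi>]] by simp
  qed
qed

subsection \<open>Coordinates of multivectors\<close>

text \<open>The map that \<open>L\<close> induces on the exterior power. Defined through
  \<open>pairing\<close>, it is linear on all tensors without a choice of representation.\<close>

definition mv_map :: "(real ^ 'n \<Rightarrow> real ^ 'n) \<Rightarrow> real ^ ('i::finite \<Rightarrow> 'n) \<Rightarrow> real ^ ('i \<Rightarrow> 'n)" where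
  "mv_map L \<xi> = (\<chi> f. pairing (\<lambda>v. wedge (\<lambda>i. L (v i)) $ f) \<xi>)"

lemma linear_mv_map: "linear (mv_map L)"
  by (rule linearI)
    (simp_all add: mv_map_def vec_eq_iff linear_add[OF linear_pairing] pairing_scale_right)

lemma mv_map_wedge: "linear L \<Longrightarrow> mv_map L (wedge v) = wedge (\<lambda>i. L (v i))"
  by (simp add: mv_map_def vec_eq_iff pairing_wedge alt_form_compose_linear[OF alt_form_wedge])

text \<open>The restriction to multivectors is essential, since \<open>pairing\<close> with
  alternating forms sees only the antisymmetric part of a tensor.\<close>

lemma mv_map_inverse:
  assumes "linear L" "linear M" "\<And>u. M (L u) = u" "\<xi> \<in> multivectors"
  shows "mv_map M (mv_map L \<xi>) = \<xi>"
  using assms(4) unfolding multivectors_def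
  by (induction rule: span_induct_alt)
    (auto simp: linear_0[OF linear_mv_map] linear_add[OF linear_mv_map] linear_scale[OF linear_mv_map] mv_map_wedge assms)

lemma mv_to_chart_inj:
  assumes "c \<in> A" "x \<in> fst c" "\<xi> \<in> multivectors" "\<zeta> \<in> multivectors"
    and "mv_map (to_chart c x) \<xi> = mv_map (to_chart c x) \<zeta>"
  shows "\<xi> = \<zeta>"
  using mv_map_inverse[of "to_chart c x" "from_chart A c x"] linear_to_chart linear_from_chart from_to_chart assms
  by metis

text \<open>The form \<open>dx_f\<close> of the chart \<open>c\<close>, cut off so as to live on the
  whole manifold. Pairings with these forms read off the coordinates of a multivector.\<close>

definition coord_form :: "('x, 'n) chart \<Rightarrow> ('x \<Rightarrow> real) \<Rightarrow> ('i::finite \<Rightarrow> 'n) \<Rightarrow> ('x, 'i, 'n) form" where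
  "coord_form c \<psi> f x v = \<psi> x * wedge (\<lambda>i. to_chart c x (v i)) $ f"

lemma pairing_coord_form: "pairing (coord_form c \<psi> f x) \<xi> = \<psi> x * mv_map (to_chart c x) \<xi> $ f"
  unfolding coord_form_def[abs_def] pairing_scale_left by (simp add: mv_map_def)

lemma test_form_coord_form:
  assumes c: "c \<in> A" and \<psi>: "cutoff \<psi> K" "K \<subseteq> fst c"
  shows "test_form A (coord_form c \<psi> f)"
proof -
  have sm: "smooth_fun \<psi>" and K: "compact K" and \<psi>0: "\<And>x. x \<notin> K \<Longrightarrow> \<psi> x = 0" using \<psi> by (auto simp: cutoff_def)
  have "alt_form (coord_form c \<psi> f x)" for x
  proof (cases "x \<in> K")
    case True
    then have "linear (to_chart c x)" using linear_to_chart[OF c] \<psi>(2) by blast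
    then show ?thesis unfolding coord_form_def[abs_def]
      by (intro alt_form_scale alt_form_compose_linear[OF alt_form_wedge])
  next
    case False
    then show ?thesis by (simp add: coord_form_def[abs_def] \<psi>0 alt_form_def linear_zero)
  qed
  moreover have "smooth_on (chart_img d) (\<lambda>y. form_in_chart A d (coord_form c \<psi> f) y v)" if d: "d \<in> A" for d v
  proof -
    let ?P = "snd d ` (fst d \<inter> fst c)" and ?Q = "chart_img d \<inter> chart_inv d -` (- K)"
    have o: "open ?P" "open ?Q"
      using chart_image_open[OF d chart_open(1)[OF c]] open_overlap[OF d, of "- K"] compact_imp_closed[OF K]
      by (auto simp: open_Compl)
    have PI: "?P \<subseteq> chart_img d" by (auto simp: chart_img_def)
    have 1: "smooth_on ?P (\<lambda>y. frechet_derivative (trans d c) (at y) u $ k)" for u k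
      using smooth_on_inner[OF smooth_on_deriv[OF trans_smooth[OF d c]] o(1), of u "axis k 1"] by (simp add: inner_axis)
    have 2: "smooth_on ?P (\<lambda>y. \<psi> (chart_inv d y))"
      using sm d PI smooth_on_subset unfolding smooth_fun_def by blast
    have "smooth_on ?P (\<lambda>y. \<psi> (chart_inv d y) * det (\<chi> i j. frechet_derivative (trans d c) (at y) (v i) $ f j))"
      using o(1) by (intro smooth_on_mult 2 smooth_on_det) (auto intro: 1)
    then have "smooth_on ?P (\<lambda>y. form_in_chart A d (coord_form c \<psi> f) y v)"
    proof (rule smooth_on_cong[OF _ o(1)])
      fix y assume "y \<in> ?P"
      then obtain x where x: "x \<in> fst d" "x \<in> fst c" "y = snd d x" by blast
      then show "form_in_chart A d (coord_form c \<psi> f) y v =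
          \<psi> (chart_inv d y) * det (\<chi> i j. frechet_derivative (trans d c) (at y) (v i) $ f j)"
        by (simp add: form_in_chart_def coord_form_def chart_inv_chart[OF d] to_chart_from_chart[OF d c] wedge_def dtrans_def)
    qed
    moreover have "smooth_on ?Q (\<lambda>y. form_in_chart A d (coord_form c \<psi> f) y v)"
      by (rule smooth_on_cong[OF smooth_on_const[OF o(2), of 0] o(2)]) (auto simp: form_in_chart_def coord_form_def \<psi>0)
    ultimately have "smooth_on (?P \<union> ?Q) (\<lambda>y. form_in_chart A d (coord_form c \<psi> f) y v)" using o by (intro smooth_on_Un)
    moreover have "chart_img d \<subseteq> ?P \<union> ?Q"
      using \<psi>(2) unfolding overlap_eq[OF d] by blast
    ultimately show ?thesis by (rule smooth_on_subset)
  qed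
  ultimately have "smooth_form A (coord_form c \<psi> f)" by (simp add: smooth_form_def)
  moreover have "compact (form_support (coord_form c \<psi> f))"
    by (rule form_support_subset[OF K]) (simp add: coord_form_def \<psi>0)
  ultimately show ?thesis by (simp add: test_form_def)
qed

subsection \<open>Countability and measures\<close>

text \<open>Every point of \<open>W\<close> has a compact neighbourhood in \<open>W\<close>,
  supplied by a local cutoff, hence a basic open neighbourhood with compact closure in
  \<open>W\<close>; there are only countably many of these.\<close>

lemma open_sigma_compact:
  assumes "open (W :: 'x set)"
  obtains C :: "nat \<Rightarrow> 'x set" where "\<And>n. compact (C n)" "incseq C" "(\<Union>n. C n) = W"
proof -
  obtain B :: "'x set set" where B: "countable B" "topological_basis B" using ex_countable_basis by blast
  define D where "D = {closure b | b. b \<in> B \<and> compact (closure b) \<and> closure b \<subseteq> W}"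
  have "D \<subseteq> closure ` B" by (auto simp: D_def)
  then have "countable D" by (rule countable_subset) (use B(1) in simp)
  then have cD: "countable (insert {} D)" by simp
  define E where "E = from_nat_into (insert {} D)"
  have rE: "range E = insert {} D" unfolding E_def using cD by (intro range_from_nat_into) auto
  have Ec: "compact (E n)" "E n \<subseteq> W" for n
  proof -
    have "E n \<in> insert {} D" using rE by blast
    moreover have "compact X \<and> X \<subseteq> W" if "X \<in> D" for X using that unfolding D_def by blast
    ultimately show "compact (E n)" "E n \<subseteq> W" by auto
  qed
  have "W \<subseteq> \<Union> (range E)"
  proof
    fix x assume x: "x \<in> W"
    obtain \<psi> K V where K: "cutoff \<psi> K" "K \<subseteq> W" "open V" "x \<in> V" "\<And>y. y \<in> V \<Longrightarrow> \<psi> y = 1"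
      using local_cutoff[OF assms x] by blast
    have VK: "V \<subseteq> K" using K(1,5) unfolding cutoff_def by (metis subsetI zero_neq_one)
    obtain b where b: "b \<in> B" "x \<in> b" "b \<subseteq> V" using B(2) K(3,4) topological_basisE by metis
    have "compact K" using K(1) by (simp add: cutoff_def)
    then have "closure b \<subseteq> K" using b VK compact_imp_closed by (intro closure_minimal) auto
    then have "compact (closure b)" using \<open>compact K\<close> compact_Int_closed[of K "closure b"] by (simp add: Int_absorb1)
    moreover have "closure b \<subseteq> W" using \<open>closure b \<subseteq> K\<close> K(2) by simp
    ultimately have "closure b \<in> D" unfolding D_def using b(1) by blast
    then have "closure b \<in> range E" unfolding rE by blast
    moreover have "x \<in> closure b" using b(2) closure_subset[of b] by blast
    ultimately show "x \<in> \<Union> (range E)" by blast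
  qed
  then have "(\<Union>n. E n) = W" using Ec by blast
  then show thesis
    using Ec by (intro that[of "\<lambda>n. \<Union>i\<le>n. E i"]) (auto simp: incseq_def intro!: compact_UN, force+)
qed

lemma cutoff_sequence:
  assumes "open (W :: 'x set)"
  obtains \<psi> K where "\<And>n::nat. cutoff (\<psi> n) (K n)" "\<And>x. (\<lambda>n. \<psi> n x) \<longlonglongrightarrow> indicator W x"
proof -
  obtain C :: "nat \<Rightarrow> 'x set" where C: "\<And>n. compact (C n)" "incseq C" "(\<Union>n. C n) = W"
    using open_sigma_compact[OF assms] by blast
  have "\<exists>\<psi> K. cutoff \<psi> K \<and> K \<subseteq> W \<and> (\<forall>x\<in>C n. \<psi> x = 1)" for n
    using compact_cutoff[OF C(1) _ assms, of n] C(3) by (metis UN_upper UNIV_I subsetD)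
  then obtain \<psi> K where X: "\<And>n. cutoff (\<psi> n) (K n)" "\<And>n. K n \<subseteq> W" "\<And>n x. x \<in> C n \<Longrightarrow> \<psi> n x = 1"
    by metis
  show thesis
  proof (rule that[OF X(1)])
    fix x
    show "(\<lambda>n. \<psi> n x) \<longlonglongrightarrow> indicator W x"
    proof (cases "x \<in> W")
      case True
      then obtain m where "x \<in> C m" using C(3) by blast
      then have "\<psi> n x = 1" if "n \<ge> m" for n using that C(2) X(3) by (meson incseqD subsetD)
      then have "eventually (\<lambda>n. \<psi> n x = 1) sequentially" by (auto simp: eventually_sequentially)
      then show ?thesis using True by (simp add: tendsto_eventually)
    next
      case False
      then have "\<psi> n x = 0" for n using X(1,2) unfolding cutoff_def by blast
      then show ?thesis using False by simp
    qed
  qed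
qed

text \<open>By Lindelof countably many plateaus of local cutoffs suffice, so that statements about
  almost every point can be checked chart by chart.\<close>

lemma countable_cutoff_cover:
  obtains c :: "nat \<Rightarrow> ('x, 'n) chart" and \<psi> K V where "\<And>n. c n \<in> A" "\<And>n. cutoff (\<psi> n) (K n)" "\<And>n. K n \<subseteq> fst (c n)"
    "\<And>n. open (V n)" "\<And>n x. x \<in> V n \<Longrightarrow> \<psi> n x = 1" "(\<Union>n. V n) = UNIV"
proof -
  define P where "P V c \<psi> K \<longleftrightarrow> c \<in> A \<and> cutoff \<psi> K \<and> K \<subseteq> fst c \<and> open V \<and> (\<forall>x\<in>V. \<psi> x = 1)" for V :: "'x set" and c \<psi> K
  define F where "F = {V. \<exists>c \<psi> K. P V c \<psi> K}"
  have "\<Union>F = UNIV"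
  proof -
    have "x \<in> \<Union>F" for x
    proof -
      obtain c where c: "c \<in> A" "x \<in> fst c" using chart_cover by blast
      obtain \<psi> K V where "cutoff \<psi> K" "K \<subseteq> fst c" "open V" "x \<in> V" "\<And>y. y \<in> V \<Longrightarrow> \<psi> y = 1"
        using local_cutoff[OF chart_open(1)[OF c(1)] c(2)] by blast
      then show ?thesis using c unfolding F_def P_def by blast
    qed
    then show ?thesis by blast
  qed
  moreover have "\<And>S. S \<in> F \<Longrightarrow> open S" by (auto simp: F_def P_def)
  ultimately obtain F' where F': "F' \<subseteq> F" "countable F'" "\<Union>F' = UNIV"
    using Lindelof[of F] by metis
  have "F' \<noteq> {}" using F'(3) by auto
  define V where "V = from_nat_into F'"
  have rV: "range V = F'" unfolding V_def by (intro range_from_nat_into \<open>F' \<noteq> {}\<close> F'(2))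
  then have "\<forall>n. \<exists>c \<psi> K. P (V n) c \<psi> K" using F'(1) F_def by blast
  then obtain c \<psi> K where "\<And>n. P (V n) (c n) (\<psi> n) (K n)" by metis
  then show thesis using that[of c \<psi> K V] F'(3) rV unfolding P_def by blast
qed

section \<open>Comparison of signed measures through cutoff functions\<close>

lemma cutoff_measurable: "cutoff \<psi> K \<Longrightarrow> \<psi> \<in> borel_measurable borel"
  using smooth_fun_continuous by (auto simp: cutoff_def intro: borel_measurable_continuous_onI)

text \<open>The signed measures that are compared are \<open>h \<mu>\<close> and the image of \<open>j \<rho>\<close> under \<open>\<pi>\<close>.\<close>

lemma measures_agree_sets:
  fixes \<mu> :: "'x measure" and h :: "'x \<Rightarrow> real"
  assumes \<mu>: "sets \<mu> = sets borel" and h: "integrable \<mu> h"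
    and \<pi>: "\<pi> \<in> measurable \<rho> borel" and j: "integrable \<rho> j"
    and eq: "\<And>\<psi> K. cutoff \<psi> K \<Longrightarrow> (LINT x|\<mu>. \<psi> x * h x) = (LINT y|\<rho>. \<psi> (\<pi> y) * j y)"
    and B: "B \<in> sets borel"
  shows "(LINT x|\<mu>. indicator B x * h x) = (LINT y|\<rho>. indicator B (\<pi> y) * j y)"
proof -
  note [measurable_cong] = \<mu>
  note [measurable] = \<pi> borel_measurable_integrable[OF h] borel_measurable_integrable[OF j]
  have op: "(LINT x|\<mu>. indicator W x * h x) = (LINT y|\<rho>. indicator W (\<pi> y) * j y)" if W: "open W" for W
  proof -
    obtain \<psi> K where \<psi>: "\<And>n::nat. cutoff (\<psi> n) (K n)" "\<And>x. (\<lambda>n. \<psi> n x) \<longlonglongrightarrow> indicator W x"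
      using cutoff_sequence[OF W] by blast
    have [measurable]: "\<psi> n \<in> borel_measurable borel" for n using cutoff_measurable[OF \<psi>(1)] .
    have [measurable]: "W \<in> sets borel" using W by simp
    have bd: "\<bar>\<psi> n x\<bar> \<le> 1" for n x using \<psi>(1)[of n] unfolding cutoff_def by (metis abs_of_nonneg)
    have "(\<lambda>n. LINT x|\<mu>. \<psi> n x * h x) \<longlonglongrightarrow> (LINT x|\<mu>. indicator W x * h x)"
      by (rule integral_dominated_convergence[where w = "\<lambda>x. \<bar>h x\<bar>"])
        (use h bd in \<open>auto intro!: tendsto_mult \<psi>(2) mult_left_le_one_le simp: abs_mult\<close>)
    moreover have "(\<lambda>n. LINT y|\<rho>. \<psi> n (\<pi> y) * j y) \<longlonglongrightarrow> (LINT y|\<rho>. indicator W (\<pi> y) * j y)"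
      by (rule integral_dominated_convergence[where w = "\<lambda>x. \<bar>j x\<bar>"])
        (use j bd in \<open>auto intro!: tendsto_mult \<psi>(2) mult_left_le_one_le simp: abs_mult\<close>)
    ultimately show ?thesis using eq[OF \<psi>(1)] LIMSEQ_unique by simp
  qed
  have ib: "\<bar>indicator U z * r\<bar> \<le> \<bar>r :: real\<bar>" for U and z :: 'x and r by (simp add: indicator_def)
  have ind: "integrable \<mu> (\<lambda>x. indicator B x * h x)" "integrable \<rho> (\<lambda>y. indicator B (\<pi> y) * j y)"
    if [measurable]: "B \<in> sets borel" for B
    by (rule Bochner_Integration.integrable_bound[OF h] Bochner_Integration.integrable_bound[OF j];
      auto simp: indicator_def)+
  have stb: "Int_stable {S :: 'x set. open S}" by (auto simp: Int_stable_def)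
  have pow: "{S :: 'x set. open S} \<subseteq> Pow UNIV" by simp
  \<comment> \<open>Dynkin induction starting from the open sets, whose indicators are limits of
    cutoffs. The measures are signed, so each step rests on integrability instead of
    monotonicity.\<close>
  show ?thesis
    using stb pow B[unfolded sets_borel]
  proof (induction rule: sigma_sets_induct_disjoint)
    case (basic W) then show ?case using op by simp
  next
    case empty then show ?case by simp
  next
    case (compl B)
    then have B: "B \<in> sets borel" by (simp add: sets_borel)
    have "(LINT x|\<mu>. indicator (UNIV - B) x * h x) = (LINT x|\<mu>. indicator UNIV x * h x - indicator B x * h x)"
      by (intro Bochner_Integration.integral_cong) (auto simp: indicator_def)
    also have "\<dots> = (LINT x|\<mu>. indicator UNIV x * h x) - (LINT x|\<mu>. indicator B x * h x)"
      using ind(1)[OF B] ind(1)[of UNIV] by (intro Bochner_Integration.integral_diff) auto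
    also have "\<dots> = (LINT y|\<rho>. indicator UNIV (\<pi> y) * j y) - (LINT y|\<rho>. indicator B (\<pi> y) * j y)"
      using compl op[of UNIV] by simp
    also have "\<dots> = (LINT y|\<rho>. indicator UNIV (\<pi> y) * j y - indicator B (\<pi> y) * j y)"
      using ind(2)[OF B] ind(2)[of UNIV] by (intro Bochner_Integration.integral_diff[symmetric]) auto
    also have "\<dots> = (LINT y|\<rho>. indicator (UNIV - B) (\<pi> y) * j y)"
      by (intro Bochner_Integration.integral_cong) (auto simp: indicator_def)
    finally show ?case .
  next
    case (union B)
    then have B[measurable]: "\<And>n. B n \<in> sets borel" by (auto simp: sets_borel)
    let ?U = "\<lambda>n. \<Union>i<n. B i"
    have [measurable]: "(\<Union>n. B n) \<in> sets borel" "?U n \<in> sets borel" for n by auto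
    have lim: "(\<lambda>n. indicator (?U n) x) \<longlonglongrightarrow> (indicator (\<Union>n. B n) x :: real)" for x
    proof -
      have "eventually (\<lambda>n. indicator (?U n) x = (indicator (\<Union>n. B n) x :: real)) sequentially"
      proof (cases "x \<in> (\<Union>n. B n)")
        case True
        then obtain m where "x \<in> B m" by blast
        then show ?thesis using True by (intro eventually_sequentiallyI[of "Suc m"]) (auto simp: indicator_def)
      qed (auto simp: indicator_def)
      then show ?thesis by (rule tendsto_eventually)
    qed
    have sum: "indicator (?U n) x = (\<Sum>i<n. indicator (B i) x :: real)" for n x
      using union(1) by (intro indicator_UN_disjoint) (auto simp: disjoint_family_on_def)
    have "(LINT x|\<mu>. indicator (?U n) x * h x) = (LINT y|\<rho>. indicator (?U n) (\<pi> y) * j y)" for n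
    proof -
      have "(LINT x|\<mu>. indicator (?U n) x * h x) = (\<Sum>i<n. LINT x|\<mu>. indicator (B i) x * h x)"
        unfolding sum sum_distrib_right by (rule Bochner_Integration.integral_sum) (rule ind(1)[OF B])
      moreover have "(LINT y|\<rho>. indicator (?U n) (\<pi> y) * j y) = (\<Sum>i<n. LINT y|\<rho>. indicator (B i) (\<pi> y) * j y)"
        unfolding sum sum_distrib_right by (rule Bochner_Integration.integral_sum) (rule ind(2)[OF B])
      ultimately show ?thesis using union by simp
    qed
    moreover have "(\<lambda>n. LINT x|\<mu>. indicator (?U n) x * h x) \<longlonglongrightarrow> (LINT x|\<mu>. indicator (\<Union>n. B n) x * h x)"
      by (rule integral_dominated_convergence[where w = "\<lambda>x. \<bar>h x\<bar>"])
        (use h in \<open>auto intro!: tendsto_mult lim simp: ib\<close>)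
    moreover have "(\<lambda>n. LINT y|\<rho>. indicator (?U n) (\<pi> y) * j y) \<longlonglongrightarrow> (LINT y|\<rho>. indicator (\<Union>n. B n) (\<pi> y) * j y)"
      by (rule integral_dominated_convergence[where w = "\<lambda>x. \<bar>j x\<bar>"])
        (use j in \<open>auto intro!: tendsto_mult lim simp: ib\<close>)
    ultimately show ?case using LIMSEQ_unique by simp
  qed
qed

lemma measures_agree:
  fixes \<mu> :: "'x measure" and h b :: "'x \<Rightarrow> real"
  assumes \<mu>: "sets \<mu> = sets borel" and h: "integrable \<mu> h"
    and \<pi>: "\<pi> \<in> measurable \<rho> borel" and j: "integrable \<rho> j"
    and eq: "\<And>\<psi> K. cutoff \<psi> K \<Longrightarrow> (LINT x|\<mu>. \<psi> x * h x) = (LINT y|\<rho>. \<psi> (\<pi> y) * j y)"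
    and b: "b \<in> borel_measurable borel" and bd: "\<And>x. \<bar>b x\<bar> \<le> C"
  shows "(LINT x|\<mu>. b x * h x) = (LINT y|\<rho>. b (\<pi> y) * j y)"
proof -
  note [measurable_cong] = \<mu>
  note [measurable] = \<pi> borel_measurable_integrable[OF h] borel_measurable_integrable[OF j] b
  obtain F where F: "\<And>i. simple_function borel (F i)" "\<And>x. (\<lambda>i. F i x) \<longlonglongrightarrow> b x" "\<And>i x. \<bar>F i x\<bar> \<le> 2 * \<bar>b x\<bar>"
    using borel_measurable_implies_sequence_metric[OF b, of 0] by (auto simp: dist_real_def)
  have [measurable]: "F i \<in> borel_measurable borel" for i using F(1) by (rule borel_measurable_simple_function)
  have Fb: "\<bar>F i x\<bar> \<le> 2 * C" for i x using F(3)[of i x] bd[of x] by linarith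
  have step: "(LINT x|\<mu>. F i x * h x) = (LINT y|\<rho>. F i (\<pi> y) * j y)" for i
  proof -
    have fin: "finite (range (F i))" using F(1)[of i] by (simp add: simple_function_def)
    have Fs: "F i -` {z} \<in> sets borel" for z
      using measurable_sets[of "F i" borel borel "{z}"] by simp
    have rep: "F i x = (\<Sum>z\<in>range (F i). z * indicator (F i -` {z}) x)" for x
      using fin by (simp add: indicator_def if_distrib cong: if_cong)
    have 1: "integrable \<mu> (\<lambda>x. z * (indicator (F i -` {z}) x * h x))" for z
      by (rule integrable_mult_right, rule Bochner_Integration.integrable_bound[OF h])
        (use Fs[of z] in \<open>auto simp: indicator_def\<close>)
    have 2: "integrable \<rho> (\<lambda>y. z * (indicator (F i -` {z}) (\<pi> y) * j y))" for z
      by (rule integrable_mult_right, rule Bochner_Integration.integrable_bound[OF j])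
        (use Fs[of z] in \<open>auto simp: indicator_def\<close>)
    have "(LINT x|\<mu>. F i x * h x) = (LINT x|\<mu>. (\<Sum>z\<in>range (F i). z * (indicator (F i -` {z}) x * h x)))"
      by (subst rep) (simp add: sum_distrib_right mult.assoc)
    also have "\<dots> = (\<Sum>z\<in>range (F i). z * (LINT x|\<mu>. indicator (F i -` {z}) x * h x))"
      using 1 by (subst Bochner_Integration.integral_sum) auto
    also have "\<dots> = (\<Sum>z\<in>range (F i). z * (LINT y|\<rho>. indicator (F i -` {z}) (\<pi> y) * j y))"
      by (simp add: measures_agree_sets[OF \<mu> h \<pi> j eq Fs])
    also have "\<dots> = (LINT y|\<rho>. (\<Sum>z\<in>range (F i). z * (indicator (F i -` {z}) (\<pi> y) * j y)))"
      using 2 by (subst Bochner_Integration.integral_sum) auto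
    also have "\<dots> = (LINT y|\<rho>. F i (\<pi> y) * j y)"
      by (simp only: rep[of "\<pi> _"] sum_distrib_right mult.assoc)
    finally show ?thesis .
  qed
  have C: "C \<ge> 0" using bd[of undefined] by simp
  have "(\<lambda>i. LINT x|\<mu>. F i x * h x) \<longlonglongrightarrow> (LINT x|\<mu>. b x * h x)"
    by (rule integral_dominated_convergence[where w = "\<lambda>x. 2 * C * \<bar>h x\<bar>"])
      (use h Fb C in \<open>auto intro!: tendsto_mult F(2) mult_right_mono simp: abs_mult\<close>)
  moreover have "(\<lambda>i. LINT y|\<rho>. F i (\<pi> y) * j y) \<longlonglongrightarrow> (LINT y|\<rho>. b (\<pi> y) * j y)"
    by (rule integral_dominated_convergence[where w = "\<lambda>x. 2 * C * \<bar>j x\<bar>"])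
      (use j Fb C in \<open>auto intro!: tendsto_mult F(2) mult_right_mono simp: abs_mult\<close>)
  ultimately show ?thesis unfolding step using LIMSEQ_unique by blast
qed

lemma AE_zero_of_sets:
  fixes h :: "'x \<Rightarrow> real"
  assumes "sets \<mu> = sets borel" and h: "integrable \<mu> h"
    and 0: "\<And>B. B \<in> sets borel \<Longrightarrow> (LINT x|\<mu>. indicator B x * h x) = 0"
  shows "AE x in \<mu>. h x = 0"
proof -
  note [measurable_cong] = assms(1)
  note [measurable] = borel_measurable_integrable[OF h]
  have S: "{x. h x > 0} \<in> sets borel" "{x. h x < 0} \<in> sets borel"
  proof -
    have "{x \<in> space \<mu>. h x > 0} \<in> sets \<mu>" "{x \<in> space \<mu>. h x < 0} \<in> sets \<mu>" by measurable
    then show "{x. h x > 0} \<in> sets borel" "{x. h x < 0} \<in> sets borel"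
      using assms(1) sets_eq_imp_space_eq[OF assms(1)] by auto
  qed
  have ab: "indicator {x. h x > 0} x * h x = \<bar>h x\<bar> + indicator {x. h x < 0} x * h x" for x
    by (auto simp: indicator_def)
  have i: "integrable \<mu> (\<lambda>x. indicator {x. h x < 0} x * h x)"
    by (rule Bochner_Integration.integrable_bound[OF h]) (use S in \<open>auto simp: indicator_def\<close>)
  have "(LINT x|\<mu>. \<bar>h x\<bar>) = 0"
    using 0[OF S(1)] 0[OF S(2)] i h unfolding ab by simp
  then show ?thesis using integral_nonneg_eq_0_iff_AE[of \<mu> "\<lambda>x. \<bar>h x\<bar>"] h by simp
qed

end

section \<open>Rectifiable currents have simple multivectors\<close>

lemma wedge_dependent:
  fixes v :: "'i::finite \<Rightarrow> real ^ 'n::finite"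
  assumes c: "c \<noteq> 0" and z: "(\<Sum>i\<in>UNIV. c $ i *\<^sub>R v i) = 0"
  shows "wedge v = 0"
proof -
  have "det (\<chi> i j. v i $ f j) = 0" for f
  proof (rule ccontr)
    assume "det (\<chi> i j. v i $ f j) \<noteq> 0"
    define A where "A = (\<chi> i j. v i $ f j)"
    have "det (transpose A) \<noteq> 0" using \<open>det _ \<noteq> 0\<close> by (simp add: A_def)
    then have "invertible (transpose A)" by (simp add: invertible_det_nz)
    then obtain B where B: "B ** transpose A = mat 1" by (auto simp: invertible_def)
    have "(transpose A *v c) $ j = (\<Sum>i\<in>UNIV. c $ i *\<^sub>R v i) $ f j" for j
      by (simp add: A_def transpose_def matrix_vector_mult_def mult.commute)
    then have "transpose A *v c = 0" by (simp add: z vec_eq_iff)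
    then have "(B ** transpose A) *v c = 0"
      by (simp only: matrix_vector_mul_assoc[symmetric] matrix_vector_mult_0_right)
    then show False using c by (simp only: B matrix_vector_mul_lid)
  qed
  then show ?thesis by (simp add: wedge_def vec_eq_iff)
qed

interpretation dot: symmetric_form "(\<bullet>) :: real ^ 'n::finite \<Rightarrow> _"
  by unfold_locales (auto simp: bilinear_def linear_iff inner_simps inner_commute)

lemma wedge_frame_nonzero: "dot.frame e \<Longrightarrow> wedge e \<noteq> 0"
  using dot.ip_frame[of e] dot.pairing_ip[of e e] linear_0[OF linear_pairing] by (metis zero_neq_one)

text \<open>Independent vectors are \<open>positive\<close> for the Euclidean inner product, so
  their wedge is a positive multiple of that of an orthonormal frame.\<close>

lemma wedge_independent:
  fixes v :: "'i::finite \<Rightarrow> real ^ 'n::finite"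
  assumes "\<And>c. c \<noteq> 0 \<Longrightarrow> (\<Sum>i\<in>UNIV. c $ i *\<^sub>R v i) \<noteq> 0"
  shows "wedge v \<noteq> 0"
proof -
  have "dot.positive v"
    unfolding dot.positive_def
  proof (intro allI impI)
    fix c :: "'i \<Rightarrow> real" assume "c \<noteq> (\<lambda>_. 0)"
    then have "(\<chi> i. c i) \<noteq> 0" by (auto simp: vec_eq_iff fun_eq_iff)
    from assms[OF this] show "(\<Sum>i\<in>UNIV. c i *\<^sub>R v i) \<bullet> (\<Sum>i\<in>UNIV. c i *\<^sub>R v i) > 0" by simp
  qed
  then obtain e :: "'i \<Rightarrow> real ^ 'n" and m where "dot.frame e" "m > 0" "wedge v = m *\<^sub>R wedge e"
    by (rule dot.orthonormalize)
  then show ?thesis using wedge_frame_nonzero by simp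
qed

subsection \<open>Derivatives of Lipschitz maps\<close>

text \<open>A Borel function, defined everywhere, that gives the partial derivatives where \<open>F\<close> is
  differentiable. At other points the limits may be junk.\<close>

definition jac :: "(real ^ 'i::finite \<Rightarrow> real ^ 'n::finite) \<Rightarrow> real ^ 'i \<Rightarrow> 'i \<Rightarrow> real ^ 'n" where
  "jac F y i = (\<chi> l. lim (\<lambda>n. (F (y + (1 / real (Suc n)) *\<^sub>R axis i 1) $ l - F y $ l) * real (Suc n)))"

lemma jac_eq:
  assumes "F differentiable (at y)"
  shows "jac F y i = frechet_derivative F (at y) (axis i 1)"
proof -
  let ?D = "frechet_derivative F (at y)"
  have D: "(F has_derivative ?D) (at y)" using assms frechet_derivative_works by blast
  have "(\<lambda>n. (F (y + (1 / real (Suc n)) *\<^sub>R axis i 1) $ l - F y $ l) * real (Suc n)) \<longlonglongrightarrow> ?D (axis i 1) $ l" for l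
  proof -
    have "((\<lambda>h. F (y + h *\<^sub>R axis i 1)) has_derivative (\<lambda>h. ?D (h *\<^sub>R axis i 1))) (at 0)"
      by (rule has_derivative_compose[of "\<lambda>h. y + h *\<^sub>R axis i 1" "\<lambda>h. h *\<^sub>R axis i 1" 0 UNIV F ?D])
        (use D in \<open>auto intro!: derivative_eq_intros\<close>)
    then have "((\<lambda>h. F (y + h *\<^sub>R axis i 1) $ l) has_derivative (\<lambda>h. ?D (h *\<^sub>R axis i 1) $ l)) (at 0)"
      by (rule bounded_linear.has_derivative[OF bounded_linear_vec_nth])
    then have "((\<lambda>h. F (y + h *\<^sub>R axis i 1) $ l) has_real_derivative ?D (axis i 1) $ l) (at 0)"
      using linear_scale[OF has_derivative_linear[OF D]] by (simp add: has_field_derivative_def mult.commute[of _ "frechet_derivative F (at y) (axis i 1) $ l"])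
    then have "((\<lambda>h. (F (y + h *\<^sub>R axis i 1) $ l - F y $ l) / h) \<longlongrightarrow> ?D (axis i 1) $ l) (at 0)"
      by (simp add: DERIV_def)
    then have "(\<lambda>n. (F (y + (1 / real (Suc n)) *\<^sub>R axis i 1) $ l - F y $ l) / (1 / real (Suc n))) \<longlonglongrightarrow> ?D (axis i 1) $ l"
    proof (rule filterlim_compose)
      have "(\<lambda>n. 1 / real (Suc n)) \<longlonglongrightarrow> 0"
        using LIMSEQ_inverse_real_of_nat by (simp add: inverse_eq_divide)
      then show "filterlim (\<lambda>n. 1 / real (Suc n)) (at 0) sequentially"
        by (auto simp: filterlim_at simp del: of_nat_Suc)
    qed
    then show ?thesis by (simp del: of_nat_Suc)
  qed
  then show ?thesis by (simp add: jac_def vec_eq_iff limI del: of_nat_Suc)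
qed

lemma jac_measurable:
  assumes "continuous_on UNIV F"
  shows "(\<lambda>y. jac F y i $ l) \<in> borel_measurable borel"
proof -
  have "continuous_on UNIV (\<lambda>y. F (y + c))" for c
    by (rule continuous_on_compose2[OF assms]) (auto intro: continuous_intros)
  then have "continuous_on UNIV (\<lambda>y. (F (y + c) $ l - F y $ l) * r)" for c r
    by (intro continuous_intros assms)
  then have [measurable]: "(\<lambda>y. (F (y + c) $ l - F y $ l) * r) \<in> borel_measurable borel" for c r
    by (rule borel_measurable_continuous_onI)
  show ?thesis unfolding jac_def vec_lambda_beta by measurable
qed

text \<open>Inner regularity: removing a null set leaves countably many compact sets, whose images
  under continuous maps are again compact.\<close>

lemma regular_compact_pieces:
  fixes Q :: "'a::euclidean_space set"
  assumes Q: "compact Q" and N: "negligible N"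
  obtains C :: "nat \<Rightarrow> 'a set" and N' where "\<And>n. compact (C n)" "\<And>n. C n \<subseteq> Q - N" "negligible N'" "Q - N' \<subseteq> (\<Union>n. C n)"
proof -
  have S: "Q - N \<in> sets lebesgue"
    using Q N by (auto intro!: sets.Diff simp: negligible_iff_null_sets compact_imp_closed)
  have "\<exists>T. closed T \<and> T \<subseteq> Q - N \<and> emeasure lebesgue (Q - N - T) < ennreal (1 / real (Suc n)) \<and> Q - N - T \<in> sets lebesgue" for n
    using sets_lebesgue_inner_closed[OF S, of "1 / real (Suc n)"] by (metis fmeasurableD of_nat_0_less_iff zero_less_Suc zero_less_divide_1_iff)
  then obtain T where T: "\<And>n. closed (T n)" "\<And>n. T n \<subseteq> Q - N" "\<And>n. emeasure lebesgue (Q - N - T n) < ennreal (1 / real (Suc n))"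
    "\<And>n. Q - N - T n \<in> sets lebesgue"
    by metis
  let ?R = "Q - N - (\<Union>n. T n)"
  have R: "?R \<in> sets lebesgue" using S T(1) by (auto intro!: sets.Diff sets.countable_UN)
  have "emeasure lebesgue ?R \<le> ennreal (1 / real (Suc n))" for n
    using emeasure_mono[of ?R "Q - N - T n" lebesgue] T(3)[of n] T(4)[of n] by (auto intro: order_trans less_imp_le)
  moreover have "(\<lambda>n. ennreal (1 / real (Suc n))) \<longlonglongrightarrow> ennreal 0"
    by (intro tendsto_ennrealI) (use LIMSEQ_inverse_real_of_nat in \<open>simp add: inverse_eq_divide\<close>)
  ultimately have "emeasure lebesgue ?R \<le> ennreal 0" by (rule_tac LIMSEQ_le_const) auto
  then have "negligible ?R" using R by (simp add: negligible_iff_null_sets null_sets_def)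
  then have "negligible (N \<union> ?R)" using N by (rule_tac negligible_Un)
  moreover have "compact (T n)" for n using T(1,2)[of n] Q by (metis Diff_subset compact_Int_closed inf.absorb2 order_trans)
  ultimately show thesis using T(2) by (intro that[of T "N \<union> ?R"]) auto
qed

text \<open>An injective derivative at \<open>y\<close> bounds the increments of \<open>F\<close>
  from below near \<open>y\<close>, at some scale and with some constant. Sorting such points by
  scale and by a nearby centre from a countable dense set makes the bound uniform on each
  class.\<close>

lemma bilipschitz_pieces:
  fixes F :: "real ^ 'i::finite \<Rightarrow> real ^ 'n::finite"
  assumes lip: "L-lipschitz_on UNIV F" and K: "compact K"
  obtains P :: "nat \<Rightarrow> (real ^ 'i) set" and \<delta> N where "\<And>j. compact (P j)" "\<And>j. P j \<subseteq> K" "\<And>j. \<delta> j > 0"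
    "\<And>j y z. y \<in> P j \<Longrightarrow> z \<in> P j \<Longrightarrow> \<delta> j * norm (z - y) \<le> norm (F z - F y)"
    "\<And>j y. y \<in> P j \<Longrightarrow> F differentiable (at y) \<and> inj (frechet_derivative F (at y))"
    "negligible N" "\<And>y. y \<in> K - N \<Longrightarrow> F differentiable (at y) \<and>
       (y \<in> (\<Union>j. P j) \<or> \<not> inj (frechet_derivative F (at y)))"
proof -
  obtain N0 where N0: "negligible N0" "\<And>x. x \<notin> N0 \<Longrightarrow> F differentiable (at x)"
    using Rademacher[OF lip] by blast
  obtain D where D: "countable D" "\<And>(v::real ^ 'i) e. e > 0 \<Longrightarrow> \<exists>w\<in>D. dist w v < e"
    using countable_dense_setE[where 'a="real ^ 'i"]
    by (metis (mono_tags, lifting) centre_in_ball ex_in_conv mem_ball dist_commute open_ball)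
  have "D \<noteq> {}" using D(2)[of 1 0] by auto
  \<comment> \<open>The number \<open>1 / Suc j\<close> is both the scale and the lower Lipschitz
    constant. Balls of a third of this radius keep any two points of \<open>Q j a\<close> within the
    scale.\<close>
  define Q where "Q j a = K \<inter> cball a (1 / (3 * real (Suc j))) \<inter>
     {y. \<forall>z. norm (z - y) \<le> 1 / real (Suc j) \<longrightarrow> norm (F z - F y) \<ge> norm (z - y) / real (Suc j)}" for j a
  have cF: "continuous_on UNIV F" by (rule lipschitz_on_continuous_on[OF lip])
  have Qc: "compact (Q j a)" for j a
  proof -
    have "{y. \<forall>z. norm (z - y) \<le> 1 / real (Suc j) \<longrightarrow> norm (F z - F y) \<ge> norm (z - y) / real (Suc j)} =
      (\<Inter>u\<in>cball 0 (1 / real (Suc j)). {y. norm (F (y + u) - F y) \<ge> norm u / real (Suc j)})" (is "?A = ?B")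
    proof (intro equalityI subsetI)
      fix y assume "y \<in> ?A"
      then show "y \<in> ?B" by (auto dest: spec[of _ "y + _"])
    next
      fix y assume y: "y \<in> ?B"
      show "y \<in> ?A"
      proof (intro CollectI allI impI)
        fix z assume "norm (z - y) \<le> 1 / real (Suc j)"
        then have "z - y \<in> cball 0 (1 / real (Suc j))" by (simp add: norm_minus_commute)
        then have "norm (F (y + (z - y)) - F y) \<ge> norm (z - y) / real (Suc j)" using y by blast
        then show "norm (F z - F y) \<ge> norm (z - y) / real (Suc j)" by simp
      qed
    qed
    moreover have "closed ?B"
    proof (intro closed_INT ballI closed_Collect_le continuous_intros)
      fix u show "continuous_on UNIV (\<lambda>y. F (y + u))"
        by (rule continuous_on_compose2[OF cF]) (auto intro: continuous_intros)
    qed (rule cF)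
    ultimately show ?thesis unfolding Q_def
      by (intro compact_Int_closed K) auto
  qed
  have "\<exists>C N'. (\<forall>n. compact (C n)) \<and> (\<forall>n. C n \<subseteq> Q j a - N0) \<and> negligible N' \<and> Q j a - N' \<subseteq> (\<Union>n::nat. C n)" for j a
    using regular_compact_pieces[OF Qc[of j a] N0(1)] by metis
  then obtain C N' where C: "\<And>j a n. compact (C j a n)" "\<And>j a n. C j a n \<subseteq> Q j a - N0" "\<And>j a. negligible (N' j a)"
    "\<And>j a. Q j a - N' j a \<subseteq> (\<Union>n::nat. C j a n)"
    by metis
  \<comment> \<open>Decodes one natural number into scale, centre and compact piece.\<close>
  define dec where "dec m = (fst (prod_decode m), from_nat_into D (fst (prod_decode (snd (prod_decode m)))), snd (prod_decode (snd (prod_decode m))))" for m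
  define P where "P m = (case dec m of (j, a, n) \<Rightarrow> C j a n)" for m
  define \<delta> where "\<delta> m = (case dec m of (j, a, n) \<Rightarrow> 1 / real (Suc j))" for m
  define N where "N = N0 \<union> (\<Union>(j, a)\<in>UNIV \<times> D. N' j a)"
  have PQ: "\<exists>j a. P m \<subseteq> Q j a - N0 \<and> \<delta> m = 1 / real (Suc j)" for m
  proof -
    obtain j a n where "dec m = (j, a, n)" by (metis surj_pair)
    then show ?thesis using C(2)[of j a n] unfolding P_def \<delta>_def by auto
  qed
  have bil: "\<delta> m * norm (z - y) \<le> norm (F z - F y)" if "y \<in> P m" "z \<in> P m" for m y z
  proof -
    obtain j a where ja: "P m \<subseteq> Q j a - N0" "\<delta> m = 1 / real (Suc j)" using PQ by blast
    have "dist a y \<le> 1 / (3 * real (Suc j))" "dist a z \<le> 1 / (3 * real (Suc j))" using that ja unfolding Q_def by auto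
    then have "dist z y \<le> 1 / (3 * real (Suc j)) + 1 / (3 * real (Suc j))"
      using dist_triangle3[of z y a] by linarith
    also have "\<dots> \<le> 1 / real (Suc j)" by (simp add: field_simps)
    finally have "norm (z - y) \<le> 1 / real (Suc j)" by (simp add: dist_norm)
    moreover have "y \<in> Q j a" using that ja by blast
    ultimately have "norm (z - y) / real (Suc j) \<le> norm (F z - F y)" unfolding Q_def by blast
    then show ?thesis using ja(2) by simp
  qed
  have dif: "F differentiable (at y) \<and> inj (frechet_derivative F (at y))" if "y \<in> P m" for m y
  proof
    obtain j a where ja: "P m \<subseteq> Q j a - N0" "\<delta> m = 1 / real (Suc j)" using PQ by blast
    then show "F differentiable (at y)" using N0(2) that by blast
    then have D: "(F has_derivative frechet_derivative F (at y)) (at y)" using frechet_derivative_works by blast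
    let ?D = "frechet_derivative F (at y)"
    have yQ: "norm (F z - F y) \<ge> norm (z - y) / real (Suc j)" if "norm (z - y) \<le> 1 / real (Suc j)" for z
      using \<open>y \<in> P m\<close> ja that unfolding Q_def by blast
    have lD: "linear ?D" using has_derivative_linear[OF D] .
    show "inj ?D"
    proof (rule ccontr)
      assume "\<not> inj ?D"
      then obtain u where u: "?D u = 0" "u \<noteq> 0" using linear_injective_0[OF lD] by blast
      obtain d where d: "d > 0" "\<And>z. norm (z - y) < d \<Longrightarrow> norm (F z - F y - ?D (z - y)) \<le> 1 / (2 * real (Suc j)) * norm (z - y)"
        using D unfolding has_derivative_at_alt by (metis divide_pos_pos mult_pos_pos of_nat_0_less_iff zero_less_Suc zero_less_numeral zero_less_one)
      define t where "t = min (d / 2) (1 / real (Suc j)) / norm u"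
      have t: "t > 0" using d u by (simp add: t_def)
      have "norm (t *\<^sub>R u) = t * norm u" using t by simp
      then have ntu: "norm (t *\<^sub>R u) = min (d / 2) (1 / real (Suc j))" using u by (simp add: t_def)
      have "norm (F (y + t *\<^sub>R u) - F y) \<le> 1 / (2 * real (Suc j)) * norm (t *\<^sub>R u)"
        using d(2)[of "y + t *\<^sub>R u"] d(1) ntu u(1) linear_scale[OF lD, of t u] by simp
      moreover have "norm (F (y + t *\<^sub>R u) - F y) \<ge> norm (t *\<^sub>R u) / real (Suc j)"
        using yQ[of "y + t *\<^sub>R u"] ntu by simp
      moreover have "1 / (2 * real (Suc j)) * norm (t *\<^sub>R u) > 0" using t u by simp
      moreover have "norm (t *\<^sub>R u) / real (Suc j) = 2 * (1 / (2 * real (Suc j)) * norm (t *\<^sub>R u))"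
        by (simp add: field_simps del: norm_scaleR)
      ultimately show False by linarith
    qed
  qed
  have cov: "y \<in> (\<Union>m. P m) \<or> \<not> inj (frechet_derivative F (at y))" if y: "y \<in> K - N" for y
  proof (cases "inj (frechet_derivative F (at y))")
    case True
    let ?D = "frechet_derivative F (at y)"
    have der: "(F has_derivative ?D) (at y)" using y N0(2) frechet_derivative_works by (auto simp: N_def)
    obtain B where B: "B > 0" "\<And>u. B * norm u \<le> norm (?D u)"
      using linear_inj_bounded_below_pos[OF has_derivative_linear[OF der] True] by blast
    obtain d where d: "d > 0" "\<And>z. norm (z - y) < d \<Longrightarrow> norm (F z - F y - ?D (z - y)) \<le> B / 2 * norm (z - y)"
      using der B(1) unfolding has_derivative_at_alt by (meson half_gt_zero)
    obtain j where j: "1 / real (Suc j) < min d (B / 2)"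
      using reals_Archimedean[of "min d (B / 2)"] d(1) B(1) by (auto simp: inverse_eq_divide)
    have 1: "norm (F z - F y) \<ge> norm (z - y) / real (Suc j)" if "norm (z - y) \<le> 1 / real (Suc j)" for z
    proof -
      have "norm (?D (z - y)) \<le> norm (F z - F y) + norm (F z - F y - ?D (z - y))"
        by (metis norm_minus_commute norm_triangle_sub add.commute)
      then have "B / 2 * norm (z - y) \<le> norm (F z - F y)" using B(2)[of "z - y"] d(2)[of z] that j by simp
      moreover have "norm (z - y) / real (Suc j) \<le> B / 2 * norm (z - y)"
        using j mult_right_mono[of "1 / real (Suc j)" "B / 2" "norm (z - y)"] by simp
      ultimately show ?thesis by linarith
    qed
    obtain a where a: "a \<in> D" "dist a y < 1 / (3 * real (Suc j))"
      using D(2)[of "1 / (3 * real (Suc j))" y] by auto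
    have "y \<in> Q j a" using y a 1 by (auto simp: Q_def simp del: of_nat_Suc)
    moreover have "y \<notin> N' j a" using y a(1) by (auto simp: N_def)
    ultimately obtain n where n: "y \<in> C j a n" using C(4) by blast
    obtain l where l: "from_nat_into D l = a" using a(1) D(1) by (metis from_nat_into_to_nat_on)
    have "dec (prod_encode (j, prod_encode (l, n))) = (j, a, n)" by (simp add: dec_def l)
    then have "y \<in> P (prod_encode (j, prod_encode (l, n)))" using n by (simp add: P_def)
    then show ?thesis by blast
  qed simp
  show thesis
  proof (rule that[of P \<delta> N])
    show "compact (P m)" for m using C(1) by (simp add: P_def split: prod.split)
    show "P m \<subseteq> K" for m using PQ[of m] by (auto simp: Q_def)
    show "\<delta> m > 0" for m using PQ[of m] by auto
    show "negligible N" unfolding N_def using D(1) C(3) N0(1)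
      by (intro negligible_Un negligible_countable_Union) auto
  qed (use bil dif cov N0(2) in \<open>auto simp: N_def\<close>)
qed

subsection \<open>Uniqueness of tangent planes\<close>

text \<open>A point \<open>z\<close> of \<open>Q\<close> near \<open>y + t *\<^sub>R u\<close> has a
  displacement \<open>H z - H y\<close> that \<open>F\<close> also realizes from \<open>y'\<close>
  to some \<open>z'\<close>, and the lower Lipschitz bound keeps \<open>z' - y'\<close> of order
  \<open>t\<close>. Linearizing both sides puts \<open>DH u\<close> in the closure of the range of
  \<open>DF\<close>, which is closed.\<close>

lemma tangent_inclusion:
  fixes H :: "'a::real_normed_vector \<Rightarrow> 'b::euclidean_space" and F :: "'c::euclidean_space \<Rightarrow> 'b"
  assumes H: "(H has_derivative DH) (at y)" and F: "(F has_derivative DF) (at y')" and \<delta>: "\<delta> > 0"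
    and eq: "\<And>z. z \<in> Q \<Longrightarrow> \<exists>z'. F z' - F y' = H z - H y \<and> \<delta> * norm (z' - y') \<le> norm (F z' - F y')"
    and dens: "\<And>\<eta>. \<eta> > 0 \<Longrightarrow> \<exists>r>0. \<forall>h. norm h < r \<longrightarrow> (\<exists>z\<in>Q. norm (z - (y + h)) \<le> \<eta> * norm h)"
  shows "DH u \<in> range DF"
proof (cases "u = 0")
  case True
  then show ?thesis using linear_0[OF has_derivative_linear[OF H]] linear_0[OF has_derivative_linear[OF F]]
    by (metis rangeI)
next
  case False
  define U where "U = norm u"
  have U: "U > 0" using False by (simp add: U_def)
  obtain B where B: "B > 0" "\<And>v. norm (DH v) \<le> norm v * B"
    using bounded_linear.pos_bounded[OF has_derivative_bounded_linear[OF H]] by blast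
  have lH: "linear DH" and lF: "linear DF" using H F has_derivative_linear by auto
  have "closed (range DF)" by (intro closed_subspace linear_subspace_image[OF lF]) simp
  moreover have "DH u \<in> closure (range DF)"
    unfolding closure_approachable
  proof (intro allI impI)
    fix e :: real assume "e > 0"
    define \<epsilon> where "\<epsilon> = e / 2"
    have \<epsilon>: "\<epsilon> > 0" using \<open>e > 0\<close> by (simp add: \<epsilon>_def)
    \<comment> \<open>Three errors of at most a third of \<open>\<epsilon>\<close> each, relative to
      \<open>t\<close>: \<open>\<eta>\<close> for the position of \<open>z\<close>,
      \<open>e1\<close> for linearizing \<open>H\<close>, and \<open>e2\<close> for linearizing
      \<open>F\<close> over the distance \<open>C * (t * U)\<close> that bounds
      \<open>norm (z' - y')\<close>.\<close>
    define e1 where "e1 = min 1 (\<epsilon> / (6 * U))"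
    define \<eta> where "\<eta> = min 1 (\<epsilon> / (3 * B * U))"
    define e2 where "e2 = \<epsilon> * \<delta> / (6 * U * (B + 1))"
    have pos: "e1 > 0" "\<eta> > 0" "e2 > 0" using U B \<epsilon> \<delta> by (auto simp: e1_def \<eta>_def e2_def)
    have le1: "2 * e1 * U \<le> \<epsilon> / 3" using U by (simp add: e1_def min_def field_simps)
    have leB: "B * \<eta> * U \<le> \<epsilon> / 3" using U B by (simp add: \<eta>_def min_def field_simps)
    have e1_1: "e1 \<le> 1" "\<eta> \<le> 1" by (auto simp: e1_def \<eta>_def)
    define C where "C = 2 * (B + 1) / \<delta>"
    have C: "C > 0" using B \<delta> by (simp add: C_def)
    have le2: "e2 * C * U = \<epsilon> / 3"
    proof -
      define b where "b = B + 1"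
      have "b > 0" using B by (simp add: b_def)
      then show ?thesis unfolding e2_def C_def b_def[symmetric] using U \<delta> by (simp add: field_simps)
    qed
    obtain d1 where d1: "d1 > 0" "\<And>z. norm (z - y) < d1 \<Longrightarrow> norm (H z - H y - DH (z - y)) \<le> e1 * norm (z - y)"
      using H pos unfolding has_derivative_at_alt by metis
    obtain d2 where d2: "d2 > 0" "\<And>z. norm (z - y') < d2 \<Longrightarrow> norm (F z - F y' - DF (z - y')) \<le> e2 * norm (z - y')"
      using F pos unfolding has_derivative_at_alt by metis
    obtain r where r: "r > 0" "\<And>h. norm h < r \<Longrightarrow> \<exists>z\<in>Q. norm (z - (y + h)) \<le> \<eta> * norm h"
      using dens[OF pos(2)] by blast
    define t where "t = min (r / 2) (min (d1 / 4) (d2 / (2 * C))) / U"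
    have t: "t > 0" using r d1 d2 U C by (simp add: t_def)
    have tU: "t * U = min (r / 2) (min (d1 / 4) (d2 / (2 * C)))" using U by (simp add: t_def)
    have tUr: "t * U < r" "2 * (t * U) < d1" using r d1 unfolding tU by (auto simp: min_def)
    have tUd: "C * (t * U) < d2"
    proof -
      have "C * (t * U) \<le> C * (d2 / (2 * C))" using C unfolding tU by (intro mult_left_mono) auto
      also have "\<dots> = d2 / 2" using C by simp
      also have "\<dots> < d2" using d2(1) by simp
      finally show ?thesis .
    qed
    have nt: "norm (t *\<^sub>R u) = t * U" using t by (simp add: U_def)
    obtain z where z: "z \<in> Q" "norm (z - (y + t *\<^sub>R u)) \<le> \<eta> * (t * U)" using r(2)[of "t *\<^sub>R u"] tUr nt by auto
    have zy: "norm (z - y) \<le> 2 * (t * U)"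
    proof -
      have "norm (z - y) \<le> norm (z - (y + t *\<^sub>R u)) + norm (t *\<^sub>R u)"
        using norm_triangle_ineq[of "z - (y + t *\<^sub>R u)" "t *\<^sub>R u"] by simp
      also have "\<dots> \<le> 1 * (t * U) + t * U"
      proof -
        have "\<eta> * (t * U) \<le> 1 * (t * U)" using e1_1(2) t U by (intro mult_right_mono) auto
        then show ?thesis unfolding nt using z(2) by linarith
      qed
      also have "\<dots> = 2 * (t * U)" by (simp only: mult_1 mult_2)
      finally show ?thesis .
    qed
    obtain z' where z': "F z' - F y' = H z - H y" "\<delta> * norm (z' - y') \<le> norm (F z' - F y')" using eq[OF z(1)] by blast
    have h1: "norm (H z - H y - DH (z - y)) \<le> e1 * norm (z - y)" using d1(2)[of z] zy tUr by simp
    have "norm (H z - H y) \<le> norm (H z - H y - DH (z - y)) + norm (DH (z - y))"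
      using norm_triangle_ineq[of "H z - H y - DH (z - y)" "DH (z - y)"] by simp
    also have "\<dots> \<le> e1 * norm (z - y) + norm (z - y) * B" using h1 B(2)[of "z - y"] by simp
    also have "\<dots> = (e1 + B) * norm (z - y)" by (simp add: algebra_simps)
    also have "\<dots> \<le> (1 + B) * (2 * (t * U))" using zy e1_1 B pos t U by (intro mult_mono) auto
    finally have "\<delta> * norm (z' - y') \<le> (1 + B) * (2 * (t * U))" using z' by simp
    then have z'y: "norm (z' - y') \<le> C * (t * U)" using \<delta> by (simp add: C_def field_simps)
    have h2: "norm (F z' - F y' - DF (z' - y')) \<le> e2 * norm (z' - y')" using d2(2)[of z'] z'y tUd by simp
    have "norm (t *\<^sub>R DH u - DF (z' - y')) \<le> norm (DH (t *\<^sub>R u - (z - y))) + norm (H z - H y - DH (z - y)) + norm (F z' - F y' - DF (z' - y'))"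
    proof -
      have split: "t *\<^sub>R DH u - DF (z' - y') = DH (t *\<^sub>R u - (z - y)) - (H z - H y - DH (z - y)) + (F z' - F y' - DF (z' - y'))"
        using linear_diff[OF lH, of "t *\<^sub>R u" "z - y"] linear_scale[OF lH, of t u] z'(1) by simp
      show ?thesis
        unfolding split
        using norm_triangle_ineq[of "DH (t *\<^sub>R u - (z - y)) - (H z - H y - DH (z - y))" "F z' - F y' - DF (z' - y')"]
          norm_triangle_ineq4[of "DH (t *\<^sub>R u - (z - y))" "H z - H y - DH (z - y)"] by linarith
    qed
    also have "\<dots> \<le> (\<eta> * (t * U)) * B + e1 * (2 * (t * U)) + e2 * (C * (t * U))"
    proof (intro add_mono)
      have "norm (t *\<^sub>R u - (z - y)) \<le> \<eta> * (t * U)" using z(2) norm_minus_commute[of "t *\<^sub>R u" "z - y"] by (simp add: algebra_simps)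
      then show "norm (DH (t *\<^sub>R u - (z - y))) \<le> (\<eta> * (t * U)) * B"
        using B(2)[of "t *\<^sub>R u - (z - y)"] B(1) by (meson less_imp_le mult_right_mono order_trans)
      show "norm (H z - H y - DH (z - y)) \<le> e1 * (2 * (t * U))"
        using h1 mult_left_mono[OF zy, of e1] pos(1) by linarith
      show "norm (F z' - F y' - DF (z' - y')) \<le> e2 * (C * (t * U))"
        using h2 mult_left_mono[OF z'y, of e2] pos(3) by linarith
    qed
    also have "\<dots> = t * (B * \<eta> * U + 2 * e1 * U + e2 * C * U)" by (simp add: algebra_simps)
    also have "\<dots> \<le> t * \<epsilon>" using leB le1 le2 t by (intro mult_left_mono) auto
    finally have "norm (t *\<^sub>R DH u - DF (z' - y')) \<le> t * \<epsilon>" .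
    moreover have "t *\<^sub>R DH u - DF (z' - y') = t *\<^sub>R (DH u - DF ((1 / t) *\<^sub>R (z' - y')))"
      using t linear_scale[OF lF, of "1 / t" "z' - y'"] by (simp add: scaleR_diff_right)
    ultimately have "norm (DH u - DF ((1 / t) *\<^sub>R (z' - y'))) \<le> \<epsilon>" using t by simp
    also have "\<epsilon> < e" using \<open>e > 0\<close> by (simp add: \<epsilon>_def)
    finally have "dist (DF ((1 / t) *\<^sub>R (z' - y'))) (DH u) < e" by (simp add: dist_norm norm_minus_commute)
    then show "\<exists>x\<in>range DF. dist x (DH u) < e" by blast
  qed
  ultimately show ?thesis by (simp add: closure_closed)
qed

context smooth_manifold
begin

lemma push_frame_transition:
  assumes c: "c \<in> A" "x \<in> fst c" and d: "d \<in> A" "x \<in> fst d"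
    and F: "F y = snd c x" "F differentiable (at y)"
  shows "((trans c d \<circ> F) has_derivative (\<lambda>u. dtrans c d x (frechet_derivative F (at y) u))) (at y)"
    and "(trans c d \<circ> F) y = snd d x"
proof -
  have "(F has_derivative frechet_derivative F (at y)) (at y)" using F(2) frechet_derivative_works by blast
  from diff_chain_at[OF this, of "trans c d" "dtrans c d x"] trans_derivative[OF c(1) d(1) c(2) d(2)] F(1)
  show "((trans c d \<circ> F) has_derivative (\<lambda>u. dtrans c d x (frechet_derivative F (at y) u))) (at y)"
    by (simp add: o_def)
  show "(trans c d \<circ> F) y = snd d x" using F(1) c by (simp add: trans_def chart_inv_chart)
qed

text \<open>At a density point of the common part of two pieces, both tangent planes are determined by that
  common part.\<close>

lemma tangent_plane_unique:
  fixes F :: "real ^ 'i::finite \<Rightarrow> real ^ 'n" and F' :: "real ^ 'i \<Rightarrow> real ^ 'n"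
  assumes c: "c \<in> A" and K: "compact K" "F ` K \<subseteq> chart_img c" "continuous_on K F"
    and c': "c' \<in> A" and P: "compact P" "F' ` P \<subseteq> chart_img c'" "continuous_on P F'" and \<delta>: "\<delta> > 0"
    and bil: "\<And>y z. y \<in> P \<Longrightarrow> z \<in> P \<Longrightarrow> \<delta> * norm (z - y) \<le> norm (F' z - F' y)"
    and dif: "\<And>y. y \<in> P \<Longrightarrow> F' differentiable (at y)"
  obtains N where "negligible N"
    "\<And>y y'. y \<in> K - N \<Longrightarrow> F differentiable (at y) \<Longrightarrow> y' \<in> P \<Longrightarrow> chart_inv c (F y) = chart_inv c' (F' y') \<Longrightarrow>
      \<exists>r. wedge (push_frame A c F y) = r *\<^sub>R wedge (push_frame A c' F' y')"
proof -
  let ?X = "\<lambda>y. chart_inv c (F y)" and ?X' = "\<lambda>y. chart_inv c' (F' y)"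
  have cX: "continuous_on K ?X" "continuous_on P ?X'"
    using continuous_on_compose2[OF chart_continuous(2)[OF c] K(3,2)] continuous_on_compose2[OF chart_continuous(2)[OF c'] P(3,2)] by auto
  \<comment> \<open>The parameters in \<open>K\<close> whose points also lie on the second piece;
    compactness of that piece makes this set closed.\<close>
  define Q where "Q = K \<inter> ?X -` (?X' ` P)"
  have "closed (?X' ` P)" using compact_continuous_image[OF cX(2) P(1)] compact_imp_closed by blast
  then have "closed Q"
    unfolding Q_def using continuous_closed_preimage[OF cX(1) compact_imp_closed[OF K(1)]] by blast
  then obtain N where N: "negligible N" "\<And>x \<eta>. x \<in> Q - N \<Longrightarrow> 0 < \<eta> \<Longrightarrow>
       \<exists>r>0. \<forall>h. norm h < r \<longrightarrow> (\<exists>z\<in>Q. norm (z - (x + h)) \<le> \<eta> * norm h)"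
    using closed_density_points[of Q] by metis
  show thesis
  proof (rule that[OF N(1)])
    fix y y' assume y: "y \<in> K - N" "F differentiable (at y)" and y': "y' \<in> P" "?X y = ?X' y'"
    define x where "x = ?X y"
    have yQ: "y \<in> Q - N" using y y' by (auto simp: Q_def)
    have xc: "x \<in> fst c" "F y = snd c x" "x \<in> fst c'" "F' y' = snd c' x"
      using K(2) P(2) y y' c c' by (auto simp: x_def chart_inv_mem chart_chart_inv image_subset_iff) (metis chart_inv_mem chart_chart_inv image_subset_iff c c')+
    let ?H = "trans c c' \<circ> F"
    note H = push_frame_transition[OF c xc(1) c' xc(3) xc(2) y(2)]
    have DF': "(F' has_derivative frechet_derivative F' (at y')) (at y')" using dif[OF y'(1)] frechet_derivative_works by blast
    have "\<exists>z'. F' z' - F' y' = ?H z - ?H y \<and> \<delta> * norm (z' - y') \<le> norm (F' z' - F' y')" if z: "z \<in> Q" for z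
    proof -
      obtain z' where z': "z' \<in> P" "?X z = ?X' z'" using z by (auto simp: Q_def)
      have "F' z' = snd c' (?X' z')" using z'(1) P(2) c' by (simp add: chart_chart_inv image_subset_iff)
      then have "F' z' = ?H z" using z'(2) by (simp add: trans_def)
      then show ?thesis using bil[OF y'(1) z'(1)] H(2) xc(4) by auto
    qed
    then have "dtrans c c' x (frechet_derivative F (at y) u) \<in> range (frechet_derivative F' (at y'))" for u
      using N(2)[OF yQ] by (intro tangent_inclusion[OF H(1) DF' \<delta>]) simp_all
    then have "\<exists>w. dtrans c c' x (frechet_derivative F (at y) (axis i 1)) = frechet_derivative F' (at y') w" for i
      by blast
    then obtain w where w: "\<And>i. dtrans c c' x (frechet_derivative F (at y) (axis i 1)) = frechet_derivative F' (at y') (w i)" by metis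
    have "push_frame A c F y i = (\<Sum>j\<in>UNIV. (\<chi> i j. w i $ j) $ i $ j *\<^sub>R push_frame A c' F' y' j)" for i
    proof -
      have lF': "linear (frechet_derivative F' (at y'))" using has_derivative_linear[OF DF'] .
      have lc: "linear (from_chart A c' x)" by (rule linear_from_chart[OF c' xc(3)])
      have "push_frame A c F y i = from_chart A c' x (dtrans c c' x (frechet_derivative F (at y) (axis i 1)))"
        by (simp add: push_frame_def x_def[symmetric] from_chart_dtrans[OF c c' xc(1,3)])
      also have "\<dots> = from_chart A c' x (frechet_derivative F' (at y') (\<Sum>j\<in>UNIV. w i $ j *\<^sub>R axis j 1))"
        by (simp add: w basis_expansion scalar_mult_eq_scaleR[symmetric])
      also have "\<dots> = (\<Sum>j\<in>UNIV. w i $ j *\<^sub>R from_chart A c' x (frechet_derivative F' (at y') (axis j 1)))"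
        by (simp add: linear_sum[OF lF'] linear_scale[OF lF'] linear_sum[OF lc] linear_scale[OF lc])
      finally show ?thesis using y'(2) by (simp add: push_frame_def x_def)
    qed
    from wedge_linear_combination[OF this]
    show "\<exists>r. wedge (push_frame A c F y) = r *\<^sub>R wedge (push_frame A c' F' y')" by blast
  qed
qed

end

section \<open>Bounds for coordinate forms by the Riemannian mass\<close>

lemma alt_form_abs_le_mass:
  fixes \<alpha> :: "('i::finite \<Rightarrow> real ^ 'n::finite) \<Rightarrow> real"
  assumes h: "riemannian_metric A h" and \<alpha>: "alt_form \<alpha>" and C: "C > 0"
    and bd: "\<And>e. orthonormal_frame h x e \<Longrightarrow> \<bar>\<alpha> e\<bar> \<le> C"
  shows "\<bar>\<alpha> v\<bar> \<le> C * riemannian_mass h x (wedge v)"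
proof -
  interpret G: symmetric_form "h x"
    using h by unfold_locales (auto simp: riemannian_metric_def smooth_symmetric_tensor_def)
  have pos: "u \<noteq> 0 \<Longrightarrow> h x u u > 0" for u using h by (simp add: riemannian_metric_def)
  have fr: "orthonormal_frame h x e \<longleftrightarrow> G.frame e" for e :: "'i \<Rightarrow> real ^ 'n"
    by (simp add: orthonormal_frame_def G.frame_def)
  define S where "S = {pairing \<beta> (wedge v) | \<beta>. alt_form \<beta> \<and> (\<forall>e. orthonormal_frame h x e \<longrightarrow> \<beta> e \<le> 1)}"
  have mass: "riemannian_mass h x (wedge v) = Sup S" by (simp add: riemannian_mass_def S_def)
  \<comment> \<open>A supremum dominates its competitors only if they are bounded above. Either
    \<open>wedge v\<close> is a positive multiple of an orthonormal frame, or it is zero.\<close>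
  have bdd: "bdd_above S"
  proof (cases "G.positive v")
    case True
    then obtain e :: "'i \<Rightarrow> real ^ 'n" and m where e: "G.frame e" "m > 0" "wedge v = m *\<^sub>R wedge e"
      by (rule G.orthonormalize)
    show ?thesis
    proof (rule bdd_aboveI[of _ m])
      fix s assume "s \<in> S"
      then obtain \<beta> where b: "s = pairing \<beta> (wedge v)" "alt_form \<beta>" "\<beta> e \<le> 1" using e(1) fr by (auto simp: S_def)
      then have "s = m * \<beta> e" by (simp add: e(3) pairing_scale_right pairing_wedge)
      then show "s \<le> m" using b(3) e(2) by simp
    qed
  next
    case False
    then obtain c where c: "c \<noteq> (\<lambda>_. 0)" "\<not> h x (\<Sum>i\<in>UNIV. c i *\<^sub>R v i) (\<Sum>i\<in>UNIV. c i *\<^sub>R v i) > 0"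
      unfolding G.positive_def by blast
    then have "(\<Sum>i\<in>UNIV. (\<chi> i. c i) $ i *\<^sub>R v i) = 0" using pos by auto
    then have "wedge v = 0" by (rule wedge_dependent[rotated]) (use c(1) in \<open>auto simp: vec_eq_iff fun_eq_iff\<close>)
    then have "S \<subseteq> {0}" by (auto simp: S_def linear_0[OF linear_pairing])
    then show ?thesis using bdd_above_mono[of "{0}" S] by simp
  qed
  \<comment> \<open>Divided by \<open>C\<close>, both the form and its negative compete in the
    supremum.\<close>
  have le: "s * \<alpha> v \<le> C * Sup S" if s: "s = 1 \<or> s = -1" for s
  proof -
    have "(s / C) * \<alpha> v \<in> S"
      unfolding S_def
    proof (intro CollectI exI[of _ "\<lambda>v. (s / C) * \<alpha> v"] conjI allI impI)
      show "(s / C) * \<alpha> v = pairing (\<lambda>v. (s / C) * \<alpha> v) (wedge v)"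
        by (rule pairing_wedge[symmetric]) (rule alt_form_scale[OF \<alpha>])
      show "alt_form (\<lambda>v. (s / C) * \<alpha> v)" by (rule alt_form_scale[OF \<alpha>])
      fix e :: "'i \<Rightarrow> real ^ 'n" assume "orthonormal_frame h x e"
      then have "s * \<alpha> e \<le> C" using bd s by fastforce
      then show "(s / C) * \<alpha> e \<le> 1" using C by (simp add: field_simps)
    qed
    then have "(s / C) * \<alpha> v \<le> Sup S" using bdd by (rule cSup_upper)
    then show ?thesis using C by (simp add: field_simps)
  qed
  show ?thesis unfolding mass using le[of 1] le[of "-1"] by (simp add: abs_le_iff)
qed

lemma scale_wedge: "r *\<^sub>R wedge v = wedge (v(i := r *\<^sub>R v i))"
proof -
  have 1: "linear (\<lambda>u. wedge (v(i := u)) $ f)" for f by (rule alt_form_linear[OF alt_form_wedge])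
  show ?thesis using linear_scale[OF 1, of r "v i"] by (simp add: vec_eq_iff)
qed

lemma abs_wedge_le:
  fixes u :: "'i::finite \<Rightarrow> real ^ 'n::finite"
  assumes "\<And>i. norm (u i) \<le> M"
  shows "\<bar>wedge u $ f\<bar> \<le> real (card {p. p permutes (UNIV :: 'i set)}) * M ^ CARD('i)"
proof -
  have "\<bar>\<Prod>i\<in>UNIV. u i $ f (p i)\<bar> \<le> M ^ CARD('i)" for p
  proof -
    have "\<bar>\<Prod>i\<in>UNIV. u i $ f (p i)\<bar> \<le> (\<Prod>i\<in>(UNIV :: 'i set). M)"
      unfolding abs_prod by (intro prod_mono conjI abs_ge_zero order_trans[OF component_le_norm_cart assms])
    then show ?thesis by simp
  qed
  then show ?thesis
    unfolding wedge_def det_def vec_lambda_beta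
    by (intro order_trans[OF sum_abs] order_trans[OF sum_bounded_above]) (auto simp: abs_mult sign_def)
qed

context smooth_manifold
begin

text \<open>The metric attains a positive minimum \<open>m\<close> over the compact set of points
  and Euclidean unit vectors, and scaling gives the bound \<open>sqrt (1 / m)\<close>.\<close>

lemma chart_norm_bound:
  assumes h: "riemannian_metric A h" and d: "d \<in> A" and K: "compact K" "K \<subseteq> fst d"
  obtains M where "M > 0" "\<And>x u. x \<in> K \<Longrightarrow> h x u u = 1 \<Longrightarrow> norm (to_chart d x u) \<le> M"
proof (cases "K = {}")
  case True then show thesis by (intro that[of 1]) auto
next
  case False
  let ?H = "\<lambda>y a b. h (chart_inv d y) (from_chart A d (chart_inv d y) a) (from_chart A d (chart_inv d y) b)"
  have bil: "bilinear (h x)" for x using h by (simp add: riemannian_metric_def smooth_symmetric_tensor_def)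
  define Z where "Z = snd d ` K"
  have Z: "compact Z" "Z \<subseteq> chart_img d"
    unfolding Z_def using K d compact_continuous_image[OF continuous_on_subset[OF chart_continuous(1)[OF d] K(2)] K(1)]
    by (auto intro: chart_mem)
  have lf: "linear (from_chart A d (chart_inv d y))" if "y \<in> chart_img d" for y
    using linear_from_chart[OF d chart_inv_mem[OF d that]] .
  have ex: "?H y u u = (\<Sum>a\<in>UNIV. \<Sum>b\<in>UNIV. u $ a * u $ b * ?H y (axis a 1) (axis b 1))" if y: "y \<in> chart_img d" for y u
  proof -
    let ?f = "from_chart A d (chart_inv d y)"
    have "?f u = (\<Sum>a\<in>UNIV. u $ a *\<^sub>R ?f (axis a 1))"
      using arg_cong[OF basis_expansion[of u], of ?f] lf[OF y] by (simp add: linear_sum linear_scale scalar_mult_eq_scaleR)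
    then have "?H y u u = h (chart_inv d y) (\<Sum>a\<in>UNIV. u $ a *\<^sub>R ?f (axis a 1)) (\<Sum>b\<in>UNIV. u $ b *\<^sub>R ?f (axis b 1))" by simp
    also have "\<dots> = (\<Sum>(a, b)\<in>UNIV \<times> UNIV. h (chart_inv d y) (u $ a *\<^sub>R ?f (axis a 1)) (u $ b *\<^sub>R ?f (axis b 1)))"
      by (rule bilinear_sum[OF bil])
    also have "\<dots> = (\<Sum>a\<in>UNIV. \<Sum>b\<in>UNIV. u $ a * u $ b * ?H y (axis a 1) (axis b 1))"
      unfolding sum.cartesian_product[symmetric] by (simp add: bilinear_lmul[OF bil] bilinear_rmul[OF bil] mult_ac)
    finally show ?thesis .
  qed
  have cH: "continuous_on (chart_img d) (\<lambda>y. ?H y a b)" for a b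
    using h d by (intro smooth_on_continuous chart_open(2)) (simp_all add: riemannian_metric_def smooth_symmetric_tensor_def Let_def)
  have "continuous_on (Z \<times> sphere 0 1) (\<lambda>(y, u). \<Sum>a\<in>UNIV. \<Sum>b\<in>UNIV. u $ a * u $ b * ?H y (axis a 1) (axis b 1))"
    unfolding split_beta
    by (intro continuous_intros continuous_on_compose2[OF continuous_on_subset[OF cH Z(2)]]) auto
  moreover have "compact (Z \<times> sphere (0 :: real ^ 'n) 1)" using Z(1) by (intro compact_Times) auto
  moreover have "Z \<times> sphere (0 :: real ^ 'n) 1 \<noteq> {}" using False by (auto simp: Z_def)
  ultimately obtain p where p: "p \<in> Z \<times> sphere (0 :: real ^ 'n) 1"
    "\<And>q. q \<in> Z \<times> sphere 0 1 \<Longrightarrow> (\<lambda>(y, u). \<Sum>a\<in>UNIV. \<Sum>b\<in>UNIV. u $ a * u $ b * ?H y (axis a 1) (axis b 1)) p \<le>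
      (\<lambda>(y, u). \<Sum>a\<in>UNIV. \<Sum>b\<in>UNIV. u $ a * u $ b * ?H y (axis a 1) (axis b 1)) q"
    using continuous_attains_inf by (metis (no_types, lifting))
  obtain y0 u0 where p0: "p = (y0, u0)" by fastforce
  define m where "m = ?H y0 u0 u0"
  have y0: "y0 \<in> chart_img d" "norm u0 = 1" using p(1) p0 Z(2) by auto
  have mmin: "m \<le> ?H y u u" if "y \<in> Z" "norm u = 1" for y u
    using p(2)[of "(y, u)"] that Z(2) ex[OF y0(1), of u0] ex[of y u] by (auto simp: p0 m_def)
  have "from_chart A d (chart_inv d y0) u0 \<noteq> 0"
    using to_from_chart[OF d chart_inv_mem[OF d y0(1)], of u0] y0(2)
      linear_0[OF linear_to_chart[OF d chart_inv_mem[OF d y0(1)]]] by auto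
  then have m: "m > 0" using h by (simp add: m_def riemannian_metric_def)
  show thesis
  proof (rule that[of "sqrt (1 / m)"])
    show "sqrt (1 / m) > 0" using m by simp
    fix x u assume x: "x \<in> K" and u: "h x u u = 1"
    have xd: "x \<in> fst d" using x K(2) by blast
    let ?w = "to_chart d x u" and ?y = "snd d x"
    have y: "?y \<in> Z" "chart_inv d ?y = x" using x xd d by (auto simp: Z_def chart_inv_chart)
    have one: "?H ?y ?w ?w = 1" using u by (simp add: y(2) from_to_chart[OF d xd])
    show "norm ?w \<le> sqrt (1 / m)"
    proof (cases "?w = 0")
      case False
      define n where "n = norm ?w"
      have n: "n > 0" using False by (simp add: n_def)
      have yi: "?y \<in> chart_img d" using y Z by blast
      have "m \<le> ?H ?y ((1 / n) *\<^sub>R ?w) ((1 / n) *\<^sub>R ?w)" using n by (intro mmin y(1)) (simp add: n_def)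
      also have "\<dots> = (1 / n) * (1 / n) * ?H ?y ?w ?w"
        unfolding linear_scale[OF lf[OF yi]] bilinear_lmul[OF bil] bilinear_rmul[OF bil] by simp
      finally have "m \<le> 1 / n\<^sup>2" unfolding one by (simp add: power2_eq_square)
      then have "n\<^sup>2 \<le> 1 / m" using m n by (simp add: field_simps)
      then show ?thesis unfolding n_def[symmetric] by (rule real_le_rsqrt)
    qed (use m in simp)
  qed
qed

text \<open>Turns summable mass of the pieces into integrability of their coordinates. Over
  \<open>K\<close> orthonormal frames have bounded coordinates; off \<open>K\<close> the form is
  zero.\<close>

lemma coord_form_le_mass:
  assumes h: "riemannian_metric A h" and d: "d \<in> A" and \<psi>: "cutoff \<psi> K" "K \<subseteq> fst d"
  obtains C where "C > 0" "\<And>x (v :: 'i::finite \<Rightarrow> real ^ 'n). \<bar>coord_form d \<psi> f x v\<bar> \<le> C * riemannian_mass h x (wedge v)"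
proof -
  obtain M where M: "M > 0" "\<And>x u. x \<in> K \<Longrightarrow> h x u u = 1 \<Longrightarrow> norm (to_chart d x u) \<le> M"
    using chart_norm_bound[OF h d _ \<psi>(2)] \<psi>(1) by (auto simp: cutoff_def)
  define C where "C = real (card {p. p permutes (UNIV :: 'i set)}) * M ^ CARD('i)"
  have "card {p. p permutes (UNIV :: 'i set)} > 0" by (simp add: card_permutations[of UNIV "CARD('i)"])
  then have C: "C > 0" using M(1) by (simp add: C_def)
  show thesis
  proof (rule that[OF C])
    fix x and v :: "'i \<Rightarrow> real ^ 'n"
    show "\<bar>coord_form d \<psi> f x v\<bar> \<le> C * riemannian_mass h x (wedge v)"
    proof (rule alt_form_abs_le_mass[OF h _ C])
      show "alt_form (coord_form d \<psi> f x)"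
        using test_form_coord_form[OF d \<psi>, of f] by (simp add: test_form_def smooth_form_def)
      fix e :: "'i \<Rightarrow> real ^ 'n" assume e: "orthonormal_frame h x e"
      show "\<bar>coord_form d \<psi> f x e\<bar> \<le> C"
      proof (cases "x \<in> K")
        case True
        have "\<bar>wedge (\<lambda>i. to_chart d x (e i)) $ f\<bar> \<le> C"
          unfolding C_def using e by (intro abs_wedge_le M(2)[OF True]) (simp add: orthonormal_frame_def)
        moreover have "0 \<le> \<psi> x" "\<psi> x \<le> 1" using \<psi>(1) by (auto simp: cutoff_def)
        ultimately show ?thesis
          unfolding coord_form_def abs_mult
          using mult_mono[of "\<bar>\<psi> x\<bar>" 1 "\<bar>wedge (\<lambda>i. to_chart d x (e i)) $ f\<bar>" C] by simp
      next
        case False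
        then show ?thesis using \<psi>(1) C by (simp add: coord_form_def cutoff_def)
      qed
    qed
  qed
qed

text \<open>The frame passes through the fixed tangent spaces, whose identification is not
  measurable. Going from \<open>c\<close> to \<open>d\<close> directly by \<open>dtrans\<close>
  eliminates it; what remains is continuous on the closed set \<open>E\<close>, apart from the Borel
  function \<open>jac\<close>.\<close>

lemma coord_form_measurable:
  fixes F :: "real ^ 'i::finite \<Rightarrow> real ^ 'n"
  assumes c: "c \<in> A" and F: "continuous_on UNIV F" and K: "compact K" "F ` K \<subseteq> chart_img c"
    and d: "d \<in> A" and \<psi>: "cutoff \<psi> K'" "K' \<subseteq> fst d"
  obtains \<Theta> where "\<Theta> \<in> borel_measurable borel"
    "\<And>y. y \<in> K \<Longrightarrow> \<Theta> y = coord_form d \<psi> f (chart_inv c (F y)) (\<lambda>i. from_chart A c (chart_inv c (F y)) (jac F y i))"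
proof -
  let ?X = "\<lambda>y. chart_inv c (F y)"
  have cK: "continuous_on K F" using F continuous_on_subset by blast
  have cX: "continuous_on K ?X" by (rule continuous_on_compose2[OF chart_continuous(2)[OF c] cK K(2)])
  define E where "E = K \<inter> ?X -` K'"
  have "compact K'" using \<psi>(1) by (simp add: cutoff_def)
  then have "closed E" unfolding E_def
    by (intro continuous_closed_preimage cX compact_imp_closed K(1))
  then have E[measurable]: "E \<in> sets borel" by simp
  have EK: "E \<subseteq> K" by (auto simp: E_def)
  have Xc: "?X y \<in> fst c" "snd c (?X y) = F y" if "y \<in> K" for y
    using that K(2) c by (auto intro!: chart_inv_mem chart_chart_inv)
  have Xd: "?X y \<in> fst d" if "y \<in> E" for y using that \<psi>(2) by (auto simp: E_def)
  define t where "t l a y = (if y \<in> E then dtrans c d (?X y) (axis l 1) $ a else 0)" for l a y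
  define s where "s y = (if y \<in> E then \<psi> (?X y) else 0)" for y
  have [measurable]: "t l a \<in> borel_measurable borel" for l a
  proof -
    let ?O = "snd c ` (fst c \<inter> fst d)"
    have o: "open ?O" by (rule chart_image_open[OF c chart_open(1)[OF d]])
    have g: "continuous_on ?O (\<lambda>z. frechet_derivative (trans c d) (at z) (axis l 1) \<bullet> axis a 1)"
      by (intro smooth_on_continuous smooth_on_inner smooth_on_deriv trans_smooth c d o)
    have sub: "F ` E \<subseteq> ?O"
    proof
      fix z assume "z \<in> F ` E"
      then obtain y where y: "y \<in> E" "z = F y" by blast
      then have "y \<in> K" using EK by blast
      then have "z = snd c (?X y)" "?X y \<in> fst c \<inter> fst d" using Xc[of y] Xd[OF y(1)] y(2) by auto
      then show "z \<in> ?O" by (rule image_eqI)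
    qed
    have "continuous_on E (\<lambda>y. frechet_derivative (trans c d) (at (F y)) (axis l 1) \<bullet> axis a 1)"
      by (rule continuous_on_compose2[OF g continuous_on_subset[OF F subset_UNIV] sub])
    then have "continuous_on E (\<lambda>y. dtrans c d (?X y) (axis l 1) $ a)"
    proof (rule continuous_on_eq)
      fix y assume "y \<in> E"
      then have "y \<in> K" using EK by blast
      show "frechet_derivative (trans c d) (at (F y)) (axis l 1) \<bullet> axis a 1 = dtrans c d (?X y) (axis l 1) $ a"
        unfolding dtrans_def Xc(2)[OF \<open>y \<in> K\<close>] inner_axis inner_real_def by (rule mult.right_neutral)
    qed
    then show ?thesis unfolding t_def by (intro borel_measurable_continuous_on_if E continuous_on_const)
  qed
  have "continuous_on E (\<lambda>y. \<psi> (?X y))"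
  proof (rule continuous_on_compose2[OF _ continuous_on_subset[OF cX EK] subset_UNIV])
    have "smooth_fun \<psi>" using \<psi>(1) by (simp add: cutoff_def)
    then show "continuous_on UNIV \<psi>" by (rule smooth_fun_continuous)
  qed
  then have [measurable]: "s \<in> borel_measurable borel"
    unfolding s_def by (intro borel_measurable_continuous_on_if E continuous_on_const)
  note [measurable] = jac_measurable[OF F]
  show thesis
  proof (rule that)
    show "(\<lambda>y. s y * det (\<chi> i j. \<Sum>l\<in>UNIV. jac F y i $ l * t l (f j) y)) \<in> borel_measurable borel"
      unfolding det_def vec_lambda_beta by measurable
    fix y assume y: "y \<in> K"
    show "s y * det (\<chi> i j. \<Sum>l\<in>UNIV. jac F y i $ l * t l (f j) y) = coord_form d \<psi> f (?X y) (\<lambda>i. from_chart A c (?X y) (jac F y i))"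
    proof (cases "y \<in> E")
      case True
      have lin: "linear (dtrans c d (?X y))" by (rule linear_dtrans[OF c d Xc(1)[OF y] Xd[OF True]])
      have "(\<Sum>l\<in>UNIV. jac F y i $ l * t l a y) = to_chart d (?X y) (from_chart A c (?X y) (jac F y i)) $ a" for i a
      proof -
        have "dtrans c d (?X y) (jac F y i) = (\<Sum>l\<in>UNIV. jac F y i $ l *\<^sub>R dtrans c d (?X y) (axis l 1))"
          using arg_cong[OF basis_expansion[of "jac F y i"], of "dtrans c d (?X y)"] lin
          by (simp add: linear_sum linear_scale scalar_mult_eq_scaleR)
        then show ?thesis using True
          by (simp add: t_def to_chart_from_chart[OF c d Xc(1)[OF y] Xd[OF True]])
      qed
      then show ?thesis using True by (simp add: s_def coord_form_def wedge_def)
    next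
      case False
      then have "\<psi> (?X y) = 0" using y \<psi>(1) by (auto simp: E_def cutoff_def)
      then show ?thesis using False by (simp add: s_def coord_form_def)
    qed
  qed
qed

end

section \<open>A sequence of integrals as one integral over a product\<close>

lemma integral_count_space_pair_0:
  fixes g :: "nat \<times> 'a::euclidean_space \<Rightarrow> real"
  assumes g: "integrable (count_space UNIV \<Otimes>\<^sub>M lborel) g" and 0: "\<And>k. AE y in lborel. g (k, y) = 0"
  shows "integral\<^sup>L (count_space UNIV \<Otimes>\<^sub>M lborel) g = 0"
proof -
  interpret pair_sigma_finite "count_space (UNIV :: nat set)" "lborel :: 'a measure"
    by (intro pair_sigma_finite.intro sigma_finite_measure_count_space lborel.sigma_finite_measure_axioms)
  have "(LINT y|lborel. g (k, y)) = 0" for k using 0[of k] by (rule integral_eq_zero_AE)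
  then show ?thesis using integral_fst'[OF g] by simp
qed

lemma sums_integral_count_space_pair:
  fixes g :: "nat \<times> 'a::euclidean_space \<Rightarrow> real"
  assumes g: "integrable (count_space UNIV \<Otimes>\<^sub>M lborel) g"
  shows "(\<lambda>k. LINT y|lborel. g (k, y)) sums integral\<^sup>L (count_space UNIV \<Otimes>\<^sub>M lborel) g"
proof -
  interpret pair_sigma_finite "count_space (UNIV :: nat set)" "lborel :: 'a measure"
    by (intro pair_sigma_finite.intro sigma_finite_measure_count_space lborel.sigma_finite_measure_axioms)
  show ?thesis using sums_integral_count_space_nat[OF integrable_fst'[OF g]] integral_fst'[OF g] by simp
qed

lemma integrable_count_space_pair:
  fixes g :: "nat \<times> 'a::euclidean_space \<Rightarrow> real"
  assumes m: "\<And>k. (\<lambda>y. g (k, y)) \<in> borel_measurable lborel"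
    and fin: "(\<Sum>k. \<integral>\<^sup>+ y. ennreal \<bar>g (k, y)\<bar> \<partial>lborel) < \<infinity>"
  shows "integrable (count_space UNIV \<Otimes>\<^sub>M lborel) g"
proof -
  have [measurable]: "g \<in> borel_measurable (count_space UNIV \<Otimes>\<^sub>M lborel)"
    by (rule measurable_pair_measure_countable1) (use m in auto)
  have "(\<integral>\<^sup>+ z. ennreal (norm (g z)) \<partial>(count_space UNIV \<Otimes>\<^sub>M lborel)) =
      (\<integral>\<^sup>+ k. \<integral>\<^sup>+ y. ennreal (norm (g (k, y))) \<partial>lborel \<partial>count_space UNIV)"
    by (rule lborel.nn_integral_fst[symmetric]) measurable
  also have "\<dots> = (\<Sum>k. \<integral>\<^sup>+ y. ennreal \<bar>g (k, y)\<bar> \<partial>lborel)" by (simp add: nn_integral_count_space_nat)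
  finally show ?thesis using fin by (intro integrableI_bounded) auto
qed

lemma AE_lborel_of_negligible: "negligible N \<Longrightarrow> AE y in lborel. y \<notin> N"
  by (metis AE_completion_iff AE_not_in negligible_iff_null_sets)

context smooth_manifold
begin

section \<open>Simplicity of the polar multivector of a rectifiable current\<close>

lemma coord_form_wedge_cong:
  assumes d: "d \<in> A" "x \<in> fst d" and w: "wedge v = r *\<^sub>R wedge w"
  shows "coord_form d \<psi> f x v = r * coord_form d \<psi> f x w"
proof -
  have L: "linear (to_chart d x)" by (rule linear_to_chart[OF d])
  have "wedge (\<lambda>i. to_chart d x (v i)) = r *\<^sub>R wedge (\<lambda>i. to_chart d x (w i))"
    using arg_cong[OF w, of "mv_map (to_chart d x)"] by (simp add: mv_map_wedge[OF L] linear_scale[OF linear_mv_map])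
  then show ?thesis by (simp add: coord_form_def)
qed

text \<open>In coordinates, \<open>\<xi> \<mu>\<close> is the image of the sum of the pieces. On the bi-Lipschitz piece \<open>E k l\<close> all
  pieces have the same tangent plane almost everywhere, so there the components of \<open>\<xi>\<close> are proportional
  to those of \<open>wedge (J k y)\<close>; off these pieces the Jacobians, and hence \<open>\<xi>\<close>, vanish.\<close>

lemma rectifiable_simple_local:
  fixes S :: "('x, 'i::finite, 'n) current" and h \<mu>
  assumes rect: "locally_rectifiable A S" and rep: "represents A S \<xi> \<mu>"
    and d: "d \<in> A" and \<psi>: "cutoff \<psi> K'" "K' \<subseteq> fst d"
  shows "AE x in \<mu>. \<psi> x = 1 \<longrightarrow> \<xi> x \<in> multivectors \<longrightarrow> (\<exists>v. \<xi> x = wedge v)"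
proof -
  obtain m :: "nat \<Rightarrow> int" and K :: "nat \<Rightarrow> (real ^ 'i) set" and c F h where
    h: "riemannian_metric A h"
    and X0: "\<forall>k. compact (K k) \<and> c k \<in> A \<and> (\<exists>L. L-lipschitz_on UNIV (F k)) \<and> F k ` K k \<subseteq> chart_img (c k)"
    and mass0: "\<forall>C. compact C \<longrightarrow>
           (\<Sum>k. \<integral>\<^sup>+ y. ennreal (\<bar>of_int (m k)\<bar> *
              riemannian_mass h (chart_inv (c k) (F k y)) (wedge (push_frame A (c k) (F k) y))) *
              indicator {y \<in> K k. chart_inv (c k) (F k y) \<in> C} y \<partial>lebesgue) < \<infinity>"
    and sums0: "\<forall>\<omega>. test_form A \<omega> \<longrightarrow>
           (\<lambda>k. of_int (m k) *
              (LINT y:K k|lebesgue. \<omega> (chart_inv (c k) (F k y)) (push_frame A (c k) (F k) y)))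
             sums S \<omega>"
    using rect unfolding locally_rectifiable_def by (elim conjE exE) (rule that; assumption)
  note X = X0[rule_format] and mass = mass0[rule_format] and sums = sums0[rule_format]
  have K: "compact (K k)" and cA: "c k \<in> A" and FK: "F k ` K k \<subseteq> chart_img (c k)" for k using X by auto
  have "\<exists>L :: nat \<Rightarrow> real. \<forall>k::nat. (L k)-lipschitz_on UNIV (F k)" using X by metis
  then obtain L :: "nat \<Rightarrow> real" where L: "\<And>k::nat. (L k)-lipschitz_on UNIV (F k)" by blast
  have cF: "continuous_on UNIV (F k)" for k by (rule lipschitz_on_continuous_on[OF L])
  define X where "X k y = chart_inv (c k) (F k y)" for k y
  define J where "J k y = push_frame A (c k) (F k) y" for k y
  have Xc: "X k y \<in> fst (c k)" "snd (c k) (X k y) = F k y" if "y \<in> K k" for k y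
    unfolding X_def using that FK[of k] cA[of k] by (auto intro!: chart_inv_mem chart_chart_inv)
  have cX: "continuous_on (K k) (X k)" for k
    unfolding X_def by (rule continuous_on_compose2[OF chart_continuous(2)[OF cA] continuous_on_subset[OF cF subset_UNIV] FK])
  have [measurable]: "K k \<in> sets borel" for k using K[of k] by (simp add: borel_compact)
  define \<omega> where "\<omega> = (coord_form d \<psi> :: ('i \<Rightarrow> 'n) \<Rightarrow> _)"
  have \<omega>t: "test_form A (\<omega> f)" for f unfolding \<omega>_def by (rule test_form_coord_form[OF d \<psi>])
  have K': "compact K'" and \<psi>0: "\<And>x. x \<notin> K' \<Longrightarrow> \<psi> x = 0" using \<psi>(1) by (auto simp: cutoff_def)
  \<comment> \<open>Borel representatives of the coordinates along the pieces; where
    \<open>F k\<close> is differentiable they are the values on the frame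
    \<open>J k y\<close>.\<close>
  have "\<forall>k f. \<exists>\<Theta>. \<Theta> \<in> borel_measurable borel \<and> (\<forall>y\<in>K k. \<Theta> y = \<omega> f (X k y) (\<lambda>i. from_chart A (c k) (X k y) (jac (F k) y i)))"
    unfolding \<omega>_def X_def using coord_form_measurable[OF cA cF K FK d \<psi>] by metis
  then obtain \<Theta> where \<Theta>m[measurable]: "\<And>k f. \<Theta> k f \<in> borel_measurable borel"
    and \<Theta>: "\<And>k f y. y \<in> K k \<Longrightarrow> \<Theta> k f y = \<omega> f (X k y) (\<lambda>i. from_chart A (c k) (X k y) (jac (F k) y i))"
    by metis
  have \<Theta>J: "\<Theta> k f y = \<omega> f (X k y) (J k y)" if "y \<in> K k" "F k differentiable (at y)" for k f y
    unfolding \<Theta>[OF that(1)] J_def push_frame_def[abs_def] X_def jac_eq[OF that(2)] by (rule refl)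
  have "\<exists>N. negligible N \<and> (\<forall>y. y \<notin> N \<longrightarrow> F k differentiable (at y))" for k
    using Rademacher[OF L[of k]] by metis
  then obtain N0 where N0: "\<And>k. negligible (N0 k)" "\<And>k y. y \<notin> N0 k \<Longrightarrow> F k differentiable (at y)" by metis
  \<comment> \<open>All pieces as one measure space of pairs \<open>(k, y)\<close>, with density
    \<open>j f\<close> and position \<open>\<pi>\<close> on the manifold. The default value of
    \<open>\<pi>\<close> off \<open>K k\<close> is harmless, since \<open>j f\<close> is zero
    there.\<close>
  define \<rho> where "\<rho> = (count_space UNIV \<Otimes>\<^sub>M lborel :: (nat \<times> (real ^ 'i)) measure)"
  define j where "j f = (\<lambda>(k, y). of_int (m k) * (indicator (K k) y * \<Theta> k f y))" for f
  define \<pi> where "\<pi> = (\<lambda>(k, y). if y \<in> K k then X k y else undefined)"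
  have \<pi>m: "\<pi> \<in> measurable \<rho> borel"
    unfolding \<rho>_def \<pi>_def using cX K
    by (intro measurable_pair_measure_countable1) (auto intro!: borel_measurable_continuous_on_if)
  note [measurable] = \<pi>m
  \<comment> \<open>Only points over the compact set \<open>K'\<close> contribute, and there the
    densities are dominated by masses whose sum is finite by rectifiability.\<close>
  have jint: "integrable \<rho> (j f)" for f
  proof -
    obtain C where C: "C > 0" "\<And>x v. \<bar>\<omega> f x v\<bar> \<le> C * riemannian_mass h x (wedge v)"
      unfolding \<omega>_def using coord_form_le_mass[OF h d \<psi>] by blast
    let ?g = "\<lambda>k y. ennreal (\<bar>of_int (m k)\<bar> * riemannian_mass h (X k y) (wedge (J k y))) * indicator {y \<in> K k. X k y \<in> K'} y"
    have le: "(\<integral>\<^sup>+ y. ennreal \<bar>(1 / C) * j f (k, y)\<bar> \<partial>lborel) \<le> (\<integral>\<^sup>+ y. ?g k y \<partial>lebesgue)" for k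
    proof -
      have "(\<integral>\<^sup>+ y. ennreal \<bar>(1 / C) * j f (k, y)\<bar> \<partial>lborel) = (\<integral>\<^sup>+ y. ennreal \<bar>(1 / C) * j f (k, y)\<bar> \<partial>lebesgue)"
        by (rule nn_integral_completion[symmetric])
      also have "\<dots> \<le> (\<integral>\<^sup>+ y. ?g k y \<partial>lebesgue)"
      proof (rule nn_integral_mono_AE)
        have "AE y in lebesgue. y \<notin> N0 k" using N0(1) by (simp add: AE_not_in negligible_iff_null_sets)
        then show "AE y in lebesgue. ennreal \<bar>(1 / C) * j f (k, y)\<bar> \<le> ?g k y"
        proof eventually_elim
          case (elim y)
          show ?case
          proof (cases "y \<in> K k \<and> X k y \<in> K'")
            case True
            have "\<bar>\<omega> f (X k y) (J k y)\<bar> \<le> C * riemannian_mass h (X k y) (wedge (J k y))" by (rule C(2))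
            then have "(1 / C) * \<bar>\<omega> f (X k y) (J k y)\<bar> \<le> riemannian_mass h (X k y) (wedge (J k y))"
              using C(1) by (simp add: field_simps)
            then have "\<bar>of_int (m k)\<bar> * ((1 / C) * \<bar>\<omega> f (X k y) (J k y)\<bar>) \<le> \<bar>of_int (m k)\<bar> * riemannian_mass h (X k y) (wedge (J k y))"
              by (intro mult_left_mono) auto
            then show ?thesis using True N0(2)[OF elim] C(1)
              by (simp add: j_def \<Theta>J abs_mult mult.left_commute ennreal_leI)
          next
            case False
            then have "j f (k, y) = 0"
              using \<psi>0 by (auto simp: j_def \<Theta> \<omega>_def coord_form_def indicator_def)
            then show ?thesis by simp
          qed
        qed
      qed
      finally show ?thesis .
    qed
    have "(\<Sum>k. \<integral>\<^sup>+ y. ennreal \<bar>(1 / C) * j f (k, y)\<bar> \<partial>lborel) \<le> (\<Sum>k. \<integral>\<^sup>+ y. ?g k y \<partial>lebesgue)"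
      by (intro suminf_le le summableI)
    also have "\<dots> < \<infinity>" using mass[OF K'] by (simp add: X_def J_def)
    finally have "integrable \<rho> (\<lambda>z. (1 / C) * j f z)"
      unfolding \<rho>_def by (intro integrable_count_space_pair) (auto simp: j_def)
    from integrable_mult_right[OF this, of C] show ?thesis using C(1) by simp
  qed
  define H where "H f x = pairing (\<omega> f x) (\<xi> x)" for f x
  have \<mu>: "sets \<mu> = sets borel" and Hint: "integrable \<mu> (H f)" for f
    using rep \<omega>t unfolding represents_def radon_measure_def H_def by auto
  have bint: "integrable \<rho> (\<lambda>z. b (\<pi> z) * j f z)" if b: "b \<in> borel_measurable borel" "\<And>x. \<bar>b x\<bar> \<le> C" for b :: "'x \<Rightarrow> real" and C f
  proof (rule Bochner_Integration.integrable_bound)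
    show "integrable \<rho> (\<lambda>z. C * j f z)" using jint by simp
    have C: "C \<ge> 0" using b(2)[of undefined] by simp
    show "AE z in \<rho>. norm (b (\<pi> z) * j f z) \<le> norm (C * j f z)"
      using b(2) C by (auto simp: abs_mult intro!: mult_right_mono)
    note [measurable] = b(1) borel_measurable_integrable[OF jint]
    show "(\<lambda>z. b (\<pi> z) * j f z) \<in> borel_measurable \<rho>" by measurable
  qed
  have bintH: "integrable \<mu> (\<lambda>x. b x * H f x)" if b: "b \<in> borel_measurable borel" "\<And>x. \<bar>b x\<bar> \<le> C" for b :: "'x \<Rightarrow> real" and C f
  proof (rule Bochner_Integration.integrable_bound)
    show "integrable \<mu> (\<lambda>x. C * H f x)" using Hint by simp
    have C: "C \<ge> 0" using b(2)[of undefined] by simp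
    show "AE x in \<mu>. norm (b x * H f x) \<le> norm (C * H f x)"
      using b(2) C by (auto simp: abs_mult intro!: mult_right_mono)
    note [measurable_cong] = \<mu>
    note [measurable] = b(1) borel_measurable_integrable[OF Hint]
    show "(\<lambda>x. b x * H f x) \<in> borel_measurable \<mu>" by measurable
  qed
  \<comment> \<open>On cutoff functions both sides compute \<open>S\<close> on a multiple of the
    coordinate form; \<open>measures_agree\<close> extends the equality to bounded Borel
    functions.\<close>
  have agree: "(LINT x|\<mu>. b x * H f x) = (LINT z|\<rho>. b (\<pi> z) * j f z)"
    if b: "b \<in> borel_measurable borel" "\<And>x. \<bar>b x\<bar> \<le> C" for b :: "'x \<Rightarrow> real" and C f
  proof (rule measures_agree[OF \<mu> Hint \<pi>m jint _ b])
    fix \<kappa> Z assume \<kappa>: "cutoff \<kappa> Z"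
    have \<kappa>m[measurable]: "\<kappa> \<in> borel_measurable borel" by (rule cutoff_measurable[OF \<kappa>])
    have \<kappa>b: "\<bar>\<kappa> x\<bar> \<le> 1" for x using \<kappa> by (auto simp: cutoff_def)
    have t: "test_form A (\<lambda>x v. \<kappa> x * \<omega> f x v)"
      using \<kappa> \<omega>t by (intro test_form_mult_test) (auto simp: cutoff_def)
    have "S (\<lambda>x v. \<kappa> x * \<omega> f x v) = (LINT x|\<mu>. \<kappa> x * H f x)"
      using rep t unfolding represents_def by (simp add: H_def pairing_scale_left)
    moreover have "(\<lambda>k. of_int (m k) * (LINT y:K k|lebesgue. \<kappa> (X k y) * \<omega> f (X k y) (J k y))) sums S (\<lambda>x v. \<kappa> x * \<omega> f x v)"
      using sums[OF t] by (simp add: X_def J_def)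
    moreover have "of_int (m k) * (LINT y:K k|lebesgue. \<kappa> (X k y) * \<omega> f (X k y) (J k y)) = (LINT y|lborel. \<kappa> (\<pi> (k, y)) * j f (k, y))" for k
    proof -
      have pm[measurable]: "(\<lambda>y. \<pi> (k, y)) \<in> measurable borel borel"
        unfolding \<pi>_def using cX K by (auto intro!: borel_measurable_continuous_on_if)
      let ?f = "\<lambda>y. \<kappa> (\<pi> (k, y)) * j f (k, y)"
      have fm: "?f \<in> borel_measurable lborel" unfolding j_def by (simp, measurable)
      have "(LINT y|lborel. ?f y) = (LINT y|lebesgue. ?f y)"
        by (rule integral_completion[symmetric, OF fm])
      also have "\<dots> = (LINT y|lebesgue. of_int (m k) * (indicator (K k) y *\<^sub>R (\<kappa> (X k y) * \<omega> f (X k y) (J k y))))"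
      proof -
        have "AE y in lebesgue. y \<notin> N0 k" using N0(1) by (simp add: AE_not_in negligible_iff_null_sets)
        then have ae: "AE y in lebesgue. ?f y = of_int (m k) * (indicator (K k) y *\<^sub>R (\<kappa> (X k y) * \<omega> f (X k y) (J k y)))"
        proof eventually_elim
          case (elim y)
          then show ?case using \<Theta>J[of y k f] N0(2)[of y k] by (simp add: j_def \<pi>_def indicator_def)
        qed
        have "?f \<in> borel_measurable lebesgue" using fm by (rule measurable_completion)
        from borel_measurable_AE[OF this ae] this ae show ?thesis by (intro integral_cong_AE)
      qed
      finally show ?thesis by (simp add: set_lebesgue_integral_def)
    qed
    moreover have "(\<lambda>k. LINT y|lborel. \<kappa> (\<pi> (k, y)) * j f (k, y)) sums (LINT z|\<rho>. \<kappa> (\<pi> z) * j f z)"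
      using sums_integral_count_space_pair bint[OF \<kappa>m \<kappa>b] unfolding \<rho>_def by blast
    ultimately show "(LINT x|\<mu>. \<kappa> x * H f x) = (LINT z|\<rho>. \<kappa> (\<pi> z) * j f z)"
      using sums_unique2 by (metis (no_types, lifting) sums_cong)
  qed
  \<comment> \<open>Bundles the properties of the bi-Lipschitz pieces of one map, so that they can
    be chosen for all \<open>k\<close> at once.\<close>
  define Q where "Q k P \<delta> N \<longleftrightarrow> (\<forall>l. compact (P l)) \<and> (\<forall>l. P l \<subseteq> K k) \<and> (\<forall>l. \<delta> l > 0) \<and>
    (\<forall>l. \<forall>y\<in>P l. \<forall>z\<in>P l. \<delta> l * norm (z - y) \<le> norm (F k z - F k y)) \<and>
    (\<forall>l. \<forall>y\<in>P l. F k differentiable (at y) \<and> inj (frechet_derivative (F k) (at y))) \<and>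
    negligible N \<and> (\<forall>y\<in>K k - N. F k differentiable (at y) \<and>
       (y \<in> (\<Union>l. P l) \<or> \<not> inj (frechet_derivative (F k) (at y))))"
    for k and P :: "nat \<Rightarrow> (real ^ 'i) set" and \<delta> N
  have "\<forall>k. \<exists>P \<delta> N. Q k P \<delta> N"
  proof
    fix k
    obtain P \<delta> N where p: "\<And>j::nat. compact (P j)" "\<And>j. P j \<subseteq> K k" "\<And>j. \<delta> j > 0"
      "\<And>j y z. y \<in> P j \<Longrightarrow> z \<in> P j \<Longrightarrow> \<delta> j * norm (z - y) \<le> norm (F k z - F k y)"
      "\<And>j y. y \<in> P j \<Longrightarrow> F k differentiable (at y) \<and> inj (frechet_derivative (F k) (at y))"
      "negligible N" "\<And>y. y \<in> K k - N \<Longrightarrow> F k differentiable (at y) \<and>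
         (y \<in> (\<Union>j. P j) \<or> \<not> inj (frechet_derivative (F k) (at y)))"
      by (rule bilipschitz_pieces[OF L[of k] K[of k]]) (rule that; assumption)
    show "\<exists>P \<delta> N. Q k P \<delta> N"
      unfolding Q_def
      by (intro exI[of _ P] exI[of _ \<delta>] exI[of _ N] conjI allI ballI)
        (rule p(1,2,3,6) | erule conjunct1[OF p(5)] conjunct2[OF p(5)] conjunct1[OF p(7)] conjunct2[OF p(7)] | erule (1) p(4))+
  qed
  from choice[OF this] obtain P where "\<forall>k. \<exists>\<delta> N. Q k (P k) \<delta> N" ..
  from choice[OF this] obtain \<delta> where "\<forall>k. \<exists>N. Q k (P k) (\<delta> k) N" ..
  from choice[OF this] obtain N where Q: "\<forall>k. Q k (P k) (\<delta> k) (N k)" ..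
  have P: "\<And>k l. compact (P k l)" "\<And>k l. P k l \<subseteq> K k" "\<And>k l. \<delta> k l > 0"
    "\<And>k l y z. y \<in> P k l \<Longrightarrow> z \<in> P k l \<Longrightarrow> \<delta> k l * norm (z - y) \<le> norm (F k z - F k y)"
    "\<And>k l y. y \<in> P k l \<Longrightarrow> F k differentiable (at y) \<and> inj (frechet_derivative (F k) (at y))"
    and N: "\<And>k. negligible (N k)" "\<And>k y. y \<in> K k - N k \<Longrightarrow> F k differentiable (at y) \<and>
       (y \<in> (\<Union>l. P k l) \<or> \<not> inj (frechet_derivative (F k) (at y)))"
    using Q unfolding Q_def by blast+
  define E where "E k l = X k ` P k l" for k l
  have Ec: "compact (E k l)" for k l
    unfolding E_def by (intro compact_continuous_image continuous_on_subset[OF cX] P)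
  then have [measurable]: "E k l \<in> sets borel" for k l by (simp add: borel_compact)
  \<comment> \<open>A kernel vector of the derivative is a linear relation among the vectors
    \<open>J k y\<close>.\<close>
  have zero: "\<omega> f (X k y) (J k y) = 0" if y: "y \<in> K k" "F k differentiable (at y)" "\<not> inj (frechet_derivative (F k) (at y))" for f k y
  proof (cases "X k y \<in> K'")
    case True
    have D: "linear (frechet_derivative (F k) (at y))"
      using y(2) has_derivative_linear frechet_derivative_works by blast
    obtain u where u: "frechet_derivative (F k) (at y) u = 0" "u \<noteq> 0" using y(3) linear_injective_0[OF D] by blast
    have lc: "linear (from_chart A (c k) (X k y))" by (rule linear_from_chart[OF cA Xc(1)[OF y(1)]])
    have "(\<Sum>i\<in>UNIV. u $ i *\<^sub>R J k y i) = from_chart A (c k) (X k y) (frechet_derivative (F k) (at y) (\<Sum>i\<in>UNIV. u $ i *\<^sub>R axis i 1))"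
      by (simp add: J_def push_frame_def X_def linear_sum[OF D] linear_scale[OF D] linear_sum[OF lc[unfolded X_def]] linear_scale[OF lc[unfolded X_def]])
    also have "(\<Sum>i\<in>UNIV. u $ i *\<^sub>R axis i 1) = u" by (simp add: basis_expansion scalar_mult_eq_scaleR[symmetric])
    finally have "wedge (J k y) = 0"
      using u linear_0[OF lc] by (intro wedge_dependent[of u]) auto
    then show ?thesis
      using coord_form_wedge_cong[OF d, of "X k y" "J k y" 0 "J k y"] True \<psi>(2) by (auto simp: \<omega>_def)
  next
    case False
    then show ?thesis using \<psi>0 by (simp add: \<omega>_def coord_form_def)
  qed
  have off: "AE x in \<mu>. x \<in> (\<Union>k l. E k l) \<or> H f x = 0" for f
  proof -
    let ?U = "\<Union>k l. E k l"
    have [measurable]: "?U \<in> sets borel" by auto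
    have "AE x in \<mu>. indicator (- ?U) x * H f x = 0"
    proof (rule AE_zero_of_sets[OF \<mu>])
      show "integrable \<mu> (\<lambda>x. indicator (- ?U) x * H f x)"
        by (rule bintH[of _ 1]) (auto simp: indicator_def)
      fix B :: "'x set" assume [measurable]: "B \<in> sets borel"
      let ?b = "\<lambda>x. indicator B x * indicator (- ?U) x :: real"
      have bm: "?b \<in> borel_measurable borel" by measurable
      have bb: "\<bar>?b x\<bar> \<le> 1" for x by (auto simp: indicator_def)
      have "(LINT x|\<mu>. indicator B x * (indicator (- ?U) x * H f x)) = (LINT z|\<rho>. ?b (\<pi> z) * j f z)"
        using agree[OF bm bb] by (simp add: mult.assoc)
      also have "\<dots> = 0"
        unfolding \<rho>_def
      proof (rule integral_count_space_pair_0)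
        show "integrable (count_space UNIV \<Otimes>\<^sub>M lborel) (\<lambda>z. ?b (\<pi> z) * j f z)"
          using bint[OF bm bb] unfolding \<rho>_def .
        fix k
        show "AE y in lborel. ?b (\<pi> (k, y)) * j f (k, y) = 0"
          using AE_lborel_of_negligible[OF N(1)[of k]]
        proof eventually_elim
          case (elim y)
          show ?case
          proof (cases "y \<in> K k \<and> X k y \<notin> ?U")
            case True
            then have "\<not> inj (frechet_derivative (F k) (at y))" "F k differentiable (at y)"
              using N(2)[of y k] elim by (auto simp: E_def)
            then have "\<Theta> k f y = 0" using zero True \<Theta>J by simp
            then show ?thesis by (simp add: j_def)
          next
            case False
            then show ?thesis by (auto simp: j_def \<pi>_def indicator_def)
          qed
        qed
      qed
      finally show "(LINT x|\<mu>. indicator B x * (indicator (- ?U) x * H f x)) = 0" .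
    qed
    then show ?thesis by eventually_elim (auto simp: indicator_def split: if_splits)
  qed
  \<comment> \<open>Proportionality is written as the vanishing of 2 by 2 minors, a condition linear
    in \<open>H\<close> that can be tested by integration.\<close>
  have par: "AE x in \<mu>. \<forall>y\<in>P k l. x = X k y \<longrightarrow> \<omega> a x (J k y) * H b x = \<omega> b x (J k y) * H a x" for k l a b
  proof -
    have inj: "inj_on (X k) (P k l)"
    proof (rule inj_onI)
      fix y z assume yz: "y \<in> P k l" "z \<in> P k l" "X k y = X k z"
      have "y \<in> K k" "z \<in> K k" using yz(1,2) P(2) by blast+
      then have "F k y = F k z" using Xc(2)[of y k] Xc(2)[of z k] yz(3) by simp
      then have "\<delta> k l * norm (z - y) \<le> 0" using P(4)[OF yz(1,2)] by simp
      then show "y = z" using P(3)[of k l] by (simp add: mult_le_0_iff)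
    qed
    \<comment> \<open>Inverting the parametrization over \<open>E k l\<close> makes the coordinates
      of its frame a Borel function \<open>G\<close> of the point on the manifold.\<close>
    define Y where "Y x = (if x \<in> E k l then inv_into (P k l) (X k) x else 0)" for x
    have Yx: "Y (X k y) = y" if "y \<in> P k l" for y using that inj by (simp add: Y_def E_def)
    have "continuous_on (E k l) (inv_into (P k l) (X k))"
      unfolding E_def by (rule continuous_on_inv[OF continuous_on_subset[OF cX P(2)] P(1)]) (simp add: inj)
    then have [measurable]: "Y \<in> measurable borel borel"
      unfolding Y_def by (intro borel_measurable_continuous_on_if) auto
    define G where "G f x = indicator (E k l) x * \<Theta> k f (Y x)" for f x
    have [measurable]: "G f \<in> borel_measurable borel" for f unfolding G_def by measurable
    \<comment> \<open>Normalizes the functions \<open>G a\<close> and \<open>G b\<close> to absolute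
      value at most 1, as \<open>agree\<close> requires bounded functions.\<close>
    define D where "D x = 1 + \<bar>G a x\<bar> + \<bar>G b x\<bar>" for x
    have D: "D x > 0" for x by (simp add: D_def)
    let ?p = "\<lambda>f x. G f x / D x"
    have pm: "?p f \<in> borel_measurable borel" for f unfolding D_def by measurable
    have GX: "G f (X k y) = \<omega> f (X k y) (J k y)" if "y \<in> P k l" for f y
      using that P(2)[of k l] P(5)[OF that] by (simp add: G_def Yx \<Theta>J subset_iff) (simp add: E_def)
    obtain NN where NN: "\<And>k'. negligible (NN k')" "\<And>k' y y'. y \<in> K k' - NN k' \<Longrightarrow> F k' differentiable (at y) \<Longrightarrow> y' \<in> P k l \<Longrightarrow>
        X k' y = X k y' \<Longrightarrow> \<exists>r. wedge (J k' y) = r *\<^sub>R wedge (J k y')"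
    proof -
      have "\<forall>k'. \<exists>N. negligible N \<and> (\<forall>y y'. y \<in> K k' - N \<longrightarrow> F k' differentiable (at y) \<longrightarrow> y' \<in> P k l \<longrightarrow>
        X k' y = X k y' \<longrightarrow> (\<exists>r. wedge (J k' y) = r *\<^sub>R wedge (J k y')))"
      proof
        fix k'
        have 1: "F k ` P k l \<subseteq> chart_img (c k)" using P(2)[of k l] FK[of k] by blast
        have 2: "F k differentiable (at y)" if "y \<in> P k l" for y using P(5)[OF that] by simp
        show "\<exists>N. negligible N \<and> (\<forall>y y'. y \<in> K k' - N \<longrightarrow> F k' differentiable (at y) \<longrightarrow> y' \<in> P k l \<longrightarrow>
          X k' y = X k y' \<longrightarrow> (\<exists>r. wedge (J k' y) = r *\<^sub>R wedge (J k y')))"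
          using tangent_plane_unique[OF cA[of k'] K[of k'] FK[of k'] continuous_on_subset[OF cF subset_UNIV] cA[of k] P(1)[of k l] 1
              continuous_on_subset[OF cF subset_UNIV] P(3)[of k l] P(4) 2]
          unfolding X_def J_def by metis
      qed
      then show thesis using that by metis
    qed
    \<comment> \<open>Any piece that passes through \<open>E k l\<close> has there, at almost every
      parameter, a frame whose wedge is proportional to that of this piece. The minors thus vanish
      piece by piece, whatever the multiplicities.\<close>
    have pair: "?p a x * j b (k', y) = ?p b x * j a (k', y)" if y: "y \<notin> NN k'" "y \<notin> N0 k'" and x: "x = \<pi> (k', y)" for k' x y
    proof (cases "y \<in> K k' \<and> x \<in> E k l")
      case True
      then obtain y' where y': "y' \<in> P k l" "x = X k y'" by (auto simp: E_def)
      have xx: "x = X k' y" using True x by (simp add: \<pi>_def)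
      have dif: "F k' differentiable (at y)" using N0(2)[OF y(2)] .
      obtain r where r: "wedge (J k' y) = r *\<^sub>R wedge (J k y')"
        using NN(2)[of y k' y'] True y dif y' xx by auto
      have "\<Theta> k' f y = r * G f x" for f
      proof (cases "x \<in> K'")
        case True
        then have "\<omega> f x (J k' y) = r * \<omega> f x (J k y')"
          unfolding \<omega>_def using \<psi>(2) r by (intro coord_form_wedge_cong[OF d]) auto
        then show ?thesis using \<Theta>J[OF _ dif, of f] \<open>y \<in> K k' \<and> x \<in> E k l\<close> GX[OF y'(1)] xx y'(2) by simp
      next
        case False
        then show ?thesis using \<Theta>J[OF _ dif, of f] \<open>y \<in> K k' \<and> x \<in> E k l\<close> GX[OF y'(1)] xx y'(2) \<psi>0
          by (simp add: \<omega>_def coord_form_def)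
      qed
      then show ?thesis by (simp add: j_def)
    next
      case False
      then show ?thesis by (auto simp: j_def G_def)
    qed
    have "AE x in \<mu>. ?p a x * H b x - ?p b x * H a x = 0"
    proof (rule AE_zero_of_sets[OF \<mu>])
      have pb: "\<bar>?p a x\<bar> \<le> 1" "\<bar>?p b x\<bar> \<le> 1" for x using D[of x] by (auto simp: D_def)
      show "integrable \<mu> (\<lambda>x. ?p a x * H b x - ?p b x * H a x)"
        by (intro Bochner_Integration.integrable_diff bintH[of _ 1] pm pb)
      fix B :: "'x set" assume [measurable]: "B \<in> sets borel"
      note [measurable] = pm
      let ?q = "\<lambda>f x. indicator B x * ?p f x"
      have qm: "?q f \<in> borel_measurable borel" for f by measurable
      have qb: "\<bar>?q a x\<bar> \<le> 1" "\<bar>?q b x\<bar> \<le> 1" for x using pb[of x] by (auto simp: indicator_def)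
      have "(LINT x|\<mu>. indicator B x * (?p a x * H b x - ?p b x * H a x)) = (LINT x|\<mu>. ?q a x * H b x - ?q b x * H a x)"
        by (intro Bochner_Integration.integral_cong) (auto simp: algebra_simps)
      also have "\<dots> = (LINT x|\<mu>. ?q a x * H b x) - (LINT x|\<mu>. ?q b x * H a x)"
        by (intro Bochner_Integration.integral_diff bintH[of _ 1] qm qb)
      also have "\<dots> = (LINT z|\<rho>. ?q a (\<pi> z) * j b z) - (LINT z|\<rho>. ?q b (\<pi> z) * j a z)"
        using agree[OF qm qb(1)] agree[OF qm qb(2)] by simp
      also have "\<dots> = (LINT z|\<rho>. ?q a (\<pi> z) * j b z - ?q b (\<pi> z) * j a z)"
        by (intro Bochner_Integration.integral_diff[symmetric] bint[of _ 1] qm qb)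
      also have "\<dots> = 0"
        unfolding \<rho>_def
      proof (rule integral_count_space_pair_0)
        show "integrable (count_space UNIV \<Otimes>\<^sub>M lborel) (\<lambda>z. ?q a (\<pi> z) * j b z - ?q b (\<pi> z) * j a z)"
          unfolding \<rho>_def[symmetric] by (intro Bochner_Integration.integrable_diff bint[of _ 1] qm qb)
        fix k'
        show "AE y in lborel. ?q a (\<pi> (k', y)) * j b (k', y) - ?q b (\<pi> (k', y)) * j a (k', y) = 0"
          using AE_lborel_of_negligible[OF NN(1)[of k']] AE_lborel_of_negligible[OF N0(1)[of k']]
        proof eventually_elim
          case (elim y)
          show ?case unfolding mult.assoc pair[OF elim refl] by (rule diff_self)
        qed
      qed
      finally show "(LINT x|\<mu>. indicator B x * (?p a x * H b x - ?p b x * H a x)) = 0" .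
    qed
    then show ?thesis
    proof eventually_elim
      case (elim x)
      show ?case
      proof (intro ballI impI)
        fix y assume y: "y \<in> P k l" "x = X k y"
        have "(G a x * H b x - G b x * H a x) / D x = 0" using elim by (simp add: diff_divide_distrib)
        then show "\<omega> a x (J k y) * H b x = \<omega> b x (J k y) * H a x" using D[of x] GX[OF y(1)] y(2) by simp
      qed
    qed
  qed
  have "AE x in \<mu>. (\<forall>f. x \<in> (\<Union>k l. E k l) \<or> H f x = 0) \<and>
    (\<forall>k l a b. \<forall>y\<in>P k l. x = X k y \<longrightarrow> \<omega> a x (J k y) * H b x = \<omega> b x (J k y) * H a x)"
    unfolding AE_conj_iff AE_all_countable using off par by blast
  then show ?thesis
  proof eventually_elim
    case (elim x)
    show ?case
    proof (intro impI)
      assume x1: "\<psi> x = 1" and mv: "\<xi> x \<in> multivectors"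
      have xd: "x \<in> fst d" using x1 \<psi>0[of x] \<psi>(2) by fastforce
      have Lx: "linear (to_chart d x)" by (rule linear_to_chart[OF d xd])
      have Hx: "H f x = mv_map (to_chart d x) (\<xi> x) $ f" for f
        by (simp add: H_def \<omega>_def pairing_coord_form x1)
      show "\<exists>v. \<xi> x = wedge v"
      proof (cases "x \<in> (\<Union>k l. E k l)")
        case False
        then have "mv_map (to_chart d x) (\<xi> x) = 0" using elim Hx by (simp add: vec_eq_iff)
        also have "0 = mv_map (to_chart d x) (0 *\<^sub>R wedge (\<lambda>_. 0))" by (simp add: linear_0[OF linear_mv_map])
        finally have "\<xi> x = 0 *\<^sub>R wedge (\<lambda>_. 0)"
          by (intro mv_to_chart_inj[OF d xd mv]) (auto simp: subspace_0 subspace_multivectors)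
        then show ?thesis unfolding scale_wedge[where i = undefined] by blast
      next
        case True
        then obtain k l y where y: "y \<in> P k l" "x = X k y" by (auto simp: E_def)
        have yK: "y \<in> K k" using y P(2) by blast
        have par: "\<omega> a x (J k y) * H b x = \<omega> b x (J k y) * H a x" for a b using elim y by blast
        have \<omega>x: "\<omega> f x (J k y) = wedge (\<lambda>i. to_chart d x (J k y i)) $ f" for f by (simp add: \<omega>_def coord_form_def x1)
        have dif: "F k differentiable (at y)" "inj (frechet_derivative (F k) (at y))" using P(5)[OF y(1)] by auto
        let ?D = "frechet_derivative (F k) (at y)"
        have D: "linear ?D" using dif(1) has_derivative_linear frechet_derivative_works by blast
        have xc: "x \<in> fst (c k)" using Xc(1)[OF yK] y(2) by simp
        have lt: "linear (dtrans (c k) d x)" by (rule linear_dtrans[OF cA d xc xd])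
        have tJ: "to_chart d x (J k y i) = dtrans (c k) d x (?D (axis i 1))" for i
          using to_chart_from_chart[OF cA d xc xd] y(2) by (simp add: J_def push_frame_def X_def)
        have "wedge (\<lambda>i. to_chart d x (J k y i)) \<noteq> 0"
        proof (rule wedge_independent)
          fix u :: "real ^ 'i" assume u: "u \<noteq> 0"
          have "(\<Sum>i\<in>UNIV. u $ i *\<^sub>R to_chart d x (J k y i)) = dtrans (c k) d x (?D (\<Sum>i\<in>UNIV. u $ i *\<^sub>R axis i 1))"
            by (simp add: tJ linear_sum[OF D] linear_scale[OF D] linear_sum[OF lt] linear_scale[OF lt])
          also have "(\<Sum>i\<in>UNIV. u $ i *\<^sub>R axis i 1) = u" by (simp add: basis_expansion scalar_mult_eq_scaleR[symmetric])
          finally have e: "(\<Sum>i\<in>UNIV. u $ i *\<^sub>R to_chart d x (J k y i)) = dtrans (c k) d x (?D u)" .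
          show "(\<Sum>i\<in>UNIV. u $ i *\<^sub>R to_chart d x (J k y i)) \<noteq> 0"
          proof
            assume "(\<Sum>i\<in>UNIV. u $ i *\<^sub>R to_chart d x (J k y i)) = 0"
            then have "dtrans d (c k) x (dtrans (c k) d x (?D u)) = dtrans d (c k) x 0" using e by simp
            then have "?D u = 0"
              using dtrans_inverse[OF cA d xc xd] linear_0[OF linear_dtrans[OF d cA xd xc]] by simp
            then show False using u dif(2) linear_injective_0[OF D] by blast
          qed
        qed
        \<comment> \<open>The derivative is injective at \<open>y\<close>, so some coordinate of
          \<open>wedge (J k y)\<close> is nonzero; it determines the factor
          \<open>r\<close>.\<close>
        then obtain a where a: "\<omega> a x (J k y) \<noteq> 0" by (auto simp: vec_eq_iff \<omega>x)
        define r where "r = H a x / \<omega> a x (J k y)"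
        have "H b x = r * \<omega> b x (J k y)" for b using par[of a b] a by (simp add: r_def field_simps)
        then have "mv_map (to_chart d x) (\<xi> x) = mv_map (to_chart d x) (r *\<^sub>R wedge (J k y))"
          by (simp add: vec_eq_iff Hx[symmetric] linear_scale[OF linear_mv_map] mv_map_wedge[OF Lx] \<omega>x)
        then have "\<xi> x = r *\<^sub>R wedge (J k y)"
          by (intro mv_to_chart_inj[OF d xd mv] subspace_scale subspace_multivectors wedge_in_multivectors)
        then show ?thesis unfolding scale_wedge[where i = undefined] by blast
      qed
    qed
  qed
qed

lemma rectifiable_simple:
  assumes rect: "locally_rectifiable A S" and rep: "represents A S \<xi> \<mu>"
    and mv: "AE x in \<mu>. \<xi> x \<in> multivectors"
  shows "AE x in \<mu>. \<exists>v. \<xi> x = wedge v"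
proof -
  obtain c :: "nat \<Rightarrow> ('x, 'n) chart" and \<psi> K V where c: "\<And>n. c n \<in> A" "\<And>n. cutoff (\<psi> n) (K n)" "\<And>n. K n \<subseteq> fst (c n)"
    "\<And>n. open (V n)" "\<And>n x. x \<in> V n \<Longrightarrow> \<psi> n x = 1" "(\<Union>n. V n) = UNIV"
    using countable_cutoff_cover by blast
  have "AE x in \<mu>. \<forall>n. \<psi> n x = 1 \<longrightarrow> \<xi> x \<in> multivectors \<longrightarrow> (\<exists>v. \<xi> x = wedge v)"
    unfolding AE_all_countable using rectifiable_simple_local[OF rect rep c(1-3)] by blast
  with mv show ?thesis
  proof eventually_elim
    case (elim x)
    obtain n where "x \<in> V n" using c(6) by blast
    then show ?case using elim c(5) by blast
  qed
qed

end

section \<open>Volume and calibrations\<close>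

locale calibrated_manifold = smooth_manifold A
  for A :: "('x::{t2_space,second_countable_topology}, 'p::finite + 'q::finite) chart set" +
  fixes g :: "('x, 'p + 'q) metric" and G :: "'x \<Rightarrow> (real ^ ('p \<Rightarrow> 'p + 'q)) set"
    and \<phi> :: "('x, 'p, 'p + 'q) form"
  assumes metric: "semi_riemannian_metric A g" and orientation: "space_like_orientation A g G"
    and calibration: "calibration A G \<phi>"
begin

section \<open>The mass cone, the mass norm and the calibration at one point\<close>

lemma metric_bilinear: "bilinear (g x)"
  using metric by (simp add: semi_riemannian_metric_def smooth_symmetric_tensor_def)

lemma metric_form: "space_like_form (g x)"
proof
  show "bilinear (g x)" by (rule metric_bilinear)
  show "g x u v = g x v u" for u v
    using metric unfolding semi_riemannian_metric_def smooth_symmetric_tensor_def by blast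
  show "\<exists>b :: 'p + 'q \<Rightarrow> real ^ ('p + 'q).
        \<forall>i j. g x (b i) (b j) = (if i \<noteq> j then 0 else if i \<in> range Inl then 1 else - 1)"
    using metric unfolding semi_riemannian_metric_def by blast
qed

lemma metric_symmetric_form: "symmetric_form (g x)"
  by (rule space_like_form.axioms(1)[OF metric_form])

lemma planes_component: "G x \<in> components (space_like_form.planes (g x))"
proof -
  have "space_like_form.planes (g x) = space_like_planes g x"
    unfolding space_like_form.planes_def[OF metric_form] symmetric_form.frame_def[OF metric_symmetric_form]
      space_like_planes_def orthonormal_frame_def ..
  then show ?thesis using orientation by (simp add: space_like_orientation_def)
qed

lemma plane_frame:
  assumes "\<eta> \<in> G x"
  obtains e where "symmetric_form.frame (g x) e" "\<eta> = wedge e"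
  using space_like_form.G_subset[OF metric_form planes_component] assms
  unfolding space_like_form.planes_def[OF metric_form] by blast

lemma calibration_plane: "\<eta> \<in> G x \<Longrightarrow> pairing (\<phi> x) \<eta> \<ge> 1"
  using calibration by (simp add: calibration_def)

lemma plane_in_cone: "\<eta> \<in> G x \<Longrightarrow> t > 0 \<Longrightarrow> t *\<^sub>R \<eta> \<in> mass_cone G x"
  unfolding mass_cone_def mass_ball_def by (intro CollectI exI[of _ t] exI[of _ \<eta>] conjI refl hull_inc)

lemma mass_cone_multivector:
  assumes "\<xi> \<in> mass_cone G x" shows "\<xi> \<in> multivectors"
proof -
  obtain t b where t: "\<xi> = t *\<^sub>R b" "b \<in> convex hull (G x)"
    using assms by (auto simp: mass_cone_def mass_ball_def)
  have "G x \<subseteq> multivectors"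
  proof
    fix \<eta> assume "\<eta> \<in> G x"
    then obtain e where "\<eta> = wedge e" by (rule plane_frame)
    then show "\<eta> \<in> multivectors" by (simp add: wedge_in_multivectors)
  qed
  then have "convex hull (G x) \<subseteq> multivectors"
    by (intro hull_minimal subspace_imp_convex subspace_multivectors)
  then have "b \<in> multivectors" using t(2) by (rule subsetD)
  then show ?thesis unfolding t(1) by (rule subspace_scale[OF subspace_multivectors])
qed

text \<open>The bound on planes passes to their convex hull. Strict positivity on the cone is what
  later excludes cancellation.\<close>

lemma calibration_cone:
  assumes "\<xi> \<in> mass_cone G x" shows "pairing (\<phi> x) \<xi> > 0"
proof -
  obtain t b where t: "\<xi> = t *\<^sub>R b" "t > 0" "b \<in> convex hull (G x)"
    using assms by (auto simp: mass_cone_def mass_ball_def)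
  have "convex (pairing (\<phi> x) -` {1..})"
    by (rule convex_linear_vimage[OF linear_pairing]) simp
  then have "convex hull (G x) \<subseteq> pairing (\<phi> x) -` {1..}"
    using calibration_plane by (intro hull_minimal) auto
  then have "pairing (\<phi> x) b \<ge> 1" using t(3) by auto
  then show ?thesis using t(1,2) by (simp add: pairing_scale_right)
qed

text \<open>By \<open>frontier_hull\<close> exactly one multiple of a plane lies on the frontier, so
  the description in \<open>mass_norm\<close> denotes on these rays.\<close>

lemma mass_norm_plane:
  assumes \<eta>: "\<eta> \<in> G x" and t: "t > 0"
  shows "mass_norm G x (t *\<^sub>R \<eta>) = t"
proof -
  obtain e where e: "symmetric_form.frame (g x) e" "\<eta> = wedge e" using plane_frame[OF \<eta>] .
  have *: "l *\<^sub>R t *\<^sub>R \<eta> \<in> (top_of_set multivectors) frontier_of (mass_ball G x) \<longleftrightarrow> l * t = 1" if "l > 0" for l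
    using space_like_form.frontier_hull[OF metric_form planes_component e(1), of "l * t"] \<eta> e(2) t that
    by (simp add: mass_ball_def)
  have "(THE l. l > 0 \<and> l *\<^sub>R t *\<^sub>R \<eta> \<in> (top_of_set multivectors) frontier_of (mass_ball G x)) = 1 / t"
  proof (rule the_equality)
    show "1 / t > 0 \<and> (1 / t) *\<^sub>R t *\<^sub>R \<eta> \<in> (top_of_set multivectors) frontier_of (mass_ball G x)"
      using *[of "1 / t"] t by simp
    fix l assume "l > 0 \<and> l *\<^sub>R t *\<^sub>R \<eta> \<in> (top_of_set multivectors) frontier_of (mass_ball G x)"
    then have "l * t = 1" using * by blast
    then show "l = 1 / t" using t by (simp add: field_simps)
  qed
  then show ?thesis by (simp add: mass_norm_def)
qed

lemma simple_in_mass_cone: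
  assumes "wedge v \<in> mass_cone G x"
  obtains m \<eta> where "m > 0" "\<eta> \<in> G x" "wedge v = m *\<^sub>R \<eta>"
proof -
  obtain t b where t: "wedge v = t *\<^sub>R b" "t > 0" "b \<in> convex hull (G x)"
    using assms by (auto simp: mass_cone_def mass_ball_def)
  show thesis
    by (rule space_like_form.simple_in_cone[OF metric_form planes_component t(2,3,1)]) (rule that)
qed

section \<open>Measurability of the scale factor\<close>

definition chart_metric :: "('x, 'p + 'q) chart \<Rightarrow> 'x \<Rightarrow> real ^ ('p + 'q) \<Rightarrow> real ^ ('p + 'q) \<Rightarrow> real" where
  "chart_metric c x u v = g x (from_chart A c x u) (from_chart A c x v)"

lemma chart_metric_continuous:
  assumes c: "c \<in> A" shows "continuous_on (fst c) (\<lambda>x. chart_metric c x u v)"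
proof -
  have "smooth_on (chart_img c) (\<lambda>y. chart_metric c (chart_inv c y) u v)"
    using metric c by (simp add: semi_riemannian_metric_def smooth_symmetric_tensor_def chart_metric_def Let_def)
  then have "continuous_on (chart_img c) (\<lambda>y. chart_metric c (chart_inv c y) u v)"
    by (rule smooth_on_continuous[OF _ chart_open(2)[OF c]])
  then have "continuous_on (fst c) (\<lambda>x. chart_metric c (chart_inv c (snd c x)) u v)"
    by (rule continuous_on_compose2[OF _ chart_continuous(1)[OF c]]) (use chart_mem[OF c] in blast)
  then show ?thesis
    by (rule continuous_on_eq) (simp add: chart_inv_chart[OF c])
qed

lemma gram_form_plane:
  assumes "\<eta> \<in> G x" shows "gram_form (g x) (t *\<^sub>R \<eta>) = t\<^sup>2"
proof -
  obtain e where e: "symmetric_form.frame (g x) e" "\<eta> = wedge e" using plane_frame[OF assms] .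
  have "gram_form (g x) \<eta> = 1"
    using symmetric_form.ip_frame[OF metric_symmetric_form e(1)]
    by (simp add: e(2) gram_form_wedge[OF metric_bilinear] symmetric_form.ip_def[OF metric_symmetric_form])
  then show ?thesis by (simp add: gram_form_scale)
qed

lemma gram_form_chart:
  assumes c: "c \<in> A" "x \<in> fst c"
  shows "gram_form (chart_metric c x) (mv_map (to_chart c x) (wedge v)) = gram_form (g x) (wedge v)"
proof -
  have L: "linear (from_chart A c x)" by (rule linear_from_chart[OF c])
  have "bilinear (chart_metric c x)"
    using metric_bilinear[of x] L unfolding bilinear_def chart_metric_def
    by (auto intro: linear_compose[of "from_chart A c x", unfolded o_def])
  then show ?thesis
    by (simp add: mv_map_wedge[OF linear_to_chart[OF c]] gram_form_wedge metric_bilinear chart_metric_def from_to_chart[OF c])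
qed

lemma calibrated_factor_measurable:
  assumes rep: "represents A S \<xi> \<mu>" and simple: "AE x in \<mu>. \<exists>v m \<eta>. \<xi> x = wedge v \<and> m > 0 \<and> \<eta> \<in> G x \<and> \<xi> x = m *\<^sub>R \<eta>"
  obtains k where "k \<in> borel_measurable \<mu>" "\<And>x. k x > 0" "AE x in \<mu>. \<exists>\<eta>\<in>G x. \<xi> x = k x *\<^sub>R \<eta>"
proof -
  obtain c :: "nat \<Rightarrow> ('x, 'p + 'q) chart" and \<psi> K V where c: "\<And>n. c n \<in> A" "\<And>n. cutoff (\<psi> n) (K n)" "\<And>n. K n \<subseteq> fst (c n)"
    "\<And>n. open (V n)" "\<And>n x. x \<in> V n \<Longrightarrow> \<psi> n x = 1" "(\<Union>n. V n) = UNIV"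
    using countable_cutoff_cover by blast
  have VK: "V n \<subseteq> fst (c n)" for n
  proof
    fix x assume "x \<in> V n"
    then have "\<psi> n x \<noteq> 0" using c(5) by simp
    then show "x \<in> fst (c n)" using c(2)[of n] c(3)[of n] unfolding cutoff_def by blast
  qed
  have \<mu>: "sets \<mu> = sets borel" using rep by (simp add: represents_def radon_measure_def)
  note [measurable_cong] = \<mu>
  define H where "H n f x = pairing (coord_form (c n) (\<psi> n) f x) (\<xi> x)" for n and f :: "'p \<Rightarrow> 'p + 'q" and x
  have [measurable]: "H n f \<in> borel_measurable \<mu>" for n f
    using rep test_form_coord_form[OF c(1) c(2) c(3)] unfolding represents_def H_def by blast
  define \<Gamma> where "\<Gamma> n a b x = (if x \<in> V n then chart_metric (c n) x (axis a 1) (axis b 1) else 0)" for n a b x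
  have [measurable]: "V n \<in> sets borel" for n using c(4) by simp
  have [measurable]: "\<Gamma> n a b \<in> borel_measurable borel" for n a b
    unfolding \<Gamma>_def
    by (intro borel_measurable_continuous_on_if continuous_on_const continuous_on_subset[OF chart_metric_continuous[OF c(1)] VK]) measurable
  define Q where "Q n x = (\<Sum>f\<in>UNIV. \<Sum>h\<in>UNIV. H n f x * H n h x * (\<Prod>i\<in>UNIV. \<Gamma> n (f i) (h i) x)) / fact CARD('p)" for n x
  have [measurable]: "Q n \<in> borel_measurable \<mu>" for n unfolding Q_def by measurable
  \<comment> \<open>The index of the first plateau that contains \<open>x\<close>: a measurable
    choice of chart.\<close>
  define N where "N x = (LEAST n. x \<in> V n)" for x
  have N: "x \<in> V (N x)" for x
    unfolding N_def by (rule LeastI_ex) (use c(6) in blast)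
  have [measurable]: "N \<in> measurable \<mu> (count_space UNIV)" unfolding N_def by measurable
  have [measurable]: "(\<lambda>x. Q (N x) x) \<in> borel_measurable \<mu>"
    by (rule measurable_compose_countable) measurable
  have Q: "Q n x = gram_form (g x) (\<xi> x)" if "x \<in> V n" "\<xi> x = wedge v" for n x v
  proof -
    have "Q n x = gram_form (chart_metric (c n) x) (mv_map (to_chart (c n) x) (\<xi> x))"
      using that(1) c(5)[OF that(1)] by (simp add: Q_def gram_form_def H_def pairing_coord_form \<Gamma>_def)
    then show ?thesis using gram_form_chart[OF c(1)[of n], of x v] VK that by auto
  qed
  \<comment> \<open>The default value 1 makes the factor positive at every point, not merely almost
    everywhere.\<close>
  define k where "k x = (if sqrt (Q (N x) x) > 0 then sqrt (Q (N x) x) else 1)" for x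
  show thesis
  proof (rule that[of k])
    show "k \<in> borel_measurable \<mu>" unfolding k_def by measurable
    show "k x > 0" for x by (simp add: k_def)
    show "AE x in \<mu>. \<exists>\<eta>\<in>G x. \<xi> x = k x *\<^sub>R \<eta>"
      using simple
    proof eventually_elim
      case (elim x)
      then obtain v m \<eta> where x: "\<xi> x = wedge v" "m > 0" "\<eta> \<in> G x" "\<xi> x = m *\<^sub>R \<eta>" by blast
      have "Q (N x) x = m\<^sup>2" using Q[OF N x(1)] gram_form_plane[OF x(3), of m] x(4) by simp
      then show ?case using x(2,3,4) by (auto simp: k_def)
    qed
  qed
qed

text \<open>Positivity of \<open>\<phi>\<close> on the mass cone rules out cancellation, so the representing measure charges
  only the support of the current.\<close>

lemma concentrated_on_support:
  assumes rep: "represents A S \<xi> \<mu>" and S: "is_current A S" "compact (current_support A S)"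
    and pos: "AE x in \<mu>. \<xi> x \<in> mass_cone G x"
  shows "AE x in \<mu>. x \<in> current_support A S"
proof -
  let ?W = "- current_support A S"
  have W: "open ?W" using compact_imp_closed[OF S(2)] by blast
  obtain C :: "nat \<Rightarrow> 'x set" where C: "\<And>n. compact (C n)" "(\<Union>n. C n) = ?W"
    using open_sigma_compact[OF W] by metis
  have "AE x in \<mu>. x \<notin> C n" for n
  proof -
    have "C n \<subseteq> ?W" using C(2) by blast
    then obtain \<psi> L V where \<psi>: "cutoff \<psi> L" "L \<subseteq> ?W" "C n \<subseteq> V" "\<And>y. y \<in> V \<Longrightarrow> \<psi> y = 1"
      using compact_cutoff[OF C(1) _ W] by metis
    let ?h = "\<lambda>x. pairing (\<lambda>v. \<psi> x * \<phi> x v) (\<xi> x)"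
    have sm: "smooth_form A \<phi>" using calibration by (simp add: calibration_def)
    have t: "test_form A (\<lambda>x v. \<psi> x * \<phi> x v)" by (rule test_form_mult(1)[OF \<psi>(1) sm])
    have "S (\<lambda>x v. \<psi> x * \<phi> x v) = 0"
      using test_form_mult(2)[OF \<psi>(1) sm] \<psi>(2) by (intro current_eq_0[OF S(1) t]) blast
    then have i: "integrable \<mu> ?h" "(LINT x|\<mu>. ?h x) = 0" using rep t by (auto simp: represents_def)
    have nn: "AE x in \<mu>. 0 \<le> ?h x"
      using pos
    proof eventually_elim
      case (elim x)
      then show ?case using calibration_cone[OF elim] \<psi>(1) by (simp add: pairing_scale_left cutoff_def)
    qed
    have "AE x in \<mu>. ?h x = 0" using integral_nonneg_eq_0_iff_AE[OF i(1) nn] i(2) by blast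
    with pos show ?thesis
    proof eventually_elim
      case (elim x)
      then show ?case using calibration_cone[OF elim(1)] \<psi>(3,4) by (auto simp: pairing_scale_left)
    qed
  qed
  then have "AE x in \<mu>. \<forall>n. x \<notin> C n" by (simp add: AE_all_countable)
  then show ?thesis by eventually_elim (use C(2) in blast)
qed

lemma simple_polar_form:
  assumes rect: "locally_rectifiable A S" and rep: "represents A S \<xi> \<mu>"
    and cone: "AE x in \<mu>. \<xi> x \<in> mass_cone G x"
  obtains k where "k \<in> borel_measurable \<mu>" "\<And>x. k x > 0" "AE x in \<mu>. \<exists>\<eta>\<in>G x. \<xi> x = k x *\<^sub>R \<eta>"
proof -
  have "AE x in \<mu>. \<xi> x \<in> multivectors" using cone by eventually_elim (rule mass_cone_multivector)
  from rectifiable_simple[OF rect rep this] cone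
  have "AE x in \<mu>. \<exists>v m \<eta>. \<xi> x = wedge v \<and> m > 0 \<and> \<eta> \<in> G x \<and> \<xi> x = m *\<^sub>R \<eta>"
  proof eventually_elim
    case (elim x)
    then obtain v where v: "\<xi> x = wedge v" by blast
    then obtain m \<eta> where "m > 0" "\<eta> \<in> G x" "wedge v = m *\<^sub>R \<eta>"
      using simple_in_mass_cone[of v x thesis] elim(2) by metis
    then show ?case by (intro exI[of _ v] exI[of _ m] exI[of _ \<eta>]) (simp add: v)
  qed
  then show thesis by (rule calibrated_factor_measurable[OF rep _ that])
qed

text \<open>The calibration need not have compact support. Cutting it off changes nothing on the
  support of the current, where \<open>\<mu>\<close> is concentrated.\<close>

lemma calibration_integral:
  assumes rep: "represents A S \<xi> \<mu>" and S: "is_current A S" "compact (current_support A S)"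
    and pos: "AE x in \<mu>. \<xi> x \<in> mass_cone G x"
    and \<psi>: "cutoff \<psi> L" "current_support A S \<subseteq> V" "\<forall>y\<in>V. \<psi> y = 1"
  defines "\<omega> \<equiv> \<lambda>x v. \<psi> x * \<phi> x v"
  shows "integrable \<mu> (\<lambda>x. pairing (\<omega> x) (\<xi> x))" "S \<omega> = (LINT x|\<mu>. pairing (\<omega> x) (\<xi> x))"
    and "AE x in \<mu>. pairing (\<omega> x) (\<xi> x) = pairing (\<phi> x) (\<xi> x)"
proof -
  have "smooth_form A \<phi>" using calibration by (simp add: calibration_def)
  from test_form_mult(1)[OF \<psi>(1) this]
  show "integrable \<mu> (\<lambda>x. pairing (\<omega> x) (\<xi> x))" "S \<omega> = (LINT x|\<mu>. pairing (\<omega> x) (\<xi> x))"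
    using rep by (auto simp: represents_def \<omega>_def)
  show "AE x in \<mu>. pairing (\<omega> x) (\<xi> x) = pairing (\<phi> x) (\<xi> x)"
    using concentrated_on_support[OF rep S pos]
  proof eventually_elim
    case (elim x)
    then show ?case using \<psi>(2,3) by (auto simp: \<omega>_def pairing_scale_left)
  qed
qed

text \<open>Two polar forms of the same current have proportional multivectors almost everywhere with
  respect to the common measure obtained by weighting with \<open>\<phi>\<close>. This makes the volume independent of
  the polar form.\<close>

lemma polar_form_unique:
  assumes S: "is_current A S" "compact (current_support A S)"
    and 1: "represents A S \<xi> \<mu>" "AE x in \<mu>. \<xi> x \<in> mass_cone G x"
    and 2: "represents A S \<xi>' \<mu>'" "AE x in \<mu>'. \<xi>' x \<in> mass_cone G x"
    and \<psi>: "cutoff \<psi> L" "current_support A S \<subseteq> V" "\<forall>y\<in>V. \<psi> y = 1"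
  defines "h \<equiv> \<lambda>x. pairing (\<lambda>v. \<psi> x * \<phi> x v) (\<xi> x)" and "h' \<equiv> \<lambda>x. pairing (\<lambda>v. \<psi> x * \<phi> x v) (\<xi>' x)"
  shows "density \<mu> h = density \<mu>' h'" "AE x in density \<mu> h. (1 / h x) *\<^sub>R \<xi> x = (1 / h' x) *\<^sub>R \<xi>' x"
proof -
  have \<mu>: "sets \<mu> = sets borel" and \<mu>': "sets \<mu>' = sets borel"
    using 1(1) 2(1) by (auto simp: represents_def radon_measure_def)
  note [measurable_cong] = \<mu> \<mu>'
  have hi: "integrable \<mu> h" "integrable \<mu>' h'"
    unfolding h_def h'_def by (rule calibration_integral(1)[OF 1(1) S 1(2) \<psi>] calibration_integral(1)[OF 2(1) S 2(2) \<psi>])+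
  note [measurable] = borel_measurable_integrable[OF hi(1)] borel_measurable_integrable[OF hi(2)]
  have hpos: "AE x in \<mu>. h x > 0"
    using calibration_integral(3)[OF 1(1) S 1(2) \<psi>] 1(2)
  proof eventually_elim
    case (elim x) then show ?case unfolding h_def using calibration_cone[OF elim(2)] by simp
  qed
  have hpos': "AE x in \<mu>'. h' x > 0"
    using calibration_integral(3)[OF 2(1) S 2(2) \<psi>] 2(2)
  proof eventually_elim
    case (elim x) then show ?case unfolding h'_def using calibration_cone[OF elim(2)] by simp
  qed
  have agree: "(LINT x|\<mu>. indicator B x * pairing (\<omega> x) (\<xi> x)) = (LINT x|\<mu>'. indicator B x * pairing (\<omega> x) (\<xi>' x))"
    if \<omega>: "test_form A \<omega>" and B: "B \<in> sets borel" for \<omega> B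
  proof (rule measures_agree_sets[OF \<mu> _ _ _ _ B])
    show "integrable \<mu> (\<lambda>x. pairing (\<omega> x) (\<xi> x))" "integrable \<mu>' (\<lambda>x. pairing (\<omega> x) (\<xi>' x))"
      using 1(1) 2(1) \<omega> by (auto simp: represents_def)
    show "(\<lambda>x. x) \<in> measurable \<mu>' borel" by measurable
    fix \<kappa> Z assume "cutoff \<kappa> Z"
    then have t: "test_form A (\<lambda>x v. \<kappa> x * \<omega> x v)" using \<omega> by (intro test_form_mult_test) (auto simp: cutoff_def)
    have "S (\<lambda>x v. \<kappa> x * \<omega> x v) = (LINT x|\<mu>. \<kappa> x * pairing (\<omega> x) (\<xi> x))"
      "S (\<lambda>x v. \<kappa> x * \<omega> x v) = (LINT x|\<mu>'. \<kappa> x * pairing (\<omega> x) (\<xi>' x))"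
      using 1(1) 2(1) t unfolding represents_def by (auto simp: pairing_scale_left)
    then show "(LINT x|\<mu>. \<kappa> x * pairing (\<omega> x) (\<xi> x)) = (LINT x|\<mu>'. \<kappa> x * pairing (\<omega> x) (\<xi>' x))" by simp
  qed
  have t\<omega>: "test_form A (\<lambda>x v. \<psi> x * \<phi> x v)"
    by (rule test_form_mult(1)[OF \<psi>(1)]) (use calibration in \<open>simp add: calibration_def\<close>)
  show eq: "density \<mu> h = density \<mu>' h'"
  proof (rule measure_eqI)
    show "sets (density \<mu> h) = sets (density \<mu>' h')" by (simp add: \<mu> \<mu>')
    fix B assume "B \<in> sets (density \<mu> h)"
    then have B[measurable]: "B \<in> sets borel" by (simp add: \<mu>)
    have "emeasure (density \<mu> h) B = (\<integral>\<^sup>+ x. ennreal (indicator B x * h x) \<partial>\<mu>)"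
      by (subst emeasure_density) (auto intro!: nn_integral_cong simp: indicator_def \<mu>)
    also have "\<dots> = ennreal (LINT x|\<mu>. indicator B x * h x)"
      using hpos by (intro nn_integral_eq_integral integrable_real_mult_indicator[of B \<mu> h, unfolded mult.commute[of "h _"]])
        (auto simp: \<mu> hi elim!: eventually_mono)
    also have "\<dots> = ennreal (LINT x|\<mu>'. indicator B x * h' x)"
      unfolding h_def h'_def agree[OF t\<omega> B] ..
    also have "\<dots> = (\<integral>\<^sup>+ x. ennreal (indicator B x * h' x) \<partial>\<mu>')"
      using hpos' by (intro nn_integral_eq_integral[symmetric] integrable_real_mult_indicator[of B \<mu>' h', unfolded mult.commute[of "h' _"]])
        (auto simp: \<mu>' hi elim!: eventually_mono)
    also have "\<dots> = emeasure (density \<mu>' h') B"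
      by (subst emeasure_density) (auto intro!: nn_integral_cong simp: indicator_def \<mu>')
    finally show "emeasure (density \<mu> h) B = emeasure (density \<mu>' h') B" .
  qed
  \<comment> \<open>Over this common measure the coordinates of both fields, divided by their
    weights, can be integrated against the same sets.\<close>
  define \<nu> where "\<nu> = density \<mu> h"
  have \<nu>': "\<nu> = density \<mu>' h'" by (simp add: \<nu>_def eq)
  have s\<nu>: "sets \<nu> = sets borel" by (simp add: \<nu>_def \<mu>)
  note [measurable_cong] = s\<nu>
  have AE1: "AE x in \<nu>. P x" if "AE x in \<mu>. P x" for P
    using that unfolding \<nu>_def by (subst AE_density) (auto elim: eventually_mono)
  have AE2: "AE x in \<nu>. P x" if "AE x in \<mu>'. P x" for P
    using that unfolding \<nu>' by (subst AE_density) (auto elim: eventually_mono)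
  have nn: "AE x in \<mu>. 0 \<le> h x" "AE x in \<mu>'. 0 \<le> h' x" using hpos hpos' by (auto elim!: eventually_mono)
  obtain c :: "nat \<Rightarrow> ('x, 'p + 'q) chart" and \<chi>' K W where c: "\<And>n. c n \<in> A" "\<And>n. cutoff (\<chi>' n) (K n)" "\<And>n. K n \<subseteq> fst (c n)"
    "\<And>n. open (W n)" "\<And>n x. x \<in> W n \<Longrightarrow> \<chi>' n x = 1" "(\<Union>n. W n) = UNIV"
    using countable_cutoff_cover by blast
  define H where "H n f x = pairing (coord_form (c n) (\<chi>' n) f x) (\<xi> x)" for n and f :: "'p \<Rightarrow> 'p + 'q" and x
  define H' where "H' n f x = pairing (coord_form (c n) (\<chi>' n) f x) (\<xi>' x)" for n and f :: "'p \<Rightarrow> 'p + 'q" and x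
  have tf: "test_form A (coord_form (c n) (\<chi>' n) f)" for n and f :: "'p \<Rightarrow> 'p + 'q"
    by (rule test_form_coord_form[OF c(1) c(2) c(3)])
  have Hi: "integrable \<mu> (H n f)" "integrable \<mu>' (H' n f)" for n f
    using 1(1) 2(1) tf unfolding represents_def H_def H'_def by blast+
  have "AE x in \<nu>. H n f x / h x - H' n f x / h' x = 0" for n f
  proof (rule AE_zero_of_sets[OF s\<nu>])
    note [measurable] = borel_measurable_integrable[OF Hi(1)] borel_measurable_integrable[OF Hi(2)]
    have cancel: "AE x in \<mu>. h x * (H n f x / h x) = H n f x" "AE x in \<mu>'. h' x * (H' n f x / h' x) = H' n f x"
      using hpos hpos' by (auto elim!: eventually_mono)
    have i: "integrable \<nu> (\<lambda>x. H n f x / h x)" "integrable \<nu> (\<lambda>x. H' n f x / h' x)"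
    proof -
      have "integrable \<mu> (\<lambda>x. h x * (H n f x / h x))" "integrable \<mu>' (\<lambda>x. h' x * (H' n f x / h' x))"
        using integrable_cong_AE[OF _ _ cancel(1)] integrable_cong_AE[OF _ _ cancel(2)] Hi by auto
      then show "integrable \<nu> (\<lambda>x. H n f x / h x)" "integrable \<nu> (\<lambda>x. H' n f x / h' x)"
        using integrable_real_density[of h \<mu> "\<lambda>x. H n f x / h x"] integrable_real_density[of h' \<mu>' "\<lambda>x. H' n f x / h' x"] nn
        unfolding \<nu>_def[symmetric] \<nu>'[symmetric] by simp_all
    qed
    then show "integrable \<nu> (\<lambda>x. H n f x / h x - H' n f x / h' x)" by simp
    fix B :: "'x set" assume [measurable]: "B \<in> sets borel"
    have "(LINT x|\<nu>. indicator B x * (H n f x / h x)) = (LINT x|\<mu>. h x * (indicator B x * (H n f x / h x)))"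
      unfolding \<nu>_def by (rule integral_real_density) (use nn in auto)
    also have "\<dots> = (LINT x|\<mu>. indicator B x * H n f x)"
      using hpos by (intro integral_cong_AE) (auto elim!: eventually_mono)
    also have "\<dots> = (LINT x|\<mu>'. indicator B x * H' n f x)"
      unfolding H_def H'_def by (rule agree[OF tf]) measurable
    also have "\<dots> = (LINT x|\<mu>'. h' x * (indicator B x * (H' n f x / h' x)))"
      using hpos' by (intro integral_cong_AE) (auto elim!: eventually_mono)
    also have "\<dots> = (LINT x|\<nu>. indicator B x * (H' n f x / h' x))"
      unfolding \<nu>' by (rule integral_real_density[symmetric]) (use nn in auto)
    finally have e: "(LINT x|\<nu>. indicator B x * (H n f x / h x)) = (LINT x|\<nu>. indicator B x * (H' n f x / h' x))" .
    have "integrable \<nu> (\<lambda>x. indicator B x * (H n f x / h x))" "integrable \<nu> (\<lambda>x. indicator B x * (H' n f x / h' x))"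
      using integrable_mult_indicator[OF _ i(1), of B] integrable_mult_indicator[OF _ i(2), of B] by (simp_all add: s\<nu>)
    then show "(LINT x|\<nu>. indicator B x * (H n f x / h x - H' n f x / h' x)) = 0"
      using e by (simp add: right_diff_distrib)
  qed
  then have "AE x in \<nu>. \<forall>n f. H n f x / h x - H' n f x / h' x = 0" by (simp add: AE_all_countable)
  with AE1[OF 1(2)] AE2[OF 2(2)] have "AE x in \<nu>. (1 / h x) *\<^sub>R \<xi> x = (1 / h' x) *\<^sub>R \<xi>' x"
  proof eventually_elim
    case (elim x)
    obtain n where n: "x \<in> W n" using c(6) by blast
    have "\<chi>' n x = 1" using c(5) n by blast
    then have xc: "x \<in> fst (c n)" using c(2)[of n] c(3)[of n] unfolding cutoff_def by fastforce
    have "mv_map (to_chart (c n) x) ((1 / h x) *\<^sub>R \<xi> x) = mv_map (to_chart (c n) x) ((1 / h' x) *\<^sub>R \<xi>' x)"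
    proof (intro vec_eq_iff[THEN iffD2] allI)
      fix f
      have "H n f x / h x = H' n f x / h' x" using elim(3) by simp
      then show "mv_map (to_chart (c n) x) ((1 / h x) *\<^sub>R \<xi> x) $ f = mv_map (to_chart (c n) x) ((1 / h' x) *\<^sub>R \<xi>' x) $ f"
        using \<open>\<chi>' n x = 1\<close> by (simp add: linear_scale[OF linear_mv_map] H_def H'_def pairing_coord_form)
    qed
    then show ?case
      by (rule mv_to_chart_inj[OF c(1) xc subspace_scale[OF subspace_multivectors mass_cone_multivector[OF elim(1)]]
            subspace_scale[OF subspace_multivectors mass_cone_multivector[OF elim(2)]]])
  qed
  then show "AE x in density \<mu> h. (1 / h x) *\<^sub>R \<xi> x = (1 / h' x) *\<^sub>R \<xi>' x" unfolding \<nu>_def .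
qed

section \<open>The volume as the integral of the scale factor\<close>

context
  fixes S \<xi> \<mu> k \<psi> L V
  assumes S: "is_current A S" "compact (current_support A S)"
    and rep: "represents A S \<xi> \<mu>"
    and k: "k \<in> borel_measurable \<mu>" "\<And>x. k x > 0" "AE x in \<mu>. \<exists>\<eta>\<in>G x. \<xi> x = k x *\<^sub>R \<eta>"
    and \<psi>: "cutoff \<psi> L" "current_support A S \<subseteq> V" "\<forall>y\<in>V. \<psi> y = 1"
begin

abbreviation (input) weight :: "'x \<Rightarrow> real" where
  "weight x \<equiv> pairing (\<lambda>v. \<psi> x * \<phi> x v) (\<xi> x)"

lemma polar_cone: "AE x in \<mu>. \<xi> x \<in> mass_cone G x"
  using k(3)
proof eventually_elim
  case (elim x)
  then obtain \<eta> where "\<eta> \<in> G x" "\<xi> x = k x *\<^sub>R \<eta>" by blast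
  then show ?case using plane_in_cone[of \<eta> x "k x"] k(2) by simp
qed

lemma weight_integrable: "integrable \<mu> weight"
  and weight_integral: "S (\<lambda>x v. \<psi> x * \<phi> x v) = (LINT x|\<mu>. weight x)"
  and weight_eq: "AE x in \<mu>. weight x = pairing (\<phi> x) (\<xi> x)"
  by (rule calibration_integral[OF rep S polar_cone \<psi>])+

lemma factor_le_weight: "AE x in \<mu>. k x \<le> weight x"
  using k(3) weight_eq
proof eventually_elim
  case (elim x)
  then obtain \<eta> where \<eta>: "\<eta> \<in> G x" "\<xi> x = k x *\<^sub>R \<eta>" by blast
  then show ?case
    using mult_left_mono[OF calibration_plane[OF \<eta>(1)], of "k x"] k(2)[of x] elim(2)
    by (simp add: pairing_scale_right)
qed

lemma factor_integrable: "integrable \<mu> k"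
proof (rule Bochner_Integration.integrable_bound[OF weight_integrable k(1)])
  show "AE x in \<mu>. norm (k x) \<le> norm (weight x)"
    using factor_le_weight
  proof eventually_elim
    case (elim x)
    then show ?case using k(2)[of x] by simp
  qed
qed

text \<open>The factor \<open>k\<close> moves from the multivector to the measure and leaves a
  plane, of mass norm 1. The new measure is finite because the integrable weight dominates
  \<open>k\<close>.\<close>

lemma semi_riemannian_polar_form_exists:
  "semi_riemannian_polar_form A G S (\<lambda>x. (1 / k x) *\<^sub>R \<xi> x) (density \<mu> k)"
proof -
  have \<mu>: "sets \<mu> = sets borel" using rep by (simp add: represents_def radon_measure_def)
  note [measurable] = k(1)
  have km: "(\<lambda>x. ennreal (k x)) \<in> borel_measurable \<mu>" by measurable
  have fin: "emeasure (density \<mu> k) K < \<infinity>" for K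
  proof -
    have "emeasure (density \<mu> k) K \<le> emeasure (density \<mu> k) (space (density \<mu> k))" by (rule emeasure_space)
    also have "\<dots> = (\<integral>\<^sup>+ x. ennreal (k x) \<partial>\<mu>)"
      by (subst emeasure_density[OF km]) (auto intro!: nn_integral_cong)
    also have "\<dots> = ennreal (LINT x|\<mu>. k x)"
      using k(2) by (intro nn_integral_eq_integral factor_integrable) (auto intro: less_imp_le)
    finally show ?thesis by (simp add: le_less_trans)
  qed
  have "integrable (density \<mu> k) (\<lambda>x. pairing (\<omega> x) ((1 / k x) *\<^sub>R \<xi> x)) \<and>
      S \<omega> = (LINT x|density \<mu> k. pairing (\<omega> x) ((1 / k x) *\<^sub>R \<xi> x))" if \<omega>: "test_form A \<omega>" for \<omega>
  proof -
    have i: "integrable \<mu> (\<lambda>x. pairing (\<omega> x) (\<xi> x))" "S \<omega> = (LINT x|\<mu>. pairing (\<omega> x) (\<xi> x))"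
      using rep \<omega> by (auto simp: represents_def)
    note [measurable] = borel_measurable_integrable[OF i(1)]
    have m: "(\<lambda>x. pairing (\<omega> x) ((1 / k x) *\<^sub>R \<xi> x)) \<in> borel_measurable \<mu>"
      unfolding pairing_scale_right by measurable
    have nn: "AE x in \<mu>. 0 \<le> k x" using k(2) by (simp add: less_imp_le)
    have e: "k x * pairing (\<omega> x) ((1 / k x) *\<^sub>R \<xi> x) = pairing (\<omega> x) (\<xi> x)" for x
      unfolding pairing_scale_right using k(2)[of x] by simp
    show ?thesis
      unfolding integrable_real_density[OF k(1) nn m] integral_real_density[OF k(1) nn m] e using i by blast
  qed
  moreover have "AE x in density \<mu> k. (1 / k x) *\<^sub>R \<xi> x \<in> mass_cone G x \<and> mass_norm G x ((1 / k x) *\<^sub>R \<xi> x) = 1"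
    unfolding AE_density[OF km] using k(3)
  proof eventually_elim
    case (elim x)
    then obtain \<eta> where \<eta>: "\<eta> \<in> G x" "\<xi> x = k x *\<^sub>R \<eta>" by blast
    then have "(1 / k x) *\<^sub>R \<xi> x = 1 *\<^sub>R \<eta>" using k(2)[of x] by simp
    then show ?case using plane_in_cone[OF \<eta>(1), of 1] mass_norm_plane[OF \<eta>(1), of 1] by simp
  qed
  ultimately show ?thesis
    using fin unfolding semi_riemannian_polar_form_def represents_def radon_measure_def by (simp add: \<mu>)
qed

text \<open>By \<open>polar_form_unique\<close> the two fields agree up to their weights
  \<open>h\<close> and \<open>h'\<close>. Mass norm 1 of \<open>\<xi>'\<close> forces
  \<open>k x / h x = 1 / h' x\<close>, and integrating this ratio over the common weighted measure
  yields both totals.\<close>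

lemma semi_riemannian_polar_form_total:
  assumes polar: "semi_riemannian_polar_form A G S \<xi>' \<mu>'"
  shows "emeasure \<mu>' (space \<mu>') = (\<integral>\<^sup>+ x. ennreal (k x) \<partial>\<mu>)"
proof -
  have rep': "represents A S \<xi>' \<mu>'" and cone': "AE x in \<mu>'. \<xi>' x \<in> mass_cone G x"
    and norm': "AE x in \<mu>'. mass_norm G x (\<xi>' x) = 1"
    using polar by (auto simp: semi_riemannian_polar_form_def elim: eventually_mono)
  define h where "h x = weight x" for x
  define h' where "h' x = pairing (\<lambda>v. \<psi> x * \<phi> x v) (\<xi>' x)" for x
  have "density \<mu> h = density \<mu>' h'" and proportional: "AE x in density \<mu> h. (1 / h x) *\<^sub>R \<xi> x = (1 / h' x) *\<^sub>R \<xi>' x"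
    unfolding h_def h'_def
    by (rule polar_form_unique[OF S rep polar_cone rep' cone' \<psi>])+
  then have eq: "density \<mu> h = density \<mu>' h'" by blast
  note [measurable] = k(1)
  have hi: "integrable \<mu> h" "integrable \<mu>' h'"
    unfolding h_def h'_def using weight_integrable calibration_integral(1)[OF rep' S cone' \<psi>] by blast+
  note [measurable] = borel_measurable_integrable[OF hi(1)] borel_measurable_integrable[OF hi(2)]
  have hm: "(\<lambda>x. ennreal (h x)) \<in> borel_measurable \<mu>" "(\<lambda>x. ennreal (h' x)) \<in> borel_measurable \<mu>'" by measurable
  have s: "sets \<mu> = sets borel" "sets \<mu>' = sets borel"
    using rep rep' by (auto simp: represents_def radon_measure_def)
  have hpos: "AE x in \<mu>. h x > 0"
    using factor_le_weight unfolding h_def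
  proof eventually_elim
    case (elim x) then show ?case using k(2)[of x] by simp
  qed
  have hpos': "AE x in \<mu>'. h' x > 0"
    using calibration_integral(3)[OF rep' S cone' \<psi>] cone'
  proof eventually_elim
    case (elim x) then show ?case unfolding h'_def using calibration_cone[OF elim(2)] by simp
  qed
  have AE1: "AE x in density \<mu> h. P x" if "AE x in \<mu>. P x" for P
    using that unfolding AE_density[OF hm(1)] by (auto elim: eventually_mono)
  have AE2: "AE x in density \<mu> h. P x" if "AE x in \<mu>'. P x" for P
    using that unfolding eq AE_density[OF hm(2)] by (auto elim: eventually_mono)
  have ratio: "AE x in density \<mu> h. k x / h x = 1 / h' x"
    using AE1[OF k(3)] AE1[OF hpos] AE2[OF hpos'] AE2[OF norm'] proportional
  proof eventually_elim
    case (elim x)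
    obtain \<eta> where \<eta>: "\<eta> \<in> G x" "\<xi> x = k x *\<^sub>R \<eta>" using elim(1) by blast
    have "\<xi>' x = h' x *\<^sub>R (1 / h' x) *\<^sub>R \<xi>' x" using elim(3) by simp
    also have "\<dots> = (h' x / h x * k x) *\<^sub>R \<eta>" unfolding elim(5)[symmetric] \<eta>(2) by simp
    finally have "mass_norm G x ((h' x / h x * k x) *\<^sub>R \<eta>) = 1" using elim(4) by simp
    then have "h' x / h x * k x = 1"
      using mass_norm_plane[OF \<eta>(1), of "h' x / h x * k x"] elim(2,3) k(2)[of x] by simp
    then show ?case using elim(2,3) k(2)[of x] by (simp add: field_simps)
  qed
  have km: "(\<lambda>x. ennreal (k x / h x)) \<in> borel_measurable \<mu>" "(\<lambda>x. ennreal (1 / h' x)) \<in> borel_measurable \<mu>'" by measurable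
  have "(\<integral>\<^sup>+ x. ennreal (k x) \<partial>\<mu>) = (\<integral>\<^sup>+ x. ennreal (h x) * ennreal (k x / h x) \<partial>\<mu>)"
    using hpos
  proof (intro nn_integral_cong_AE, eventually_elim)
    case (elim x)
    then show ?case using k(2)[of x] by (simp add: ennreal_mult[symmetric] less_imp_le)
  qed
  also have "\<dots> = (\<integral>\<^sup>+ x. ennreal (k x / h x) \<partial>density \<mu> h)"
    by (rule nn_integral_density[symmetric, OF hm(1) km(1)])
  also have "\<dots> = (\<integral>\<^sup>+ x. ennreal (1 / h' x) \<partial>density \<mu> h)"
    using ratio by (intro nn_integral_cong_AE, eventually_elim) simp
  also have "\<dots> = (\<integral>\<^sup>+ x. ennreal (h' x) * ennreal (1 / h' x) \<partial>\<mu>')"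
    unfolding eq by (rule nn_integral_density[OF hm(2) km(2)])
  also have "\<dots> = (\<integral>\<^sup>+ x. 1 \<partial>\<mu>')"
    using hpos'
  proof (intro nn_integral_cong_AE, eventually_elim)
    case (elim x)
    then show ?case by (simp add: ennreal_mult[symmetric] less_imp_le)
  qed
  finally show ?thesis by simp
qed

lemma vol_eq: "vol A G S = (\<integral>\<^sup>+ x. ennreal (k x) \<partial>\<mu>)"
  unfolding vol_def
proof (rule the_equality)
  show "\<exists>\<xi>' \<mu>'. semi_riemannian_polar_form A G S \<xi>' \<mu>' \<and> (\<integral>\<^sup>+ x. ennreal (k x) \<partial>\<mu>) = emeasure \<mu>' (space \<mu>')"
    using semi_riemannian_polar_form_exists semi_riemannian_polar_form_total[OF semi_riemannian_polar_form_exists, symmetric]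
    by (intro exI conjI)
qed (use semi_riemannian_polar_form_total in blast)

text \<open>The weight dominates the factor and both are integrable, so the integrals coincide only
  if the functions coincide almost everywhere.\<close>

lemma vol_le_weight: "vol A G S \<le> ennreal (S (\<lambda>x v. \<psi> x * \<phi> x v))"
  and vol_eq_weight: "vol A G S = ennreal (S (\<lambda>x v. \<psi> x * \<phi> x v)) \<longleftrightarrow>
    (AE x in \<mu>. pairing (\<phi> x) (\<xi> x) = k x)"
proof -
  have v: "vol A G S = ennreal (LINT x|\<mu>. k x)"
    unfolding vol_eq using k(2) by (intro nn_integral_eq_integral factor_integrable) (auto intro: less_imp_le)
  have le: "(LINT x|\<mu>. k x) \<le> (LINT x|\<mu>. weight x)"
    by (rule integral_mono_AE[OF factor_integrable weight_integrable factor_le_weight])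
  then show "vol A G S \<le> ennreal (S (\<lambda>x v. \<psi> x * \<phi> x v))"
    unfolding v weight_integral by (rule ennreal_leI)
  have "(LINT x|\<mu>. k x) \<ge> 0" using k(2) by (intro integral_nonneg_AE) (auto intro: less_imp_le)
  then have "vol A G S = ennreal (S (\<lambda>x v. \<psi> x * \<phi> x v)) \<longleftrightarrow> (LINT x|\<mu>. weight x - k x) = 0"
    unfolding v weight_integral using le weight_integrable factor_integrable by auto
  also have "\<dots> \<longleftrightarrow> (AE x in \<mu>. weight x - k x = 0)"
    using factor_le_weight weight_integrable factor_integrable
    by (intro integral_nonneg_eq_0_iff_AE) (auto elim: eventually_mono)
  also have "\<dots> \<longleftrightarrow> (AE x in \<mu>. pairing (\<phi> x) (\<xi> x) = k x)"
  proof
    assume "AE x in \<mu>. weight x - k x = 0"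
    with weight_eq show "AE x in \<mu>. pairing (\<phi> x) (\<xi> x) = k x" by eventually_elim simp
  next
    assume "AE x in \<mu>. pairing (\<phi> x) (\<xi> x) = k x"
    with weight_eq show "AE x in \<mu>. weight x - k x = 0" by eventually_elim simp
  qed
  finally show "vol A G S = ennreal (S (\<lambda>x v. \<psi> x * \<phi> x v)) \<longleftrightarrow>
    (AE x in \<mu>. pairing (\<phi> x) (\<xi> x) = k x)" .
qed

end

section \<open>Comparison of volume and calibration, with the case of equality\<close>

lemma calibrated_positive:
  assumes "calibrated_subvariety A G \<phi> S" shows "positive_space_like A G S"
proof -
  obtain h \<xi> \<mu> where p: "riemannian_metric A h" "riemannian_polar_form A h S \<xi> \<mu>"
    and c: "AE x in \<mu>. \<xi> x \<in> {t *\<^sub>R \<eta> | t \<eta>. t > 0 \<and> \<eta> \<in> calibrated_planes G \<phi> x}"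
    using assms unfolding calibrated_subvariety_def of_type_def by blast
  have "AE x in \<mu>. \<xi> x \<in> mass_cone G x"
    using c
  proof eventually_elim
    case (elim x)
    then obtain t \<eta> where "\<xi> x = t *\<^sub>R \<eta>" "t > 0" "\<eta> \<in> G x" by (auto simp: calibrated_planes_def)
    then show ?case using plane_in_cone by simp
  qed
  then show ?thesis using p unfolding positive_space_like_def of_type_def by blast
qed

lemma vol_calibration:
  assumes pos: "positive_space_like A G S" and rect: "locally_rectifiable A S" and cpt: "compact (current_support A S)"
    and \<psi>: "cutoff \<psi> L" "current_support A S \<subseteq> V" "\<forall>y\<in>V. \<psi> y = 1"
  shows "vol A G S \<le> ennreal (S (\<lambda>x v. \<psi> x * \<phi> x v))"
    and "vol A G S = ennreal (S (\<lambda>x v. \<psi> x * \<phi> x v)) \<longleftrightarrow> calibrated_subvariety A G \<phi> S"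
proof -
  have S: "is_current A S" using rect by (simp add: locally_rectifiable_def)
  obtain h \<xi> \<mu> where p: "riemannian_metric A h" "riemannian_polar_form A h S \<xi> \<mu>"
    and cone: "AE x in \<mu>. \<xi> x \<in> mass_cone G x"
    using pos unfolding positive_space_like_def of_type_def by blast
  have rep: "represents A S \<xi> \<mu>" using p(2) by (simp add: riemannian_polar_form_def)
  obtain k where k: "k \<in> borel_measurable \<mu>" "\<And>x. k x > 0" "AE x in \<mu>. \<exists>\<eta>\<in>G x. \<xi> x = k x *\<^sub>R \<eta>"
    by (rule simple_polar_form[OF rect rep cone]) (rule that; assumption)
  show "vol A G S \<le> ennreal (S (\<lambda>x v. \<psi> x * \<phi> x v))"
    by (rule vol_le_weight[OF S cpt rep k \<psi>])
  show "vol A G S = ennreal (S (\<lambda>x v. \<psi> x * \<phi> x v)) \<longleftrightarrow> calibrated_subvariety A G \<phi> S"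
  proof
    assume "vol A G S = ennreal (S (\<lambda>x v. \<psi> x * \<phi> x v))"
    then have "AE x in \<mu>. pairing (\<phi> x) (\<xi> x) = k x"
      unfolding vol_eq_weight[OF S cpt rep k \<psi>] .
    with k(3) have "AE x in \<mu>. \<xi> x \<in> {t *\<^sub>R \<eta> | t \<eta>. t > 0 \<and> \<eta> \<in> calibrated_planes G \<phi> x}"
    proof eventually_elim
      case (elim x)
      then obtain \<eta> where \<eta>: "\<eta> \<in> G x" "\<xi> x = k x *\<^sub>R \<eta>" by blast
      then have "pairing (\<phi> x) \<eta> = 1" using elim(2) k(2)[of x] by (simp add: pairing_scale_right)
      then have "\<eta> \<in> calibrated_planes G \<phi> x" using \<eta>(1) by (simp add: calibrated_planes_def)
      then show ?case unfolding \<eta>(2) by (intro CollectI exI[of _ "k x"] exI[of _ \<eta>] conjI refl k(2))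
    qed
    then show "calibrated_subvariety A G \<phi> S"
      using rect p unfolding calibrated_subvariety_def of_type_def by blast
  next
    \<comment> \<open>The polar form that witnesses calibration may differ from the one fixed above,
      so the equality criterion is applied to it afresh.\<close>
    assume "calibrated_subvariety A G \<phi> S"
    then obtain h' \<xi>' \<mu>' where p': "riemannian_polar_form A h' S \<xi>' \<mu>'"
      and c: "AE x in \<mu>'. \<xi>' x \<in> {t *\<^sub>R \<eta> | t \<eta>. t > 0 \<and> \<eta> \<in> calibrated_planes G \<phi> x}"
      unfolding calibrated_subvariety_def of_type_def by blast
    have rep': "represents A S \<xi>' \<mu>'" using p' by (simp add: riemannian_polar_form_def)
    have cone': "AE x in \<mu>'. \<xi>' x \<in> mass_cone G x"
      using c
    proof eventually_elim
      case (elim x)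
      then obtain t \<eta> where "\<xi>' x = t *\<^sub>R \<eta>" "t > 0" "\<eta> \<in> G x" by (auto simp: calibrated_planes_def)
      then show ?case using plane_in_cone by simp
    qed
    obtain k' where k': "k' \<in> borel_measurable \<mu>'" "\<And>x. k' x > 0" "AE x in \<mu>'. \<exists>\<eta>\<in>G x. \<xi>' x = k' x *\<^sub>R \<eta>"
      by (rule simple_polar_form[OF rect rep' cone']) (rule that; assumption)
    show "vol A G S = ennreal (S (\<lambda>x v. \<psi> x * \<phi> x v))"
      unfolding vol_eq_weight[OF S cpt rep' k' \<psi>]
      using k'(3) c
    proof eventually_elim
      case (elim x)
      obtain \<eta> where \<eta>: "\<eta> \<in> G x" "\<xi>' x = k' x *\<^sub>R \<eta>" using elim(1) by blast
      obtain t \<zeta> where t: "\<xi>' x = t *\<^sub>R \<zeta>" "t > 0" "\<zeta> \<in> G x" "pairing (\<phi> x) \<zeta> = 1"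
        using elim(2) by (auto simp: calibrated_planes_def)
      \<comment> \<open>Both decompositions are multiples of planes in \<open>G\<close>, so the mass
        norm identifies the factors.\<close>
      have "k' x = t"
        using mass_norm_plane[OF \<eta>(1) k'(2)] mass_norm_plane[OF t(3,2)] \<eta>(2) t(1) by simp
      then show ?case by (simp add: t pairing_scale_right)
    qed
  qed
qed

end

theorem theoremD10:
  fixes A :: "('x::{t2_space,second_countable_topology}, 'p::finite + 'q::finite) chart set"
    and g :: "('x, 'p + 'q) metric"
    and G :: "'x \<Rightarrow> (real ^ ('p \<Rightarrow> 'p + 'q)) set"
    and \<phi> :: "('x, 'p, 'p + 'q) form"
    and T :: "('x, 'p, 'p + 'q) current"
  assumes "smooth_atlas A"
    and "semi_riemannian_metric A g"
    and "space_like_orientation A g G"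
    and "calibration A G \<phi>"
    and "calibrated_subvariety A G \<phi> T"
    and "compact (current_support A T)"
  shows "\<forall>S :: ('x, 'p, 'p + 'q) current.
    positive_space_like A G S \<and> locally_rectifiable A S \<and> compact (current_support A S) \<and>
    homologous A S T \<longrightarrow>
      vol A G T \<ge> vol A G S \<and>
      (vol A G T = vol A G S \<longleftrightarrow> calibrated_subvariety A G \<phi> S)"
proof (intro allI impI)
  fix S :: "('x, 'p, 'p + 'q) current"
  assume "positive_space_like A G S \<and> locally_rectifiable A S \<and> compact (current_support A S) \<and>
    homologous A S T"
  then have S: "positive_space_like A G S" "locally_rectifiable A S" "compact (current_support A S)"
    and hom: "homologous A S T" by auto
  interpret calibrated_manifold A g G \<phi>
    by unfold_locales (use assms in auto)
  have sm: "smooth_form A \<phi>" and closed: "\<And>x v. ext_deriv A \<phi> x v = 0"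
    using calibration by (auto simp: calibration_def)
  have "\<exists>K. compact K \<and> (\<forall>\<psi> L V. cutoff \<psi> L \<longrightarrow> open V \<longrightarrow> K \<subseteq> V \<longrightarrow> (\<forall>y\<in>V. \<psi> y = 1) \<longrightarrow>
       S (\<lambda>x v. \<psi> x * \<phi> x v) = T (\<lambda>x v. \<psi> x * \<phi> x v))"
  proof (rule homologous_closed_form[OF hom sm closed])
    fix K assume "compact K" and K: "\<And>\<psi> L V. cutoff \<psi> L \<Longrightarrow> open V \<Longrightarrow> K \<subseteq> V \<Longrightarrow> (\<And>y. y \<in> V \<Longrightarrow> \<psi> y = 1) \<Longrightarrow>
       S (\<lambda>x v. \<psi> x * \<phi> x v) = T (\<lambda>x v. \<psi> x * \<phi> x v)"
    then show ?thesis by (intro exI[of _ K] conjI allI impI K) auto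
  qed
  then obtain K where K: "compact K" "\<forall>\<psi> L V. cutoff \<psi> L \<longrightarrow> open V \<longrightarrow> K \<subseteq> V \<longrightarrow> (\<forall>y\<in>V. \<psi> y = 1) \<longrightarrow>
       S (\<lambda>x v. \<psi> x * \<phi> x v) = T (\<lambda>x v. \<psi> x * \<phi> x v)"
    by (elim exE conjE)
  have "compact (K \<union> current_support A S \<union> current_support A T)"
    using K(1) S assms(6) by (intro compact_Un) auto
  then have "\<exists>\<psi> L V. cutoff \<psi> L \<and> open V \<and> K \<union> current_support A S \<union> current_support A T \<subseteq> V \<and> (\<forall>y\<in>V. \<psi> y = 1)"
    by (rule compact_cutoff[OF _ subset_UNIV open_UNIV]) blast
  then obtain \<psi> L V where \<psi>: "cutoff \<psi> L" "open V" "K \<union> current_support A S \<union> current_support A T \<subseteq> V"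
    and 1: "\<forall>y\<in>V. \<psi> y = 1" by (elim exE conjE)
  have sub: "K \<subseteq> V" "current_support A S \<subseteq> V" "current_support A T \<subseteq> V" using \<psi>(3) by auto
  have rectT: "locally_rectifiable A T" using assms(5) by (simp add: calibrated_subvariety_def)
  have "vol A G T = ennreal (T (\<lambda>x v. \<psi> x * \<phi> x v))"
    using vol_calibration(2)[OF calibrated_positive[OF assms(5)] rectT assms(6) \<psi>(1) sub(3) 1] assms(5) by blast
  also have "\<dots> = ennreal (S (\<lambda>x v. \<psi> x * \<phi> x v))"
    using K(2)[THEN spec, THEN spec, THEN spec, THEN mp, THEN mp, THEN mp, THEN mp, OF \<psi>(1,2) sub(1) 1] by simp
  finally have T: "vol A G T = ennreal (S (\<lambda>x v. \<psi> x * \<phi> x v))" .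
  have "vol A G S \<le> ennreal (S (\<lambda>x v. \<psi> x * \<phi> x v))"
    "vol A G S = ennreal (S (\<lambda>x v. \<psi> x * \<phi> x v)) \<longleftrightarrow> calibrated_subvariety A G \<phi> S"
    by (rule vol_calibration[OF S(1,2,3) \<psi>(1) sub(2) 1])+
  then show "vol A G T \<ge> vol A G S \<and> (vol A G T = vol A G S \<longleftrightarrow> calibrated_subvariety A G \<phi> S)"
    unfolding T eq_commute[of "ennreal (S (\<lambda>x v. \<psi> x * \<phi> x v))" "vol A G S"] by (rule conjI)
qed

end
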